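(* Let $\gamma\ge6$, $p(\rho)=\rho^\gamma$, and let $G\in D_0^{1,q}(\mathbb{R}^3)$ for some $\frac{6\gamma}{5\gamma-6}\le q\le\frac32$. Let $(\rho,\mathbf{u})$ be a weak solution in $\mathbb{R}^3$ of the steady barotropic Navier--Stokes system with pressure $p$ and force potential $G$. If $\rho\in L^6\cap L^\gamma(\mathbb{R}^3)$, then $\mathbf{u}=0$ a.e. in $\mathbb{R}^3$.
   Context: The system is $\operatorname{div}(\rho\mathbf{u})=0$, $\operatorname{div}(\rho\mathbf{u}\otimes\mathbf{u})+\nabla p(\rho)-\operatorname{div}\mathbb{S}(\nabla\mathbf{u})=\rho\nabla G$ in $\mathbb{R}^3$, where $\mathbb{S}(\nabla\mathbf{u})=\mu\left(\nabla\mathbf{u}+\nabla^t\mathbf{u}-\frac23\operatorname{div}\mathbf{u}\,\mathbb{I}\right)+\eta\operatorname{div}\mathbf{u}\,\mathbb{I}$ with constants $\mu>0$, $\eta\ge0$. Function space: for $1\le q<\infty$, $D_0^{1,q}(\mathbb{R}^3)$ is the completion of $C_c^\infty(\mathbb{R}^3)$ in the norm $\left(\int_{\mathbb{R}^3}|\nabla v|^q\,dx\right)^{1/q}$; $D_0^{1,q}(\mathbb{R}^3;\mathbb{R}^3)$ is the vector-valued version. For matrices, $F:G=\sum_{i,j}F_{ij}G_{ij}$. Weak solution: $(\rho,\mathbf{u})$ is a weak solution if (1) $\rho,\mathbf{u}$ are measurable in $\mathbb{R}^3$ and $\rho\ge0$ a.e.; (2) $\rho\mathbf{u}\in L^1_{\rm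 loc}(\mathbb{R}^3;\mathbb{R}^3)$ and $\int_{\mathbb{R}^3}\rho\mathbf{u}\cdot\nabla\phi\,dx=0$ for all $\phi\in C_c^\infty(\mathbb{R}^3)$; (3) $\rho,\ \rho|\mathbf{u}|^2,\ p(\rho),\ \rho\nabla G$ are in $L^1_{\rm loc}(\mathbb{R}^3)$, $\mathbf{u}\in D_0^{1,2}(\mathbb{R}^3;\mathbb{R}^3)$, and $$\int_{\mathbb{R}^3}[\rho\mathbf{u}\otimes\mathbf{u}:\nabla\boldsymbol{\varphi}+p(\rho)\operatorname{div}\boldsymbol{\varphi}]\,dx=\int_{\mathbb{R}^3}\mathbb{S}(\nabla\mathbf{u}):\nabla\boldsymbol{\varphi}\,dx-\int_{\mathbb{R}^3}\rho\nabla G\cdot\boldsymbol{\varphi}\,dx$$ for all $\boldsymbol{\varphi}\in C_c^1(\mathbb{R}^3;\mathbb{R}^3)$. *)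

theory Defs
  imports "HOL-Analysis.Analysis"
begin

primrec Ck :: "nat \<Rightarrow> ('a::euclidean_space \<Rightarrow> 'b::real_normed_vector) \<Rightarrow> bool" where
  "Ck 0 f \<longleftrightarrow> continuous_on UNIV f"
| "Ck (Suc k) f \<longleftrightarrow> (\<forall>x. f differentiable (at x)) \<and>
     (\<forall>i\<in>Basis. Ck k (\<lambda>x. frechet_derivative f (at x) i))"

definition compact_support :: "('a::topological_space \<Rightarrow> 'b::zero) \<Rightarrow> bool" where
  "compact_support f \<longleftrightarrow> compact (closure {x. f x \<noteq> 0})"

definition Cc1 :: "('a::euclidean_space \<Rightarrow> 'b::real_normed_vector) set" where
  "Cc1 = {f. Ck 1 f \<and> compact_support f}"

definition Cc_inf :: "('a::euclidean_space \<Rightarrow> 'b::real_normed_vector) set" where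
  "Cc_inf = {f. (\<forall>k. Ck k f) \<and> compact_support f}"

definition L1_loc :: "('a::euclidean_space \<Rightarrow> 'b::euclidean_space) set" where
  "L1_loc = {f. \<forall>K. compact K \<longrightarrow> f absolutely_integrable_on K}"

definition Lp :: "real \<Rightarrow> ('a::euclidean_space \<Rightarrow> 'b::euclidean_space) set" where
  "Lp r = {f. f \<in> borel_measurable lebesgue \<and> integrable lebesgue (\<lambda>x. norm (f x) powr r)}"

text \<open>The norm \<open>(\<integral>|\<nabla>v|\<^sup>q)\<^sup>1\<^sup>/\<^sup>q\<close> of a test function; the pointwise norm of the gradient is
  the Euclidean (Frobenius) one, for scalar and for vector-valued \<open>v\<close>.\<close>

definition D0_norm :: "real \<Rightarrow> ('a::euclidean_space \<Rightarrow> 'b::euclidean_space) \<Rightarrow> real" where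
  "D0_norm q v =
     (LINT x|lebesgue. L2_set (\<lambda>i. norm (frechet_derivative v (at x) i)) Basis powr q) powr (1 / q)"

text \<open>The completion of the test functions in \<open>D0_norm q\<close>, realised as a space of functions:
  an element is the \<open>L\<^sup>1\<^sub>l\<^sub>o\<^sub>c\<close> limit of a Cauchy sequence of test functions.  When the exponent is
  smaller than the space dimension, the Sobolev inequality shows that every Cauchy sequence has
  such a limit and that the limit (up to null sets) determines the Cauchy class.  For larger
  exponents the completion is not a space of functions and this definition must not be used.\<close>

definition D0 :: "real \<Rightarrow> ('a::euclidean_space \<Rightarrow> 'b::euclidean_space) set" where
  "D0 q = {v. v \<in> L1_loc \<and>
     (\<exists>\<phi>. (\<forall>n::nat. \<phi> n \<in> Cc_inf) \<and>
        (\<forall>\<epsilon>>0. \<exists>N. \<forall>m\<ge>N. \<forall>n\<ge>N. D0_norm q (\<lambda>x. \<phi> m x - \<phi> n x) < \<epsilon>) \<and>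
        (\<forall>K. compact K \<longrightarrow>
           (\<lambda>n. LINT x:K|lebesgue. norm (\<phi> n x - v x)) \<longlonglongrightarrow> 0))}"

definition has_weak_deriv ::
  "('a::euclidean_space \<Rightarrow> 'b::euclidean_space) \<Rightarrow> 'a \<Rightarrow> ('a \<Rightarrow> 'b) \<Rightarrow> bool" where
  "has_weak_deriv v i g \<longleftrightarrow> v \<in> L1_loc \<and> g \<in> L1_loc \<and>
     (\<forall>\<phi>\<in>Cc_inf. (LINT x|lebesgue. frechet_derivative \<phi> (at x) i *\<^sub>R v x)
                = - (LINT x|lebesgue. (\<phi> x :: real) *\<^sub>R g x))"

text \<open>Weak derivatives are unique only up to null sets, so a representative is chosen; elements
  of \<open>D0 q\<close> with \<open>1 \<le> q\<close> do have weak derivatives.\<close>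

definition weak_deriv ::
  "('a::euclidean_space \<Rightarrow> 'b::euclidean_space) \<Rightarrow> 'a \<Rightarrow> 'a \<Rightarrow> 'b" where
  "weak_deriv v i = (SOME g. has_weak_deriv v i g)"

definition weak_grad :: "(real^'n \<Rightarrow> real) \<Rightarrow> real^'n \<Rightarrow> real^'n" where
  "weak_grad v x = (\<chi> i. weak_deriv v (axis i 1) x)"

text \<open>Row \<open>i\<close>, column \<open>j\<close> is \<open>\<partial>\<^sub>j u\<^sub>i\<close>, the convention of the library's \<open>jacobian\<close>.\<close>

definition weak_jacobian :: "(real^'n \<Rightarrow> real^'m) \<Rightarrow> real^'n \<Rightarrow> real^'n^'m" where
  "weak_jacobian u x = (\<chi> i j. weak_deriv u (axis j 1) x $ i)"

definition grad :: "(real^'n \<Rightarrow> real) \<Rightarrow> real^'n \<Rightarrow> real^'n" where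
  "grad \<phi> x = (\<chi> i. frechet_derivative \<phi> (at x) (axis i 1))"

definition stress :: "real \<Rightarrow> real \<Rightarrow> real^3^3 \<Rightarrow> real^3^3" where
  "stress \<mu> \<eta> A =
     \<mu> *\<^sub>R (A + transpose A - (2 / 3 * trace A) *\<^sub>R mat 1) + (\<eta> * trace A) *\<^sub>R mat 1"

definition tensor :: "real^'m \<Rightarrow> real^'n \<Rightarrow> real^'n^'m" where
  "tensor a b = (\<chi> i j. a $ i * b $ j)"

definition ddot :: "real^'n^'m \<Rightarrow> real^'n^'m \<Rightarrow> real" where
  "ddot F H = (\<Sum>i\<in>UNIV. \<Sum>j\<in>UNIV. F $ i $ j * H $ i $ j)"

text \<open>The divergence of a field is the trace of its Jacobian matrix.\<close>

definition weak_solution ::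
  "real \<Rightarrow> real \<Rightarrow> (real \<Rightarrow> real) \<Rightarrow> (real^3 \<Rightarrow> real) \<Rightarrow> (real^3 \<Rightarrow> real) \<Rightarrow> (real^3 \<Rightarrow> real^3) \<Rightarrow> bool"
where
  "weak_solution \<mu> \<eta> p G \<rho> u \<longleftrightarrow>
     \<rho> \<in> borel_measurable lebesgue \<and> u \<in> borel_measurable lebesgue \<and>
     (AE x in lebesgue. 0 \<le> \<rho> x) \<and>
     (\<lambda>x. \<rho> x *\<^sub>R u x) \<in> L1_loc \<and>
     (\<forall>\<phi>\<in>Cc_inf. (LINT x|lebesgue. (\<rho> x *\<^sub>R u x) \<bullet> grad \<phi> x) = 0) \<and>
     \<rho> \<in> L1_loc \<and>
     (\<lambda>x. \<rho> x * (norm (u x))\<^sup>2) \<in> L1_loc \<and>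
     (\<lambda>x. p (\<rho> x)) \<in> L1_loc \<and>
     (\<lambda>x. \<rho> x *\<^sub>R weak_grad G x) \<in> L1_loc \<and>
     u \<in> D0 2 \<and>
     (\<forall>\<phi>\<in>Cc1.
        (LINT x|lebesgue. ddot (tensor (\<rho> x *\<^sub>R u x) (u x)) (jacobian \<phi> (at x))
                            + p (\<rho> x) * trace (jacobian \<phi> (at x)))
      = (LINT x|lebesgue. ddot (stress \<mu> \<eta> (weak_jacobian u x)) (jacobian \<phi> (at x)))
        - (LINT x|lebesgue. (\<rho> x *\<^sub>R weak_grad G x) \<bullet> \<phi> x))"

end

theory Submission
  imports Defs
begin

text \<open>Energy argument, with the limit functions \<open>u\<close> and \<open>G\<close> replaced by their approximating test functions
  so that no spatial cut-off is needed.  By the Sobolev inequality \<open>u \<in> L\<^sup>6\<close>, hence \<open>\<rho> u \<otimes> u \<in> L\<^sup>2\<close>, and the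
  range of \<open>q\<close> is exactly what gives \<open>\<rho> \<nabla>G \<in> L\<^sup>6\<^sup>/\<^sup>5\<close>.  The momentum equation therefore bounds \<open>\<nabla>p\<close> in the dual of
  \<open>D\<^sub>0\<^sup>1\<^sup>,\<^sup>2\<close>; testing it with gradients of truncated Newtonian potentials upgrades \<open>p = \<rho>\<^sup>\<gamma>\<close> from \<open>L\<^sup>1\<close> to \<open>L\<^sup>2\<close>.
  Now \<open>u\<close> itself is admissible in the momentum equation.  The convective term and the force term vanish by the
  continuity equation tested with \<open>|u|\<^sup>2/2\<close> and with \<open>G\<close>; the pressure term \<open>\<integral> p div u\<close> vanishes by the
  renormalized continuity equation, for which \<open>\<rho> \<in> L\<^sup>2\<^sup>\<gamma>\<close> makes the commutators converge without truncating
  \<open>\<rho>\<^sup>\<gamma>\<close>.  What remains is \<open>\<mu> \<integral> |\<nabla>u|\<^sup>2 + (\<mu>/3 + \<eta>) \<integral> (div u)\<^sup>2 = 0\<close>, so \<open>\<nabla>u = 0\<close> and, by the Sobolev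
  inequality again, \<open>u = 0\<close>.\<close>

section \<open>Lebesgue norms\<close>

text \<open>The obstacle is the pressure: \<rho>^\<gamma> is only in L^1 at the start and div u only
  in L^2, so the integral I of their product is not even known to exist. To repair this, the
  momentum equation is tested with grad(Omega * f), where Omega is the difference of two regularised
  Newtonian potentials of radii a < b. They agree outside radius b, so Omega has compact support,
  and its Laplacian is K_b - K_a for two bumps of equal mass. As b grows, the K_b part disappears
  because p is in L^1; what remains bounds K_a * p in L^2 uniformly in a. Once I makes sense,
  multiplying the mollified continuity equation by the power \<gamma> - 1 of the mollified density
  gives I = I / \<gamma> in the limit, hence I = 0. The window for q is that of an exponent a with
  1/a + 1/q = 5/6: q <= 3/2 means a >= 6 and the lower bound means a <= \<gamma>, so \<rho> is in
  L^a by interpolation. The coefficient \<mu>/3 + \<eta> arises because the integral of the sum of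
  (d_j u_i)(d_i u_j) equals that of (div u)^2, which joins \<mu> to \<eta> - 2\<mu>/3.\<close>

text \<open>Borel functions and \<open>lborel\<close>, in contrast to \<open>Lp\<close>:
  compositions such as f(x - z) and integrands on product spaces then stay measurable. The Lebesgue
  measurable data enter at the end through Borel representatives.\<close>

definition in_Lp :: "real \<Rightarrow> ('a::euclidean_space \<Rightarrow> real) \<Rightarrow> bool" where
  "in_Lp r f \<longleftrightarrow> f \<in> borel_measurable borel \<and> integrable lborel (\<lambda>x. \<bar>f x\<bar> powr r)"

definition Lp_norm :: "real \<Rightarrow> ('a::euclidean_space \<Rightarrow> real) \<Rightarrow> real" where
  "Lp_norm r f = (LINT x|lborel. \<bar>f x\<bar> powr r) powr (1 / r)"

lemma in_Lp_measurable [measurable_dest]: "in_Lp r f \<Longrightarrow> f \<in> borel_measurable borel"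
  by (simp add: in_Lp_def)

lemma in_Lp_integrable: "in_Lp r f \<Longrightarrow> integrable lborel (\<lambda>x. \<bar>f x\<bar> powr r)"
  by (simp add: in_Lp_def)

lemma Lp_norm_nonneg [simp]: "0 \<le> Lp_norm r f"
  by (simp add: Lp_norm_def)

lemma Lp_norm_powr: "r > 0 \<Longrightarrow> Lp_norm r f powr r = (LINT x|lborel. \<bar>f x\<bar> powr r)"
  by (simp add: Lp_norm_def powr_powr)

lemma Lp_norm_le:
  assumes "r > 0" "C \<ge> 0" "(LINT x|lborel. \<bar>f x\<bar> powr r) \<le> C powr r"
  shows "Lp_norm r f \<le> C"
proof -
  have "Lp_norm r f \<le> (C powr r) powr (1 / r)"
    unfolding Lp_norm_def using assms by (intro powr_mono2) auto
  then show ?thesis using assms by (simp add: powr_powr)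
qed

lemma Lp_norm_le_iff:
  assumes "r > 0" "C \<ge> 0"
  shows "Lp_norm r f \<le> C \<longleftrightarrow> (LINT x|lborel. \<bar>f x\<bar> powr r) \<le> C powr r"
  using Lp_norm_le[OF assms] Lp_norm_powr[OF assms(1), of f] powr_mono2[of r "Lp_norm r f" C] assms
  by auto

lemma Lp_norm_cong_AE:
  assumes "AE x in lborel. f x = g x" "f \<in> borel_measurable borel" "g \<in> borel_measurable borel"
  shows "Lp_norm r f = Lp_norm r g"
  unfolding Lp_norm_def using assms
  by (intro arg_cong2[where f="(powr)"] integral_cong_AE refl) auto

lemma in_Lp_bound:
  assumes "in_Lp r g" "f \<in> borel_measurable borel" "AE x in lborel. \<bar>f x\<bar> \<le> \<bar>g x\<bar>" "r \<ge> 0"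
  shows "in_Lp r f" "Lp_norm r f \<le> Lp_norm r g"
proof -
  have A: "AE x in lborel. \<bar>f x\<bar> powr r \<le> \<bar>g x\<bar> powr r"
    using assms(3) by eventually_elim (auto intro!: powr_mono2 simp: assms)
  have I: "integrable lborel (\<lambda>x. \<bar>f x\<bar> powr r)"
    apply (rule Bochner_Integration.integrable_bound[OF in_Lp_integrable[OF assms(1)]])
    using A assms(2) by auto
  then show "in_Lp r f" using assms by (simp add: in_Lp_def)
  show "Lp_norm r f \<le> Lp_norm r g"
    unfolding Lp_norm_def using A I in_Lp_integrable[OF assms(1)] assms
    by (intro powr_mono2 integral_mono_AE) auto
qed

lemma in_Lp_zero [simp]: "in_Lp r (\<lambda>_. 0)" and Lp_norm_zero [simp]: "Lp_norm r (\<lambda>_. 0) = 0"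
  by (auto simp: in_Lp_def Lp_norm_def)

lemma in_Lp_cmult: "in_Lp r f \<Longrightarrow> in_Lp r (\<lambda>x. c * f x)"
  by (auto simp: in_Lp_def abs_mult powr_mult)

lemma Lp_norm_cmult: "r > 0 \<Longrightarrow> Lp_norm r (\<lambda>x. c * f x) = \<bar>c\<bar> * Lp_norm r f"
  by (simp add: Lp_norm_def abs_mult powr_mult powr_powr)

lemma Lp_norm_minus: "Lp_norm r (\<lambda>x. - f x) = Lp_norm r f"
  by (simp add: Lp_norm_def)

lemma Lp_norm_diff_commute: "Lp_norm r (\<lambda>x. f x - g x) = Lp_norm r (\<lambda>x. g x - f x)"
  by (simp add: Lp_norm_def abs_minus_commute)

lemma in_Lp_abs: "in_Lp r f \<Longrightarrow> in_Lp r (\<lambda>x. \<bar>f x\<bar>)"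
  and Lp_norm_abs: "Lp_norm r (\<lambda>x. \<bar>f x\<bar>) = Lp_norm r f"
  by (auto simp: in_Lp_def Lp_norm_def)

lemma in_Lp_powr:
  assumes "in_Lp r f" "s > 0"
  shows "in_Lp (r / s) (\<lambda>x. \<bar>f x\<bar> powr s)"
  using assms by (auto simp: in_Lp_def powr_powr)

lemma Lp_norm_powr_fun:
  assumes "r > 0" "s > 0"
  shows "Lp_norm (r / s) (\<lambda>x. \<bar>f x\<bar> powr s) = Lp_norm r f powr s"
  using assms by (simp add: Lp_norm_def powr_powr)

text \<open>The pointwise bound |f|^c <= |f|^a + |f|^b suffices: the first term wins where |f| <= 1
  and the second elsewhere. It gives membership without a norm inequality.\<close>

lemma in_Lp_interpolate:
  assumes "in_Lp a f" "in_Lp b f" "a \<le> c" "c \<le> b" "0 < a"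
  shows "in_Lp c f"
proof -
  have *: "\<bar>f x\<bar> powr c \<le> \<bar>f x\<bar> powr a + \<bar>f x\<bar> powr b" for x
  proof (cases "\<bar>f x\<bar> \<le> 1")
    case True
    have "\<bar>f x\<bar> powr c \<le> \<bar>f x\<bar> powr a"
      using True assms by (intro powr_mono') auto
    then show ?thesis by (smt (verit) powr_ge_zero)
  next
    case False
    then have "\<bar>f x\<bar> powr c \<le> \<bar>f x\<bar> powr b" using assms by (intro powr_mono) auto
    then show ?thesis by (smt (verit) powr_ge_zero)
  qed
  have "integrable lborel (\<lambda>x. \<bar>f x\<bar> powr c)"
    by (rule Bochner_Integration.integrable_bound[OF Bochner_Integration.integrable_add
          [OF in_Lp_integrable[OF assms(1)] in_Lp_integrable[OF assms(2)]]])
       (use * in_Lp_measurable[OF assms(1)] in auto)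
  then show ?thesis using assms by (auto simp: in_Lp_def)
qed

lemma Lp_norm_eq_0_AE:
  assumes "in_Lp r f" "Lp_norm r f = 0" "r > 0"
  shows "AE x in lborel. f x = 0"
proof -
  have "(LINT x|lborel. \<bar>f x\<bar> powr r) = 0"
    using Lp_norm_powr[of r f] assms by simp
  then have "AE x in lborel. \<bar>f x\<bar> powr r = 0"
    using integral_nonneg_eq_0_iff_AE[OF in_Lp_integrable[OF assms(1)]] by simp
  then show ?thesis by eventually_elim simp
qed

text \<open>Young's inequality with weights c/a and c/b is applied to f/A and g/B, where A and B
  exceed the norms by \<delta>. The margin keeps the divisors positive when a norm is zero, and
  \<delta> tends to 0 at the end.\<close>

lemma Holder:
  assumes f: "in_Lp a f" and g: "in_Lp b g" and pos: "a > 0" "b > 0" "c > 0" and abc: "1/a + 1/b = 1/c"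
  shows "in_Lp c (\<lambda>x. f x * g x)" "Lp_norm c (\<lambda>x. f x * g x) \<le> Lp_norm a f * Lp_norm b g"
proof -
  note [measurable] = in_Lp_measurable[OF f] in_Lp_measurable[OF g]
  define \<alpha> where "\<alpha> = c / a" define \<beta> where "\<beta> = c / b"
  have ab: "\<alpha> > 0" "\<beta> > 0" "\<alpha> + \<beta> = 1" "\<alpha> * a = c" "\<beta> * b = c"
    using pos abc unfolding \<alpha>_def \<beta>_def
    by (auto simp: field_simps)
  have young: "x powr c * y powr c \<le> \<alpha> * x powr a + \<beta> * y powr b" if "x \<ge> 0" "y \<ge> 0" for x y
  proof (cases "x = 0 \<or> y = 0")
    case True then show ?thesis using ab by (auto simp: pos)
  next
    case False
    then have "(x powr a) powr \<alpha> * (y powr b) powr \<beta> \<le> \<alpha> * x powr a + \<beta> * y powr b"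
      using that ab by (intro Youngs_inequality_0) auto
    then show ?thesis using ab by (simp add: powr_powr mult.commute)
  qed
  have fi: "integrable lborel (\<lambda>x. \<bar>f x\<bar> powr a)" and gi: "integrable lborel (\<lambda>x. \<bar>g x\<bar> powr b)"
    using f g by (auto simp: in_Lp_def)
  have eq: "\<bar>f x * g x\<bar> powr c = \<bar>f x\<bar> powr c * \<bar>g x\<bar> powr c" for x
    by (simp add: abs_mult powr_mult)
  have int: "integrable lborel (\<lambda>x. \<bar>f x * g x\<bar> powr c)"
    apply (rule Bochner_Integration.integrable_bound[where f="\<lambda>x. \<alpha> * \<bar>f x\<bar> powr a + \<beta> * \<bar>g x\<bar> powr b"])
    using fi gi apply simp
    using f g apply measurable
    using young ab by (auto simp: eq intro!: AE_I2)
  then show "in_Lp c (\<lambda>x. f x * g x)" by (auto simp: in_Lp_def)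
  have le: "Lp_norm c (\<lambda>x. f x * g x) \<le> (Lp_norm a f + \<delta>) * (Lp_norm b g + \<delta>)" if "\<delta> > 0" for \<delta>
  proof (rule Lp_norm_le)
    define A where "A = Lp_norm a f + \<delta>" define B where "B = Lp_norm b g + \<delta>"
    have AB: "A > 0" "B > 0" unfolding A_def B_def using that by (auto intro: add_nonneg_pos)
    have A1: "(LINT x|lborel. \<bar>f x\<bar> powr a) \<le> A powr a" and B1: "(LINT x|lborel. \<bar>g x\<bar> powr b) \<le> B powr b"
      using Lp_norm_le_iff[of a A f] Lp_norm_le_iff[of b B g] AB that pos by (auto simp: A_def B_def)
    have pt: "\<bar>f x * g x\<bar> powr c \<le> (A*B) powr c * (\<alpha> / A powr a * \<bar>f x\<bar> powr a + \<beta> / B powr b * \<bar>g x\<bar> powr b)" for x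
    proof -
      have "(\<bar>f x\<bar>/A) powr c * (\<bar>g x\<bar>/B) powr c \<le> \<alpha> * (\<bar>f x\<bar>/A) powr a + \<beta> * (\<bar>g x\<bar>/B) powr b"
        using AB by (intro young) auto
      then show ?thesis using AB by (simp add: eq powr_divide powr_mult field_simps)
    qed
    have "(LINT x|lborel. \<bar>f x * g x\<bar> powr c)
        \<le> (LINT x|lborel. (A*B) powr c * (\<alpha> / A powr a * \<bar>f x\<bar> powr a + \<beta> / B powr b * \<bar>g x\<bar> powr b))"
      using int fi gi pt by (intro integral_mono) auto
    also have "\<dots> = (A*B) powr c * (\<alpha> / A powr a * (LINT x|lborel. \<bar>f x\<bar> powr a) + \<beta> / B powr b * (LINT x|lborel. \<bar>g x\<bar> powr b))"
      using fi gi by simp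
    also have "\<dots> \<le> (A*B) powr c * (\<alpha> / A powr a * A powr a + \<beta> / B powr b * B powr b)"
      using A1 B1 ab AB by (intro mult_left_mono add_mono) auto
    also have "\<dots> = (A*B) powr c" using AB ab by simp
    finally show "(LINT x|lborel. \<bar>f x * g x\<bar> powr c) \<le> ((Lp_norm a f + \<delta>) * (Lp_norm b g + \<delta>)) powr c"
      by (simp add: A_def B_def)
  qed (use that pos in auto)
  show "Lp_norm c (\<lambda>x. f x * g x) \<le> Lp_norm a f * Lp_norm b g"
  proof (rule tendsto_lowerbound)
    show "((\<lambda>\<delta>. (Lp_norm a f + \<delta>) * (Lp_norm b g + \<delta>)) \<longlongrightarrow> Lp_norm a f * Lp_norm b g) (at_right 0)"
      by (rule tendsto_eq_intros refl | simp)+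
    show "\<forall>\<^sub>F \<delta> in at_right 0. Lp_norm c (\<lambda>x. f x * g x) \<le> (Lp_norm a f + \<delta>) * (Lp_norm b g + \<delta>)"
      using le by (auto simp: eventually_at_right_field intro: exI[of _ 1])
  qed simp
qed

text \<open>Convexity of the power is used on positive arguments; if x or y is 0, the claim reduces
  to c^r <= c for c in [0, 1].\<close>

lemma powr_convex_combination:
  fixes x y :: real
  assumes "r \<ge> 1" "x \<ge> 0" "y \<ge> 0" "s \<ge> 0" "t \<ge> 0" "s + t = 1"
  shows "(s * x + t * y) powr r \<le> s * x powr r + t * y powr r"
proof -
  have small: "(c * z) powr r \<le> c * z powr r" if "0 \<le> c" "c \<le> 1" "z \<ge> 0" for c z
  proof -
    have "c powr r \<le> c powr 1" using that assms(1) by (intro powr_mono') auto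
    then show ?thesis using that by (simp add: powr_mult mult_right_mono)
  qed
  consider "x = 0" | "y = 0" | "x > 0" "y > 0" using assms by linarith
  then show ?thesis
  proof cases
    case 3
    then show ?thesis using powr_convex[OF assms(1)] assms unfolding convex_on_def by auto
  qed (use small[of t y] small[of s x] assms in auto)
qed

text \<open>With A and B slightly above the two norms, (|f| + |g|)/(A + B) is the convex combination
  of |f|/A and |g|/B with weights A/(A+B) and B/(A+B). Convexity of the power therefore gives the
  bound after integration.\<close>

lemma Minkowski:
  assumes f: "in_Lp r f" and g: "in_Lp r g" and r: "r \<ge> 1"
  shows "in_Lp r (\<lambda>x. f x + g x)" "Lp_norm r (\<lambda>x. f x + g x) \<le> Lp_norm r f + Lp_norm r g"
proof -
  note [measurable] = in_Lp_measurable[OF f] in_Lp_measurable[OF g]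
  have fi: "integrable lborel (\<lambda>x. \<bar>f x\<bar> powr r)" and gi: "integrable lborel (\<lambda>x. \<bar>g x\<bar> powr r)"
    using f g by (auto simp: in_Lp_def)
  have pt: "\<bar>f x + g x\<bar> powr r \<le> (A+B) powr r * (A/(A+B) / A powr r * \<bar>f x\<bar> powr r + B/(A+B) / B powr r * \<bar>g x\<bar> powr r)"
    if AB: "A > 0" "B > 0" for A B x
  proof -
    have "(A/(A+B)) * (\<bar>f x\<bar>/A) + (B/(A+B)) * (\<bar>g x\<bar>/B) = (\<bar>f x\<bar> + \<bar>g x\<bar>) / (A+B)"
      using AB by (simp add: add_divide_distrib)
    moreover have "((A/(A+B)) * (\<bar>f x\<bar>/A) + (B/(A+B)) * (\<bar>g x\<bar>/B)) powr r
       \<le> (A/(A+B)) * (\<bar>f x\<bar>/A) powr r + (B/(A+B)) * (\<bar>g x\<bar>/B) powr r"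
      using AB r by (intro powr_convex_combination) (auto simp: add_divide_distrib[symmetric])
    ultimately have "(\<bar>f x\<bar> + \<bar>g x\<bar>) powr r / (A+B) powr r \<le> (A/(A+B)) * (\<bar>f x\<bar> powr r / A powr r) + (B/(A+B)) * (\<bar>g x\<bar> powr r / B powr r)"
      using AB by (simp add: powr_divide)
    then have "(\<bar>f x\<bar> + \<bar>g x\<bar>) powr r \<le> (A+B) powr r * ((A/(A+B)) * (\<bar>f x\<bar> powr r / A powr r) + (B/(A+B)) * (\<bar>g x\<bar> powr r / B powr r))"
      using AB by (subst (asm) pos_divide_le_eq) (auto simp: mult.commute)
    moreover have "\<bar>f x + g x\<bar> powr r \<le> (\<bar>f x\<bar> + \<bar>g x\<bar>) powr r"
      using r by (intro powr_mono2) auto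
    ultimately show ?thesis by simp
  qed
  have int: "integrable lborel (\<lambda>x. \<bar>f x + g x\<bar> powr r)"
    apply (rule Bochner_Integration.integrable_bound[where f="\<lambda>x. (1+1) powr r * (1/(1+1) / 1 powr r * \<bar>f x\<bar> powr r + 1/(1+1) / 1 powr r * \<bar>g x\<bar> powr r)"])
    using fi gi apply simp
    using f g apply measurable
    using pt[of 1 1] by (auto intro!: AE_I2)
  then show "in_Lp r (\<lambda>x. f x + g x)" by (auto simp: in_Lp_def)
  have le: "Lp_norm r (\<lambda>x. f x + g x) \<le> (Lp_norm r f + \<delta>) + (Lp_norm r g + \<delta>)" if "\<delta> > 0" for \<delta>
  proof (rule Lp_norm_le)
    define A where "A = Lp_norm r f + \<delta>" define B where "B = Lp_norm r g + \<delta>"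
    have AB: "A > 0" "B > 0" unfolding A_def B_def using that by (auto intro: add_nonneg_pos)
    have A1: "(LINT x|lborel. \<bar>f x\<bar> powr r) \<le> A powr r" and B1: "(LINT x|lborel. \<bar>g x\<bar> powr r) \<le> B powr r"
      using Lp_norm_le_iff[of r A f] Lp_norm_le_iff[of r B g] AB that r by (auto simp: A_def B_def)
    have "(LINT x|lborel. \<bar>f x + g x\<bar> powr r)
        \<le> (LINT x|lborel. (A+B) powr r * (A/(A+B) / A powr r * \<bar>f x\<bar> powr r + B/(A+B) / B powr r * \<bar>g x\<bar> powr r))"
      using int fi gi pt[OF AB] by (intro integral_mono) auto
    also have "\<dots> = (A+B) powr r * (A/(A+B) / A powr r * (LINT x|lborel. \<bar>f x\<bar> powr r) + B/(A+B) / B powr r * (LINT x|lborel. \<bar>g x\<bar> powr r))"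
      using fi gi by simp
    also have "\<dots> \<le> (A+B) powr r * (A/(A+B) / A powr r * A powr r + B/(A+B) / B powr r * B powr r)"
      using A1 B1 AB by (intro mult_left_mono add_mono) auto
    also have "\<dots> = (A+B) powr r * (A/(A+B) + B/(A+B))" using AB by simp
    also have "A/(A+B) + B/(A+B) = 1" using AB by (simp add: add_divide_distrib[symmetric])
    finally show "(LINT x|lborel. \<bar>f x + g x\<bar> powr r) \<le> ((Lp_norm r f + \<delta>) + (Lp_norm r g + \<delta>)) powr r"
      by (simp add: A_def B_def)
  qed (use that r in \<open>auto intro!: add_nonneg_nonneg\<close>)
  show "Lp_norm r (\<lambda>x. f x + g x) \<le> Lp_norm r f + Lp_norm r g"
  proof (rule tendsto_lowerbound)
    show "((\<lambda>\<delta>. (Lp_norm r f + \<delta>) + (Lp_norm r g + \<delta>)) \<longlongrightarrow> Lp_norm r f + Lp_norm r g) (at_right 0)"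
      by (rule tendsto_eq_intros refl | simp)+
    show "\<forall>\<^sub>F \<delta> in at_right 0. Lp_norm r (\<lambda>x. f x + g x) \<le> (Lp_norm r f + \<delta>) + (Lp_norm r g + \<delta>)"
      using le by (auto simp: eventually_at_right_field intro: exI[of _ 1])
  qed simp
qed

lemma in_Lp_minus: "in_Lp r f \<Longrightarrow> in_Lp r (\<lambda>x. - f x)"
  by (auto simp: in_Lp_def)

lemma Minkowski_diff:
  assumes f: "in_Lp r f" and g: "in_Lp r g" and r: "r \<ge> 1"
  shows "in_Lp r (\<lambda>x. f x - g x)" "Lp_norm r (\<lambda>x. f x - g x) \<le> Lp_norm r f + Lp_norm r g"
  using Minkowski[OF f in_Lp_minus[OF g] r] by (auto simp: Lp_norm_minus)

lemma Lp_norm_triangle3: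
  assumes "in_Lp r f" "in_Lp r g" "in_Lp r h" "r \<ge> 1"
  shows "Lp_norm r (\<lambda>x. f x - h x) \<le> Lp_norm r (\<lambda>x. f x - g x) + Lp_norm r (\<lambda>x. g x - h x)"
  using Minkowski(2)[OF Minkowski_diff(1)[OF assms(1,2,4)] Minkowski_diff(1)[OF assms(2,3,4)] assms(4)] by simp

lemma in_Lp_sum:
  assumes "\<And>i. i \<in> I \<Longrightarrow> in_Lp r (f i)" "r \<ge> 1"
  shows "in_Lp r (\<lambda>x. \<Sum>i\<in>I. f i x)"
  using assms(1)
proof (induction I rule: infinite_finite_induct)
  case (insert i I) then show ?case using Minkowski(1)[of r "f i"] assms(2) by simp
qed auto

lemma Lp_norm_sum:
  assumes "\<And>i. i \<in> I \<Longrightarrow> in_Lp r (f i)" "r \<ge> 1"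
  shows "Lp_norm r (\<lambda>x. \<Sum>i\<in>I. f i x) \<le> (\<Sum>i\<in>I. Lp_norm r (f i))"
  using assms(1)
proof (induction I rule: infinite_finite_induct)
  case (insert i I)
  then show ?case using Minkowski(2)[of r "f i" "\<lambda>x. \<Sum>i\<in>I. f i x"] in_Lp_sum[of I r f] assms(2)
    by fastforce
qed auto

lemma in_L1_integrable: "in_Lp 1 f \<Longrightarrow> integrable lborel f"
  using integrable_abs_iff[of f lborel] by (auto simp: in_Lp_def)

lemma integrable_in_L1: "integrable lborel f \<Longrightarrow> in_Lp 1 f"
  by (auto simp: in_Lp_def)

lemma integral_le_L1_norm: "in_Lp 1 f \<Longrightarrow> \<bar>LINT x|lborel. f x\<bar> \<le> Lp_norm 1 f"
  using integral_abs_bound[of lborel f] by (simp add: Lp_norm_def)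

lemma Holder_integral:
  assumes f: "in_Lp a f" and g: "in_Lp b g" and pos: "a > 0" "b > 0" and ab: "1/a + 1/b = 1"
  shows "integrable lborel (\<lambda>x. f x * g x)" "\<bar>LINT x|lborel. f x * g x\<bar> \<le> Lp_norm a f * Lp_norm b g"
  using in_L1_integrable[OF Holder(1)[OF f g pos zero_less_one]] integral_le_L1_norm[OF Holder(1)[OF f g pos zero_less_one]]
   Holder(2)[OF f g pos zero_less_one] ab by auto

section \<open>Convergence in L^r\<close>

text \<open>Memberships are part of the notion because the Bochner integral of a non-integrable
  function is 0, so that \<open>Lp_norm\<close> also vanishes on functions outside L^r and its
  convergence to 0 alone would say nothing.\<close>

definition Lp_tendsto :: "real \<Rightarrow> (nat \<Rightarrow> 'a::euclidean_space \<Rightarrow> real) \<Rightarrow> ('a \<Rightarrow> real) \<Rightarrow> bool" where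
  "Lp_tendsto r F f \<longleftrightarrow> (\<forall>n. in_Lp r (F n)) \<and> in_Lp r f \<and> (\<lambda>n. Lp_norm r (\<lambda>x. F n x - f x)) \<longlonglongrightarrow> 0"

lemma Lp_tendstoD:
  assumes "Lp_tendsto r F f"
  shows "in_Lp r (F n)" "in_Lp r f" "(\<lambda>n. Lp_norm r (\<lambda>x. F n x - f x)) \<longlonglongrightarrow> 0"
  using assms by (auto simp: Lp_tendsto_def)

lemma Lp_tendsto_const: "in_Lp r f \<Longrightarrow> Lp_tendsto r (\<lambda>_. f) f"
  by (simp add: Lp_tendsto_def)

lemma Lp_tendsto_subseq: "Lp_tendsto r F f \<Longrightarrow> strict_mono s \<Longrightarrow> Lp_tendsto r (\<lambda>n. F (s n)) f"
  unfolding Lp_tendsto_def using LIMSEQ_subseq_LIMSEQ[of "\<lambda>n. Lp_norm r (\<lambda>x. F n x - f x)" 0 s]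
  by (auto simp: o_def)

lemma Lp_tendsto_norm:
  assumes "Lp_tendsto r F f" "r \<ge> 1"
  shows "(\<lambda>n. Lp_norm r (F n)) \<longlonglongrightarrow> Lp_norm r f"
proof (rule LIM_zero_cancel, rule Lim_null_comparison[OF _ Lp_tendstoD(3)[OF assms(1)]])
  note [simp] = Lp_tendstoD[OF assms(1)]
  show "\<forall>\<^sub>F n in sequentially. norm (Lp_norm r (F n) - Lp_norm r f) \<le> Lp_norm r (\<lambda>x. F n x - f x)"
  proof (rule always_eventually, rule allI)
    fix n
    have "Lp_norm r (F n) \<le> Lp_norm r (\<lambda>x. F n x - f x) + Lp_norm r f"
      using Minkowski(2)[of r "\<lambda>x. F n x - f x" f] Minkowski_diff(1)[of r "F n" f] assms(2) by simp
    moreover have "Lp_norm r f \<le> Lp_norm r (\<lambda>x. F n x - f x) + Lp_norm r (F n)"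
      using Minkowski(2)[of r "\<lambda>x. f x - F n x" "F n"] Minkowski_diff(1)[of r f "F n"] assms(2)
      by (simp add: Lp_norm_diff_commute)
    ultimately show "norm (Lp_norm r (F n) - Lp_norm r f) \<le> Lp_norm r (\<lambda>x. F n x - f x)" by simp
  qed
qed

lemma Lp_tendsto_add:
  assumes "Lp_tendsto r F f" "Lp_tendsto r G g" "r \<ge> 1"
  shows "Lp_tendsto r (\<lambda>n x. F n x + G n x) (\<lambda>x. f x + g x)"
  unfolding Lp_tendsto_def
proof (intro conjI allI)
  note F = Lp_tendstoD[OF assms(1)] and G = Lp_tendstoD[OF assms(2)]
  show "in_Lp r (\<lambda>x. F n x + G n x)" for n using F G assms(3) by (auto intro: Minkowski)
  show "in_Lp r (\<lambda>x. f x + g x)" using F G assms(3) by (auto intro: Minkowski)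
  show "(\<lambda>n. Lp_norm r (\<lambda>x. F n x + G n x - (f x + g x))) \<longlonglongrightarrow> 0"
  proof (rule Lim_null_comparison)
    show "(\<lambda>n. Lp_norm r (\<lambda>x. F n x - f x) + Lp_norm r (\<lambda>x. G n x - g x)) \<longlonglongrightarrow> 0"
      using tendsto_add[OF F(3) G(3)] by simp
    show "\<forall>\<^sub>F n in sequentially. norm (Lp_norm r (\<lambda>x. F n x + G n x - (f x + g x))) \<le> Lp_norm r (\<lambda>x. F n x - f x) + Lp_norm r (\<lambda>x. G n x - g x)"
      using Minkowski(2)[OF Minkowski_diff(1)[OF F(1) F(2)] Minkowski_diff(1)[OF G(1) G(2)]] assms(3)
      by (intro always_eventually) (auto simp: algebra_simps)
  qed
qed

lemma Lp_tendsto_cmult: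
  assumes "Lp_tendsto r F f" "r > 0"
  shows "Lp_tendsto r (\<lambda>n x. c * F n x) (\<lambda>x. c * f x)"
  using assms tendsto_mult_right_zero[OF Lp_tendstoD(3)[OF assms(1)], of "\<bar>c\<bar>"]
  by (auto simp: Lp_tendsto_def in_Lp_cmult Lp_norm_cmult right_diff_distrib[symmetric])

lemma Lp_tendsto_sum:
  assumes "\<And>i. i \<in> I \<Longrightarrow> Lp_tendsto r (F i) (f i)" "r \<ge> 1"
  shows "Lp_tendsto r (\<lambda>n x. \<Sum>i\<in>I. F i n x) (\<lambda>x. \<Sum>i\<in>I. f i x)"
  using assms(1)
proof (induction I rule: infinite_finite_induct)
  case (insert i I) then show ?case using Lp_tendsto_add[of r "F i" "f i"] assms(2) by simp
qed (auto simp: Lp_tendsto_def)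

text \<open>The difference is split as (F - f) G + f (G - g); the norms of G converge and so stay
  bounded. Chained with itself, this passes to the limit in the triple products of the energy
  identity.\<close>

lemma Lp_tendsto_mult:
  assumes "Lp_tendsto a F f" "Lp_tendsto b G g" "a \<ge> 1" "b \<ge> 1" "c \<ge> 1" "1/a + 1/b = 1/c"
  shows "Lp_tendsto c (\<lambda>n x. F n x * G n x) (\<lambda>x. f x * g x)"
  unfolding Lp_tendsto_def
proof (intro conjI allI)
  note F = Lp_tendstoD[OF assms(1)] and G = Lp_tendstoD[OF assms(2)]
  have pos: "a > 0" "b > 0" "c > 0" using assms by auto
  note H = Holder[OF _ _ pos assms(6)]
  show "in_Lp c (\<lambda>x. F n x * G n x)" for n using F G by (auto intro: H)
  show "in_Lp c (\<lambda>x. f x * g x)" using F G by (auto intro: H)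
  show "(\<lambda>n. Lp_norm c (\<lambda>x. F n x * G n x - f x * g x)) \<longlonglongrightarrow> 0"
  proof (rule Lim_null_comparison)
    show "(\<lambda>n. Lp_norm a (\<lambda>x. F n x - f x) * Lp_norm b (G n) + Lp_norm a f * Lp_norm b (\<lambda>x. G n x - g x)) \<longlonglongrightarrow> 0"
      using tendsto_add[OF tendsto_mult[OF F(3) Lp_tendsto_norm[OF assms(2,4)]] tendsto_mult[OF tendsto_const[of "Lp_norm a f"] G(3)]] by simp
    show "\<forall>\<^sub>F n in sequentially. norm (Lp_norm c (\<lambda>x. F n x * G n x - f x * g x)) \<le> Lp_norm a (\<lambda>x. F n x - f x) * Lp_norm b (G n) + Lp_norm a f * Lp_norm b (\<lambda>x. G n x - g x)"
    proof (rule always_eventually, rule allI)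
      fix n
      have 1: "in_Lp a (\<lambda>x. F n x - f x)" "in_Lp b (\<lambda>x. G n x - g x)"
        using F G assms by (auto intro: Minkowski_diff)
      have "Lp_norm c (\<lambda>x. (F n x - f x) * G n x + f x * (G n x - g x))
         \<le> Lp_norm c (\<lambda>x. (F n x - f x) * G n x) + Lp_norm c (\<lambda>x. f x * (G n x - g x))"
        using F G 1 assms(5) by (intro Minkowski(2) H(1)) auto
      also have "\<dots> \<le> Lp_norm a (\<lambda>x. F n x - f x) * Lp_norm b (G n) + Lp_norm a f * Lp_norm b (\<lambda>x. G n x - g x)"
        using F G 1 by (intro add_mono H(2)) auto
      finally show "norm (Lp_norm c (\<lambda>x. F n x * G n x - f x * g x)) \<le> Lp_norm a (\<lambda>x. F n x - f x) * Lp_norm b (G n) + Lp_norm a f * Lp_norm b (\<lambda>x. G n x - g x)"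
        by (simp add: algebra_simps)
    qed
  qed
qed

lemma L1_tendsto_integral:
  assumes "Lp_tendsto 1 F f"
  shows "(\<lambda>n. LINT x|lborel. F n x) \<longlonglongrightarrow> (LINT x|lborel. f x)"
proof (rule LIM_zero_cancel, rule Lim_null_comparison[OF _ Lp_tendstoD(3)[OF assms]])
  note F = Lp_tendstoD[OF assms]
  show "\<forall>\<^sub>F n in sequentially. norm ((LINT x|lborel. F n x) - (LINT x|lborel. f x)) \<le> Lp_norm 1 (\<lambda>x. F n x - f x)"
  proof (rule always_eventually, rule allI)
    fix n
    have "(LINT x|lborel. F n x) - (LINT x|lborel. f x) = (LINT x|lborel. F n x - f x)"
      using in_L1_integrable[OF F(1)[of n]] in_L1_integrable[OF F(2)] by simp
    then show "norm ((LINT x|lborel. F n x) - (LINT x|lborel. f x)) \<le> Lp_norm 1 (\<lambda>x. F n x - f x)"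
      using integral_le_L1_norm[OF Minkowski_diff(1)[OF F(1)[of n] F(2)]] by simp
  qed
qed

lemma Lp_tendsto_integral_mult:
  assumes "Lp_tendsto a F f" "Lp_tendsto b G g" "a \<ge> 1" "b \<ge> 1" "1/a + 1/b = 1"
  shows "(\<lambda>n. LINT x|lborel. F n x * G n x) \<longlonglongrightarrow> (LINT x|lborel. f x * g x)"
  using L1_tendsto_integral Lp_tendsto_mult[OF assms(1-4), of 1] assms(5) by auto

lemma Lp_tendsto_AE_subseq:
  assumes "Lp_tendsto r F f" "r \<ge> 1"
  obtains s :: "nat \<Rightarrow> nat" where "strict_mono s" "AE x in lborel. (\<lambda>n. F (s n) x) \<longlonglongrightarrow> f x"
proof -
  note F = Lp_tendstoD[OF assms(1)]
  have D: "in_Lp r (\<lambda>x. F n x - f x)" for n using F assms by (intro Minkowski_diff) auto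
  have "(\<lambda>n. Lp_norm r (\<lambda>x. F n x - f x) powr r) \<longlonglongrightarrow> 0 powr r"
    using F(3) assms(2) by (intro tendsto_powr') (auto intro!: always_eventually)
  then have "(\<lambda>n. LINT x|lborel. norm (\<bar>F n x - f x\<bar> powr r)) \<longlonglongrightarrow> 0"
    using assms(2) by (subst (asm) Lp_norm_powr) auto
  from tendsto_L1_AE_subseq[OF in_Lp_integrable[OF D] this]
  obtain s where s: "strict_mono s" "AE x in lborel. (\<lambda>n. \<bar>F (s n) x - f x\<bar> powr r) \<longlonglongrightarrow> 0" by auto
  have "AE x in lborel. (\<lambda>n. F (s n) x) \<longlonglongrightarrow> f x"
    using s(2)
  proof eventually_elim
    case (elim x)
    have "(\<lambda>n. (\<bar>F (s n) x - f x\<bar> powr r) powr (1/r)) \<longlonglongrightarrow> 0 powr (1/r)"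
      using elim assms(2) by (intro tendsto_powr') (auto intro!: always_eventually)
    then have "(\<lambda>n. \<bar>F (s n) x - f x\<bar>) \<longlonglongrightarrow> 0" using assms(2) by (simp add: powr_powr)
    then show ?case by (simp add: tendsto_rabs_zero_iff LIM_zero_iff)
  qed
  with s(1) show ?thesis using that by blast
qed

text \<open>The standard way here to obtain membership of a limit: a uniform bound along an almost
  everywhere convergent sequence yields both integrability and the same bound.\<close>

lemma Lp_Fatou:
  assumes F: "\<And>n. in_Lp r (F n)" "\<And>n. Lp_norm r (F n) \<le> C" and r: "r > 0"
    and f: "f \<in> borel_measurable borel" and lim: "AE x in lborel. (\<lambda>n. F n x) \<longlonglongrightarrow> f x"
  shows "in_Lp r f" "Lp_norm r f \<le> C"
proof -
  have C: "C \<ge> 0" using F(2)[of 0] Lp_norm_nonneg[of r "F 0"] by linarith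
  note [measurable] = in_Lp_measurable[OF F(1)] f
  have "(\<integral>\<^sup>+x. ennreal (\<bar>f x\<bar> powr r) \<partial>lborel) \<le> (\<integral>\<^sup>+x. liminf (\<lambda>n. ennreal (\<bar>F n x\<bar> powr r)) \<partial>lborel)"
  proof (rule nn_integral_mono_AE, use lim in eventually_elim)
    case (elim x)
    have "(\<lambda>n. ennreal (\<bar>F n x\<bar> powr r)) \<longlonglongrightarrow> ennreal (\<bar>f x\<bar> powr r)"
      using elim r by (intro tendsto_ennrealI tendsto_powr' tendsto_rabs) auto
    from lim_imp_Liminf[OF _ this] show ?case by simp
  qed
  also have "\<dots> \<le> liminf (\<lambda>n. \<integral>\<^sup>+x. ennreal (\<bar>F n x\<bar> powr r) \<partial>lborel)"
    by (rule nn_integral_liminf) measurable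
  also have "\<dots> \<le> ennreal (C powr r)"
  proof (rule order_trans[OF Liminf_le_Limsup Limsup_bounded])
    have "(\<integral>\<^sup>+x. ennreal (\<bar>F n x\<bar> powr r) \<partial>lborel) \<le> ennreal (C powr r)" for n
      using Lp_norm_le_iff[OF r C, of "F n"] F(2)[of n] in_Lp_integrable[OF F(1)[of n]]
      by (subst nn_integral_eq_integral) (auto intro!: ennreal_leI)
    then show "\<forall>\<^sub>F n in sequentially. (\<integral>\<^sup>+x. ennreal (\<bar>F n x\<bar> powr r) \<partial>lborel) \<le> ennreal (C powr r)" by simp
  qed simp
  finally have le: "(\<integral>\<^sup>+x. ennreal (\<bar>f x\<bar> powr r) \<partial>lborel) \<le> ennreal (C powr r)" .
  then have I: "integrable lborel (\<lambda>x. \<bar>f x\<bar> powr r)"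
    by (intro integrableI_bounded) (auto simp: le_less_trans[OF le])
  then show "in_Lp r f" using f by (simp add: in_Lp_def)
  have "(LINT x|lborel. \<bar>f x\<bar> powr r) \<le> C powr r"
    using le I by (subst (asm) nn_integral_eq_integral) (auto simp: ennreal_le_iff)
  then show "Lp_norm r f \<le> C" using C r by (simp add: Lp_norm_le)
qed

section \<open>Completeness, translations and mollification\<close>

lemma Lp_dominated:
  assumes g: "in_Lp r g" and F: "\<And>n. F n \<in> borel_measurable borel" "\<And>n. AE x in lborel. \<bar>F n x\<bar> \<le> \<bar>g x\<bar>"
    and f: "f \<in> borel_measurable borel" and lim: "AE x in lborel. (\<lambda>n. F n x) \<longlonglongrightarrow> f x" and r: "r \<ge> 1"
  shows "Lp_tendsto r F f"
proof -
  note [measurable] = F(1) f in_Lp_measurable[OF g]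
  have bd: "AE x in lborel. \<forall>n. \<bar>F n x\<bar> \<le> \<bar>g x\<bar>" using F(2) by (simp add: AE_all_countable)
  have fb: "AE x in lborel. \<bar>f x\<bar> \<le> \<bar>g x\<bar>"
    using bd lim
  proof eventually_elim
    case (elim x) then show ?case by (intro LIMSEQ_le_const2[OF tendsto_rabs]) auto
  qed
  have inF: "in_Lp r (F n)" for n using F(2)[of n] r by (intro in_Lp_bound(1)[OF g]) auto
  have inf: "in_Lp r f" using fb r by (intro in_Lp_bound(1)[OF g]) auto
  have "(\<lambda>n. LINT x|lborel. \<bar>F n x - f x\<bar> powr r) \<longlonglongrightarrow> (LINT x|(lborel::'a measure). 0)"
  proof (rule integral_dominated_convergence)
    show "integrable lborel (\<lambda>x. 2 powr r * \<bar>g x\<bar> powr r)" using in_Lp_integrable[OF g] by simp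
    show "AE x in lborel. (\<lambda>n. \<bar>F n x - f x\<bar> powr r) \<longlonglongrightarrow> 0"
      using lim
    proof eventually_elim
      case (elim x)
      have "(\<lambda>n. \<bar>F n x - f x\<bar>) \<longlonglongrightarrow> 0" using elim by (simp add: tendsto_rabs_zero_iff LIM_zero_iff)
      then have "(\<lambda>n. \<bar>F n x - f x\<bar> powr r) \<longlonglongrightarrow> 0 powr r"
        using r by (intro tendsto_powr') (auto intro!: always_eventually)
      then show ?case by simp
    qed
    show "AE x in lborel. norm (\<bar>F n x - f x\<bar> powr r) \<le> 2 powr r * \<bar>g x\<bar> powr r" for n
      using bd fb
    proof eventually_elim
      case (elim x)
      have "\<bar>F n x - f x\<bar> powr r \<le> (2 * \<bar>g x\<bar>) powr r"
        using elim(1)[rule_format, of n] elim(2) r by (intro powr_mono2) auto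
      then show ?case by (simp add: powr_mult)
    qed
  qed measurable
  then have "(\<lambda>n. (LINT x|lborel. \<bar>F n x - f x\<bar> powr r) powr (1/r)) \<longlonglongrightarrow> 0 powr (1/r)"
    using r by (intro tendsto_powr') (auto intro!: always_eventually)
  then show ?thesis using inF inf r by (simp add: Lp_tendsto_def Lp_norm_def)
qed

text \<open>A subsequence has increments of norm at most 4^-k. Almost everywhere convergence of its
  telescoping series is obtained by a weight instead of an infinite triangle inequality, and Fatou's
  lemma then bounds the distance of every member to the limit.\<close>

lemma Lp_complete:
  fixes F :: "nat \<Rightarrow> 'a::euclidean_space \<Rightarrow> real"
  assumes F: "\<And>n. in_Lp r (F n)" and r: "r \<ge> 1"
    and cauchy: "\<And>e. e > 0 \<Longrightarrow> \<exists>N. \<forall>m\<ge>N. \<forall>n\<ge>N. Lp_norm r (\<lambda>x. F m x - F n x) < e"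
  obtains f where "Lp_tendsto r F f"
proof -
  note [measurable] = in_Lp_measurable[OF F]
  have D: "in_Lp r (\<lambda>x. F m x - F n x)" for m n using F r by (intro Minkowski_diff) auto
  have "\<exists>s::nat\<Rightarrow>nat. \<forall>k. (\<forall>n\<ge>s k. Lp_norm r (\<lambda>x. F n x - F (s k) x) < (1/4)^k) \<and> s k < s (Suc k)"
  proof (rule dependent_nat_choice)
    show "\<exists>N. \<forall>n\<ge>N. Lp_norm r (\<lambda>x. F n x - F N x) < (1/4)^0"
      using cauchy[of 1] by auto
    fix M k
    obtain N where N: "\<forall>m\<ge>N. \<forall>n\<ge>N. Lp_norm r (\<lambda>x. F m x - F n x) < (1/4)^Suc k"
      using cauchy[of "(1/4)^Suc k"] by auto
    show "\<exists>y. (\<forall>n\<ge>y. Lp_norm r (\<lambda>x. F n x - F y x) < (1/4)^Suc k) \<and> M < y"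
      using N by (intro exI[of _ "max N (Suc M)"]) auto
  qed
  then obtain s :: "nat \<Rightarrow> nat" where s: "\<And>k n. n \<ge> s k \<Longrightarrow> Lp_norm r (\<lambda>x. F n x - F (s k) x) < (1/4)^k"
    and mono: "strict_mono s" by (auto simp: strict_mono_Suc_iff)
  define d where "d k x = F (s (Suc k)) x - F (s k) x" for k x
  have [measurable]: "d k \<in> borel_measurable borel" for k unfolding d_def by measurable
  \<comment> \<open>Since 2^k 4^-k = 2^-k, the integrals of (2^k |d_k|)^r are summable. Their sum is
    thus finite almost everywhere, which bounds 2^k |d_k(x)| uniformly in k and makes the increments
    geometrically small at x.\<close>
  have dn: "(\<integral>\<^sup>+x. ennreal ((2^k * \<bar>d k x\<bar>) powr r) \<partial>lborel) \<le> ennreal (((1/2) powr r)^k)" for k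
  proof -
    have "Lp_norm r (d k) \<le> (1/4)^k"
      using s[of k "s (Suc k)"] strict_mono_less_eq[OF mono, of k "Suc k"] unfolding d_def by force
    then have "Lp_norm r (\<lambda>x. 2^k * d k x) \<le> 2^k * (1/4)^k"
      using r by (simp add: Lp_norm_cmult)
    also have "2^k * (1/4)^k = ((1/2)::real)^k" by (simp flip: power_mult_distrib)
    finally have 1: "(LINT x|lborel. \<bar>2^k * d k x\<bar> powr r) \<le> ((1/2)^k) powr r"
      using r by (subst (asm) Lp_norm_le_iff) auto
    have 2: "((1/2::real)^k) powr r = ((1/2) powr r)^k"
      by (simp add: powr_realpow[symmetric] powr_powr mult.commute)
    have "in_Lp r (\<lambda>x. 2^k * d k x)" unfolding d_def by (intro in_Lp_cmult D)
    from in_Lp_integrable[OF this] have "(\<integral>\<^sup>+x. ennreal (\<bar>2^k * d k x\<bar> powr r) \<partial>lborel) = ennreal (LINT x|lborel. \<bar>2^k * d k x\<bar> powr r)"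
      by (intro nn_integral_eq_integral) auto
    then show ?thesis using 1 2 by (auto simp: abs_mult intro!: ennreal_leI)
  qed
  have "(\<integral>\<^sup>+x. (\<Sum>k. ennreal ((2^k * \<bar>d k x\<bar>) powr r)) \<partial>lborel) = (\<Sum>k. \<integral>\<^sup>+x. ennreal ((2^k * \<bar>d k x\<bar>) powr r) \<partial>lborel)"
    by (rule nn_integral_suminf) measurable
  also have "\<dots> \<le> (\<Sum>k. ennreal (((1/2) powr r)^k))"
    by (intro suminf_le dn) auto
  also have "\<dots> < \<infinity>"
  proof -
    have "(1/2::real) powr r < 1 powr r" using r by (intro powr_less_mono2) auto
    then have "summable (\<lambda>k. ((1/2::real) powr r)^k)" by (intro summable_geometric) auto
    then show ?thesis by (simp add: suminf_ennreal2)
  qed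
  finally have less: "(\<integral>\<^sup>+x. (\<Sum>k. ennreal ((2^k * \<bar>d k x\<bar>) powr r)) \<partial>lborel) < \<infinity>" .
  have fin: "AE x in lborel. (\<Sum>k. ennreal ((2^k * \<bar>d k x\<bar>) powr r)) \<noteq> \<infinity>"
  proof (rule nn_integral_PInf_AE)
    show "(\<lambda>x. \<Sum>k. ennreal ((2^k * \<bar>d k x\<bar>) powr r)) \<in> borel_measurable lborel" by measurable
  qed (rule less_imp_neq[OF less])
  have conv: "AE x in lborel. convergent (\<lambda>k. F (s k) x)"
    using fin
  proof eventually_elim
    case (elim x)
    define S where "S = (\<Sum>k. ennreal ((2^k * \<bar>d k x\<bar>) powr r))"
    have "S \<noteq> \<infinity>" using elim unfolding S_def .
    then obtain K where K: "S = ennreal K" "K \<ge> 0" by (cases S) auto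
    have S_ge: "ennreal ((2^k * \<bar>d k x\<bar>) powr r) \<le> S" for k
    proof -
      have "sum (\<lambda>k. ennreal ((2^k * \<bar>d k x\<bar>) powr r)) {k} \<le> S"
        unfolding S_def by (rule sum_le_suminf[OF summableI]) simp_all
      then show ?thesis by (simp only: sum.insert_if sum.empty finite.emptyI empty_iff if_False add_0_right)
    qed
    have le: "\<bar>d k x\<bar> \<le> K powr (1/r) * (1/2)^k" for k
    proof -
      have "ennreal ((2^k * \<bar>d k x\<bar>) powr r) \<le> ennreal K" using S_ge[of k] K(1) by simp
      then have "(2^k * \<bar>d k x\<bar>) powr r \<le> K" using K(2) by simp
      then have "((2^k * \<bar>d k x\<bar>) powr r) powr (1/r) \<le> K powr (1/r)" using r by (intro powr_mono2) auto
      then have "2^k * \<bar>d k x\<bar> \<le> K powr (1/r)" using r by (simp add: powr_powr)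
      then show ?thesis by (simp add: field_simps)
    qed
    have "summable (\<lambda>k. d k x)"
      using le by (intro summable_comparison_test[OF _ summable_mult[OF summable_geometric[of "1/2::real"]]]) auto
    then have "convergent (\<lambda>n. \<Sum>k<n. d k x)" by (simp add: summable_iff_convergent)
    moreover have "(\<Sum>k<n. d k x) = F (s n) x - F (s 0) x" for n
      unfolding d_def by (rule sum_lessThan_telescope[of "\<lambda>k. F (s k) x"])
    ultimately have "convergent (\<lambda>n. F (s n) x - F (s 0) x)" by simp
    from convergent_add[OF this convergent_const[of "F (s 0) x"]] show ?case by simp
  qed
  \<comment> \<open>Where the subsequence diverges, \<open>lim\<close> is an unspecified value; this
    happens only on a null set, and measurability of f holds all the same.\<close>
  define f where "f x = lim (\<lambda>k. F (s k) x)" for x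
  have fm [measurable]: "f \<in> borel_measurable borel" unfolding f_def by measurable
  have lim: "AE x in lborel. (\<lambda>k. F (s k) x) \<longlonglongrightarrow> f x"
    using conv by eventually_elim (simp add: f_def convergent_LIMSEQ_iff)
  have key: "in_Lp r (\<lambda>x. F m x - f x) \<and> Lp_norm r (\<lambda>x. F m x - f x) \<le> e"
    if N: "\<forall>m\<ge>N. \<forall>n\<ge>N. Lp_norm r (\<lambda>x. F m x - F n x) < e" and m: "m \<ge> N" for e N m
  proof -
    have l: "AE x in lborel. (\<lambda>k. F m x - F (s (k + N)) x) \<longlonglongrightarrow> F m x - f x"
      using lim by eventually_elim (intro tendsto_intros LIMSEQ_ignore_initial_segment)
    have "s (k + N) \<ge> N" for k using strict_mono_imp_increasing[OF mono, of "k+N"] by simp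
    then have "Lp_norm r (\<lambda>x. F m x - F (s (k + N)) x) \<le> e" for k using N m by (simp add: less_imp_le)
    from Lp_Fatou[where F="\<lambda>k x. F m x - F (s (k + N)) x", OF D this _ _ l] r show ?thesis by auto
  qed
  obtain N1 where N1: "\<forall>m\<ge>N1. \<forall>n\<ge>N1. Lp_norm r (\<lambda>x. F m x - F n x) < 1" using cauchy[of 1] by auto
  have "in_Lp r (\<lambda>x. F N1 x - (F N1 x - f x))" by (rule Minkowski_diff(1)[OF F _ r]) (use key[OF N1, of N1] in auto)
  then have inf: "in_Lp r f" by simp
  have "(\<lambda>n. Lp_norm r (\<lambda>x. F n x - f x)) \<longlonglongrightarrow> 0"
  proof (rule LIMSEQ_I)
    fix e :: real assume "e > 0"
    then obtain N where N: "\<forall>m\<ge>N. \<forall>n\<ge>N. Lp_norm r (\<lambda>x. F m x - F n x) < e/2" using cauchy[of "e/2"] by auto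
    show "\<exists>N. \<forall>n\<ge>N. norm (Lp_norm r (\<lambda>x. F n x - f x) - 0) < e"
      using key[OF N] \<open>e > 0\<close> by (intro exI[of _ N]) (force)
  qed
  with inf F show ?thesis using that by (auto simp: Lp_tendsto_def)
qed

section \<open>Continuity of translations\<close>

lemma distr_lborel_translate: "distr lborel borel (\<lambda>x. x - h) = (lborel :: 'a::euclidean_space measure)"
proof -
  have "(+) (- h) = (\<lambda>x. x - h)" by (auto simp: fun_eq_iff)
  then show ?thesis using lborel_distr_plus[of "- h"] by simp
qed

lemma distr_lborel_reflect: "distr lborel borel (\<lambda>x. a - x) = (lborel :: 'a::euclidean_space measure)"
  using lborel_affine[of "-1" a] by (simp add: density_1)

lemma integral_lborel_translate:
  fixes f :: "'a::euclidean_space \<Rightarrow> real"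
  assumes "f \<in> borel_measurable borel"
  shows "(LINT x|lborel. f (x - h)) = (LINT x|lborel. f x)"
    "integrable lborel (\<lambda>x. f (x - h)) \<longleftrightarrow> integrable lborel f"
  using assms integral_distr[of "\<lambda>x. x - h" lborel borel f] integrable_distr_eq[of "\<lambda>x. x - h" lborel borel f]
  by (simp_all add: distr_lborel_translate)

lemma integral_lborel_reflect:
  fixes f :: "'a::euclidean_space \<Rightarrow> real"
  assumes "f \<in> borel_measurable borel"
  shows "(LINT x|lborel. f (a - x)) = (LINT x|lborel. f x)"
    "integrable lborel (\<lambda>x. f (a - x)) \<longleftrightarrow> integrable lborel f"
  using assms integral_distr[of "\<lambda>x. a - x" lborel borel f] integrable_distr_eq[of "\<lambda>x. a - x" lborel borel f]
  by (simp_all add: distr_lborel_reflect)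

lemma in_Lp_translate: "in_Lp r f \<Longrightarrow> in_Lp r (\<lambda>x. f (x - h))"
  using integral_lborel_translate(2)[of "\<lambda>x. \<bar>f x\<bar> powr r" h] by (auto simp: in_Lp_def)

lemma Lp_norm_translate: "in_Lp r f \<Longrightarrow> Lp_norm r (\<lambda>x. f (x - h)) = Lp_norm r f"
  using integral_lborel_translate(1)[of "\<lambda>x. \<bar>f x\<bar> powr r" h] by (auto simp: in_Lp_def Lp_norm_def)

text \<open>For open U the pointwise limit of the translated indicator is clear only at points of U.
  The symmetric difference is therefore written as twice the loss of overlap, an integral over U
  alone, and dominated convergence applies. Outer regularity passes from open sets to A.\<close>

lemma L1_translation_indicator:
  fixes A :: "'a::euclidean_space set"
  assumes A: "A \<in> sets borel" "emeasure lborel A < \<infinity>" and h: "h \<longlonglongrightarrow> 0"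
  shows "(\<lambda>n. LINT x|lborel. \<bar>indicator A (x - h n) - indicator A x\<bar> :: real) \<longlonglongrightarrow> 0"
proof -
  have openc: "(\<lambda>n. LINT x|lborel. \<bar>indicator U (x - h n) - indicator U x\<bar> :: real) \<longlonglongrightarrow> 0"
    if U: "open U" "emeasure lborel U < \<infinity>" for U :: "'a set"
  proof -
    have [measurable]: "U \<in> sets borel" using U by simp
    have iU: "integrable lborel (\<lambda>x. indicator U x :: real)" using U by (simp add: integrable_indicator_iff)
    have iUh: "integrable lborel (\<lambda>x. indicator U (x - a) :: real)" for a
      using iU by (subst integral_lborel_translate(2)) auto
    have iM: "integrable lborel (\<lambda>x. indicator U (x - a) * indicator U x :: real)" for a
      by (rule Bochner_Integration.integrable_bound[OF iU]) (auto simp: indicator_def)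
    have "(\<lambda>n. LINT x|lborel. indicator U (x - h n) * indicator U x :: real) \<longlonglongrightarrow> (LINT x|lborel. indicator U x)"
    proof (rule integral_dominated_convergence[OF _ _ iU])
      show "AE x in lborel. (\<lambda>n. indicator U (x - h n) * indicator U x :: real) \<longlonglongrightarrow> indicator U x"
      proof (rule AE_I2)
        fix x
        show "(\<lambda>n. indicator U (x - h n) * indicator U x :: real) \<longlonglongrightarrow> indicator U x"
        proof (cases "x \<in> U")
          case True
          have "(\<lambda>n. x - h n) \<longlonglongrightarrow> x - 0" using h by (intro tendsto_intros)
          then have "\<forall>\<^sub>F n in sequentially. x - h n \<in> U" using topological_tendstoD[of _ x sequentially U] U True by auto
          then show ?thesis using True by (intro tendsto_eventually) (auto elim!: eventually_mono)
        qed simp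
      qed
    qed (auto simp: indicator_def)
    then have lim: "(\<lambda>n. 2 * ((LINT x|lborel. indicator U x) - (LINT x|lborel. indicator U (x - h n) * indicator U x :: real))) \<longlonglongrightarrow> 2 * ((LINT x|lborel. indicator U x) - (LINT x|lborel. indicator U x))"
      by (intro tendsto_intros)
    have "(LINT x|lborel. \<bar>indicator U (x - a) - indicator U x\<bar> :: real) = 2 * ((LINT x|lborel. indicator U x) - (LINT x|lborel. indicator U (x - a) * indicator U x :: real))" for a
    proof -
      have "(LINT x|lborel. \<bar>indicator U (x - a) - indicator U x\<bar> :: real)
        = (LINT x|lborel. indicator U (x - a) + indicator U x - 2 * (indicator U (x - a) * indicator U x))"
        by (intro Bochner_Integration.integral_cong) (auto simp: indicator_def)
      also have "\<dots> = (LINT x|lborel. indicator U (x - a)) + (LINT x|lborel. indicator U x) - 2 * (LINT x|lborel. indicator U (x - a) * indicator U x)"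
        using iU iUh iM by simp
      also have "(LINT x|lborel. indicator U (x - a) :: real) = (LINT x|lborel. indicator U x)"
        by (rule integral_lborel_translate) auto
      finally show ?thesis by simp
    qed
    then show ?thesis using lim by simp
  qed
  show ?thesis
  proof (rule LIMSEQ_I)
    fix e :: real assume e: "e > 0"
    obtain U where U: "open U" "A \<subseteq> U" "emeasure lborel (U - A) < ennreal (e/4)"
      using outer_regular_lborel[of A "e/4"] A e by (metis divide_pos_pos zero_less_numeral ennreal_less_zero_iff)
    have [measurable]: "U \<in> sets borel" "A \<in> sets borel" using U A by simp_all
    have "emeasure lborel U = emeasure lborel A + emeasure lborel (U - A)"
      using U by (subst plus_emeasure) (auto intro!: arg_cong[where f="emeasure lborel"])
    also have "\<dots> < \<infinity>" using A(2) order.strict_trans[OF U(3), of \<infinity>] by simp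
    finally have finU: "emeasure lborel U < \<infinity>" .
    have iU: "integrable lborel (\<lambda>x. indicator U x :: real)" and iA: "integrable lborel (\<lambda>x. indicator A x :: real)"
      and iD: "integrable lborel (\<lambda>x. indicator (U - A) x :: real)"
      using finU A order.strict_trans[OF U(3), of \<infinity>] by (auto simp: integrable_indicator_iff)
    have tr: "integrable lborel (\<lambda>x. indicator B (x - a) :: real)" if "B \<in> sets borel" "integrable lborel (\<lambda>x. indicator B x :: real)" for B and a :: 'a
      using that by (subst integral_lborel_translate(2)) auto
    have mD: "(LINT x|lborel. indicator (U - A) x :: real) < e/4"
    proof -
      have "measure lborel (U - A) < e/4"
        using U(3) e order.strict_trans[OF U(3), of \<infinity>]
        by (subst (asm) emeasure_eq_ennreal_measure) (auto simp: ennreal_less_iff)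
      then show ?thesis by simp
    qed
    obtain N where N: "\<And>n. n \<ge> N \<Longrightarrow> (LINT x|lborel. \<bar>indicator U (x - h n) - indicator U x\<bar> :: real) < e/2"
      using LIMSEQ_D[OF openc[OF U(1) finU], of "e/2"] e by force
    show "\<exists>N. \<forall>n\<ge>N. norm ((LINT x|lborel. \<bar>indicator A (x - h n) - indicator A x\<bar> :: real) - 0) < e"
    proof (intro exI[of _ N] allI impI)
      fix n assume n: "n \<ge> N"
      have iUU: "integrable lborel (\<lambda>x. \<bar>indicator U (x - h n) - indicator U x\<bar> :: real)"
        using iU tr[OF _ iU] by (auto intro!: Bochner_Integration.integrable_abs)
      have "(LINT x|lborel. \<bar>indicator A (x - h n) - indicator A x\<bar> :: real)
        \<le> (LINT x|lborel. \<bar>indicator U (x - h n) - indicator U x\<bar> + indicator (U - A) (x - h n) + indicator (U - A) x)"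
      proof (rule integral_mono)
        show "integrable lborel (\<lambda>x. \<bar>indicator A (x - h n) - indicator A x\<bar> :: real)"
          using iA tr[OF _ iA] by (auto intro!: Bochner_Integration.integrable_abs)
        show "integrable lborel (\<lambda>x. \<bar>indicator U (x - h n) - indicator U x\<bar> + indicator (U - A) (x - h n) + indicator (U - A) x :: real)"
          using iUU iD tr[OF _ iD] by auto
      qed (use U(2) in \<open>auto simp: indicator_def\<close>)
      also have "\<dots> = (LINT x|lborel. \<bar>indicator U (x - h n) - indicator U x\<bar>) + (LINT x|lborel. indicator (U - A) (x - h n)) + (LINT x|lborel. indicator (U - A) x)"
        using iUU iD tr[OF _ iD] by simp
      also have "(LINT x|lborel. indicator (U - A) (x - h n) :: real) = (LINT x|lborel. indicator (U - A) x)"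
        by (rule integral_lborel_translate) auto
      finally show "norm ((LINT x|lborel. \<bar>indicator A (x - h n) - indicator A x\<bar> :: real) - 0) < e"
        using N[OF n] mD by simp
    qed
  qed
qed

lemma L1_translation_continuous:
  fixes f :: "'a::euclidean_space \<Rightarrow> real"
  assumes "integrable lborel f" "h \<longlonglongrightarrow> 0"
  shows "(\<lambda>n. LINT x|lborel. \<bar>f (x - h n) - f x\<bar>) \<longlonglongrightarrow> 0"
  using assms(1)
proof (induction f rule: integrable_induct)
  case (base A c)
  have "(\<lambda>n. \<bar>c\<bar> * (LINT x|lborel. \<bar>indicator A (x - h n) - indicator A x\<bar> :: real)) \<longlonglongrightarrow> \<bar>c\<bar> * 0"
    using base L1_translation_indicator[OF _ _ assms(2)] by (intro tendsto_intros) auto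
  moreover have "\<bar>indicator A (x - h n) *\<^sub>R c - indicator A x *\<^sub>R c\<bar> = \<bar>c\<bar> * \<bar>indicator A (x - h n) - indicator A x :: real\<bar>" for x n
    by (auto simp: indicator_def)
  ultimately show ?case by simp
next
  case (add f g)
  note [measurable] = borel_measurable_integrable[OF add(1)] borel_measurable_integrable[OF add(2)]
  have [simp]: "integrable lborel (\<lambda>x. f (x - a))" "integrable lborel (\<lambda>x. g (x - a))" for a
    using add by (subst integral_lborel_translate(2); auto)+
  show ?case
  proof (rule Lim_null_comparison)
    show "(\<lambda>n. (LINT x|lborel. \<bar>f (x - h n) - f x\<bar>) + (LINT x|lborel. \<bar>g (x - h n) - g x\<bar>)) \<longlonglongrightarrow> 0"
      using tendsto_add[OF add.IH] by simp
    show "\<forall>\<^sub>F n in sequentially. norm (LINT x|lborel. \<bar>f (x - h n) + g (x - h n) - (f x + g x)\<bar>)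
       \<le> (LINT x|lborel. \<bar>f (x - h n) - f x\<bar>) + (LINT x|lborel. \<bar>g (x - h n) - g x\<bar>)"
    proof (rule always_eventually, rule allI)
      fix n
      have "(LINT x|lborel. \<bar>f (x - h n) + g (x - h n) - (f x + g x)\<bar>) \<le> (LINT x|lborel. \<bar>f (x - h n) - f x\<bar> + \<bar>g (x - h n) - g x\<bar>)"
        using add by (intro integral_mono) (auto intro!: Bochner_Integration.integrable_abs)
      also have "\<dots> = (LINT x|lborel. \<bar>f (x - h n) - f x\<bar>) + (LINT x|lborel. \<bar>g (x - h n) - g x\<bar>)"
        using add by (intro Bochner_Integration.integral_add) (auto intro!: Bochner_Integration.integrable_abs)
      finally show "norm (LINT x|lborel. \<bar>f (x - h n) + g (x - h n) - (f x + g x)\<bar>) \<le> (LINT x|lborel. \<bar>f (x - h n) - f x\<bar>) + (LINT x|lborel. \<bar>g (x - h n) - g x\<bar>)"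
        by simp
    qed
  qed
next
  case (lim f s)
  have f1: "in_Lp 1 f" "\<And>i. in_Lp 1 (s i)" using lim by (auto intro: integrable_in_L1)
  have "Lp_tendsto 1 s f"
  proof (rule Lp_dominated[OF in_Lp_cmult[OF f1(1), of 2]])
    show "AE x in lborel. \<bar>s n x\<bar> \<le> \<bar>2 * f x\<bar>" for n using lim(3)[of _ n] by (auto simp: abs_mult)
    show "AE x in lborel. (\<lambda>n. s n x) \<longlonglongrightarrow> f x" using lim(2) by auto
  qed (use f1 in auto)
  then have l: "(\<lambda>n. Lp_norm 1 (\<lambda>x. s n x - f x)) \<longlonglongrightarrow> 0" by (rule Lp_tendstoD)
  show ?case
  proof (rule LIMSEQ_I)
    fix e :: real assume e: "e > 0"
    obtain i where i: "Lp_norm 1 (\<lambda>x. s i x - f x) < e/3" using LIMSEQ_D[OF l, of "e/3"] e by force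
    obtain N where N: "\<And>n. n \<ge> N \<Longrightarrow> (LINT x|lborel. \<bar>s i (x - h n) - s i x\<bar>) < e/3"
      using LIMSEQ_D[OF lim.IH[of i], of "e/3"] e by force
    show "\<exists>N. \<forall>n\<ge>N. norm ((LINT x|lborel. \<bar>f (x - h n) - f x\<bar>) - 0) < e"
    proof (intro exI[of _ N] allI impI)
      fix n assume n: "n \<ge> N"
      note T = in_Lp_translate[where h="h n"]
      have t: "in_Lp 1 (\<lambda>x. f (x - h n))" "in_Lp 1 (\<lambda>x. s i (x - h n))" using T f1 by blast+
      have "Lp_norm 1 (\<lambda>x. f (x - h n) - f x) \<le> Lp_norm 1 (\<lambda>x. f (x - h n) - s i (x - h n)) + Lp_norm 1 (\<lambda>x. s i (x - h n) - f x)"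
        using t f1 by (intro Lp_norm_triangle3) auto
      also have "Lp_norm 1 (\<lambda>x. s i (x - h n) - f x) \<le> Lp_norm 1 (\<lambda>x. s i (x - h n) - s i x) + Lp_norm 1 (\<lambda>x. s i x - f x)"
        using t f1 by (intro Lp_norm_triangle3) auto
      also have "Lp_norm 1 (\<lambda>x. f (x - h n) - s i (x - h n)) = Lp_norm 1 (\<lambda>x. f x - s i x)"
        using Lp_norm_translate[OF Minkowski_diff(1)[OF f1(1) f1(2)[of i]], of "h n"] by simp
      also have "Lp_norm 1 (\<lambda>x. f x - s i x) = Lp_norm 1 (\<lambda>x. s i x - f x)" by (rule Lp_norm_diff_commute)
      finally show "norm ((LINT x|lborel. \<bar>f (x - h n) - f x\<bar>) - 0) < e"
        using i N[OF n] by (simp add: Lp_norm_def)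
    qed
  qed
qed

text \<open>The L^1 case carries over to functions that are bounded and have bounded support: if |f|
  <= k, the differences y satisfy |y| <= 2k and hence |y|^r <= (2k)^(r-1) |y|. Truncation in height
  and support makes these dense, and translation is an isometry.\<close>

lemma Lp_translation_sequence:
  fixes f :: "'a::euclidean_space \<Rightarrow> real"
  assumes f: "in_Lp r f" and r: "r \<ge> 1" and h: "h \<longlonglongrightarrow> 0"
  shows "(\<lambda>n. Lp_norm r (\<lambda>x. f (x - h n) - f x)) \<longlonglongrightarrow> 0"
proof -
  note [measurable] = in_Lp_measurable[OF f]
  define g where "g k x = max (- real k) (min (real k) (f x)) * indicator (cball 0 (real k)) x" for k x
  have gm [measurable]: "g k \<in> borel_measurable borel" for k unfolding g_def
    by (intro borel_measurable_times borel_measurable_max borel_measurable_min borel_measurable_indicator) auto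
  have gk: "\<bar>g k x\<bar> \<le> real k" and gf: "\<bar>g k x\<bar> \<le> \<bar>f x\<bar>" for k x by (auto simp: g_def indicator_def)
  have "Lp_tendsto r g f"
  proof (rule Lp_dominated[OF f gm AE_I2[OF gf] _ AE_I2 r])
    fix x
    have "\<forall>\<^sub>F k in sequentially. real k \<ge> max \<bar>f x\<bar> (norm x)" using eventually_ge_at_top[of "nat \<lceil>max \<bar>f x\<bar> (norm x)\<rceil>"]
      by eventually_elim linarith
    then have "\<forall>\<^sub>F k in sequentially. g k x = f x" by eventually_elim (auto simp: g_def)
    then show "(\<lambda>k. g k x) \<longlonglongrightarrow> f x" by (rule tendsto_eventually)
  qed auto
  note G = Lp_tendstoD[OF this]
  have gi: "integrable lborel (g k)" for k
  proof (rule Bochner_Integration.integrable_bound)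
    show "integrable lborel (\<lambda>x::'a. real k * indicator (cball 0 (real k)) x)"
      using emeasure_lborel_cball_finite[of "0::'a" "real k"]
      by (intro integrable_mult_right) (simp add: integrable_indicator_iff less_top)
  qed (auto simp: g_def indicator_def)
  have gt: "(\<lambda>n. Lp_norm r (\<lambda>x. g k (x - h n) - g k x)) \<longlonglongrightarrow> 0" for k
  proof (rule Lim_null_comparison)
    define M where "M = (2 * real k) powr (r - 1)"
    show "\<forall>\<^sub>F n in sequentially. norm (Lp_norm r (\<lambda>x. g k (x - h n) - g k x)) \<le> (M * (LINT x|lborel. \<bar>g k (x - h n) - g k x\<bar>)) powr (1/r)"
    proof (rule always_eventually, rule allI)
      fix n
      have t: "in_Lp r (\<lambda>x. g k (x - h n) - g k x)" using G r in_Lp_translate by (intro Minkowski_diff) auto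
      have "integrable lborel (\<lambda>x. g k (x - h n))" using gi by (subst integral_lborel_translate(2)) auto
      then have i: "integrable lborel (\<lambda>x. \<bar>g k (x - h n) - g k x\<bar>)" using gi by (intro Bochner_Integration.integrable_abs Bochner_Integration.integrable_diff)
      have "(LINT x|lborel. \<bar>g k (x - h n) - g k x\<bar> powr r) \<le> (LINT x|lborel. M * \<bar>g k (x - h n) - g k x\<bar>)"
      proof (rule integral_mono)
        fix x
        let ?y = "\<bar>g k (x - h n) - g k x\<bar>"
        have "?y powr r = ?y powr (r - 1) * ?y"
          using powr_add[of ?y "r - 1" 1] by simp
        also have "\<dots> \<le> M * ?y" unfolding M_def
          using gk[of k x] gk[of k "x - h n"] r by (intro mult_right_mono powr_mono2) auto
        finally show "?y powr r \<le> M * ?y" .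
      qed (use in_Lp_integrable[OF t] i in auto)
      also have "\<dots> = M * (LINT x|lborel. \<bar>g k (x - h n) - g k x\<bar>)" by simp
      finally show "norm (Lp_norm r (\<lambda>x. g k (x - h n) - g k x)) \<le> (M * (LINT x|lborel. \<bar>g k (x - h n) - g k x\<bar>)) powr (1/r)"
        using r by (simp add: Lp_norm_def) (intro powr_mono2, auto)
    qed
    have "(\<lambda>n. (M * (LINT x|lborel. \<bar>g k (x - h n) - g k x\<bar>)) powr (1/r)) \<longlonglongrightarrow> (M * 0) powr (1/r)"
      using r by (intro tendsto_powr' tendsto_mult tendsto_const L1_translation_continuous[OF gi h])
        (auto intro!: always_eventually simp: M_def)
    then show "(\<lambda>n. (M * (LINT x|lborel. \<bar>g k (x - h n) - g k x\<bar>)) powr (1/r)) \<longlonglongrightarrow> 0" by simp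
  qed
  show ?thesis
  proof (rule LIMSEQ_I)
    fix e :: real assume e: "e > 0"
    obtain i where i: "Lp_norm r (\<lambda>x. g i x - f x) < e/3" using LIMSEQ_D[OF G(3), of "e/3"] e by force
    obtain N where N: "\<And>n. n \<ge> N \<Longrightarrow> Lp_norm r (\<lambda>x. g i (x - h n) - g i x) < e/3"
      using LIMSEQ_D[OF gt[of i], of "e/3"] e by force
    show "\<exists>N. \<forall>n\<ge>N. norm (Lp_norm r (\<lambda>x. f (x - h n) - f x) - 0) < e"
    proof (intro exI[of _ N] allI impI)
      fix n assume n: "n \<ge> N"
      have t: "in_Lp r (\<lambda>x. f (x - h n))" "in_Lp r (\<lambda>x. g i (x - h n))" using in_Lp_translate f G by blast+
      have "Lp_norm r (\<lambda>x. f (x - h n) - f x) \<le> Lp_norm r (\<lambda>x. f (x - h n) - g i (x - h n)) + Lp_norm r (\<lambda>x. g i (x - h n) - f x)"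
        using t f G r by (intro Lp_norm_triangle3) auto
      also have "Lp_norm r (\<lambda>x. g i (x - h n) - f x) \<le> Lp_norm r (\<lambda>x. g i (x - h n) - g i x) + Lp_norm r (\<lambda>x. g i x - f x)"
        using t f G r by (intro Lp_norm_triangle3) auto
      also have "Lp_norm r (\<lambda>x. f (x - h n) - g i (x - h n)) = Lp_norm r (\<lambda>x. f x - g i x)"
        using Lp_norm_translate[OF Minkowski_diff(1)[OF f G(1)[of i] r], of "h n"] by simp
      also have "Lp_norm r (\<lambda>x. f x - g i x) = Lp_norm r (\<lambda>x. g i x - f x)" by (rule Lp_norm_diff_commute)
      finally show "norm (Lp_norm r (\<lambda>x. f (x - h n) - f x) - 0) < e"
        using i N[OF n] by simp
    qed
  qed
qed

lemma Lp_translation_continuous: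
  fixes f :: "'a::euclidean_space \<Rightarrow> real"
  assumes f: "in_Lp r f" and r: "r \<ge> 1" and e: "e > 0"
  obtains d where "d > 0" "\<And>h. norm h < d \<Longrightarrow> Lp_norm r (\<lambda>x. f (x - h) - f x) < e"
proof -
  have "((\<lambda>h. Lp_norm r (\<lambda>x. f (x - h) - f x)) \<longlongrightarrow> 0) (at 0)"
    unfolding tendsto_at_iff_sequentially using Lp_translation_sequence[OF f r] by (auto simp: o_def)
  from LIM_D[OF this e] obtain d where "d > 0" "\<And>h. h \<noteq> 0 \<Longrightarrow> norm h < d \<Longrightarrow> Lp_norm r (\<lambda>x. f (x - h) - f x) < e"
    by auto
  moreover have "Lp_norm r (\<lambda>x. f (x - 0) - f x) < e" using e by simp
  ultimately show ?thesis using that by metis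
qed

section \<open>Superpositions and convolution\<close>

text \<open>Jensen's inequality for the finite measure k dz of arbitrary mass. It follows from
  Hoelder's inequality with the factorisation k = k^(1/a) k^(1/r), where a is conjugate to
  r.\<close>

lemma weighted_mean_powr:
  fixes k h :: "'b::euclidean_space \<Rightarrow> real"
  assumes k: "integrable lborel k" "\<And>z. k z \<ge> 0" and h: "h \<in> borel_measurable borel" and r: "r \<ge> 1"
    and i: "integrable lborel (\<lambda>z. k z * \<bar>h z\<bar> powr r)"
  shows "integrable lborel (\<lambda>z. k z * h z)"
    "\<bar>LINT z|lborel. k z * h z\<bar> powr r \<le> (LINT z|lborel. k z) powr (r - 1) * (LINT z|lborel. k z * \<bar>h z\<bar> powr r)"
proof -
  note [measurable] = h borel_measurable_integrable[OF k(1)]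
  have "integrable lborel (\<lambda>z. k z * h z) \<and> \<bar>LINT z|lborel. k z * h z\<bar> powr r \<le> (LINT z|lborel. k z) powr (r - 1) * (LINT z|lborel. k z * \<bar>h z\<bar> powr r)"
  \<comment> \<open>Zero mass is separated because \<open>0 powr 0 = 0\<close>: for r = 1 the factor
    \<open>powr (r - 1)\<close> is 1 only if the mass is positive. The case r = 1 is separated in
    turn because its conjugate exponent is infinite.\<close>
  proof (cases "(LINT z|lborel. k z) = 0")
    case True
    then have z: "AE z in lborel. k z = 0" using integral_nonneg_eq_0_iff_AE[OF k(1)] k(2) by simp
    have "integrable lborel (\<lambda>z. k z * h z) \<longleftrightarrow> integrable lborel (\<lambda>z::'b. 0::real)"
      using z by (intro integrable_cong_AE) auto
    moreover have "(LINT z|lborel. k z * h z) = (LINT z|(lborel::'b measure). 0::real)"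
      using z by (intro integral_cong_AE) auto
    ultimately show ?thesis by (simp add: k)
  next
    case False
    show ?thesis
    proof (cases "r = 1")
      case True
      have 1: "integrable lborel (\<lambda>z. \<bar>k z * h z\<bar>)" using i True k(2) by (simp add: abs_mult)
      have "\<bar>LINT z|lborel. k z * h z\<bar> \<le> (LINT z|lborel. \<bar>k z * h z\<bar>)" by (rule integral_abs_bound)
      with 1 show ?thesis using True False k(2) integrable_abs_iff[of "\<lambda>z. k z * h z" lborel] by (simp add: abs_mult)
    next
      case False
      with r have r: "r > 1" by simp
      define c where "c = (LINT z|lborel. k z)"
      define a where "a = r / (r - 1)"
      have a: "a > 0" "1/a + 1/r = 1" "1/a = (r-1)/r" using r by (auto simp: a_def field_simps)
      have 1: "in_Lp a (\<lambda>z. k z powr (1/a))" using k a(1) by (auto simp: in_Lp_def powr_powr)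
      have n1: "Lp_norm a (\<lambda>z. k z powr (1/a)) = c powr (1/a)" using k a(1) by (simp add: Lp_norm_def powr_powr c_def)
      have pt: "\<bar>k z powr (1/r) * h z\<bar> powr r = k z * \<bar>h z\<bar> powr r" for z using k(2) r by (simp add: abs_mult powr_mult powr_powr)
      have 2: "in_Lp r (\<lambda>z. k z powr (1/r) * h z)" unfolding in_Lp_def pt using i by auto
      have n2: "Lp_norm r (\<lambda>z. k z powr (1/r) * h z) = (LINT z|lborel. k z * \<bar>h z\<bar> powr r) powr (1/r)"
        unfolding Lp_norm_def pt ..
      have eq: "k z powr (1/a) * (k z powr (1/r) * h z) = k z * h z" for z
        using a k(2) by (simp add: mult.assoc[symmetric] powr_add[symmetric])
      note H = Holder_integral[OF 1 2 a(1) _ a(2), unfolded eq n1 n2]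
      have "\<bar>LINT z|lborel. k z * h z\<bar> powr r \<le> (c powr (1/a) * (LINT z|lborel. k z * \<bar>h z\<bar> powr r) powr (1/r)) powr r"
        using H r by (intro powr_mono2) auto
      also have "\<dots> = c powr (r - 1) * (LINT z|lborel. k z * \<bar>h z\<bar> powr r)"
        using r k by (simp add: powr_mult powr_powr a(3))
      finally show ?thesis using H r by (simp add: c_def)
    qed
  qed
  then show "integrable lborel (\<lambda>z. k z * h z)"
    "\<bar>LINT z|lborel. k z * h z\<bar> powr r \<le> (LINT z|lborel. k z) powr (r - 1) * (LINT z|lborel. k z * \<bar>h z\<bar> powr r)" by auto
qed

text \<open>Jensen's inequality inside, Tonelli outside; the constant closes up as c^(r-1) c C^r =
  (c C)^r. The bound on F is asked for only where k does not vanish, so that estimates valid just on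
  the support of a mollifier can be inserted.\<close>

lemma Minkowski_integral:
  fixes F :: "'a::euclidean_space \<Rightarrow> 'b::euclidean_space \<Rightarrow> real"
  assumes k: "integrable lborel k" "\<And>z. k z \<ge> 0" and r: "r \<ge> 1"
    and F [measurable]: "(\<lambda>(x,z). F x z) \<in> borel_measurable (borel \<Otimes>\<^sub>M borel)"
    and bd: "\<And>z. k z \<noteq> 0 \<Longrightarrow> in_Lp r (\<lambda>x. F x z) \<and> Lp_norm r (\<lambda>x. F x z) \<le> C" and C: "C \<ge> 0"
  shows "AE x in lborel. integrable lborel (\<lambda>z. k z * F x z)"
    "in_Lp r (\<lambda>x. LINT z|lborel. k z * F x z)"
    "Lp_norm r (\<lambda>x. LINT z|lborel. k z * F x z) \<le> (LINT z|lborel. k z) * C"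
proof -
  note [measurable] = borel_measurable_integrable[OF k(1)]
  have [measurable]: "(\<lambda>z. F x z) \<in> borel_measurable borel" for x
    using measurable_compose[OF measurable_Pair1' F, of x] by simp
  define c where "c = (LINT z|lborel. k z)"
  have c: "c \<ge> 0" unfolding c_def using k by simp
  have "(\<integral>\<^sup>+x. \<integral>\<^sup>+z. ennreal (k z * \<bar>F x z\<bar> powr r) \<partial>lborel \<partial>lborel) = (\<integral>\<^sup>+z. \<integral>\<^sup>+x. ennreal (k z * \<bar>F x z\<bar> powr r) \<partial>lborel \<partial>lborel)"
    by (rule lborel_pair.Fubini'[symmetric]) measurable
  also have "\<dots> \<le> (\<integral>\<^sup>+z. ennreal (k z * C powr r) \<partial>lborel)"
  proof (rule nn_integral_mono)
    fix z
    show "(\<integral>\<^sup>+x. ennreal (k z * \<bar>F x z\<bar> powr r) \<partial>lborel) \<le> ennreal (k z * C powr r)"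
    proof (cases "k z = 0")
      case False
      note b = bd[OF False]
      have "(\<integral>\<^sup>+x. ennreal (k z * \<bar>F x z\<bar> powr r) \<partial>lborel) = ennreal (LINT x|lborel. k z * \<bar>F x z\<bar> powr r)"
        using b k by (intro nn_integral_eq_integral integrable_mult_right in_Lp_integrable) auto
      also have "\<dots> \<le> ennreal (k z * C powr r)"
        using b r C k(2)[of z] Lp_norm_le_iff[of r C "\<lambda>x. F x z"] by (auto intro!: ennreal_leI mult_left_mono)
      finally show ?thesis .
    qed simp
  qed
  also have "\<dots> = ennreal (c * C powr r)"
    unfolding c_def using k by (subst nn_integral_eq_integral) auto
  finally have le: "(\<integral>\<^sup>+x. \<integral>\<^sup>+z. ennreal (k z * \<bar>F x z\<bar> powr r) \<partial>lborel \<partial>lborel) \<le> ennreal (c * C powr r)" .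
  then have "AE x in lborel. (\<integral>\<^sup>+z. ennreal (k z * \<bar>F x z\<bar> powr r) \<partial>lborel) \<noteq> \<infinity>"
    by (intro nn_integral_PInf_AE) (auto simp: top_unique)
  then have ae: "AE x in lborel. integrable lborel (\<lambda>z. k z * \<bar>F x z\<bar> powr r)"
  proof eventually_elim
    case (elim x) then show ?case using k by (intro integrableI_nonneg) (auto simp: less_top)
  qed
  then show "AE x in lborel. integrable lborel (\<lambda>z. k z * F x z)"
  proof eventually_elim
    case (elim x) show ?case by (rule weighted_mean_powr(1)[OF k _ r elim]) measurable
  qed
  have m [measurable]: "(\<lambda>x. LINT z|lborel. k z * F x z) \<in> borel_measurable borel"
    by measurable
  have "(\<integral>\<^sup>+x. ennreal (\<bar>LINT z|lborel. k z * F x z\<bar> powr r) \<partial>lborel)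
     \<le> (\<integral>\<^sup>+x. ennreal (c powr (r - 1)) * (\<integral>\<^sup>+z. ennreal (k z * \<bar>F x z\<bar> powr r) \<partial>lborel) \<partial>lborel)"
  proof (rule nn_integral_mono_AE, use ae in eventually_elim)
    case (elim x)
    have "\<bar>LINT z|lborel. k z * F x z\<bar> powr r \<le> c powr (r - 1) * (LINT z|lborel. k z * \<bar>F x z\<bar> powr r)"
      unfolding c_def by (rule weighted_mean_powr(2)[OF k _ r elim]) measurable
    then have "ennreal (\<bar>LINT z|lborel. k z * F x z\<bar> powr r) \<le> ennreal (c powr (r - 1) * (LINT z|lborel. k z * \<bar>F x z\<bar> powr r))"
      by (rule ennreal_leI)
    also have "\<dots> = ennreal (c powr (r - 1)) * (\<integral>\<^sup>+z. ennreal (k z * \<bar>F x z\<bar> powr r) \<partial>lborel)"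
      using elim k by (subst nn_integral_eq_integral) (auto simp: ennreal_mult)
    finally show ?case .
  qed
  also have "\<dots> = ennreal (c powr (r - 1)) * (\<integral>\<^sup>+x. \<integral>\<^sup>+z. ennreal (k z * \<bar>F x z\<bar> powr r) \<partial>lborel \<partial>lborel)"
    by (rule nn_integral_cmult) measurable
  also have "\<dots> \<le> ennreal (c powr (r - 1)) * ennreal (c * C powr r)"
    by (intro mult_left_mono le) auto
  also have "\<dots> = ennreal ((c * C) powr r)"
  proof -
    have "c powr (r - 1) * c = c powr r" using c powr_add[of c "r - 1" 1] by simp
    then show ?thesis using c C by (simp add: ennreal_mult[symmetric] powr_mult mult.assoc[symmetric])
  qed
  finally have le2: "(\<integral>\<^sup>+x. ennreal (\<bar>LINT z|lborel. k z * F x z\<bar> powr r) \<partial>lborel) \<le> ennreal ((c * C) powr r)" .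
  then have I: "integrable lborel (\<lambda>x. \<bar>LINT z|lborel. k z * F x z\<bar> powr r)"
    by (intro integrableI_bounded) (auto simp: le_less_trans[OF le2])
  then show "in_Lp r (\<lambda>x. LINT z|lborel. k z * F x z)" by (simp add: in_Lp_def)
  have "(LINT x|lborel. \<bar>LINT z|lborel. k z * F x z\<bar> powr r) \<le> (c * C) powr r"
    using le2 I by (subst (asm) nn_integral_eq_integral) (auto simp: ennreal_le_iff)
  then show "Lp_norm r (\<lambda>x. LINT z|lborel. k z * F x z) \<le> (LINT z|lborel. k z) * C"
    using r c C unfolding c_def by (intro Lp_norm_le) auto
qed

definition conv :: "('a::euclidean_space \<Rightarrow> real) \<Rightarrow> ('a \<Rightarrow> real) \<Rightarrow> 'a \<Rightarrow> real" where
  "conv k f x = (LINT z|lborel. k z * f (x - z))"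

lemma Young_convolution:
  assumes k: "integrable lborel k" "\<And>z. k z \<ge> 0" and f: "in_Lp r f" and r: "r \<ge> 1"
  shows "AE x in lborel. integrable lborel (\<lambda>z. k z * f (x - z))"
    "in_Lp r (conv k f)" "Lp_norm r (conv k f) \<le> (LINT z|lborel. k z) * Lp_norm r f"
proof -
  note [measurable] = in_Lp_measurable[OF f]
  have m: "(\<lambda>(x,z). f (x - z)) \<in> borel_measurable (borel \<Otimes>\<^sub>M borel)" by measurable
  note M = Minkowski_integral[OF k r m, of "Lp_norm r f"]
  show "AE x in lborel. integrable lborel (\<lambda>z. k z * f (x - z))"
    "in_Lp r (conv k f)" "Lp_norm r (conv k f) \<le> (LINT z|lborel. k z) * Lp_norm r f"
    unfolding conv_def using M in_Lp_translate[OF f] Lp_norm_translate[OF f] by auto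
qed

text \<open>By the integral Minkowski inequality the error is a superposition of translation
  differences f(x - z) - f(x) over small z. The mass c is left general because the kernels
  \<open>newton_kernel\<close> are not normalised to mass one.\<close>

lemma mollification_tendsto:
  fixes k :: "nat \<Rightarrow> 'a::euclidean_space \<Rightarrow> real"
  assumes k: "\<And>n. integrable lborel (k n)" "\<And>n z. k n z \<ge> 0" "\<And>n. (LINT z|lborel. k n z) = c"
    and supp: "\<And>n z. k n z \<noteq> 0 \<Longrightarrow> norm z \<le> \<delta> n" and \<delta>: "\<delta> \<longlonglongrightarrow> 0"
    and f: "in_Lp r f" and r: "r \<ge> 1"
  shows "Lp_tendsto r (\<lambda>n. conv (k n) f) (\<lambda>x. c * f x)"
  unfolding Lp_tendsto_def
proof (intro conjI allI)
  note [measurable] = in_Lp_measurable[OF f]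
  show "in_Lp r (conv (k n) f)" for n using Young_convolution[OF k(1,2) f r] by auto
  show "in_Lp r (\<lambda>x. c * f x)" by (rule in_Lp_cmult[OF f])
  have c: "c \<ge> 0" unfolding k(3)[of 0, symmetric] using k(2) by simp
  show "(\<lambda>n. Lp_norm r (\<lambda>x. conv (k n) f x - c * f x)) \<longlonglongrightarrow> 0"
  proof (rule LIMSEQ_I)
    fix e :: real assume e: "e > 0"
    define e' where "e' = e / (c + 1)"
    have e': "e' > 0" "c * e' < e" using e c by (auto simp: e'_def field_simps)
    obtain d where d: "d > 0" "\<And>h. norm h < d \<Longrightarrow> Lp_norm r (\<lambda>x. f (x - h) - f x) < e'"
      using Lp_translation_continuous[OF f r e'(1)] by blast
    obtain N where N: "\<And>n. n \<ge> N \<Longrightarrow> \<delta> n < d" using LIMSEQ_D[OF \<delta> d(1)] by force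
    show "\<exists>N. \<forall>n\<ge>N. norm (Lp_norm r (\<lambda>x. conv (k n) f x - c * f x) - 0) < e"
    proof (intro exI[of _ N] allI impI)
      fix n assume n: "n \<ge> N"
      have m: "(\<lambda>(x,z). f (x - z) - f x) \<in> borel_measurable (borel \<Otimes>\<^sub>M borel)" by measurable
      have "in_Lp r (\<lambda>x. f (x - z) - f x) \<and> Lp_norm r (\<lambda>x. f (x - z) - f x) \<le> e'" if "k n z \<noteq> 0" for z
        using supp[OF that] N[OF n] d(2)[of z] Minkowski_diff(1)[OF in_Lp_translate[OF f] f r] by force
      note M = Minkowski_integral[OF k(1,2) r m this less_imp_le[OF e'(1)]]
      have "AE x in lborel. (LINT z|lborel. k n z * (f (x - z) - f x)) = conv (k n) f x - c * f x"
        using Young_convolution(1)[OF k(1)[of n] k(2) f r]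
      proof eventually_elim
        case (elim x)
        then have "(LINT z|lborel. k n z * (f (x - z) - f x)) = (LINT z|lborel. k n z * f (x - z)) - (LINT z|lborel. k n z * f x)"
          using k(1)[of n] by (subst Bochner_Integration.integral_diff[symmetric]) (auto simp: right_diff_distrib)
        then show ?case by (simp add: conv_def k(3))
      qed
      moreover have "in_Lp r (conv (k n) f)" using Young_convolution[OF k(1,2) f r] by auto
      ultimately have "Lp_norm r (\<lambda>x. conv (k n) f x - c * f x) = Lp_norm r (\<lambda>x. LINT z|lborel. k n z * (f (x - z) - f x))"
        using in_Lp_measurable[OF M(2)] by (intro Lp_norm_cong_AE) (auto simp: in_Lp_def)
      also have "\<dots> \<le> c * e'" using M(3) by (simp add: k(3))
      finally show "norm (Lp_norm r (\<lambda>x. conv (k n) f x - c * f x) - 0) < e" using e'(2) by simp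
    qed
  qed
qed

section \<open>Functions of class \<open>C\<^sup>k\<close> with compact support\<close>

abbreviation pd :: "'a::euclidean_space \<Rightarrow> ('a \<Rightarrow> 'b::real_normed_vector) \<Rightarrow> 'a \<Rightarrow> 'b" where
  "pd i f x \<equiv> frechet_derivative f (at x) i"

lemma frechet_derivative_expand:
  assumes "f differentiable (at x)"
  shows "frechet_derivative f (at x) h = (\<Sum>i\<in>Basis. (h \<bullet> i) *\<^sub>R pd i f x)"
proof -
  interpret linear "frechet_derivative f (at x)" by (rule linear_frechet_derivative[OF assms])
  have "frechet_derivative f (at x) h = frechet_derivative f (at x) (\<Sum>i\<in>Basis. (h \<bullet> i) *\<^sub>R i)"
    by (simp add: euclidean_representation)
  then show ?thesis by (simp add: sum scale)
qed

lemma Ck_SucI: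
  assumes "\<And>x. (f has_derivative D x) (at x)" "\<And>i. i \<in> Basis \<Longrightarrow> Ck k (\<lambda>x. D x i)"
  shows "Ck (Suc k) f"
proof -
  have "frechet_derivative f (at x) = D x" for x using assms(1) by (metis frechet_derivative_at)
  then show ?thesis using assms by (auto simp: differentiable_def)
qed

lemma Ck_SucD:
  assumes "Ck (Suc k) f"
  shows "(f has_derivative frechet_derivative f (at x)) (at x)" "i \<in> Basis \<Longrightarrow> Ck k (pd i f)"
    "f differentiable (at x)"
  using assms by (auto simp: frechet_derivative_works[symmetric])

lemma frechet_derivative_eq: "(f has_derivative D) (at x) \<Longrightarrow> frechet_derivative f (at x) = D"
  by (metis frechet_derivative_at)

lemma Ck_Suc_imp: "Ck (Suc k) f \<Longrightarrow> Ck k f"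
proof (induction k arbitrary: f)
  case 0
  then show ?case by (auto simp: continuous_on_eq_continuous_at intro!: differentiable_imp_continuous_within)
qed auto

lemma Ck_continuous: "Ck k f \<Longrightarrow> continuous_on UNIV f"
  by (induction k arbitrary: f) (auto simp: continuous_on_eq_continuous_at intro!: differentiable_imp_continuous_within)

lemma Ck_mono: "Ck m f \<Longrightarrow> k \<le> m \<Longrightarrow> Ck k f"
  by (induction m) (auto simp: le_Suc_eq dest: Ck_Suc_imp simp del: Ck.simps)

lemma Ck_const: "Ck k (\<lambda>x. c)"
proof (induction k arbitrary: c)
  case (Suc k) show ?case by (rule Ck_SucI[where D="\<lambda>_ _. 0"]) (auto intro: Suc)
qed simp

lemma Ck_add: "Ck k f \<Longrightarrow> Ck k g \<Longrightarrow> Ck k (\<lambda>x. f x + g x)"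
proof (induction k arbitrary: f g)
  case (Suc k)
  show ?case
    by (rule Ck_SucI[OF has_derivative_add[OF Ck_SucD(1)[OF Suc.prems(1)] Ck_SucD(1)[OF Suc.prems(2)]]])
      (intro Suc.IH Ck_SucD(2)[OF Suc.prems(1)] Ck_SucD(2)[OF Suc.prems(2)])
qed (auto intro: continuous_intros)

lemma Ck_sum: "(\<And>i. i \<in> I \<Longrightarrow> Ck k (f i)) \<Longrightarrow> Ck k (\<lambda>x. \<Sum>i\<in>I. f i x)"
  by (induction I rule: infinite_finite_induct) (auto intro: Ck_add Ck_const simp del: Ck.simps)

lemma Ck_bounded_linear:
  assumes "bounded_linear L" shows "Ck k f \<Longrightarrow> Ck k (\<lambda>x. L (f x))"
proof (induction k arbitrary: f)
  case 0 then show ?case by (auto intro!: bounded_linear.continuous_on[OF assms])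
next
  case (Suc k)
  show ?case
    by (rule Ck_SucI[OF bounded_linear.has_derivative[OF assms Ck_SucD(1)[OF Suc.prems]]])
      (intro Suc.IH Ck_SucD(2)[OF Suc.prems])
qed

lemma Ck_mult:
  fixes f g :: "'a::euclidean_space \<Rightarrow> real"
  shows "Ck k f \<Longrightarrow> Ck k g \<Longrightarrow> Ck k (\<lambda>x. f x * g x)"
proof (induction k arbitrary: f g)
  case (Suc k)
  show ?case
    by (rule Ck_SucI[OF has_derivative_mult[OF Ck_SucD(1)[OF Suc.prems(1)] Ck_SucD(1)[OF Suc.prems(2)]]])
      (intro Ck_add Suc.IH Ck_SucD(2)[OF Suc.prems(1)] Ck_SucD(2)[OF Suc.prems(2)] Ck_Suc_imp[OF Suc.prems(1)] Ck_Suc_imp[OF Suc.prems(2)])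
qed (auto intro: continuous_intros)

lemma Ck_diff: "Ck k f \<Longrightarrow> Ck k g \<Longrightarrow> Ck k (\<lambda>x. f x - g x)"
  using Ck_add[of k f "\<lambda>x. - g x"] Ck_bounded_linear[OF bounded_linear_minus[OF bounded_linear_ident], of k g]
  by simp

lemma has_derivative_affine_comp:
  fixes f :: "'a::euclidean_space \<Rightarrow> 'b::real_normed_vector"
  assumes "(f has_derivative D) (at (a + s *\<^sub>R x))"
  shows "((\<lambda>x. f (a + s *\<^sub>R x)) has_derivative (\<lambda>h. D (s *\<^sub>R h))) (at x)"
proof -
  have "((\<lambda>x. a + s *\<^sub>R x) has_derivative (\<lambda>h. s *\<^sub>R h)) (at x)"
    by (auto intro!: derivative_eq_intros)
  from diff_chain_at[OF this assms] show ?thesis by (simp add: o_def)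
qed

lemma Ck_affine: "Ck k f \<Longrightarrow> Ck k (\<lambda>x. f (a + s *\<^sub>R x))"
proof (induction k arbitrary: f)
  case 0
  then show ?case by (auto intro!: continuous_on_compose2[of UNIV f] continuous_intros)
next
  case (Suc k)
  show ?case
  proof (rule Ck_SucI[OF has_derivative_affine_comp[OF Ck_SucD(1)[OF Suc.prems]]])
    fix i :: 'a assume i: "i \<in> Basis"
    have "frechet_derivative f (at (a + s *\<^sub>R x)) (s *\<^sub>R i) = s *\<^sub>R pd i f (a + s *\<^sub>R x)" for x
      using linear_frechet_derivative[OF Ck_SucD(3)[OF Suc.prems], of "a + s *\<^sub>R x"] by (simp add: linear_cmul)
    moreover have "Ck k (\<lambda>x. s *\<^sub>R pd i f (a + s *\<^sub>R x))"
      by (intro Ck_bounded_linear[OF bounded_linear_scaleR_right] Suc.IH Ck_SucD(2)[OF Suc.prems i])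
    ultimately show "Ck k (\<lambda>x. frechet_derivative f (at (a + s *\<^sub>R x)) (s *\<^sub>R i))" by simp
  qed
qed

lemma pd_affine:
  assumes "Ck (Suc k) f"
  shows "pd i (\<lambda>x. f (a + s *\<^sub>R x)) x = s *\<^sub>R pd i f (a + s *\<^sub>R x)"
  using frechet_derivative_eq[OF has_derivative_affine_comp[OF Ck_SucD(1)[OF assms]], of a s x]
    linear_frechet_derivative[OF Ck_SucD(3)[OF assms], of "a + s *\<^sub>R x"] by (simp add: linear_cmul)

lemma Ck_inner: "Ck k (\<lambda>x. x \<bullet> a)"
proof (cases k)
  case (Suc m)
  show ?thesis unfolding Suc
    by (rule Ck_SucI[where D="\<lambda>x h. h \<bullet> a"]) (auto intro!: derivative_eq_intros Ck_const)
qed (auto intro: continuous_intros)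

lemma pd_mult:
  fixes f g :: "'a::euclidean_space \<Rightarrow> real"
  assumes "Ck (Suc k) f" "Ck (Suc m) g"
  shows "pd i (\<lambda>x. f x * g x) x = f x * pd i g x + pd i f x * g x"
  using frechet_derivative_eq[OF has_derivative_mult[OF Ck_SucD(1)[OF assms(1)] Ck_SucD(1)[OF assms(2)]]] by simp

lemma pd_diff:
  assumes "Ck (Suc k) f" "Ck (Suc m) g"
  shows "pd i (\<lambda>x. f x - g x) x = pd i f x - pd i g x"
  using frechet_derivative_eq[OF has_derivative_diff[OF Ck_SucD(1)[OF assms(1)] Ck_SucD(1)[OF assms(2)]]] by simp

lemma pd_bounded_linear:
  assumes "bounded_linear L" "Ck (Suc k) f"
  shows "pd i (\<lambda>x. L (f x)) x = L (pd i f x)"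
  using frechet_derivative_eq[OF bounded_linear.has_derivative[OF assms(1) Ck_SucD(1)[OF assms(2)]]] by simp

lemma pd_inner: "pd i (\<lambda>x. x \<bullet> a) x = i \<bullet> a"
proof -
  have "((\<lambda>x. x \<bullet> a) has_derivative (\<lambda>h. h \<bullet> a)) (at x)" by (auto intro!: derivative_eq_intros)
  then show ?thesis by (simp add: frechet_derivative_eq)
qed

lemma compact_support_iff: "compact_support f \<longleftrightarrow> (\<exists>R>0. \<forall>x. f x \<noteq> 0 \<longrightarrow> norm x \<le> R)"
  for f :: "'a::euclidean_space \<Rightarrow> 'b::zero"
  unfolding compact_support_def by (simp add: compact_closure bounded_pos)

lemma compact_supportI: "(\<And>x. f x \<noteq> 0 \<Longrightarrow> norm x \<le> R) \<Longrightarrow> compact_support f"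
  for f :: "'a::euclidean_space \<Rightarrow> 'b::zero"
  unfolding compact_support_iff by (intro exI[of _ "max R 1"]) force

lemma compact_supportE:
  fixes f :: "'a::euclidean_space \<Rightarrow> 'b::zero"
  assumes "compact_support f" obtains R where "R > 0" "\<And>x. f x \<noteq> 0 \<Longrightarrow> norm x \<le> R"
  using assms unfolding compact_support_iff by auto

lemma pd_support:
  assumes "\<And>x. f x \<noteq> 0 \<Longrightarrow> norm x \<le> R" and "pd i f x \<noteq> 0"
  shows "norm x \<le> R"
proof (rule ccontr)
  assume "\<not> norm x \<le> R"
  then have "x \<in> - cball 0 R" by simp
  then have "(f has_derivative (\<lambda>_. 0)) (at x)"
    by (intro has_derivative_transform_within_open[OF has_derivative_const[of 0], of "- cball 0 R"])
      (use assms(1) in auto)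
  then show False using assms(2) by (simp add: frechet_derivative_eq)
qed

lemma compact_support_pd:
  assumes "compact_support f" shows "compact_support (pd i f)"
proof -
  obtain R where "\<And>x. f x \<noteq> 0 \<Longrightarrow> norm x \<le> R" using compact_supportE[OF assms] by blast
  from pd_support[of f R, OF this] show ?thesis by (rule compact_supportI)
qed

lemma compact_support_subset:
  fixes f :: "'a::euclidean_space \<Rightarrow> 'b::zero" and g :: "'a \<Rightarrow> 'c::zero"
  assumes "compact_support f" "\<And>x. f x = 0 \<Longrightarrow> g x = 0"
  shows "compact_support g"
proof -
  obtain R where "\<And>x. f x \<noteq> 0 \<Longrightarrow> norm x \<le> R" using compact_supportE[OF assms(1)] by blast
  with assms(2) show ?thesis by (intro compact_supportI[of g R]) auto
qed

lemma compact_support_mult: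
  fixes f g :: "'a::euclidean_space \<Rightarrow> real"
  shows "compact_support f \<Longrightarrow> compact_support (\<lambda>x. f x * g x)" "compact_support g \<Longrightarrow> compact_support (\<lambda>x. f x * g x)"
  by (erule compact_support_subset; simp)+

lemma compact_support_add:
  fixes f g :: "'a::euclidean_space \<Rightarrow> 'b::real_vector"
  assumes "compact_support f" "compact_support g" shows "compact_support (\<lambda>x. f x + g x)"
proof -
  obtain R R' where "\<And>x. f x \<noteq> 0 \<Longrightarrow> norm x \<le> R" "\<And>x. g x \<noteq> 0 \<Longrightarrow> norm x \<le> R'"
    using compact_supportE[OF assms(1)] compact_supportE[OF assms(2)] by metis
  then have "norm x \<le> max R R'" if "f x + g x \<noteq> 0" for x using that by (cases "f x = 0") fastforce+
  then show ?thesis by (rule compact_supportI)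
qed

lemma compact_support_sum:
  fixes f :: "'i \<Rightarrow> 'a::euclidean_space \<Rightarrow> 'b::real_vector"
  assumes "\<And>i. i \<in> I \<Longrightarrow> compact_support (f i)" shows "compact_support (\<lambda>x. \<Sum>i\<in>I. f i x)"
  using assms by (induction I rule: infinite_finite_induct) (auto intro: compact_support_add compact_supportI[of "\<lambda>_. 0" 0])

lemma compact_support_linear:
  fixes f :: "'a::euclidean_space \<Rightarrow> 'b::zero"
  assumes "L 0 = 0" "compact_support f" shows "compact_support (\<lambda>x. L (f x))"
  using assms(2) by (rule compact_support_subset) (simp add: assms(1))

lemma Cc_infD: "f \<in> Cc_inf \<Longrightarrow> Ck k f" "f \<in> Cc_inf \<Longrightarrow> compact_support f"
  by (auto simp: Cc_inf_def)

lemma Cc1D: "f \<in> Cc1 \<Longrightarrow> Ck (Suc 0) f" "f \<in> Cc1 \<Longrightarrow> compact_support f"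
  by (auto simp: Cc1_def simp del: Ck.simps)

lemma Cc1I: "Ck (Suc k) f \<Longrightarrow> compact_support f \<Longrightarrow> f \<in> Cc1"
  using Ck_mono[of "Suc k" f 1] by (auto simp: Cc1_def simp del: Ck.simps)

lemma Cc_inf_Cc1: "f \<in> Cc_inf \<Longrightarrow> f \<in> Cc1"
  by (simp add: Cc1_def Cc_inf_def del: Ck.simps)

section \<open>Uniform estimates for compactly supported functions\<close>

lemma bounded_on_compact_support:
  fixes f :: "'a::euclidean_space \<Rightarrow> real"
  assumes "continuous_on UNIV f" "compact_support f"
  obtains M where "M > 0" "\<And>x. \<bar>f x\<bar> \<le> M"
proof -
  obtain R where R: "\<And>x. f x \<noteq> 0 \<Longrightarrow> norm x \<le> R" using compact_supportE[OF assms(2)] by metis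
  have "bounded (f ` cball 0 R)"
    by (intro compact_imp_bounded compact_continuous_image continuous_on_subset[OF assms(1)]) auto
  then obtain M where "M > 0" "\<forall>x\<in>cball 0 R. \<bar>f x\<bar> \<le> M" by (auto simp: bounded_pos)
  then have "\<bar>f x\<bar> \<le> M" for x using R[of x] by (cases "f x = 0") auto
  with \<open>M > 0\<close> show ?thesis using that by blast
qed

lemma in_Lp_bounded_support:
  fixes f :: "'a::euclidean_space \<Rightarrow> real"
  assumes "f \<in> borel_measurable borel" "\<And>x. \<bar>f x\<bar> \<le> M" "\<And>x. f x \<noteq> 0 \<Longrightarrow> norm x \<le> R" "r > 0"
  shows "in_Lp r f"
proof -
  have [measurable]: "cball (0::'a) R \<in> sets borel" by simp
  have "M \<ge> 0" using assms(2)[of 0] by linarith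
  have "in_Lp r (\<lambda>x. M * indicator (cball (0::'a) R) x)"
  proof (rule in_Lp_cmult)
    have "integrable lborel (\<lambda>x. indicator (cball (0::'a) R) x :: real)"
      using emeasure_lborel_cball_finite[of "0::'a" R] by (simp add: integrable_indicator_iff less_top)
    moreover have "\<bar>indicator A x\<bar> powr r = (indicator A x :: real)" for A and x :: 'a
      using assms(4) by (auto simp: indicator_def)
    ultimately show "in_Lp r (\<lambda>x. indicator (cball (0::'a) R) x)" by (auto simp: in_Lp_def)
  qed
  then show ?thesis
    using assms \<open>M \<ge> 0\<close> by (rule_tac in_Lp_bound(1)[where g="\<lambda>x. M * indicator (cball (0::'a) R) x"])
      (auto simp: indicator_def intro!: AE_I2)
qed

lemma in_Lp_Cc:
  fixes f :: "'a::euclidean_space \<Rightarrow> real"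
  assumes "continuous_on UNIV f" "compact_support f" "r > 0"
  shows "in_Lp r f"
  using in_Lp_bounded_support[of f _ _ r] bounded_on_compact_support[OF assms(1,2)] compact_supportE[OF assms(2)]
    borel_measurable_continuous_onI[OF assms(1)] assms(3) by metis

lemma Cc1_in_Lp:
  fixes f :: "'a::euclidean_space \<Rightarrow> real"
  assumes "f \<in> Cc1" "r > 0"
  shows "in_Lp r f" "i \<in> Basis \<Longrightarrow> in_Lp r (pd i f)"
  using in_Lp_Cc[of f r] in_Lp_Cc[of "pd i f" r] Cc1D[OF assms(1)] Ck_SucD(2)[OF Cc1D(1)[OF assms(1)], of i] assms(2)
  by (auto intro: Ck_continuous compact_support_pd simp del: Ck.simps(2))

lemma uniformly_continuous_Cc:
  fixes f :: "'a::euclidean_space \<Rightarrow> real"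
  assumes f: "continuous_on UNIV f" "compact_support f" and e: "e > 0"
  obtains d where "d > 0" "\<And>x y. norm (x - y) < d \<Longrightarrow> \<bar>f x - f y\<bar> < e"
proof -
  obtain R where R: "\<And>x. f x \<noteq> 0 \<Longrightarrow> norm x \<le> R" using compact_supportE[OF f(2)] by metis
  \<comment> \<open>The margin 1 guarantees that if one of two points at distance below 1 lies in
    the support ball, both lie in the larger ball.\<close>
  have "uniformly_continuous_on (cball 0 (R + 1)) f"
    by (intro compact_uniformly_continuous continuous_on_subset[OF f(1)]) auto
  then obtain d where d: "d > 0" "\<And>x y. x \<in> cball 0 (R+1) \<Longrightarrow> y \<in> cball 0 (R+1) \<Longrightarrow> dist y x < d \<Longrightarrow> dist (f y) (f x) < e"
    unfolding uniformly_continuous_on_def using e by metis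
  have "\<bar>f x - f y\<bar> < e" if "norm (x - y) < min d 1" for x y
  proof (cases "norm x \<le> R \<or> norm y \<le> R")
    case True
    have "norm x \<le> norm y + norm (x - y)" "norm y \<le> norm x + norm (x - y)"
      by (metis add.commute diff_add_cancel norm_triangle_ineq) (metis norm_minus_commute add.commute diff_add_cancel norm_triangle_ineq)
    then have "x \<in> cball 0 (R+1)" "y \<in> cball 0 (R+1)" using that True by auto
    then show ?thesis using d(2)[of y x] that by (auto simp: dist_norm)
  next
    case False
    then have "f x = 0" "f y = 0" using R[of x] R[of y] by auto
    then show ?thesis using e by simp
  qed
  then show ?thesis using that[of "min d 1"] d(1) by auto
qed

lemma mvt_real:
  fixes f :: "'a::euclidean_space \<Rightarrow> real"
  assumes "\<And>x. f differentiable (at x)"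
  obtains t where "0 < t" "t < 1" "f (x + h) - f x = (\<Sum>i\<in>Basis. (h \<bullet> i) * pd i f (x + t *\<^sub>R h))"
proof -
  have d: "((\<lambda>t. f (x + t *\<^sub>R h)) has_derivative (\<lambda>s. frechet_derivative f (at (x + t *\<^sub>R h)) (s *\<^sub>R h))) (at t within {0..1})" for t
  proof -
    have "((\<lambda>t. x + t *\<^sub>R h) has_derivative (\<lambda>s. s *\<^sub>R h)) (at t)" by (auto intro!: derivative_eq_intros)
    from diff_chain_at[OF this, of f "frechet_derivative f (at (x + t *\<^sub>R h))"] assms
    show ?thesis by (auto simp: o_def frechet_derivative_works intro: has_derivative_at_withinI)
  qed
  obtain t where t: "t \<in> {0<..<1}" "f (x + 1 *\<^sub>R h) - f (x + 0 *\<^sub>R h) = frechet_derivative f (at (x + t *\<^sub>R h)) ((1 - 0) *\<^sub>R h)"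
    using mvt_simple[OF zero_less_one d] by blast
  then show ?thesis using that[of t] frechet_derivative_expand[OF assms, of "x + t *\<^sub>R h" h] by auto
qed

lemma Cc1_lipschitz:
  fixes f :: "'a::euclidean_space \<Rightarrow> real"
  assumes "f \<in> Cc1"
  obtains K where "K > 0" "\<And>x h. \<bar>f (x + h) - f x\<bar> \<le> K * norm h"
proof -
  note C = Cc1D[OF assms]
  have "\<exists>M. \<forall>x. \<bar>pd i f x\<bar> \<le> M" if "i \<in> Basis" for i
    using bounded_on_compact_support[OF Ck_continuous[OF Ck_SucD(2)[OF C(1) that]] compact_support_pd[OF C(2)]] by metis
  then obtain M where M: "\<And>i x. i \<in> Basis \<Longrightarrow> \<bar>pd i f x\<bar> \<le> M i" by metis
  have "\<bar>f (x + h) - f x\<bar> \<le> (1 + (\<Sum>i\<in>Basis. \<bar>M i\<bar>)) * norm h" for x h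
  proof -
    obtain t where "f (x + h) - f x = (\<Sum>i\<in>Basis. (h \<bullet> i) * pd i f (x + t *\<^sub>R h))"
      using mvt_real[OF Ck_SucD(3)[OF C(1)]] by metis
    also have "\<bar>\<dots>\<bar> \<le> (\<Sum>i\<in>Basis. norm h * \<bar>M i\<bar>)"
    proof (intro order_trans[OF sum_abs] sum_mono)
      fix i :: 'a assume i: "i \<in> Basis"
      show "\<bar>h \<bullet> i * pd i f (x + t *\<^sub>R h)\<bar> \<le> norm h * \<bar>M i\<bar>"
        unfolding abs_mult using M[OF i, of "x + t *\<^sub>R h"] Basis_le_norm[OF i, of h] by (intro mult_mono) auto
    qed
    also have "\<dots> \<le> (1 + (\<Sum>i\<in>Basis. \<bar>M i\<bar>)) * norm h" by (simp add: sum_distrib_left[symmetric] algebra_simps)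
    finally show ?thesis .
  qed
  moreover have "1 + (\<Sum>i\<in>Basis. \<bar>M i\<bar>) > 0" by (intro add_pos_nonneg sum_nonneg) auto
  ultimately show ?thesis using that by blast
qed

text \<open>The mean value theorem reduces the remainder to the oscillation of the partial
  derivatives, which is uniformly small. Uniformity in x is what permits differentiation under a
  convolution integral.\<close>

lemma Cc1_uniformly_differentiable:
  fixes f :: "'a::euclidean_space \<Rightarrow> real"
  assumes "f \<in> Cc1" "e > 0"
  obtains d where "d > 0" "\<And>x h. norm h < d \<Longrightarrow> \<bar>f (x + h) - f x - (\<Sum>i\<in>Basis. (h \<bullet> i) * pd i f x)\<bar> \<le> e * norm h"
proof -
  note C = Cc1D[OF assms(1)]
  define e' where "e' = e / DIM('a)"
  have e': "e' > 0" using assms by (simp add: e'_def)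
  have "\<exists>d>0. \<forall>x y. norm (x - y) < d \<longrightarrow> \<bar>pd i f x - pd i f y\<bar> < e'" if "i \<in> Basis" for i
    using uniformly_continuous_Cc[OF Ck_continuous[OF Ck_SucD(2)[OF C(1) that]] compact_support_pd[OF C(2)] e'] by metis
  then obtain d where d: "\<And>i. i \<in> Basis \<Longrightarrow> d i > 0" "\<And>i x y. i \<in> Basis \<Longrightarrow> norm (x - y) < d i \<Longrightarrow> \<bar>pd i f x - pd i f y\<bar> < e'"
    by metis
  define \<delta> where "\<delta> = Min (d ` Basis)"
  have \<delta>: "\<delta> > 0" "\<And>i. i \<in> Basis \<Longrightarrow> \<delta> \<le> d i" unfolding \<delta>_def using d(1) by (auto simp: Min_gr_iff)
  have "\<bar>f (x + h) - f x - (\<Sum>i\<in>Basis. (h \<bullet> i) * pd i f x)\<bar> \<le> e * norm h" if h: "norm h < \<delta>" for x h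
  proof -
    obtain t where t: "0 < t" "t < 1" "f (x + h) - f x = (\<Sum>i\<in>Basis. (h \<bullet> i) * pd i f (x + t *\<^sub>R h))"
      using mvt_real[OF Ck_SucD(3)[OF C(1)]] by metis
    have th: "norm (t *\<^sub>R h) \<le> norm h" using t by (simp add: mult_left_le_one_le)
    have "f (x + h) - f x - (\<Sum>i\<in>Basis. (h \<bullet> i) * pd i f x) = (\<Sum>i\<in>Basis. (h \<bullet> i) * (pd i f (x + t *\<^sub>R h) - pd i f x))"
      unfolding t(3) by (simp add: sum_subtractf right_diff_distrib)
    also have "\<bar>\<dots>\<bar> \<le> (\<Sum>i\<in>(Basis::'a set). norm h * e')"
    proof (intro order_trans[OF sum_abs] sum_mono)
      fix i :: 'a assume i: "i \<in> Basis"
      have "norm (x + t *\<^sub>R h - x) < d i" using th h \<delta>(2)[OF i] by simp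
      from d(2)[OF i this] show "\<bar>h \<bullet> i * (pd i f (x + t *\<^sub>R h) - pd i f x)\<bar> \<le> norm h * e'"
        unfolding abs_mult using Basis_le_norm[OF i] by (intro mult_mono) auto
    qed
    also have "\<dots> = e * norm h" by (simp add: e'_def)
    finally show ?thesis .
  qed
  with \<delta>(1) show ?thesis using that by blast
qed

section \<open>Integration by parts\<close>

text \<open>Dominated convergence: the quotients are bounded by the Lipschitz constant of f, and
  steps of length at most 1 keep them supported in a fixed ball. There g is bounded by continuity,
  so no decay of g is asked for.\<close>

lemma difference_quotient_integral:
  fixes f g :: "'a::euclidean_space \<Rightarrow> real"
  assumes f: "f \<in> Cc1" and g: "continuous_on UNIV g" and i: "i \<in> Basis"
    and t: "t \<longlonglongrightarrow> 0" "\<And>n. t n \<noteq> 0" "\<And>n. \<bar>t n\<bar> \<le> 1"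
  shows "(\<lambda>n. LINT x|lborel. g x * ((f (x + t n *\<^sub>R i) - f x) / t n)) \<longlonglongrightarrow> (LINT x|lborel. g x * pd i f x)"
proof -
  note C = Cc1D[OF f]
  obtain K where K: "K > 0" "\<And>x h. \<bar>f (x + h) - f x\<bar> \<le> K * norm h" using Cc1_lipschitz[OF f] by metis
  obtain R where R: "R > 0" "\<And>x. f x \<noteq> 0 \<Longrightarrow> norm x \<le> R" using compact_supportE[OF C(2)] by metis
  have [measurable]: "f \<in> borel_measurable borel" "g \<in> borel_measurable borel" "pd i f \<in> borel_measurable borel"
    using Ck_continuous[OF C(1)] g Ck_continuous[OF Ck_SucD(2)[OF C(1) i]] by (auto intro: borel_measurable_continuous_onI)
  have "bounded (g ` cball 0 (R + 1))"
    by (intro compact_imp_bounded compact_continuous_image continuous_on_subset[OF g]) auto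
  then obtain M where "M > 0" "\<forall>x\<in>cball 0 (R + 1). \<bar>g x\<bar> \<le> M" by (auto simp: bounded_pos)
  then have M: "\<And>x. norm x \<le> R + 1 \<Longrightarrow> \<bar>g x\<bar> \<le> M" "M > 0" by auto
  show ?thesis
  proof (rule integral_dominated_convergence[where w="\<lambda>x. M * K * indicator (cball 0 (R+1)) x"])
    show "integrable lborel (\<lambda>x::'a. M * K * indicator (cball 0 (R + 1)) x)"
      using emeasure_lborel_cball_finite[of "0::'a" "R+1"] by (intro integrable_mult_right) (simp add: integrable_indicator_iff less_top)
    show "AE x in lborel. (\<lambda>n. g x * ((f (x + t n *\<^sub>R i) - f x) / t n)) \<longlonglongrightarrow> g x * pd i f x"
    proof (intro AE_I2 tendsto_mult tendsto_const LIMSEQ_I)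
      fix x and e :: real assume e: "e > 0"
      then obtain d where d: "d > 0" "\<And>x h. norm h < d \<Longrightarrow> \<bar>f (x + h) - f x - (\<Sum>i\<in>Basis. (h \<bullet> i) * pd i f x)\<bar> \<le> e/2 * norm h"
        using Cc1_uniformly_differentiable[OF f, of "e/2"] by auto
      obtain N where N: "\<And>n. n \<ge> N \<Longrightarrow> \<bar>t n\<bar> < d" using LIMSEQ_D[OF t(1) d(1)] by auto
      show "\<exists>N. \<forall>n\<ge>N. norm ((f (x + t n *\<^sub>R i) - f x) / t n - pd i f x) < e"
      proof (intro exI[of _ N] allI impI)
        fix n assume n: "n \<ge> N"
        have "(\<Sum>j\<in>Basis. ((t n *\<^sub>R i) \<bullet> j) * pd j f x) = t n * pd i f x"
        proof -
          have "(\<Sum>j\<in>Basis. ((t n *\<^sub>R i) \<bullet> j) * pd j f x) = (\<Sum>j\<in>Basis. if j = i then t n * pd i f x else 0)"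
            using i by (intro sum.cong) (auto simp: inner_Basis)
          then show ?thesis using i by simp
        qed
        then have "\<bar>f (x + t n *\<^sub>R i) - f x - t n * pd i f x\<bar> \<le> e/2 * \<bar>t n\<bar>"
          using d(2)[of "t n *\<^sub>R i" x] N[OF n] i by simp
        then have "\<bar>f (x + t n *\<^sub>R i) - f x - t n * pd i f x\<bar> / \<bar>t n\<bar> \<le> e/2" using t(2)[of n] by (simp add: field_simps)
        also have "\<bar>f (x + t n *\<^sub>R i) - f x - t n * pd i f x\<bar> / \<bar>t n\<bar> = \<bar>(f (x + t n *\<^sub>R i) - f x) / t n - pd i f x\<bar>"
          using t(2)[of n] by (simp add: abs_divide[symmetric] diff_divide_distrib)
        finally show "norm ((f (x + t n *\<^sub>R i) - f x) / t n - pd i f x) < e" using e by simp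
      qed
    qed
    show "AE x in lborel. norm (g x * ((f (x + t n *\<^sub>R i) - f x) / t n)) \<le> M * K * indicator (cball 0 (R + 1)) x" for n
    proof (rule AE_I2)
      fix x
      show "norm (g x * ((f (x + t n *\<^sub>R i) - f x) / t n)) \<le> M * K * indicator (cball 0 (R + 1)) x"
      proof (cases "norm x \<le> R + 1")
        case True
        have "\<bar>(f (x + t n *\<^sub>R i) - f x) / t n\<bar> \<le> K" using K(2)[of x "t n *\<^sub>R i"] i t(2)[of n] by (simp add: field_simps)
        then have "\<bar>g x\<bar> * \<bar>(f (x + t n *\<^sub>R i) - f x) / t n\<bar> \<le> M * K" using M True by (intro mult_mono) auto
        then show ?thesis using True by (simp add: abs_mult)
      next
        case False
        have "norm x \<le> norm (x + t n *\<^sub>R i) + norm (t n *\<^sub>R i)" using norm_triangle_ineq4[of "x + t n *\<^sub>R i" "t n *\<^sub>R i"] by simp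
        then have "norm (x + t n *\<^sub>R i) > R" using False i t(3)[of n] by simp
        then have "f (x + t n *\<^sub>R i) = 0" "f x = 0" using R(2)[of "x + t n *\<^sub>R i"] R(2)[of x] False by force+
        then show ?thesis using K(1) M(2) by simp
      qed
    qed
  qed measurable
qed

lemma inverse_Suc_seq: "(\<lambda>n. inverse (real (Suc n))) \<longlonglongrightarrow> 0" "inverse (real (Suc n)) \<noteq> 0" "\<bar>inverse (real (Suc n))\<bar> \<le> 1"
  "(\<lambda>n. - inverse (real (Suc n))) \<longlonglongrightarrow> 0"
  using LIMSEQ_inverse_real_of_nat tendsto_minus[OF LIMSEQ_inverse_real_of_nat] by (auto simp: field_simps)

text \<open>Translation invariance of the integral makes every difference quotient integrate to
  0.\<close>

lemma integral_pd_eq_0: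
  fixes f :: "'a::euclidean_space \<Rightarrow> real"
  assumes f: "f \<in> Cc1" and i: "i \<in> Basis"
  shows "(LINT x|lborel. pd i f x) = 0"
proof -
  have m: "f \<in> borel_measurable borel" by (intro in_Lp_measurable[OF Cc1_in_Lp(1)[OF f zero_less_one]])
  have int: "integrable lborel f" by (intro in_L1_integrable Cc1_in_Lp f) auto
  have "(LINT x|lborel. 1 * ((f (x + t *\<^sub>R i) - f x) / t)) = 0" for t
  proof -
    have "integrable lborel (\<lambda>x. f (x + t *\<^sub>R i))"
      using integral_lborel_translate(2)[OF m, of "- t *\<^sub>R i"] int by simp
    then show ?thesis using integral_lborel_translate(1)[OF m, of "- t *\<^sub>R i"] int by simp
  qed
  then show ?thesis
    using difference_quotient_integral[OF f continuous_on_const[of _ 1] i inverse_Suc_seq(1-3)]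
    by (simp only: LIMSEQ_const_iff mult_1)
qed

lemma integration_by_parts:
  fixes f g :: "'a::euclidean_space \<Rightarrow> real"
  assumes f: "Ck (Suc 0) f" and g: "g \<in> Cc1" and i: "i \<in> Basis"
  shows "(LINT x|lborel. f x * pd i g x) = - (LINT x|lborel. pd i f x * g x)"
proof -
  note G = Cc1D[OF g]
  have fg: "(\<lambda>x. f x * g x) \<in> Cc1" by (intro Cc1I[of 0] Ck_mult f G compact_support_mult(2))
  have "in_Lp 1 (\<lambda>x. f x * pd i g x)" "in_Lp 1 (\<lambda>x. pd i f x * g x)"
    using G f i by (auto intro!: in_Lp_Cc continuous_intros Ck_continuous[OF f] Ck_continuous[OF G(1)] Ck_continuous[OF Ck_SucD(2)] compact_support_mult(2) compact_support_pd simp del: Ck.simps)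
  then have "(LINT x|lborel. f x * pd i g x) + (LINT x|lborel. pd i f x * g x) = (LINT x|lborel. pd i (\<lambda>x. f x * g x) x)"
    by (simp add: pd_mult[OF f G(1)] in_L1_integrable)
  then show ?thesis using integral_pd_eq_0[OF fg i] by simp
qed

text \<open>For C^1 functions there are no second derivatives to exchange. The derivative d_j b is
  replaced by a difference quotient, which may be integrated by parts in direction i and whose shift
  then moves onto a. The identity serves both the Hessian estimate and the dissipation
  integral.\<close>

lemma integral_pd_swap:
  fixes a b :: "'a::euclidean_space \<Rightarrow> real"
  assumes a: "a \<in> Cc1" and b: "b \<in> Cc1" and i: "i \<in> Basis" and j: "j \<in> Basis"
  shows "(LINT x|lborel. pd i a x * pd j b x) = (LINT x|lborel. pd j a x * pd i b x)"
proof -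
  note A = Cc1D[OF a] and B = Cc1D[OF b]
  note cont = Ck_continuous[OF A(1)] Ck_continuous[OF B(1)] Ck_continuous[OF Ck_SucD(2)[OF A(1) i]] Ck_continuous[OF Ck_SucD(2)[OF B(1) i]]
  note [measurable] = borel_measurable_continuous_onI[OF cont(1)] borel_measurable_continuous_onI[OF cont(4)]
  define t where "t n = inverse (real (Suc n))" for n
  have t: "t \<longlonglongrightarrow> 0" "\<And>n. t n \<noteq> 0" "\<And>n. \<bar>t n\<bar> \<le> 1" "(\<lambda>n. - t n) \<longlonglongrightarrow> 0"
    unfolding t_def using inverse_Suc_seq by auto
  have eq: "(LINT x|lborel. pd i a x * ((b (x + t n *\<^sub>R j) - b x) / t n)) = (LINT x|lborel. pd i b x * ((a (x + (- t n) *\<^sub>R j) - a x) / (- t n)))" for n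
  proof -
    \<comment> \<open>The argument is written with the scalar factor 1 to fit the affine form a + s
      x of \<open>Ck_affine\<close> and \<open>pd_affine\<close>.\<close>
    define D where "D x = (1 / t n) *\<^sub>R (b (t n *\<^sub>R j + 1 *\<^sub>R x) - b x)" for x
    have Cs: "Ck (Suc 0) (\<lambda>x. b (t n *\<^sub>R j + 1 *\<^sub>R x))" by (rule Ck_affine[OF B(1)])
    have D1: "Ck (Suc 0) D" unfolding D_def
      by (intro Ck_bounded_linear[OF bounded_linear_scaleR_right] Ck_diff Ck_affine B)
    have pdD: "pd i D x = (pd i b (x + t n *\<^sub>R j) - pd i b x) / t n" for x
    proof -
      have "pd i D x = (1 / t n) *\<^sub>R pd i (\<lambda>x. b (t n *\<^sub>R j + 1 *\<^sub>R x) - b x) x"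
        unfolding D_def by (rule pd_bounded_linear[OF bounded_linear_scaleR_right Ck_diff[OF Cs B(1)]])
      also have "pd i (\<lambda>x. b (t n *\<^sub>R j + 1 *\<^sub>R x) - b x) x = pd i b (t n *\<^sub>R j + 1 *\<^sub>R x) - pd i b x"
        using pd_diff[OF Cs B(1)] pd_affine[OF B(1), where a="t n *\<^sub>R j" and s=1 and i=i] by simp
      finally show ?thesis by (simp add: add.commute field_simps)
    qed
    have "(LINT x|lborel. pd i a x * ((b (x + t n *\<^sub>R j) - b x) / t n)) = (LINT x|lborel. D x * pd i a x)"
      by (simp add: D_def add.commute mult.commute)
    also have "\<dots> = - (LINT x|lborel. pd i D x * a x)" by (rule integration_by_parts[OF D1 a i])
    also have "(LINT x|lborel. pd i D x * a x) = (LINT x|lborel. pd i b (x + t n *\<^sub>R j) * a x / t n - pd i b x * a x / t n)"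
      unfolding pdD by (intro Bochner_Integration.integral_cong) (auto simp: diff_divide_distrib left_diff_distrib)
    also have "\<dots> = (LINT x|lborel. pd i b (x + t n *\<^sub>R j) * a x / t n) - (LINT x|lborel. pd i b x * a x / t n)"
    proof (rule Bochner_Integration.integral_diff)
      have "continuous_on UNIV (\<lambda>x. pd i b (x + t n *\<^sub>R j))"
        by (rule continuous_on_compose2[OF cont(4)]) (auto intro: continuous_intros)
      then show "integrable lborel (\<lambda>x. pd i b (x + t n *\<^sub>R j) * a x / t n)"
        by (intro integrable_divide in_L1_integrable in_Lp_Cc compact_support_mult(2) A continuous_intros cont) auto
      show "integrable lborel (\<lambda>x. pd i b x * a x / t n)"
        by (intro integrable_divide in_L1_integrable in_Lp_Cc compact_support_mult(2) A continuous_intros cont) auto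
    qed
    also have "(LINT x|lborel. pd i b (x + t n *\<^sub>R j) * a x / t n) = (LINT x|lborel. pd i b x * a (x - t n *\<^sub>R j) / t n)"
      using integral_lborel_translate(1)[of "\<lambda>x. pd i b (x + t n *\<^sub>R j) * a x / t n" "t n *\<^sub>R j"]
      by (auto dest: sym)
    also have "- ((LINT x|lborel. pd i b x * a (x - t n *\<^sub>R j) / t n) - (LINT x|lborel. pd i b x * a x / t n)) = (LINT x|lborel. pd i b x * ((a (x + (- t n) *\<^sub>R j) - a x) / (- t n)))"
    proof -
      have "continuous_on UNIV (\<lambda>x. a (x - t n *\<^sub>R j))"
        by (rule continuous_on_compose2[OF cont(1)]) (auto intro: continuous_intros)
      then have i1: "integrable lborel (\<lambda>x. pd i b x * a (x - t n *\<^sub>R j) / t n)"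
        by (intro integrable_divide in_L1_integrable in_Lp_Cc compact_support_mult(1) compact_support_pd B continuous_intros cont) auto
      have i2: "integrable lborel (\<lambda>x. pd i b x * a x / t n)"
        by (intro integrable_divide in_L1_integrable in_Lp_Cc compact_support_mult(2) A continuous_intros cont) auto
      show ?thesis
        unfolding Bochner_Integration.integral_diff[OF i1 i2, symmetric] integral_minus[symmetric]
        using t(2)[of n] by (intro Bochner_Integration.integral_cong) (auto simp: field_simps)
    qed
    finally show ?thesis .
  qed
  have "(\<lambda>n. LINT x|lborel. pd i a x * ((b (x + t n *\<^sub>R j) - b x) / t n)) \<longlonglongrightarrow> (LINT x|lborel. pd i a x * pd j b x)"
    by (rule difference_quotient_integral[OF b cont(3) j t(1-3)])
  moreover have "(\<lambda>n. LINT x|lborel. pd i b x * ((a (x + (- t n) *\<^sub>R j) - a x) / (- t n))) \<longlonglongrightarrow> (LINT x|lborel. pd i b x * pd j a x)"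
    by (rule difference_quotient_integral[OF a cont(4) j t(4)]) (use t in auto)
  ultimately show ?thesis unfolding eq by (simp add: LIMSEQ_unique mult.commute)
qed

section \<open>Convolution and test functions\<close>

definition locally_integrable :: "('a::euclidean_space \<Rightarrow> real) \<Rightarrow> bool" where
  "locally_integrable f \<longleftrightarrow> f \<in> borel_measurable borel \<and>
     (\<forall>R. integrable lborel (\<lambda>x. indicator (cball 0 R) x * f x))"

lemma locally_integrable_measurable: "locally_integrable f \<Longrightarrow> f \<in> borel_measurable borel"
  by (simp add: locally_integrable_def)

lemma integrable_indicator_cball: "integrable lborel (\<lambda>x::'a::euclidean_space. indicator (cball 0 R) x :: real)"
  using emeasure_lborel_cball_finite[of "0::'a" R] by (simp add: integrable_indicator_iff less_top)

lemma in_Lp_locally_integrable: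
  fixes f :: "'a::euclidean_space \<Rightarrow> real"
  assumes f: "in_Lp r f" and r: "r \<ge> 1"
  shows "locally_integrable f"
  unfolding locally_integrable_def
proof (intro conjI allI)
  note [measurable] = in_Lp_measurable[OF f]
  show "f \<in> borel_measurable borel" by measurable
  fix R
  have [measurable]: "cball (0::'a) R \<in> sets borel" by simp
  show "integrable lborel (\<lambda>x. indicator (cball 0 R) x * f x)"
  proof (rule Bochner_Integration.integrable_bound[OF Bochner_Integration.integrable_add[OF integrable_indicator_cball in_Lp_integrable[OF f]]])
    show "AE x in lborel. norm (indicator (cball 0 R) x * f x) \<le> norm (indicator (cball 0 R) x + \<bar>f x\<bar> powr r)"
    proof (rule AE_I2)
      fix x
      have "\<bar>f x\<bar> \<le> 1 + \<bar>f x\<bar> powr r"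
      proof (cases "\<bar>f x\<bar> \<le> 1")
        case False
        then have "\<bar>f x\<bar> powr 1 \<le> \<bar>f x\<bar> powr r" using r by (intro powr_mono) auto
        then show ?thesis by simp
      qed (simp add: add_increasing2)
      then show "norm (indicator (cball 0 R) x * f x) \<le> norm (indicator (cball 0 R) x + \<bar>f x\<bar> powr r)"
        by (simp add: indicator_def)
    qed
  qed measurable
qed

lemma locally_integrable_mult:
  fixes f g :: "'a::euclidean_space \<Rightarrow> real"
  assumes f: "locally_integrable f" and g: "g \<in> borel_measurable borel" "\<And>x. \<bar>g x\<bar> \<le> M" "\<And>x. g x \<noteq> 0 \<Longrightarrow> norm x \<le> R"
  shows "integrable lborel (\<lambda>x. g x * f x)"
proof -
  note [measurable] = locally_integrable_measurable[OF f] g(1)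
  have "integrable lborel (\<lambda>x. M * (indicator (cball 0 R) x * f x))"
    using f by (auto simp: locally_integrable_def)
  then show ?thesis
  proof (rule Bochner_Integration.integrable_bound)
    have "M \<ge> 0" using g(2)[of 0] by linarith
    show "AE x in lborel. norm (g x * f x) \<le> norm (M * (indicator (cball 0 R) x * f x))"
    proof (rule AE_I2)
      fix x show "norm (g x * f x) \<le> norm (M * (indicator (cball 0 R) x * f x))"
        using g(2,3)[of x] \<open>M \<ge> 0\<close> by (cases "g x = 0") (auto simp: abs_mult mult_right_mono)
    qed
  qed measurable
qed

lemma locally_integrable_mult_Cc:
  fixes f g :: "'a::euclidean_space \<Rightarrow> real"
  assumes "locally_integrable f" "continuous_on UNIV g" "compact_support g"
  shows "integrable lborel (\<lambda>x. g x * f x)"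
  using locally_integrable_mult[OF assms(1) borel_measurable_continuous_onI[OF assms(2)]]
    bounded_on_compact_support[OF assms(2,3)] compact_supportE[OF assms(3)] by metis

section \<open>Regularity of convolutions\<close>

lemma conv_alt:
  assumes "k \<in> borel_measurable borel" "f \<in> borel_measurable borel"
  shows "conv k f x = (LINT y|lborel. k (x - y) * f y)"
  using integral_lborel_reflect(1)[of "\<lambda>y. k (x - y) * f y" x] assms unfolding conv_def by simp

lemma Cc_reflect:
  fixes k :: "'a::euclidean_space \<Rightarrow> 'b::real_normed_vector"
  assumes "compact_support k" shows "compact_support (\<lambda>y. k (x - y))"
proof -
  obtain R where R: "\<And>z. k z \<noteq> 0 \<Longrightarrow> norm z \<le> R" using compact_supportE[OF assms] by metis
  have "norm y \<le> R + norm x" if "k (x - y) \<noteq> 0" for y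
    using R[OF that] norm_triangle_ineq2[of y x] by (simp add: norm_minus_commute)
  then show ?thesis by (rule compact_supportI)
qed

lemma continuous_reflect: "continuous_on UNIV k \<Longrightarrow> continuous_on UNIV (\<lambda>y. k (x - y))"
  for k :: "'a::euclidean_space \<Rightarrow> 'b::real_normed_vector"
  by (rule continuous_on_compose2[of UNIV k]) (auto intro: continuous_intros)

lemma integrable_conv:
  fixes k f :: "'a::euclidean_space \<Rightarrow> real"
  assumes "continuous_on UNIV k" "compact_support k" "locally_integrable f"
  shows "integrable lborel (\<lambda>y. k (x - y) * f y)"
  by (intro locally_integrable_mult_Cc assms Cc_reflect continuous_reflect)

text \<open>Integrability of g f is not a premise: if it fails, the integral is 0 by convention and
  the right-hand side is still nonnegative.\<close>

lemma conv_estimate: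
  fixes k f :: "'a::euclidean_space \<Rightarrow> real"
  assumes f: "locally_integrable f" and "\<And>z. \<bar>g z\<bar> \<le> c * indicator (cball 0 R) z"
  shows "\<bar>LINT z|lborel. g z * f z\<bar> \<le> c * (LINT z|lborel. \<bar>indicator (cball 0 R) z * f z\<bar>)"
proof (cases "integrable lborel (\<lambda>z. g z * f z)")
  case True
  have i: "integrable lborel (\<lambda>z. \<bar>indicator (cball 0 R) z * f z\<bar>)" using f by (auto simp: locally_integrable_def)
  have "\<bar>LINT z|lborel. g z * f z\<bar> \<le> (LINT z|lborel. \<bar>g z * f z\<bar>)" by (rule integral_abs_bound)
  also have "\<dots> \<le> (LINT z|lborel. c * \<bar>indicator (cball 0 R) z * f z\<bar>)"
  proof (rule integral_mono)
    show "integrable lborel (\<lambda>z. \<bar>g z * f z\<bar>)" using True by (rule Bochner_Integration.integrable_abs)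
    show "integrable lborel (\<lambda>z. c * \<bar>indicator (cball 0 R) z * f z\<bar>)" using i by (rule integrable_mult_right)
    fix z
    have "\<bar>g z\<bar> * \<bar>f z\<bar> \<le> (c * indicator (cball 0 R) z) * \<bar>f z\<bar>" by (intro mult_right_mono assms(2)) auto
    then show "\<bar>g z * f z\<bar> \<le> c * \<bar>indicator (cball 0 R) z * f z\<bar>" by (simp add: abs_mult mult.assoc)
  qed
  also have "\<dots> = c * (LINT z|lborel. \<bar>indicator (cball 0 R) z * f z\<bar>)" by simp
  finally show ?thesis .
next
  case False
  have "c * indicator (cball 0 R) z \<ge> 0" for z :: 'a using assms(2)[of z] by linarith
  then have "(LINT z|lborel. c * \<bar>indicator (cball 0 R) z * f z\<bar>) \<ge> 0"
    by (intro Bochner_Integration.integral_nonneg) (auto simp: abs_mult mult.assoc[symmetric])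
  then show ?thesis using False by (simp add: not_integrable_integral_eq)
qed

lemma conv_continuous:
  fixes k f :: "'a::euclidean_space \<Rightarrow> real"
  assumes k: "continuous_on UNIV k" "compact_support k" and f: "locally_integrable f"
  shows "continuous_on UNIV (conv k f)"
  unfolding continuous_on_iff
proof (intro ballI allI impI)
  fix x :: 'a and e :: real assume e: "e > 0"
  obtain R where R: "\<And>z. k z \<noteq> 0 \<Longrightarrow> norm z \<le> R" using compact_supportE[OF k(2)] by metis
  define B where "B = cball (0::'a) (norm x + 1 + R)"
  define A where "A = (LINT z|lborel. \<bar>indicator B z * f z\<bar>)"
  have A: "A \<ge> 0" unfolding A_def by simp
  obtain d where d: "d > 0" "\<And>x y. norm (x - y) < d \<Longrightarrow> \<bar>k x - k y\<bar> < e / (A + 1)"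
    using uniformly_continuous_Cc[OF k, of "e / (A+1)"] e A by auto
  note m = borel_measurable_continuous_onI[OF k(1)] locally_integrable_measurable[OF f]
  show "\<exists>d>0. \<forall>y\<in>UNIV. dist y x < d \<longrightarrow> dist (conv k f y) (conv k f x) < e"
  proof (intro exI[of _ "min d 1"] conjI ballI impI)
    fix y assume "dist y x < min d 1"
    then have y: "norm (y - x) < min d 1" by (simp add: dist_norm)
    have "conv k f y - conv k f x = (LINT z|lborel. (k (y - z) - k (x - z)) * f z)"
      unfolding conv_alt[OF m] using integrable_conv[OF k f] by (simp add: left_diff_distrib)
    also have "\<bar>\<dots>\<bar> \<le> e / (A+1) * A" unfolding A_def B_def
    proof (rule conv_estimate[OF f])
      fix z
      show "\<bar>k (y - z) - k (x - z)\<bar> \<le> e / ((LINT z|lborel. \<bar>indicator (cball 0 (norm x + 1 + R)) z * f z\<bar>) + 1) * indicator (cball 0 (norm x + 1 + R)) z"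
      proof (cases "norm z \<le> norm x + 1 + R")
        case True
        have "\<bar>k (y - z) - k (x - z)\<bar> < e / (A+1)" using d(2)[of "y - z" "x - z"] y by simp
        then show ?thesis using True by (simp add: A_def B_def)
      next
        case False
        have "norm z \<le> norm x + norm (x - z)" "norm z \<le> norm x + norm (y - x) + norm (y - z)"
          by norm+
        then have "k (y - z) = 0" "k (x - z) = 0" using False R[of "y - z"] R[of "x - z"] y by auto
        then show ?thesis using False by simp
      qed
    qed
    also have "\<dots> < e" using e A by (simp add: field_simps)
    finally show "dist (conv k f y) (conv k f x) < e" by (simp add: dist_real_def)
  qed (use d in auto)
qed

text \<open>The uniform first-order expansion of k is integrated against f. For |y - x| < 1 all
  kernels involved live in one fixed ball, so local integrability of f controls the remainder by its
  L^1 mass A there; A + 1 avoids division by 0.\<close>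

lemma conv_has_derivative:
  fixes k f :: "'a::euclidean_space \<Rightarrow> real"
  assumes k: "k \<in> Cc1" and f: "locally_integrable f"
  shows "(conv k f has_derivative (\<lambda>h. \<Sum>i\<in>Basis. (h \<bullet> i) * conv (pd i k) f x)) (at x)"
  unfolding has_derivative_at_alt
proof (intro conjI allI impI)
  show "bounded_linear (\<lambda>h. \<Sum>i\<in>Basis. (h \<bullet> i) * conv (pd i k) f x)"
    by (intro bounded_linear_sum bounded_linear_mult_const bounded_linear_inner_left)
  fix e :: real assume e: "e > 0"
  note C = Cc1D[OF k]
  obtain R where R: "\<And>z. k z \<noteq> 0 \<Longrightarrow> norm z \<le> R" using compact_supportE[OF C(2)] by metis
  note Rp = pd_support[of k R, OF R]
  define A where "A = (LINT z|lborel. \<bar>indicator (cball 0 (norm x + 1 + R)) z * f z\<bar>)"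
  have A: "A \<ge> 0" unfolding A_def by simp
  obtain d where d: "d > 0" "\<And>x h. norm h < d \<Longrightarrow> \<bar>k (x + h) - k x - (\<Sum>i\<in>Basis. (h \<bullet> i) * pd i k x)\<bar> \<le> e / (A+1) * norm h"
    using Cc1_uniformly_differentiable[OF k, of "e / (A+1)"] e A by auto
  have c1: "continuous_on UNIV k" and c2: "i \<in> Basis \<Longrightarrow> continuous_on UNIV (pd i k)" for i
    using Ck_continuous[OF C(1)] Ck_continuous[OF Ck_SucD(2)[OF C(1)]] by auto
  note m = borel_measurable_continuous_onI[OF c1] locally_integrable_measurable[OF f]
  note m2 = borel_measurable_continuous_onI[OF c2] locally_integrable_measurable[OF f]
  show "\<exists>d>0. \<forall>y. norm (y - x) < d \<longrightarrow> norm (conv k f y - conv k f x - (\<Sum>i\<in>Basis. ((y - x) \<bullet> i) * conv (pd i k) f x)) \<le> e * norm (y - x)"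
  proof (intro exI[of _ "min d 1"] conjI allI impI)
    fix y assume y: "norm (y - x) < min d 1"
    have i1: "integrable lborel (\<lambda>z. k (y - z) * f z)" for y by (rule integrable_conv[OF c1 C(2) f])
    have i2: "integrable lborel (\<lambda>z. ((y - x) \<bullet> i) * (pd i k (x - z) * f z))" if "i \<in> Basis" for i
      by (intro integrable_mult_right integrable_conv[OF c2 compact_support_pd[OF C(2)] f] that)
    have "(\<Sum>i\<in>Basis. ((y - x) \<bullet> i) * conv (pd i k) f x) = (\<Sum>i\<in>Basis. LINT z|lborel. ((y - x) \<bullet> i) * (pd i k (x - z) * f z))"
      by (intro sum.cong refl) (simp add: conv_alt[OF m2])
    also have "\<dots> = (LINT z|lborel. (\<Sum>i\<in>Basis. ((y - x) \<bullet> i) * (pd i k (x - z) * f z)))"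
      by (rule Bochner_Integration.integral_sum[symmetric]) (rule i2)
    finally have "conv k f y - conv k f x - (\<Sum>i\<in>Basis. ((y - x) \<bullet> i) * conv (pd i k) f x)
       = (LINT z|lborel. k (y - z) * f z - k (x - z) * f z - (\<Sum>i\<in>Basis. ((y - x) \<bullet> i) * (pd i k (x - z) * f z)))"
      using i1 i2 by (simp add: conv_alt[OF m])
    also have "\<dots> = (LINT z|lborel. (k (y - z) - k (x - z) - (\<Sum>i\<in>Basis. ((y - x) \<bullet> i) * pd i k (x - z))) * f z)"
      by (intro Bochner_Integration.integral_cong refl) (simp add: left_diff_distrib sum_distrib_right mult.assoc)
    also have "\<bar>\<dots>\<bar> \<le> (e / (A+1) * norm (y - x)) * A"
      unfolding A_def
    proof (rule conv_estimate[OF f])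
      fix z
      show "\<bar>k (y - z) - k (x - z) - (\<Sum>i\<in>Basis. ((y - x) \<bullet> i) * pd i k (x - z))\<bar>
        \<le> e / ((LINT z|lborel. \<bar>indicator (cball 0 (norm x + 1 + R)) z * f z\<bar>) + 1) * norm (y - x) * indicator (cball 0 (norm x + 1 + R)) z"
      proof (cases "norm z \<le> norm x + 1 + R")
        case True
        then show ?thesis using d(2)[of "y - x" "x - z"] y by (simp add: A_def)
      next
        case False
        have "norm z \<le> norm x + norm (x - z)" "norm z \<le> norm x + norm (y - x) + norm (y - z)"
          by norm+
        then have far: "\<not> norm (y - z) \<le> R" "\<not> norm (x - z) \<le> R" using False y by auto
        then have "k (y - z) = 0" "k (x - z) = 0" "pd i k (x - z) = 0" for i using R Rp by blast+
        then show ?thesis using False by simp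
      qed
    qed
    also have "\<dots> \<le> e * norm (y - x)"
    proof -
      have "e / (A+1) * A \<le> e" using e A by (simp add: field_simps)
      from mult_right_mono[OF this norm_ge_zero[of "y - x"]] show ?thesis by (simp add: mult_ac)
    qed
    finally show "norm (conv k f y - conv k f x - (\<Sum>i\<in>Basis. ((y - x) \<bullet> i) * conv (pd i k) f x)) \<le> e * norm (y - x)" by simp
  qed (use d in auto)
qed

lemma sum_Basis_inner: "i \<in> Basis \<Longrightarrow> (\<Sum>j\<in>Basis. (i \<bullet> j) * g j) = (g i :: real)" for i :: "'a::euclidean_space"
proof -
  assume i: "i \<in> Basis"
  have "(\<Sum>j\<in>Basis. (i \<bullet> j) * g j) = (\<Sum>j\<in>Basis. if j = i then g i else 0)"
    using i by (intro sum.cong) (auto simp: inner_Basis)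
  then show ?thesis using i by simp
qed

lemma pd_conv:
  fixes k f :: "'a::euclidean_space \<Rightarrow> real"
  assumes k: "k \<in> Cc1" and f: "locally_integrable f" and i: "i \<in> Basis"
  shows "pd i (conv k f) x = conv (pd i k) f x"
  using frechet_derivative_eq[OF conv_has_derivative[OF k f], of x] sum_Basis_inner[OF i, of "\<lambda>i. conv (pd i k) f x"]
  by simp

lemma Ck_conv:
  fixes k f :: "'a::euclidean_space \<Rightarrow> real"
  assumes "Ck m k" "compact_support k" and f: "locally_integrable f"
  shows "Ck m (conv k f)"
  using assms(1,2)
proof (induction m arbitrary: k)
  case 0
  then show ?case using conv_continuous f by auto
next
  case (Suc m)
  have k: "k \<in> Cc1" by (rule Cc1I[OF Suc.prems])
  show ?case
  proof (rule Ck_SucI[OF conv_has_derivative[OF k f]])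
    fix i :: 'a assume i: "i \<in> Basis"
    have "Ck m (conv (pd i k) f)" by (intro Suc.IH Ck_SucD(2)[OF Suc.prems(1) i] compact_support_pd Suc.prems)
    then show "Ck m (\<lambda>x. \<Sum>j\<in>Basis. (i \<bullet> j) * conv (pd j k) f x)"
      by (simp add: sum_Basis_inner[OF i])
  qed
qed

lemma conv_support:
  fixes k f :: "'a::euclidean_space \<Rightarrow> real"
  assumes k: "\<And>z. k z \<noteq> 0 \<Longrightarrow> norm z \<le> R" and f: "\<And>z. f z \<noteq> 0 \<Longrightarrow> norm z \<le> S" and x: "conv k f x \<noteq> 0"
  shows "norm x \<le> R + S"
proof (rule ccontr)
  assume *: "\<not> norm x \<le> R + S"
  have "k z * f (x - z) = 0" for z
  proof (rule ccontr)
    assume "k z * f (x - z) \<noteq> 0"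
    then have "norm z \<le> R" "norm (x - z) \<le> S" using k f by auto
    moreover have "norm x \<le> norm z + norm (x - z)" by norm
    ultimately show False using * by simp
  qed
  then have "(\<lambda>z. k z * f (x - z)) = (\<lambda>_. 0)" by (rule ext)
  then show False using x by (simp add: conv_def)
qed

lemma integral_lborel_scale:
  fixes f :: "'a::euclidean_space \<Rightarrow> real"
  assumes f: "f \<in> borel_measurable borel" and s: "s > 0"
  shows "(LINT x|lborel. s ^ DIM('a) * f (s *\<^sub>R x)) = (LINT x|lborel. f x)"
    "integrable lborel (\<lambda>x. s ^ DIM('a) * f (s *\<^sub>R x)) \<longleftrightarrow> integrable lborel f"
proof -
  have eq: "(lborel :: 'a measure) = density (distr lborel borel (\<lambda>x. s *\<^sub>R x)) (\<lambda>_. \<bar>s\<bar> ^ DIM('a))"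
    using lborel_affine[of s "0::'a"] s by simp
  have "integral\<^sup>L lborel f = integral\<^sup>L (density (distr lborel borel (\<lambda>x. s *\<^sub>R x)) (\<lambda>_. \<bar>s\<bar> ^ DIM('a))) f"
    by (subst eq) simp
  also have "\<dots> = (LINT x|distr lborel borel (\<lambda>x. s *\<^sub>R x). \<bar>s\<bar> ^ DIM('a) *\<^sub>R f x)"
    using f by (intro integral_density) auto
  also have "\<dots> = (LINT x|lborel. s ^ DIM('a) * f (s *\<^sub>R x))"
    using f s by (subst integral_distr) auto
  finally show "(LINT x|lborel. s ^ DIM('a) * f (s *\<^sub>R x)) = (LINT x|lborel. f x)" by simp
  have "integrable lborel f \<longleftrightarrow> integrable (density (distr lborel borel (\<lambda>x. s *\<^sub>R x)) (\<lambda>_. \<bar>s\<bar> ^ DIM('a))) f"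
    by (subst eq) simp
  also have "\<dots> \<longleftrightarrow> integrable (distr lborel borel (\<lambda>x. s *\<^sub>R x)) (\<lambda>x. \<bar>s\<bar> ^ DIM('a) *\<^sub>R f x)"
    using f by (intro integrable_density) auto
  also have "\<dots> \<longleftrightarrow> integrable lborel (\<lambda>x. s ^ DIM('a) * f (s *\<^sub>R x))"
    using f s by (subst integrable_distr_eq) auto
  finally show "integrable lborel (\<lambda>x. s ^ DIM('a) * f (s *\<^sub>R x)) \<longleftrightarrow> integrable lborel f" by simp
qed

section \<open>Smooth bumps and mollifiers\<close>

text \<open>The factor t^-m makes the family closed under differentiation up to linear combinations,
  so all derivatives of exp(-1/t) are handled by one computation.\<close>

definition flat_exp :: "nat \<Rightarrow> real \<Rightarrow> real" where
  "flat_exp m t = (if t > 0 then exp (- (1 / t)) / t ^ m else 0)"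

lemma power_le_fact_exp: "x \<ge> 0 \<Longrightarrow> x ^ n \<le> fact n * exp (x::real)"
proof -
  assume x: "x \<ge> 0"
  have "(\<Sum>k\<in>{n}. x ^ k /\<^sub>R fact k) \<le> (\<Sum>k. x ^ k /\<^sub>R fact k)"
    using x by (intro sum_le_suminf summable_exp_generic) auto
  then have "x ^ n / fact n \<le> exp x" by (simp add: exp_def divide_inverse mult.commute)
  then show ?thesis by (simp add: field_simps)
qed

text \<open>One term of the exponential series at 1/t gives exp(-1/t) <= (m+2)! t^(m+2). The two
  spare powers of t force a vanishing derivative at the joint t = 0.\<close>

lemma flat_exp_bound: "\<bar>flat_exp m t\<bar> \<le> fact (m + 2) * t\<^sup>2"
proof (cases "t > 0")
  case True
  have "(1/t) ^ (m+2) \<le> fact (m+2) * exp (1/t)" using True by (intro power_le_fact_exp) auto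
  then have "exp (- (1/t)) \<le> fact (m+2) * t ^ (m + 2)" using True
    by (simp add: exp_minus power_one_over field_simps)
  then have "exp (- (1/t)) / t ^ m \<le> fact (m+2) * t ^ (m + 2) / t ^ m" using True by (intro divide_right_mono) auto
  also have "\<dots> = fact (m+2) * t\<^sup>2" using True by (simp add: power_add power2_eq_square)
  finally show ?thesis using True by (simp add: flat_exp_def)
qed (simp add: flat_exp_def)

lemma flat_exp_derivative:
  "(flat_exp m has_field_derivative (- real m * flat_exp (m + 1) t + flat_exp (m + 2) t)) (at t)"
proof -
  consider "t > 0" | "t < 0" | "t = 0" by linarith
  then show ?thesis
  proof cases
    case 1
    have "((\<lambda>t. exp (- (1 / t)) / t ^ m) has_field_derivative (- real m * (exp (- (1 / t)) / t ^ (m+1)) + exp (- (1 / t)) / t ^ (m+2))) (at t)"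
    proof -
      have e: "((\<lambda>t. exp (- (1 / t))) has_field_derivative exp (- (1 / t)) / t\<^sup>2) (at t)"
        using 1 by (auto intro!: derivative_eq_intros simp: power2_eq_square)
      have p: "((\<lambda>t. t ^ m) has_field_derivative real m * t ^ (m - Suc 0)) (at t)" by (rule DERIV_pow)
      have "real m * t ^ (m - Suc 0) = real m * t ^ m / t" using 1 by (cases m) auto
      then have "(exp (- (1 / t)) / t\<^sup>2 * t ^ m - exp (- (1 / t)) * (real m * t ^ (m - Suc 0))) / (t ^ m * t ^ m)
        = - real m * (exp (- (1 / t)) / t ^ (m+1)) + exp (- (1 / t)) / t ^ (m+2)"
        unfolding \<open>real m * t ^ (m - Suc 0) = real m * t ^ m / t\<close> using 1 by (simp add: field_simps power2_eq_square)
      then show ?thesis by (intro DERIV_cong[OF DERIV_divide[OF e p]]) (use 1 in simp)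
    qed
    then have "(flat_exp m has_field_derivative (- real m * (exp (- (1 / t)) / t ^ (m+1)) + exp (- (1 / t)) / t ^ (m+2))) (at t)"
      by (rule has_field_derivative_transform_within_open[where S="{0<..}"]) (use 1 in \<open>auto simp: flat_exp_def\<close>)
    then show ?thesis using 1 by (simp add: flat_exp_def)
  next
    case 2
    have "((\<lambda>_. 0::real) has_field_derivative 0) (at t)" by simp
    then have "(flat_exp m has_field_derivative 0) (at t)"
      by (rule has_field_derivative_transform_within_open[where S="{..<0}"]) (use 2 in \<open>auto simp: flat_exp_def\<close>)
    then show ?thesis using 2 by (simp add: flat_exp_def)
  next
    case 3
    have "((\<lambda>h. (flat_exp m (0 + h) - flat_exp m 0) / h) \<longlongrightarrow> 0) (at 0)"
    proof (rule Lim_null_comparison)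
      show "((\<lambda>h::real. fact (m+2) * \<bar>h\<bar>) \<longlongrightarrow> 0) (at 0)" by (auto intro!: tendsto_eq_intros)
      show "\<forall>\<^sub>F h in at 0. norm ((flat_exp m (0 + h) - flat_exp m 0) / h) \<le> fact (m+2) * \<bar>h\<bar>"
      proof (rule eventually_at_filter[THEN iffD2, OF always_eventually], intro allI impI)
        fix h :: real assume "h \<noteq> 0"
        then have "\<bar>flat_exp m h\<bar> / \<bar>h\<bar> \<le> fact (m+2) * \<bar>h\<bar>"
          using flat_exp_bound[of m h] by (subst pos_divide_le_eq) (simp_all only: zero_less_abs_iff mult.assoc power2_eq_square abs_mult_self_eq simp_thms)
        then show "norm ((flat_exp m (0 + h) - flat_exp m 0) / h) \<le> fact (m+2) * \<bar>h\<bar>"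
          by (simp add: flat_exp_def[of m 0] abs_divide del: fact_Suc)
      qed
    qed
    then show ?thesis using 3 by (simp add: DERIV_def flat_exp_def)
  qed
qed

text \<open>A class closed under all directional derivatives that contains the standard bump. Being
  of class C^k for every k then follows by a single induction, without formulas for higher
  derivatives.\<close>

inductive_set smooth_bumps :: "('a::euclidean_space \<Rightarrow> real) set" where
  base: "(\<lambda>x. flat_exp m (1 - x \<bullet> x)) \<in> smooth_bumps"
| inner: "f \<in> smooth_bumps \<Longrightarrow> (\<lambda>x. (x \<bullet> v) * f x) \<in> smooth_bumps"
| cmult: "f \<in> smooth_bumps \<Longrightarrow> (\<lambda>x. c * f x) \<in> smooth_bumps"
| add: "f \<in> smooth_bumps \<Longrightarrow> g \<in> smooth_bumps \<Longrightarrow> (\<lambda>x. f x + g x) \<in> smooth_bumps"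

lemma smooth_bumps_derivative:
  "f \<in> smooth_bumps \<Longrightarrow> \<exists>D. (\<forall>x. (f has_derivative D x) (at x)) \<and> (\<forall>v. (\<lambda>x. D x v) \<in> smooth_bumps)"
proof (induction rule: smooth_bumps.induct)
  case (base m)
  define D where "D x v = (- 2 * (x \<bullet> v)) * (- real m * flat_exp (m+1) (1 - x \<bullet> x) + flat_exp (m+2) (1 - x \<bullet> x))" for x v :: 'a
  have "((\<lambda>x. flat_exp m (1 - x \<bullet> x)) has_derivative D x) (at x)" for x :: 'a
  proof -
    have 1: "((\<lambda>x. 1 - x \<bullet> x) has_derivative (\<lambda>v. - 2 * (x \<bullet> v))) (at x)"
      by (auto intro!: derivative_eq_intros simp: inner_commute)
    from diff_chain_at[OF 1 flat_exp_derivative[of m "1 - x \<bullet> x", THEN has_field_derivative_imp_has_derivative]]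
    have "((\<lambda>x. flat_exp m (1 - x \<bullet> x)) has_derivative
       (\<lambda>v. (- real m * flat_exp (m+1) (1 - x \<bullet> x) + flat_exp (m+2) (1 - x \<bullet> x)) * (- 2 * (x \<bullet> v)))) (at x)"
      by (simp only: o_def)
    moreover have "(\<lambda>v. (- real m * flat_exp (m+1) (1 - x \<bullet> x) + flat_exp (m+2) (1 - x \<bullet> x)) * (- 2 * (x \<bullet> v))) = D x"
      by (rule ext) (simp only: D_def mult.commute)
    ultimately show ?thesis by simp
  qed
  moreover have "(\<lambda>x. D x v) \<in> smooth_bumps" for v
  proof -
    have "(\<lambda>x. (x \<bullet> v) * ((2 * real m) * flat_exp (m+1) (1 - x \<bullet> x) + (- 2) * flat_exp (m+2) (1 - x \<bullet> x))) \<in> smooth_bumps"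
      by (intro smooth_bumps.intros)
    also have "(\<lambda>x. (x \<bullet> v) * ((2 * real m) * flat_exp (m+1) (1 - x \<bullet> x) + (- 2) * flat_exp (m+2) (1 - x \<bullet> x))) = (\<lambda>x. D x v)"
      by (auto simp: D_def algebra_simps)
    finally show ?thesis .
  qed
  ultimately show ?case by blast
next
  case (inner f v)
  then obtain D where D: "\<And>x. (f has_derivative D x) (at x)" "\<And>v. (\<lambda>x. D x v) \<in> smooth_bumps" by blast
  have "((\<lambda>x. (x \<bullet> v) * f x) has_derivative (\<lambda>w. (x \<bullet> v) * D x w + (w \<bullet> v) * f x)) (at x)" for x
    by (auto intro!: derivative_eq_intros D(1))
  moreover have "(\<lambda>x. (x \<bullet> v) * D x w + (w \<bullet> v) * f x) \<in> smooth_bumps" for w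
    by (intro smooth_bumps.intros D(2) inner)
  ultimately show ?case by (intro exI[of _ "\<lambda>x w. (x \<bullet> v) * D x w + (w \<bullet> v) * f x"]) auto
next
  case (cmult f c)
  then obtain D where D: "\<And>x. (f has_derivative D x) (at x)" "\<And>v. (\<lambda>x. D x v) \<in> smooth_bumps" by blast
  have "((\<lambda>x. c * f x) has_derivative (\<lambda>w. c * D x w)) (at x)" for x
    by (auto intro!: derivative_eq_intros D(1))
  then show ?case using D by (intro exI[of _ "\<lambda>x w. c * D x w"]) (auto intro: smooth_bumps.intros)
next
  case (add f g)
  then obtain D E where D: "\<And>x. (f has_derivative D x) (at x)" "\<And>v. (\<lambda>x. D x v) \<in> smooth_bumps"
    and E: "\<And>x. (g has_derivative E x) (at x)" "\<And>v. (\<lambda>x. E x v) \<in> smooth_bumps" by blast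
  have "((\<lambda>x. f x + g x) has_derivative (\<lambda>w. D x w + E x w)) (at x)" for x
    by (auto intro!: derivative_eq_intros D(1) E(1))
  then show ?case using D E by (intro exI[of _ "\<lambda>x w. D x w + E x w"]) (auto intro: smooth_bumps.intros)
qed

lemma smooth_bumps_Ck: "f \<in> smooth_bumps \<Longrightarrow> Ck k f"
proof (induction k arbitrary: f)
  case 0
  obtain D where "\<And>x. (f has_derivative D x) (at x)" using smooth_bumps_derivative[OF 0] by blast
  then show ?case by (auto simp: continuous_on_eq_continuous_at intro: has_derivative_continuous)
next
  case (Suc k)
  obtain D where D: "\<And>x. (f has_derivative D x) (at x)" "\<And>v. (\<lambda>x. D x v) \<in> smooth_bumps"
    using smooth_bumps_derivative[OF Suc.prems] by blast
  show ?case by (rule Ck_SucI[OF D(1)]) (rule Suc.IH[OF D(2)])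
qed

lemma Cc_inf_cmult: "f \<in> Cc_inf \<Longrightarrow> (\<lambda>x. c * f x) \<in> Cc_inf" for f :: "'a::euclidean_space \<Rightarrow> real"
  by (auto simp: Cc_inf_def intro: Ck_bounded_linear[OF bounded_linear_mult_right] compact_support_mult(2))

lemma Cc_inf_scale:
  fixes f :: "'a::euclidean_space \<Rightarrow> 'b::real_normed_vector"
  assumes "f \<in> Cc_inf" "s > 0" shows "(\<lambda>x. f (s *\<^sub>R x)) \<in> Cc_inf"
proof -
  obtain R where R: "\<And>x. f x \<noteq> 0 \<Longrightarrow> norm x \<le> R" using compact_supportE[OF Cc_infD(2)[OF assms(1)]] by metis
  have "norm x \<le> R / s" if "f (s *\<^sub>R x) \<noteq> 0" for x using R[OF that] assms(2) by (simp add: field_simps)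
  then have "compact_support (\<lambda>x. f (s *\<^sub>R x))" by (rule compact_supportI)
  moreover have "Ck k (\<lambda>x. f (s *\<^sub>R x))" for k using Ck_affine[OF Cc_infD(1)[OF assms(1)], of k 0 s] by simp
  ultimately show ?thesis by (simp add: Cc_inf_def)
qed

lemma Cc_inf_reflect: "f \<in> Cc_inf \<Longrightarrow> (\<lambda>y. f (x - y)) \<in> Cc_inf" for f :: "'a::euclidean_space \<Rightarrow> 'b::real_normed_vector"
  using Ck_affine[of _ f x "-1"] by (auto simp: Cc_inf_def Cc_reflect)

text \<open>Normalisation or division by the mass needs positivity only; this is used for the smooth
  bump and for \<open>newton_kernel\<close>.\<close>

lemma integral_pos_on_unit_ball:
  fixes f :: "'a::euclidean_space \<Rightarrow> real"
  assumes int: "integrable lborel f" and nn: "\<And>x. f x \<ge> 0" and pos: "\<And>x. norm x < 1 \<Longrightarrow> f x \<noteq> 0"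
  shows "(LINT x|lborel. f x) > 0"
proof (rule ccontr)
  assume "\<not> (LINT x|lborel. f x) > 0"
  then have "(LINT x|lborel. f x) = 0" using Bochner_Integration.integral_nonneg[of lborel f, OF nn] by linarith
  then have "AE x in lborel. f x = 0" using integral_nonneg_eq_0_iff_AE[OF int] nn by simp
  then have "AE x in lborel. x \<notin> ball (0::'a) 1" by eventually_elim (use pos in auto)
  then have "ball (0::'a) 1 \<in> null_sets lborel" by (subst (asm) AE_iff_null_sets[symmetric]) auto
  then have "negligible (ball (0::'a) 1)" by (simp add: negligible_iff_null_sets null_sets_completionI)
  then show False using open_not_negligible[of "ball (0::'a) 1"] by simp
qed

lemma ex_standard_mollifier:
  obtains \<eta> :: "'a::euclidean_space \<Rightarrow> real" where "\<eta> \<in> Cc_inf" "\<And>x. \<eta> x \<ge> 0" "(LINT x|lborel. \<eta> x) = 1" "\<And>x. \<eta> x \<noteq> 0 \<Longrightarrow> norm x \<le> 1"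
proof -
  define b :: "'a \<Rightarrow> real" where "b x = flat_exp 0 (1 - x \<bullet> x)" for x
  have b0: "b x \<ge> 0" for x by (simp add: b_def flat_exp_def)
  have b1: "norm x \<le> 1" if "b x \<noteq> 0" for x
  proof -
    have "x \<bullet> x < 1" using that by (auto simp: b_def flat_exp_def split: if_splits)
    then show ?thesis by (simp add: norm_eq_sqrt_inner real_le_lsqrt less_imp_le)
  qed
  have b: "b \<in> Cc_inf" using smooth_bumps_Ck[OF smooth_bumps.base[of 0]] compact_supportI[of b 1, OF b1]
    unfolding Cc_inf_def b_def by auto
  have int: "integrable lborel b" by (intro in_L1_integrable Cc1_in_Lp Cc_inf_Cc1 b) auto
  have pos: "(LINT x|lborel. b x) > 0"
  proof (rule integral_pos_on_unit_ball[OF int b0])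
    fix x :: 'a assume "norm x < 1"
    then have "x \<bullet> x < 1" by (simp add: norm_eq_sqrt_inner)
    then show "b x \<noteq> 0" by (simp add: b_def flat_exp_def)
  qed
  show ?thesis
  proof (rule that[of "\<lambda>x. (1 / (LINT x|lborel. b x)) * b x"])
    show "(\<lambda>x. (1 / (LINT x|lborel. b x)) * b x) \<in> Cc_inf" by (rule Cc_inf_cmult[OF b])
    show "(LINT x|lborel. (1 / (LINT x|lborel. b x)) * b x) = 1" using pos by simp
  qed (use pos b0 b1 in auto)
qed

text \<open>The last property is the one the commutator estimate depends on: under scaling the
  derivative gains a factor n + 1, which the weight \<open>norm x\<close> cancels, so the first
  moment of the gradient does not grow with n.\<close>

lemma ex_mollifier:
  obtains \<eta> :: "nat \<Rightarrow> 'a::euclidean_space \<Rightarrow> real" and C where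
    "\<And>n. \<eta> n \<in> Cc_inf" "\<And>n x. \<eta> n x \<ge> 0" "\<And>n. (LINT x|lborel. \<eta> n x) = 1"
    "\<And>n x. \<eta> n x \<noteq> 0 \<Longrightarrow> norm x \<le> inverse (real (Suc n))"
    "\<And>n i. i \<in> Basis \<Longrightarrow> (LINT x|lborel. norm x * \<bar>pd i (\<eta> n) x\<bar>) \<le> C"
proof -
  obtain \<eta> :: "'a \<Rightarrow> real" where \<eta>: "\<eta> \<in> Cc_inf" "\<And>x. \<eta> x \<ge> 0" "(LINT x|lborel. \<eta> x) = 1" "\<And>x. \<eta> x \<noteq> 0 \<Longrightarrow> norm x \<le> 1"
    using ex_standard_mollifier by blast
  define e where "e n x = real (Suc n) ^ DIM('a) * \<eta> (real (Suc n) *\<^sub>R x)" for n x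
  define C where "C = (\<Sum>i\<in>Basis. LINT x|lborel. norm x * \<bar>pd i \<eta> x\<bar>)"
  have Ceta: "Ck (Suc 0) \<eta>" by (rule Cc_infD[OF \<eta>(1)])
  note m = borel_measurable_continuous_onI[OF Ck_continuous[OF Ceta]] borel_measurable_continuous_onI[OF Ck_continuous[OF Ck_SucD(2)[OF Ceta]]]
  have "e n \<in> Cc_inf" for n unfolding e_def by (intro Cc_inf_cmult Cc_inf_scale \<eta>) simp
  moreover have "e n x \<ge> 0" for n x unfolding e_def using \<eta>(2) by simp
  moreover have "(LINT x|lborel. e n x) = 1" for n unfolding e_def using integral_lborel_scale(1)[OF m(1), of "real (Suc n)"] \<eta>(3) by simp
  moreover have "norm x \<le> inverse (real (Suc n))" if "e n x \<noteq> 0" for n x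
  proof -
    have "\<eta> (real (Suc n) *\<^sub>R x) \<noteq> 0" using that by (auto simp: e_def simp del: of_nat_Suc)
    then have "norm (real (Suc n) *\<^sub>R x) \<le> 1" by (rule \<eta>(4))
    then have "real (Suc n) * norm x \<le> 1" by (simp only: norm_scaleR abs_of_nat)
    then show ?thesis by (simp only: inverse_eq_divide) (subst pos_le_divide_eq, simp, simp add: mult.commute)
  qed
  moreover have "(LINT x|lborel. norm x * \<bar>pd i (e n) x\<bar>) \<le> C" if i: "i \<in> Basis" for n i
  proof -
    have "pd i (e n) x = real (Suc n) ^ DIM('a) * (real (Suc n) * pd i \<eta> (real (Suc n) *\<^sub>R x))" for x
    proof -
      have "pd i (e n) x = real (Suc n) ^ DIM('a) * pd i (\<lambda>x. \<eta> (0 + real (Suc n) *\<^sub>R x)) x"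
        using pd_bounded_linear[OF bounded_linear_mult_right[of "real (Suc n) ^ DIM('a)"] Ck_affine[OF Ceta, of 0 "real (Suc n)"], where i=i and x=x]
        unfolding e_def by simp
      then show ?thesis using pd_affine[OF Ceta, where i=i and a=0 and s="real (Suc n)" and x=x] by simp
    qed
    then have "(LINT x|lborel. norm x * \<bar>pd i (e n) x\<bar>) = (LINT x|lborel. real (Suc n) ^ DIM('a) * (norm (real (Suc n) *\<^sub>R x) * \<bar>pd i \<eta> (real (Suc n) *\<^sub>R x)\<bar>))"
      by (intro Bochner_Integration.integral_cong) (auto simp: abs_mult)
    also have "\<dots> = (LINT x|lborel. norm x * \<bar>pd i \<eta> x\<bar>)"
      using m(2)[OF i] by (intro integral_lborel_scale) auto
    also have "\<dots> \<le> C" unfolding C_def using i by (intro member_le_sum) (auto intro!: Bochner_Integration.integral_nonneg)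
    finally show ?thesis .
  qed
  ultimately show ?thesis using that by blast
qed

text \<open>Integration by parts against the coordinate function. These first moments single out the
  divergence in the limit of the commutators.\<close>

lemma moment_pd:
  fixes \<eta> :: "'a::euclidean_space \<Rightarrow> real"
  assumes "\<eta> \<in> Cc1" "j \<in> Basis" "k \<in> Basis"
  shows "(LINT z|lborel. pd j \<eta> z * (z \<bullet> k)) = - (if j = k then LINT z|lborel. \<eta> z else 0)"
  using integration_by_parts[OF Ck_inner[of _ k] assms(1,2)] assms(2,3)
  by (auto simp: pd_inner inner_Basis mult.commute)

text \<open>Cutting f off to a ball makes it integrable, so its mollifications converge almost
  everywhere along a subsequence. At an interior point a sufficiently fine mollifier does not see
  the cut-off, and the mollification is f tested with a reflected bump, hence 0.\<close>

lemma fundamental_lemma: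
  fixes f :: "'a::euclidean_space \<Rightarrow> real"
  assumes f: "locally_integrable f" and z: "\<And>\<phi>. \<phi> \<in> Cc_inf \<Longrightarrow> (LINT x|lborel. \<phi> x * f x) = 0"
  shows "AE x in lborel. f x = 0"
proof -
  obtain \<eta> :: "nat \<Rightarrow> 'a::euclidean_space \<Rightarrow> real" and C where
    \<eta>: "\<And>n. \<eta> n \<in> Cc_inf" "\<And>n x. \<eta> n x \<ge> 0" "\<And>n. (LINT x|lborel. \<eta> n x) = 1"
    "\<And>n x. \<eta> n x \<noteq> 0 \<Longrightarrow> norm x \<le> inverse (real (Suc n))"
    using ex_mollifier by metis
  have *: "AE x in lborel. norm x < real R \<longrightarrow> f x = 0" for R :: nat
  proof -
    define g where "g x = indicator (cball 0 (real R)) x * f x" for x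
    have gi: "integrable lborel g" using f by (auto simp: g_def[abs_def] locally_integrable_def)
    have "Lp_tendsto 1 (\<lambda>n. conv (\<eta> n) g) (\<lambda>x. 1 * g x)"
    proof (rule mollification_tendsto[OF _ \<eta>(2,3,4) inverse_Suc_seq(1) integrable_in_L1[OF gi]])
      show "integrable lborel (\<eta> n)" for n by (intro in_L1_integrable Cc1_in_Lp(1) Cc_inf_Cc1 \<eta>) simp
    qed auto
    then obtain s :: "nat \<Rightarrow> nat" where s: "strict_mono s" "AE x in lborel. (\<lambda>n. conv (\<eta> (s n)) g x) \<longlonglongrightarrow> 1 * g x"
      using Lp_tendsto_AE_subseq[of 1] by blast
    show ?thesis using s(2)
    proof (eventually_elim, intro impI)
      fix x assume lim: "(\<lambda>n. conv (\<eta> (s n)) g x) \<longlonglongrightarrow> 1 * g x" and x: "norm x < real R"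
      have "\<forall>\<^sub>F n in sequentially. inverse (real (Suc (s n))) < real R - norm x"
        using order_tendstoD(2)[OF LIMSEQ_subseq_LIMSEQ[OF inverse_Suc_seq(1) s(1)], of "real R - norm x"] x by (simp add: o_def)
      then have "\<forall>\<^sub>F n in sequentially. conv (\<eta> (s n)) g x = 0"
      proof eventually_elim
        case (elim n)
        have "conv (\<eta> (s n)) g x = (LINT y|lborel. \<eta> (s n) (x - y) * g y)"
        proof (rule conv_alt)
          show "\<eta> (s n) \<in> borel_measurable borel"
            by (intro borel_measurable_continuous_onI Ck_continuous[OF Cc_infD(1)[OF \<eta>(1), where k=0]])
          show "g \<in> borel_measurable borel" using borel_measurable_integrable[OF gi] by simp
        qed
        also have "\<dots> = (LINT y|lborel. \<eta> (s n) (x - y) * f y)"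
        proof (rule Bochner_Integration.integral_cong[OF refl])
          fix y
          have "norm y \<le> norm x + norm (x - y)" by norm
          then show "\<eta> (s n) (x - y) * g y = \<eta> (s n) (x - y) * f y"
            using \<eta>(4)[of "s n" "x - y"] elim by (cases "\<eta> (s n) (x - y) = 0") (auto simp: g_def)
        qed
        also have "\<dots> = 0" by (rule z[OF Cc_inf_reflect[OF \<eta>(1)]])
        finally show ?case .
      qed
      then have "(\<lambda>n. conv (\<eta> (s n)) g x) \<longlonglongrightarrow> 0" by (rule tendsto_eventually)
      with lim have "g x = 0" using LIMSEQ_unique by fastforce
      then show "f x = 0" using x by (simp add: g_def)
    qed
  qed
  have "AE x in lborel. \<forall>R::nat. norm x < real R \<longrightarrow> f x = 0" unfolding AE_all_countable using * by blast
  then show ?thesis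
  proof eventually_elim
    case (elim x)
    obtain R :: nat where "norm x < real R" using reals_Archimedean2 by blast
    with elim show ?case by blast
  qed
qed

section \<open>The Sobolev inequality\<close>

lemma Basis_real3: "(Basis :: (real^3) set) = {axis 1 1, axis 2 1, axis 3 1}"
  by (auto simp: Basis_vec_def UNIV_3)

lemma axis_real3_distinct [simp]: "axis 1 (1::real) \<noteq> (axis 2 1 :: real^3)" "axis 1 (1::real) \<noteq> (axis 3 1 :: real^3)" "axis 2 (1::real) \<noteq> (axis 3 1 :: real^3)"
  by (auto simp: axis_eq_axis)

definition pt3 :: "real \<Rightarrow> real \<Rightarrow> real \<Rightarrow> real^3" where
  "pt3 x y z = x *\<^sub>R axis 1 1 + y *\<^sub>R axis 2 1 + z *\<^sub>R axis 3 1"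

lemma pt3_nth [simp]: "pt3 x y z $ 1 = x" "pt3 x y z $ 2 = y" "pt3 x y z $ 3 = z"
  by (auto simp: pt3_def axis_def)

lemma measurable_pt3 [measurable (raw)]:
  "f \<in> borel_measurable M \<Longrightarrow> g \<in> borel_measurable M \<Longrightarrow> h \<in> borel_measurable M \<Longrightarrow>
    (\<lambda>p. pt3 (f p) (g p) (h p)) \<in> borel_measurable M"
  unfolding pt3_def by (intro borel_measurable_add borel_measurable_scaleR borel_measurable_const)

text \<open>Lebesgue measure is determined by its values on boxes, and the preimage of a box is a
  product of intervals. This allows iterated integrals in the three coordinates, as the
  Loomis-Whitney argument requires.\<close>

lemma lborel_real3:
  "distr (lborel \<Otimes>\<^sub>M (lborel \<Otimes>\<^sub>M lborel)) borel (\<lambda>(x,y,z). pt3 x y z) = (lborel :: (real^3) measure)"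
proof (rule lborel_eqI[symmetric])
  have [measurable]: "(\<lambda>(x,y,z). pt3 x y z) \<in> measurable (lborel \<Otimes>\<^sub>M (lborel \<Otimes>\<^sub>M lborel)) borel"
    unfolding pt3_def by measurable
  fix l u :: "real^3" assume le: "\<And>b. b \<in> Basis \<Longrightarrow> l \<bullet> b \<le> u \<bullet> b"
  have le': "l $ 1 \<le> u $ 1" "l $ 2 \<le> u $ 2" "l $ 3 \<le> u $ 3"
    using le[of "axis 1 1"] le[of "axis 2 1"] le[of "axis 3 1"] by (auto simp: inner_axis)
  have "emeasure (distr (lborel \<Otimes>\<^sub>M (lborel \<Otimes>\<^sub>M lborel)) borel (\<lambda>(x,y,z). pt3 x y z)) (box l u)
    = emeasure (lborel \<Otimes>\<^sub>M (lborel \<Otimes>\<^sub>M lborel)) ((\<lambda>(x,y,z). pt3 x y z) -` box l u \<inter> space (lborel \<Otimes>\<^sub>M (lborel \<Otimes>\<^sub>M lborel)))"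
    by (rule emeasure_distr) auto
  also have "(\<lambda>(x,y,z). pt3 x y z) -` box l u \<inter> space (lborel \<Otimes>\<^sub>M (lborel \<Otimes>\<^sub>M lborel)) = {l$1<..<u$1} \<times> ({l$2<..<u$2} \<times> {l$3<..<u$3})"
    by (auto simp: mem_box Basis_real3 inner_axis space_pair_measure)
  also have "emeasure (lborel \<Otimes>\<^sub>M (lborel \<Otimes>\<^sub>M lborel)) \<dots> = ennreal (u$1 - l$1) * (ennreal (u$2 - l$2) * ennreal (u$3 - l$3))"
    using le' by (simp add: lborel_pair.emeasure_pair_measure_Times lborel.emeasure_pair_measure_Times sigma_finite_measure.emeasure_pair_measure_Times[OF lborel_pair.sigma_finite_measure_axioms])
  also have "\<dots> = (\<Prod>b\<in>Basis. (u - l) \<bullet> b)"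
    using le' by (simp add: Basis_real3 inner_axis ennreal_mult mult.assoc)
  finally show "emeasure (distr (lborel \<Otimes>\<^sub>M (lborel \<Otimes>\<^sub>M lborel)) borel (\<lambda>(x,y,z). pt3 x y z)) (box l u) = (\<Prod>b\<in>Basis. (u - l) \<bullet> b)" .
qed simp

lemma nn_integral_real3:
  fixes f :: "real^3 \<Rightarrow> ennreal"
  assumes [measurable]: "f \<in> borel_measurable borel"
  shows "(\<integral>\<^sup>+p. f p \<partial>lborel) = (\<integral>\<^sup>+x. \<integral>\<^sup>+y. \<integral>\<^sup>+z. f (pt3 x y z) \<partial>lborel \<partial>lborel \<partial>lborel)"
proof -
  have [measurable]: "(\<lambda>(x,y,z). pt3 x y z) \<in> measurable (lborel \<Otimes>\<^sub>M (lborel \<Otimes>\<^sub>M lborel)) borel"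
    unfolding pt3_def by measurable
  have "(\<integral>\<^sup>+p. f p \<partial>lborel) = (\<integral>\<^sup>+p. f (case p of (x,y,z) \<Rightarrow> pt3 x y z) \<partial>(lborel \<Otimes>\<^sub>M (lborel \<Otimes>\<^sub>M lborel)))"
    unfolding lborel_real3[symmetric] by (subst nn_integral_distr) auto
  also have "\<dots> = (\<integral>\<^sup>+x. \<integral>\<^sup>+p. f (case p of (y,z) \<Rightarrow> pt3 x y z) \<partial>(lborel \<Otimes>\<^sub>M lborel) \<partial>lborel)"
  proof -
    have "(\<lambda>p. f (case p of (x,y,z) \<Rightarrow> pt3 x y z)) \<in> borel_measurable (lborel \<Otimes>\<^sub>M (lborel \<Otimes>\<^sub>M lborel))"
      by (rule measurable_compose[OF _ assms]) measurable
    from sigma_finite_measure.nn_integral_fst[OF lborel_pair.sigma_finite_measure_axioms this]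
    show ?thesis by simp
  qed
  also have "\<dots> = (\<integral>\<^sup>+x. \<integral>\<^sup>+y. \<integral>\<^sup>+z. f (pt3 x y z) \<partial>lborel \<partial>lborel \<partial>lborel)"
  proof (rule nn_integral_cong)
    fix x
    have "(\<lambda>p. f (case p of (y,z) \<Rightarrow> pt3 x y z)) \<in> borel_measurable (lborel \<Otimes>\<^sub>M lborel)"
      unfolding pt3_def by measurable
    from lborel.nn_integral_fst[OF this]
    show "(\<integral>\<^sup>+p. f (case p of (y,z) \<Rightarrow> pt3 x y z) \<partial>(lborel \<Otimes>\<^sub>M lborel)) = (\<integral>\<^sup>+y. \<integral>\<^sup>+z. f (pt3 x y z) \<partial>lborel \<partial>lborel)"
      by simp
  qed
  finally show ?thesis .
qed

text \<open>Integrating g h over x first leaves a function k of (y, z). Cauchy-Schwarz in (y, z)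
  separates f from k, Cauchy-Schwarz in x separates g from h inside k, and the remaining double
  integral factorises. Values in \<open>ennreal\<close> avoid integrability conditions.\<close>

lemma Loomis_Whitney:
  fixes f g h :: "real \<Rightarrow> real \<Rightarrow> ennreal"
  assumes [measurable]: "(\<lambda>(y,z). f y z) \<in> borel_measurable (borel \<Otimes>\<^sub>M borel)"
    "(\<lambda>(x,z). g x z) \<in> borel_measurable (borel \<Otimes>\<^sub>M borel)" "(\<lambda>(x,y). h x y) \<in> borel_measurable (borel \<Otimes>\<^sub>M borel)"
  shows "(\<integral>\<^sup>+x. \<integral>\<^sup>+y. \<integral>\<^sup>+z. f y z * g x z * h x y \<partial>lborel \<partial>lborel \<partial>lborel)\<^sup>2
     \<le> (\<integral>\<^sup>+y. \<integral>\<^sup>+z. (f y z)\<^sup>2 \<partial>lborel \<partial>lborel) * (\<integral>\<^sup>+x. \<integral>\<^sup>+z. (g x z)\<^sup>2 \<partial>lborel \<partial>lborel) * (\<integral>\<^sup>+x. \<integral>\<^sup>+y. (h x y)\<^sup>2 \<partial>lborel \<partial>lborel)"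
proof -
  define k where "k y z = (\<integral>\<^sup>+x. g x z * h x y \<partial>lborel)" for y z
  have [measurable]: "(\<lambda>(y,z). k y z) \<in> borel_measurable (borel \<Otimes>\<^sub>M borel)" unfolding k_def by measurable
  have "(\<integral>\<^sup>+x. \<integral>\<^sup>+y. \<integral>\<^sup>+z. f y z * g x z * h x y \<partial>lborel \<partial>lborel \<partial>lborel)
      = (\<integral>\<^sup>+y. \<integral>\<^sup>+x. \<integral>\<^sup>+z. f y z * g x z * h x y \<partial>lborel \<partial>lborel \<partial>lborel)"
    by (rule lborel_pair.Fubini') measurable
  also have "\<dots> = (\<integral>\<^sup>+y. \<integral>\<^sup>+z. \<integral>\<^sup>+x. f y z * g x z * h x y \<partial>lborel \<partial>lborel \<partial>lborel)"
    by (rule nn_integral_cong, rule lborel_pair.Fubini') measurable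
  also have "\<dots> = (\<integral>\<^sup>+y. \<integral>\<^sup>+z. f y z * k y z \<partial>lborel \<partial>lborel)"
    unfolding k_def by (intro nn_integral_cong) (simp add: nn_integral_cmult[symmetric] mult.assoc)
  also have "\<dots> = (\<integral>\<^sup>+p. (case p of (y,z) \<Rightarrow> f y z) * (case p of (y,z) \<Rightarrow> k y z) \<partial>(lborel \<Otimes>\<^sub>M lborel))"
    by (subst lborel.nn_integral_fst[symmetric]) auto
  finally have "(\<integral>\<^sup>+x. \<integral>\<^sup>+y. \<integral>\<^sup>+z. f y z * g x z * h x y \<partial>lborel \<partial>lborel \<partial>lborel)\<^sup>2
     \<le> (\<integral>\<^sup>+p. (case p of (y,z) \<Rightarrow> f y z)\<^sup>2 \<partial>(lborel \<Otimes>\<^sub>M lborel)) * (\<integral>\<^sup>+p. (case p of (y,z) \<Rightarrow> k y z)\<^sup>2 \<partial>(lborel \<Otimes>\<^sub>M lborel))"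
    using Cauchy_Schwarz_nn_integral[of "\<lambda>p. case p of (y,z) \<Rightarrow> f y z" "lborel \<Otimes>\<^sub>M lborel" "\<lambda>p. case p of (y,z) \<Rightarrow> k y z"] by simp
  also have "(\<integral>\<^sup>+p. (case p of (y,z) \<Rightarrow> f y z)\<^sup>2 \<partial>(lborel \<Otimes>\<^sub>M lborel)) = (\<integral>\<^sup>+y. \<integral>\<^sup>+z. (f y z)\<^sup>2 \<partial>lborel \<partial>lborel)"
    by (subst lborel.nn_integral_fst[symmetric]) auto
  also have "(\<integral>\<^sup>+p. (case p of (y,z) \<Rightarrow> k y z)\<^sup>2 \<partial>(lborel \<Otimes>\<^sub>M lborel)) = (\<integral>\<^sup>+y. \<integral>\<^sup>+z. (k y z)\<^sup>2 \<partial>lborel \<partial>lborel)"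
    by (subst lborel.nn_integral_fst[symmetric]) auto
  also have "(\<integral>\<^sup>+y. \<integral>\<^sup>+z. (k y z)\<^sup>2 \<partial>lborel \<partial>lborel) \<le> (\<integral>\<^sup>+y. \<integral>\<^sup>+z. (\<integral>\<^sup>+x. (g x z)\<^sup>2 \<partial>lborel) * (\<integral>\<^sup>+x. (h x y)\<^sup>2 \<partial>lborel) \<partial>lborel \<partial>lborel)"
    unfolding k_def by (intro nn_integral_mono Cauchy_Schwarz_nn_integral) measurable
  also have "\<dots> = (\<integral>\<^sup>+z. \<integral>\<^sup>+x. (g x z)\<^sup>2 \<partial>lborel \<partial>lborel) * (\<integral>\<^sup>+y. \<integral>\<^sup>+x. (h x y)\<^sup>2 \<partial>lborel \<partial>lborel)"
    by (simp add: nn_integral_multc nn_integral_cmult)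
  also have "(\<integral>\<^sup>+z. \<integral>\<^sup>+x. (g x z)\<^sup>2 \<partial>lborel \<partial>lborel) = (\<integral>\<^sup>+x. \<integral>\<^sup>+z. (g x z)\<^sup>2 \<partial>lborel \<partial>lborel)"
    by (rule lborel_pair.Fubini') measurable
  also have "(\<integral>\<^sup>+y. \<integral>\<^sup>+x. (h x y)\<^sup>2 \<partial>lborel \<partial>lborel) = (\<integral>\<^sup>+x. \<integral>\<^sup>+y. (h x y)\<^sup>2 \<partial>lborel \<partial>lborel)"
    by (rule lborel_pair.Fubini') measurable
  finally show ?thesis by (simp add: mult.assoc mult_left_mono)
qed

lemma has_derivative_line:
  fixes f :: "'a::euclidean_space \<Rightarrow> real"
  assumes "f differentiable (at (a + s *\<^sub>R v))"
  shows "((\<lambda>s. f (a + s *\<^sub>R v)) has_field_derivative frechet_derivative f (at (a + s *\<^sub>R v)) v) (at s)"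
proof -
  have "((\<lambda>t. a + t *\<^sub>R v) has_derivative (\<lambda>t. t *\<^sub>R v)) (at s)" by (auto intro!: derivative_eq_intros)
  from diff_chain_at[OF this, of f "frechet_derivative f (at (a + s *\<^sub>R v))"] assms
  have "((\<lambda>s. f (a + s *\<^sub>R v)) has_derivative (\<lambda>t. frechet_derivative f (at (a + s *\<^sub>R v)) (t *\<^sub>R v))) (at s)"
    by (auto simp: o_def frechet_derivative_works)
  moreover have "frechet_derivative f (at (a + s *\<^sub>R v)) (t *\<^sub>R v) = frechet_derivative f (at (a + s *\<^sub>R v)) v * t" for t
    using linear_cmul[OF linear_frechet_derivative[OF assms]] by simp
  ultimately show ?thesis unfolding has_field_derivative_def by simp
qed

text \<open>The fundamental theorem of calculus for v^4, starting at a point -T beyond the support.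
  The fourth power is chosen so that its derivative 4 v^3 dv is bounded in L^1 by the L^6 norm of v
  and the L^2 norm of the gradient.\<close>

lemma bound_by_line_integral:
  fixes v :: "'a::euclidean_space \<Rightarrow> real"
  assumes v: "v \<in> Cc1" and i: "i \<in> Basis"
  shows "integrable lborel (\<lambda>s. \<bar>4 * v (a + s *\<^sub>R i) ^ 3 * pd i v (a + s *\<^sub>R i)\<bar>)"
    "v (a + t *\<^sub>R i) ^ 4 \<le> (LINT s|lborel. \<bar>4 * v (a + s *\<^sub>R i) ^ 3 * pd i v (a + s *\<^sub>R i)\<bar>)"
proof -
  note C = Cc1D[OF v]
  define g where "g s = 4 * v (a + s *\<^sub>R i) ^ 3 * pd i v (a + s *\<^sub>R i)" for s
  obtain R where R: "R > 0" "\<And>x. v x \<noteq> 0 \<Longrightarrow> norm x \<le> R" using compact_supportE[OF C(2)] by metis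
  have line: "continuous_on UNIV (\<lambda>s::real. a + s *\<^sub>R i)" by (intro continuous_intros)
  have cg: "continuous_on UNIV g" unfolding g_def
    by (intro continuous_intros continuous_on_compose2[OF Ck_continuous[OF C(1)] line] continuous_on_compose2[OF Ck_continuous[OF Ck_SucD(2)[OF C(1) i]] line]) auto
  have supp: "\<bar>s\<bar> \<le> R + norm a" if "v (a + s *\<^sub>R i) \<noteq> 0" for s
  proof -
    have "norm (s *\<^sub>R i) \<le> norm (a + s *\<^sub>R i) + norm a"
      using norm_triangle_ineq4[of "a + s *\<^sub>R i" a] by simp
    then show ?thesis using R(2)[OF that] i by simp
  qed
  have csg: "compact_support g" by (rule compact_supportI[of g "R + norm a"]) (use supp in \<open>auto simp: g_def\<close>)
  have int: "integrable lborel g" by (intro in_L1_integrable in_Lp_Cc cg csg) simp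
  then show "integrable lborel (\<lambda>s. \<bar>4 * v (a + s *\<^sub>R i) ^ 3 * pd i v (a + s *\<^sub>R i)\<bar>)"
    unfolding g_def by (rule Bochner_Integration.integrable_abs)
  define T where "T = R + norm a + \<bar>t\<bar> + 1"
  have vT: "v (a + (- T) *\<^sub>R i) = 0"
  proof (rule ccontr)
    assume "v (a + (- T) *\<^sub>R i) \<noteq> 0" from supp[OF this] show False using R(1) by (simp add: T_def)
  qed
  have "(LINT s|lborel. g s * indicator {-T..t} s) = v (a + t *\<^sub>R i) ^ 4 - v (a + (- T) *\<^sub>R i) ^ 4"
  proof (rule integral_FTC_Icc_real)
    show "- T \<le> t" using R(1) norm_ge_zero[of a] unfolding T_def by linarith
    fix s
    show "((\<lambda>s. v (a + s *\<^sub>R i) ^ 4) has_field_derivative g s) (at s)"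
      unfolding g_def by (rule DERIV_cong[OF DERIV_power[OF has_derivative_line[OF Ck_SucD(3)[OF C(1)]], where n=4]]) simp
    show "isCont g s" using cg by (simp add: continuous_on_eq_continuous_at)
  qed
  then have "v (a + t *\<^sub>R i) ^ 4 = (LINT s|lborel. g s * indicator {-T..t} s)" using vT by simp
  also have "\<dots> \<le> (LINT s|lborel. \<bar>g s\<bar>)"
  proof (rule integral_mono)
    show "integrable lborel (\<lambda>s. g s * indicator {- T..t} s)"
      by (rule Bochner_Integration.integrable_bound[OF int]) (use borel_measurable_integrable[OF int] in \<open>auto simp: indicator_def\<close>)
  qed (use int in \<open>auto simp: indicator_def\<close>)
  finally show "v (a + t *\<^sub>R i) ^ 4 \<le> (LINT s|lborel. \<bar>4 * v (a + s *\<^sub>R i) ^ 3 * pd i v (a + s *\<^sub>R i)\<bar>)"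
    by (simp add: g_def)
qed

text \<open>Each of three copies of v^2 is bounded by the square root of a line integral, a function
  missing one coordinate. With N the L^6 norm, the Loomis-Whitney inequality yields N^12 <= 64 N^9
  d, where 64 = 4^3 comes from the three derivatives 4 v^3 dv. As N is finite, N^9 may be
  cancelled.\<close>

lemma Sobolev_product:
  fixes v :: "real^3 \<Rightarrow> real"
  assumes v: "v \<in> Cc1"
  shows "Lp_norm 6 v ^ 3 \<le> 64 * (Lp_norm 2 (pd (axis 1 1) v) * Lp_norm 2 (pd (axis 2 1) v) * Lp_norm 2 (pd (axis 3 1) v))"
proof -
  note C = Cc1D[OF v]
  define w where "w i p = \<bar>4 * v p ^ 3 * pd i v p\<bar>" for i p
  have ax: "axis k 1 \<in> (Basis :: (real^3) set)" for k by simp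
  have [measurable]: "v \<in> borel_measurable borel" by (intro borel_measurable_continuous_onI Ck_continuous[OF C(1)])
  have pdm: "i \<in> Basis \<Longrightarrow> pd i v \<in> borel_measurable borel" for i by (intro borel_measurable_continuous_onI Ck_continuous[OF Ck_SucD(2)[OF C(1)]])
  have wm: "i \<in> Basis \<Longrightarrow> w i \<in> borel_measurable borel" for i unfolding w_def using pdm by measurable
  note [measurable] = wm[OF ax]
  define f where "f y z = sqrt (LINT x|lborel. w (axis 1 1) (pt3 x y z))" for y z
  define g where "g x z = sqrt (LINT y|lborel. w (axis 2 1) (pt3 x y z))" for x z
  define h where "h x y = sqrt (LINT z|lborel. w (axis 3 1) (pt3 x y z))" for x y
  have w0: "w i p \<ge> 0" for i p by (simp add: w_def)
  have lines: "pt3 x y z = pt3 0 y z + x *\<^sub>R axis 1 1" "pt3 x y z = pt3 x 0 z + y *\<^sub>R axis 2 1" "pt3 x y z = pt3 x y 0 + z *\<^sub>R axis 3 1" for x y z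
    by (simp_all add: pt3_def)
  have I: "integrable lborel (\<lambda>x. w (axis 1 1) (pt3 x y z))" "integrable lborel (\<lambda>y. w (axis 2 1) (pt3 x y z))" "integrable lborel (\<lambda>z. w (axis 3 1) (pt3 x y z))" for x y z
    unfolding w_def using bound_by_line_integral(1)[OF v ax, of "pt3 0 y z" 1] bound_by_line_integral(1)[OF v ax, of "pt3 x 0 z" 2] bound_by_line_integral(1)[OF v ax, of "pt3 x y 0" 3]
    by (simp_all flip: lines)
  have b: "v (pt3 x y z) ^ 4 \<le> (f y z)\<^sup>2" "v (pt3 x y z) ^ 4 \<le> (g x z)\<^sup>2" "v (pt3 x y z) ^ 4 \<le> (h x y)\<^sup>2" for x y z
    unfolding f_def g_def h_def w_def using bound_by_line_integral(2)[OF v ax, of "pt3 0 y z" x 1] bound_by_line_integral(2)[OF v ax, of "pt3 x 0 z" y 2] bound_by_line_integral(2)[OF v ax, of "pt3 x y 0" z 3]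
    by (simp_all flip: lines)
  have nn: "f y z \<ge> 0" "g x z \<ge> 0" "h x y \<ge> 0" for x y z
    unfolding f_def g_def h_def using w0 by simp_all
  have pw: "v (pt3 x y z) ^ 6 \<le> f y z * g x z * h x y" for x y z
  proof -
    have s: "(v (pt3 x y z))\<^sup>2 \<le> a" if "v (pt3 x y z) ^ 4 \<le> a\<^sup>2" "a \<ge> 0" for a
      using that power2_le_imp_le[of "(v (pt3 x y z))\<^sup>2" a] by simp
    have "(v (pt3 x y z))\<^sup>2 * (v (pt3 x y z))\<^sup>2 * (v (pt3 x y z))\<^sup>2 \<le> f y z * g x z * h x y"
      using s b nn by (intro mult_mono) auto
    then show ?thesis by (simp add: power_add[symmetric] flip: power_mult)
  qed
  define N where "N = Lp_norm 6 v"
  have v6: "in_Lp 6 v" and v2: "i \<in> Basis \<Longrightarrow> in_Lp 2 (pd i v)" for i using Cc1_in_Lp[OF v] by auto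
  have N6: "(\<integral>\<^sup>+p. ennreal (v p ^ 6) \<partial>lborel) = ennreal (N ^ 6)"
  proof -
    have e: "\<bar>v p\<bar> powr 6 = v p ^ 6" for p by simp
    have "N powr 6 = (LINT p|lborel. v p ^ 6)" unfolding N_def using Lp_norm_powr[of 6 v] by (simp add: e)
    then have "N ^ 6 = (LINT p|lborel. v p ^ 6)" by (simp add: N_def)
    moreover have "integrable lborel (\<lambda>p. v p ^ 6)" using in_Lp_integrable[OF v6] by (simp add: e)
    ultimately show ?thesis by (simp add: nn_integral_eq_integral)
  qed
  have wi: "(\<integral>\<^sup>+p. ennreal (w i p) \<partial>lborel) \<le> ennreal (4 * (N ^ 3 * Lp_norm 2 (pd i v)))" if i: "i \<in> Basis" for i
  proof -
    have 1: "in_Lp (6/3) (\<lambda>p. \<bar>v p\<bar> powr 3)" by (rule in_Lp_powr[OF v6]) simp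
    have 2: "Lp_norm (6/3) (\<lambda>p. \<bar>v p\<bar> powr 3) = N ^ 3" unfolding N_def by (subst Lp_norm_powr_fun) auto
    have 3: "\<bar>v p\<bar> powr 3 = \<bar>v p\<bar> ^ 3" for p by simp
    have in2: "in_Lp 2 (\<lambda>p. \<bar>v p\<bar> ^ 3)" and n2: "Lp_norm 2 (\<lambda>p. \<bar>v p\<bar> ^ 3) = N ^ 3" using 1 2 unfolding 3 by simp_all
    have H: "integrable lborel (\<lambda>p. \<bar>v p\<bar> ^ 3 * \<bar>pd i v p\<bar>)" "\<bar>LINT p|lborel. \<bar>v p\<bar> ^ 3 * \<bar>pd i v p\<bar>\<bar> \<le> N ^ 3 * Lp_norm 2 (pd i v)"
      using Holder_integral[OF in2 in_Lp_abs[OF v2[OF i]]] by (simp_all add: n2 Lp_norm_abs)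
    have we: "w i p = 4 * (\<bar>v p\<bar> ^ 3 * \<bar>pd i v p\<bar>)" for p by (simp add: w_def abs_mult power_abs)
    have "(\<integral>\<^sup>+p. ennreal (w i p) \<partial>lborel) = ennreal (LINT p|lborel. w i p)"
      unfolding we using H(1) by (intro nn_integral_eq_integral) auto
    also have "(LINT p|lborel. w i p) \<le> 4 * (N ^ 3 * Lp_norm 2 (pd i v))" unfolding we using H(2) by simp
    finally show ?thesis by (simp add: ennreal_leI)
  qed
  have F: "(\<integral>\<^sup>+y. \<integral>\<^sup>+z. (ennreal (f y z))\<^sup>2 \<partial>lborel \<partial>lborel) = (\<integral>\<^sup>+p. ennreal (w (axis 1 1) p) \<partial>lborel)"
  proof -
    have "(ennreal (f y z))\<^sup>2 = (\<integral>\<^sup>+x. ennreal (w (axis 1 1) (pt3 x y z)) \<partial>lborel)" for y z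
      using I(1)[of y z] w0 nn(1) by (subst nn_integral_eq_integral) (auto simp: f_def ennreal_power)
    then have "(\<integral>\<^sup>+y. \<integral>\<^sup>+z. (ennreal (f y z))\<^sup>2 \<partial>lborel \<partial>lborel) = (\<integral>\<^sup>+y. \<integral>\<^sup>+z. \<integral>\<^sup>+x. ennreal (w (axis 1 1) (pt3 x y z)) \<partial>lborel \<partial>lborel \<partial>lborel)" by simp
    also have "\<dots> = (\<integral>\<^sup>+y. \<integral>\<^sup>+x. \<integral>\<^sup>+z. ennreal (w (axis 1 1) (pt3 x y z)) \<partial>lborel \<partial>lborel \<partial>lborel)"
      by (rule nn_integral_cong, rule lborel_pair.Fubini') measurable
    also have "\<dots> = (\<integral>\<^sup>+x. \<integral>\<^sup>+y. \<integral>\<^sup>+z. ennreal (w (axis 1 1) (pt3 x y z)) \<partial>lborel \<partial>lborel \<partial>lborel)"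
      by (rule lborel_pair.Fubini') measurable
    also have "\<dots> = (\<integral>\<^sup>+p. ennreal (w (axis 1 1) p) \<partial>lborel)" by (rule nn_integral_real3[symmetric]) measurable
    finally show ?thesis .
  qed
  have G: "(\<integral>\<^sup>+x. \<integral>\<^sup>+z. (ennreal (g x z))\<^sup>2 \<partial>lborel \<partial>lborel) = (\<integral>\<^sup>+p. ennreal (w (axis 2 1) p) \<partial>lborel)"
  proof -
    have "(ennreal (g x z))\<^sup>2 = (\<integral>\<^sup>+y. ennreal (w (axis 2 1) (pt3 x y z)) \<partial>lborel)" for x z
      using I(2)[of x z] w0 nn(2) by (subst nn_integral_eq_integral) (auto simp: g_def ennreal_power)
    then have "(\<integral>\<^sup>+x. \<integral>\<^sup>+z. (ennreal (g x z))\<^sup>2 \<partial>lborel \<partial>lborel) = (\<integral>\<^sup>+x. \<integral>\<^sup>+z. \<integral>\<^sup>+y. ennreal (w (axis 2 1) (pt3 x y z)) \<partial>lborel \<partial>lborel \<partial>lborel)" by simp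
    also have "\<dots> = (\<integral>\<^sup>+x. \<integral>\<^sup>+y. \<integral>\<^sup>+z. ennreal (w (axis 2 1) (pt3 x y z)) \<partial>lborel \<partial>lborel \<partial>lborel)"
      by (rule nn_integral_cong, rule lborel_pair.Fubini') measurable
    also have "\<dots> = (\<integral>\<^sup>+p. ennreal (w (axis 2 1) p) \<partial>lborel)" by (rule nn_integral_real3[symmetric]) measurable
    finally show ?thesis .
  qed
  have H: "(\<integral>\<^sup>+x. \<integral>\<^sup>+y. (ennreal (h x y))\<^sup>2 \<partial>lborel \<partial>lborel) = (\<integral>\<^sup>+p. ennreal (w (axis 3 1) p) \<partial>lborel)"
  proof -
    have "(ennreal (h x y))\<^sup>2 = (\<integral>\<^sup>+z. ennreal (w (axis 3 1) (pt3 x y z)) \<partial>lborel)" for x y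
      using I(3)[of x y] w0 nn(3) by (subst nn_integral_eq_integral) (auto simp: h_def ennreal_power)
    then have "(\<integral>\<^sup>+x. \<integral>\<^sup>+y. (ennreal (h x y))\<^sup>2 \<partial>lborel \<partial>lborel) = (\<integral>\<^sup>+x. \<integral>\<^sup>+y. \<integral>\<^sup>+z. ennreal (w (axis 3 1) (pt3 x y z)) \<partial>lborel \<partial>lborel \<partial>lborel)" by simp
    also have "\<dots> = (\<integral>\<^sup>+p. ennreal (w (axis 3 1) p) \<partial>lborel)" by (rule nn_integral_real3[symmetric]) measurable
    finally show ?thesis .
  qed
  define d where "d = Lp_norm 2 (pd (axis 1 1) v) * Lp_norm 2 (pd (axis 2 1) v) * Lp_norm 2 (pd (axis 3 1) v)"
  have N0: "N \<ge> 0" and d0: "d \<ge> 0" by (simp_all add: N_def d_def)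
  have "ennreal (N ^ 6) = (\<integral>\<^sup>+x. \<integral>\<^sup>+y. \<integral>\<^sup>+z. ennreal (v (pt3 x y z) ^ 6) \<partial>lborel \<partial>lborel \<partial>lborel)"
    unfolding N6[symmetric] by (rule nn_integral_real3) measurable
  also have "\<dots> \<le> (\<integral>\<^sup>+x. \<integral>\<^sup>+y. \<integral>\<^sup>+z. ennreal (f y z) * ennreal (g x z) * ennreal (h x y) \<partial>lborel \<partial>lborel \<partial>lborel)"
    using pw nn by (intro nn_integral_mono) (auto simp: ennreal_mult[symmetric] intro!: ennreal_leI)
  finally have "(ennreal (N ^ 6))\<^sup>2 \<le> (\<integral>\<^sup>+x. \<integral>\<^sup>+y. \<integral>\<^sup>+z. ennreal (f y z) * ennreal (g x z) * ennreal (h x y) \<partial>lborel \<partial>lborel \<partial>lborel)\<^sup>2"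
    by (rule power_mono) simp
  also have "\<dots> \<le> (\<integral>\<^sup>+y. \<integral>\<^sup>+z. (ennreal (f y z))\<^sup>2 \<partial>lborel \<partial>lborel) * (\<integral>\<^sup>+x. \<integral>\<^sup>+z. (ennreal (g x z))\<^sup>2 \<partial>lborel \<partial>lborel) * (\<integral>\<^sup>+x. \<integral>\<^sup>+y. (ennreal (h x y))\<^sup>2 \<partial>lborel \<partial>lborel)"
  proof (rule Loomis_Whitney)
    show "(\<lambda>(y, z). ennreal (f y z)) \<in> borel_measurable (borel \<Otimes>\<^sub>M borel)" unfolding f_def by measurable
    show "(\<lambda>(y, z). ennreal (g y z)) \<in> borel_measurable (borel \<Otimes>\<^sub>M borel)" unfolding g_def by measurable
    show "(\<lambda>(y, z). ennreal (h y z)) \<in> borel_measurable (borel \<Otimes>\<^sub>M borel)" unfolding h_def by measurable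
  qed
  also have "\<dots> \<le> ennreal (4 * (N ^ 3 * Lp_norm 2 (pd (axis 1 1) v))) * ennreal (4 * (N ^ 3 * Lp_norm 2 (pd (axis 2 1) v))) * ennreal (4 * (N ^ 3 * Lp_norm 2 (pd (axis 3 1) v)))"
    unfolding F G H by (intro mult_mono wi ax) auto
  also have "\<dots> = ennreal (64 * N ^ 9 * d)"
    using N0 by (simp add: ennreal_mult[symmetric] d_def mult_ac power_add[symmetric])
  finally have "ennreal (N ^ 12) \<le> ennreal (64 * N ^ 9 * d)"
    using N0 by (simp add: ennreal_power flip: power_mult)
  then have le: "N ^ 12 \<le> 64 * N ^ 9 * d" using N0 d0 by (subst (asm) ennreal_le_iff) auto
  have "N ^ 3 \<le> 64 * d"
  proof (cases "N = 0")
    case False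
    then have "N ^ 9 > 0" using N0 by simp
    have "N ^ 9 * N ^ 3 = N ^ 12" by (simp flip: power_add)
    then have "N ^ 9 * N ^ 3 \<le> N ^ 9 * (64 * d)" using le by (simp only: mult.assoc mult.left_commute)
    then show ?thesis using \<open>N ^ 9 > 0\<close> by (rule mult_left_le_imp_le)
  qed (use d0 in simp)
  then show ?thesis by (simp add: N_def d_def)
qed

lemma Sobolev_inequality:
  fixes v :: "real^3 \<Rightarrow> real"
  assumes v: "v \<in> Cc1"
  shows "Lp_norm 6 v \<le> 4 * (\<Sum>i\<in>Basis. Lp_norm 2 (pd i v))"
proof -
  define S where "S = (\<Sum>i\<in>Basis. Lp_norm 2 (pd i v))"
  have le: "Lp_norm 2 (pd i v) \<le> S" if "i \<in> Basis" for i unfolding S_def using that by (intro member_le_sum) auto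
  have S0: "S \<ge> 0" unfolding S_def by (intro sum_nonneg) auto
  have "Lp_norm 6 v ^ 3 \<le> 64 * (S * S * S)"
    using le S0 by (intro order_trans[OF Sobolev_product[OF v]] mult_left_mono mult_mono) auto
  also have "\<dots> = (4 * S) ^ 3" by (simp add: power3_eq_cube)
  finally show ?thesis using S0 power_mono_iff[of "Lp_norm 6 v" "4 * S" 3] by (simp add: S_def)
qed

section \<open>Square integrability from a gradient bound\<close>

lemma DERIV_If_glue:
  fixes f g :: "real \<Rightarrow> real"
  assumes f: "\<And>s. s \<le> a \<Longrightarrow> (f has_field_derivative f' s) (at s)" and g: "\<And>s. s \<ge> a \<Longrightarrow> (g has_field_derivative g' s) (at s)"
    and eq: "f a = g a" "f' a = g' a"
  shows "((\<lambda>s. if s \<le> a then f s else g s) has_field_derivative (if s \<le> a then f' s else g' s)) (at s)"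
proof -
  consider "s < a" | "s > a" | "s = a" by linarith
  then show ?thesis
  proof cases
    case 1
    then have "((\<lambda>s. if s \<le> a then f s else g s) has_field_derivative f' s) (at s)"
      by (intro has_field_derivative_transform_within_open[OF f, of s "{..<a}"]) auto
    then show ?thesis using 1 by simp
  next
    case 2
    then have "((\<lambda>s. if s \<le> a then f s else g s) has_field_derivative g' s) (at s)"
      by (intro has_field_derivative_transform_within_open[OF g, of s "{a<..}"]) auto
    then show ?thesis using 2 by simp
  next
    case 3
    let ?h = "\<lambda>s. if s \<le> a then f s else g s"
    have "(?h has_field_derivative f' a) (at a within {..a})"
      by (rule has_field_derivative_transform_within[OF has_field_derivative_at_within[OF f] zero_less_one]) auto
    moreover have "(?h has_field_derivative f' a) (at a within {a..})"
      unfolding eq(2)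
      by (rule has_field_derivative_transform_within[OF has_field_derivative_at_within[OF g] zero_less_one]) (use eq in auto)
    ultimately have "(?h has_field_derivative f' a) (at a within ({..a} \<union> {a..}))"
      unfolding has_field_derivative_iff by (simp add: Lim_within_Un)
    moreover have "{..a} \<union> {a..} = (UNIV::real set)" by auto
    ultimately show ?thesis using 3 by simp
  qed
qed

text \<open>The profile of the Newtonian potential \<open>s \<mapsto> s\<^sup>-\<^sup>1\<^sup>/\<^sup>2\<close> as a function of \<open>s = |x|\<^sup>2\<close>, continued inside
  the unit ball by its second-order Taylor polynomial at \<open>s = 1\<close>, so that the glued function is \<open>C\<^sup>2\<close>.\<close>

definition newton_profile :: "real \<Rightarrow> real" where
  "newton_profile s = (if s \<le> 1 then 1 + (1 - s) / 2 + 3 / 8 * (1 - s)\<^sup>2 else s powr (- 1 / 2))"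

definition newton_profile1 :: "real \<Rightarrow> real" where
  "newton_profile1 s = (if s \<le> 1 then - 1 / 2 - 3 / 4 * (1 - s) else - 1 / 2 * s powr (- 3 / 2))"

definition newton_profile2 :: "real \<Rightarrow> real" where
  "newton_profile2 s = (if s \<le> 1 then 3 / 4 else 3 / 4 * s powr (- 5 / 2))"

lemma newton_profile_deriv: "(newton_profile has_field_derivative newton_profile1 s) (at s)"
proof -
  have "((\<lambda>s. if s \<le> 1 then 1 + (1 - s) / 2 + 3 / 8 * (1 - s)\<^sup>2 else s powr (- 1 / 2)) has_field_derivative
     (if s \<le> 1 then - 1 / 2 - 3 / 4 * (1 - s) else - 1 / 2 * s powr (- 3 / 2))) (at s)"
    by (rule DERIV_If_glue) (auto intro!: derivative_eq_intros simp: field_simps)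
  then show ?thesis by (simp only: newton_profile_def[abs_def] newton_profile1_def)
qed

lemma newton_profile1_deriv: "(newton_profile1 has_field_derivative newton_profile2 s) (at s)"
proof -
  have "((\<lambda>s. if s \<le> 1 then - 1 / 2 - 3 / 4 * (1 - s) else - 1 / 2 * s powr (- 3 / 2)) has_field_derivative
     (if s \<le> 1 then 3 / 4 else 3 / 4 * s powr (- 5 / 2))) (at s)"
    by (rule DERIV_If_glue) (auto intro!: derivative_eq_intros)
  then show ?thesis by (simp only: newton_profile1_def[abs_def] newton_profile2_def)
qed

lemma newton_profile2_continuous: "continuous_on UNIV newton_profile2"
proof -
  have "continuous_on ({..1} \<union> {1..}) (\<lambda>s::real. if s \<le> 1 then 3 / 4 else 3 / 4 * s powr (- 5 / 2))"
    by (rule continuous_on_If) (auto intro!: continuous_intros)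
  moreover have "{..1} \<union> {1..} = (UNIV::real set)" by auto
  ultimately show ?thesis unfolding newton_profile2_def[abs_def] by simp
qed

text \<open>In three dimensions the Laplacian of g(|x|^2) is 6 g' + 4 |x|^2 g''. It vanishes for
  g(s) = s^(-1/2), so only the polynomial part inside the unit ball contributes.\<close>

lemma newton_profile_laplacian: "6 * newton_profile1 s + 4 * s * newton_profile2 s = - (15 / 2 * max 0 (1 - s))"
proof (cases "s \<le> 1")
  case False
  then have "s * s powr (- 5 / 2) = s powr (- 3 / 2)" using powr_add[of s 1 "-5/2"] by simp
  then show ?thesis using False by (simp add: newton_profile1_def newton_profile2_def)
qed (simp add: newton_profile1_def newton_profile2_def field_simps)

section \<open>Regularised Newtonian potentials\<close>

text \<open>The scaling is chosen so that outside the ball of radius r the value is 1/|x|, whatever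
  r is.\<close>

definition newton :: "real \<Rightarrow> real^3 \<Rightarrow> real" where
  "newton r x = newton_profile ((x \<bullet> x) / r\<^sup>2) / r"

text \<open>Minus the Laplacian of \<open>newton r\<close>: a nonnegative bump on the ball of radius
  r. Its mass, 4 pi as for the Newtonian potential, does not depend on r, while its maximum decays
  like r^-3.\<close>

definition newton_kernel :: "real \<Rightarrow> real^3 \<Rightarrow> real" where
  "newton_kernel r x = 15 / 2 * max 0 (1 - (x \<bullet> x) / r\<^sup>2) / r ^ 3"

lemma has_derivative_radial:
  fixes x :: "'a::euclidean_space"
  assumes "(g has_field_derivative D) (at ((x \<bullet> x) / r\<^sup>2))"
  shows "((\<lambda>x. g ((x \<bullet> x) / r\<^sup>2)) has_derivative (\<lambda>h. D * (2 * (x \<bullet> h) / r\<^sup>2))) (at x)"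
proof -
  have "((\<lambda>x. (x \<bullet> x) * inverse (r\<^sup>2)) has_derivative (\<lambda>h. (2 * (x \<bullet> h)) * inverse (r\<^sup>2))) (at x)"
    by (auto intro!: derivative_eq_intros simp: inner_commute)
  then have "((\<lambda>x. (x \<bullet> x) / r\<^sup>2) has_derivative (\<lambda>h. 2 * (x \<bullet> h) / r\<^sup>2)) (at x)"
    by (simp only: divide_inverse)
  from diff_chain_at[OF this assms[THEN has_field_derivative_imp_has_derivative]] show ?thesis by (simp add: o_def)
qed

definition newton_grad :: "real \<Rightarrow> real^3 \<Rightarrow> real^3 \<Rightarrow> real" where
  "newton_grad r i x = 2 / r ^ 3 * ((x \<bullet> i) * newton_profile1 ((x \<bullet> x) / r\<^sup>2))"

definition newton_hess :: "real \<Rightarrow> real^3 \<Rightarrow> real^3 \<Rightarrow> real^3 \<Rightarrow> real" where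
  "newton_hess r i j x = 2 / r ^ 3 * ((i \<bullet> j) * newton_profile1 ((x \<bullet> x) / r\<^sup>2)
      + (x \<bullet> i) * (x \<bullet> j) * (2 / r\<^sup>2 * newton_profile2 ((x \<bullet> x) / r\<^sup>2)))"

lemma newton_has_derivative:
  assumes "r > 0"
  shows "(newton r has_derivative (\<lambda>h. newton_grad r h x)) (at x)"
proof -
  have "((\<lambda>x. newton_profile ((x \<bullet> x) / r\<^sup>2) / r) has_derivative
      (\<lambda>h. newton_profile1 ((x \<bullet> x) / r\<^sup>2) * (2 * (x \<bullet> h) / r\<^sup>2) / r)) (at x)"
    using assms by (auto intro!: derivative_eq_intros has_derivative_radial newton_profile_deriv)
  also have "(\<lambda>h. newton_profile1 ((x \<bullet> x) / r\<^sup>2) * (2 * (x \<bullet> h) / r\<^sup>2) / r) = (\<lambda>h. newton_grad r h x)"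
    by (auto simp: newton_grad_def power2_eq_square power3_eq_cube)
  finally show ?thesis by (simp only: newton_def[abs_def])
qed

lemma newton_grad_has_derivative:
  assumes "r > 0"
  shows "(newton_grad r i has_derivative (\<lambda>h. newton_hess r i h x)) (at x)"
proof -
  have "((\<lambda>x. 2 / r ^ 3 * ((x \<bullet> i) * newton_profile1 ((x \<bullet> x) / r\<^sup>2))) has_derivative
      (\<lambda>h. 2 / r ^ 3 * ((x \<bullet> i) * (newton_profile2 ((x \<bullet> x) / r\<^sup>2) * (2 * (x \<bullet> h) / r\<^sup>2)) + (h \<bullet> i) * newton_profile1 ((x \<bullet> x) / r\<^sup>2)))) (at x)"
    by (intro derivative_intros has_derivative_mult has_derivative_mult_right has_derivative_radial newton_profile1_deriv)
  also have "(\<lambda>h. 2 / r ^ 3 * ((x \<bullet> i) * (newton_profile2 ((x \<bullet> x) / r\<^sup>2) * (2 * (x \<bullet> h) / r\<^sup>2)) + (h \<bullet> i) * newton_profile1 ((x \<bullet> x) / r\<^sup>2))) = (\<lambda>h. newton_hess r i h x)"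
    by (simp add: fun_eq_iff newton_hess_def inner_commute algebra_simps)
  finally show ?thesis by (simp only: newton_grad_def[abs_def])
qed

lemma newton_hess_continuous: "continuous_on UNIV (newton_hess r i j)"
proof -
  have "continuous_on UNIV newton_profile1"
    using newton_profile1_deriv by (auto simp: continuous_on_eq_continuous_at intro: DERIV_isCont)
  then have "continuous_on UNIV (\<lambda>x::real^3. newton_profile1 ((x \<bullet> x) / r\<^sup>2))"
    by (rule continuous_on_compose2) (auto simp: divide_inverse intro!: continuous_intros)
  moreover have "continuous_on UNIV (\<lambda>x::real^3. newton_profile2 ((x \<bullet> x) / r\<^sup>2))"
    by (rule continuous_on_compose2[OF newton_profile2_continuous]) (auto simp: divide_inverse intro!: continuous_intros)
  ultimately show ?thesis unfolding newton_hess_def[abs_def] by (intro continuous_intros) auto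
qed

lemma newton_hess_commute: "newton_hess r i j x = newton_hess r j i x"
  by (simp add: newton_hess_def inner_commute mult.commute[of "x \<bullet> i"])

lemma newton_laplacian:
  assumes "r > 0"
  shows "(\<Sum>i\<in>Basis. newton_hess r i i x) = - newton_kernel r x"
proof -
  define s where "s = (x \<bullet> x) / r\<^sup>2"
  define A B where "A = 2 / r ^ 3 * newton_profile1 s" and "B = 2 / r ^ 3 * (2 / r\<^sup>2 * newton_profile2 s)"
  have "newton_hess r i i x = A * (i \<bullet> i) + B * ((x \<bullet> i) * (x \<bullet> i))" for i
    by (simp add: newton_hess_def s_def A_def B_def algebra_simps)
  then have "(\<Sum>i\<in>Basis. newton_hess r i i x) = A * (\<Sum>i\<in>(Basis::(real^3) set). i \<bullet> i) + B * (\<Sum>i\<in>Basis. (x \<bullet> i) * (x \<bullet> i))"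
    by (simp only: sum.distrib sum_distrib_left)
  also have "\<dots> = 2 / r ^ 3 * ((\<Sum>i\<in>(Basis::(real^3) set). i \<bullet> i) * newton_profile1 s
      + (\<Sum>i\<in>Basis. (x \<bullet> i) * (x \<bullet> i)) * (2 / r\<^sup>2 * newton_profile2 s))"
    unfolding A_def B_def by (simp only: algebra_simps)
  also have "(\<Sum>i\<in>(Basis::(real^3) set). i \<bullet> i) = 3" by simp
  also have "(\<Sum>i\<in>Basis. (x \<bullet> i) * (x \<bullet> i)) = x \<bullet> x" by (rule euclidean_inner[symmetric])
  also have "2 / r ^ 3 * (3 * newton_profile1 s + x \<bullet> x * (2 / r\<^sup>2 * newton_profile2 s)) = (6 * newton_profile1 s + 4 * s * newton_profile2 s) / r ^ 3"
    by (simp add: s_def field_simps)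
  also have "\<dots> = - newton_kernel r x" unfolding newton_profile_laplacian by (simp add: newton_kernel_def s_def)
  finally show ?thesis .
qed

lemma newton_outside:
  assumes "r > 0" "norm x \<ge> r"
  shows "newton r x = 1 / norm x"
proof -
  have x: "norm x > 0" using assms by linarith
  have e: "(x \<bullet> x) / r\<^sup>2 = (norm x / r)\<^sup>2" by (simp add: power2_norm_eq_inner power_divide)
  have "(norm x / r) powr 2 = (norm x / r)\<^sup>2" using x assms by simp
  then have p: "((norm x / r)\<^sup>2) powr (- 1 / 2) = r / norm x"
    using x assms powr_powr[of "norm x / r" 2 "- 1 / 2"] by (simp add: powr_minus_divide)
  show ?thesis
  proof (cases "norm x = r")
    case True then show ?thesis using assms(1) by (simp add: newton_def e newton_profile_def)
  next
    case False
    then have "norm x / r > 1" using assms by simp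
    then have "(norm x / r)\<^sup>2 > 1" by (simp add: one_less_power)
    then show ?thesis using assms p by (simp add: newton_def e newton_profile_def)
  qed
qed

text \<open>The potential of two spread charges of equal mass and opposite sign. Outside the larger
  ball they cancel, so this truncates the Newtonian potential without a cut-off function and keeps
  an explicit Laplacian.\<close>

definition newton_diff :: "real \<Rightarrow> real \<Rightarrow> real^3 \<Rightarrow> real" where
  "newton_diff a b x = newton a x - newton b x"

lemma newton_diff_derivs:
  assumes "0 < a" "0 < b"
  shows "(newton_diff a b has_derivative (\<lambda>h. newton_grad a h x - newton_grad b h x)) (at x)"
    "((\<lambda>x. newton_grad a i x - newton_grad b i x) has_derivative (\<lambda>h. newton_hess a i h x - newton_hess b i h x)) (at x)"
  unfolding newton_diff_def[abs_def]
  by (intro has_derivative_diff newton_has_derivative newton_grad_has_derivative assms)+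

lemma newton_diff_Ck:
  assumes "0 < a" "0 < b"
  shows "Ck 2 (newton_diff a b)"
proof -
  have "Ck (Suc (Suc 0)) (newton_diff a b)"
    by (intro Ck_SucI[OF newton_diff_derivs(1)[OF assms]] Ck_SucI[OF newton_diff_derivs(2)[OF assms]])
      (auto intro!: continuous_intros newton_hess_continuous)
  then show ?thesis by (simp only: numeral_2_eq_2)
qed

lemma newton_diff_support:
  assumes "0 < a" "a \<le> b" "newton_diff a b x \<noteq> 0" shows "norm x \<le> b"
  using assms newton_outside[of a x] newton_outside[of b x] by (force simp: newton_diff_def)

lemma newton_kernel_continuous: "r > 0 \<Longrightarrow> continuous_on UNIV (newton_kernel r)"
  unfolding newton_kernel_def[abs_def] by (intro continuous_intros) auto

lemma newton_kernel_nonneg: "r > 0 \<Longrightarrow> newton_kernel r x \<ge> 0"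
  by (simp add: newton_kernel_def)

lemma newton_kernel_le: "r > 0 \<Longrightarrow> newton_kernel r x \<le> 15 / 2 / r ^ 3"
  unfolding newton_kernel_def by (intro divide_right_mono) auto

lemma newton_kernel_support:
  assumes "r > 0" "newton_kernel r x \<noteq> 0" shows "norm x \<le> r"
proof (rule ccontr)
  assume "\<not> norm x \<le> r"
  then have "r\<^sup>2 \<le> x \<bullet> x" using assms(1) by (simp add: power2_norm_eq_inner[symmetric] power_mono)
  then show False using assms by (simp add: newton_kernel_def)
qed

lemma newton_kernel_minus: "newton_kernel r (- x) = newton_kernel r x"
  by (simp add: newton_kernel_def)

lemma newton_kernel_integrable: "r > 0 \<Longrightarrow> integrable lborel (newton_kernel r)"
  by (intro in_L1_integrable in_Lp_Cc newton_kernel_continuous compact_supportI[of _ r]) (auto intro: newton_kernel_support)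

lemma newton_kernel_integral:
  assumes r: "r > 0" shows "(LINT x|lborel. newton_kernel r x) = (LINT x|lborel. newton_kernel 1 x)"
proof -
  have m: "newton_kernel 1 \<in> borel_measurable borel" by (intro borel_measurable_continuous_onI newton_kernel_continuous) simp
  have "newton_kernel r x = (1 / r) ^ DIM(real^3) * newton_kernel 1 ((1 / r) *\<^sub>R x)" for x
    by (simp add: newton_kernel_def power_divide power2_eq_square)
  then show ?thesis using integral_lborel_scale(1)[OF m, of "1 / r"] r by simp
qed

lemma newton_kernel_integral_pos: "(LINT x|lborel. newton_kernel 1 x) > 0"
proof (rule integral_pos_on_unit_ball)
  fix x :: "real^3" assume "norm x < 1"
  then have "x \<bullet> x < 1" by (simp add: norm_eq_sqrt_inner)
  then show "newton_kernel 1 x \<noteq> 0" by (simp add: newton_kernel_def max_def)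
qed (simp_all add: newton_kernel_integrable newton_kernel_nonneg)

section \<open>Duality with convolution kernels and the Hessian estimate\<close>

lemma conv_bound:
  fixes k f :: "'a::euclidean_space \<Rightarrow> real"
  assumes "\<And>z. \<bar>k z\<bar> \<le> M" "integrable lborel f" "k \<in> borel_measurable borel"
  shows "\<bar>conv k f x\<bar> \<le> M * (LINT y|lborel. \<bar>f y\<bar>)"
proof -
  have M: "M \<ge> 0" using assms(1)[of 0] by linarith
  note [measurable] = borel_measurable_integrable[OF assms(2)] assms(3)
  have i: "integrable lborel (\<lambda>y. M * \<bar>f y\<bar>)" using assms(2) by auto
  have le: "\<bar>k (x - y) * f y\<bar> \<le> M * \<bar>f y\<bar>" for y using assms(1) by (simp add: abs_mult mult_right_mono)
  have i2: "integrable lborel (\<lambda>y. k (x - y) * f y)"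
    by (rule Bochner_Integration.integrable_bound[OF i]) (use le M in \<open>auto simp: abs_mult\<close>)
  have "conv k f x = (LINT y|lborel. k (x - y) * f y)" using assms(3) by (intro conv_alt) auto
  also have "\<bar>\<dots>\<bar> \<le> (LINT y|lborel. \<bar>k (x - y) * f y\<bar>)" by (rule integral_abs_bound)
  also have "\<dots> \<le> (LINT y|lborel. M * \<bar>f y\<bar>)"
    using i i2 le by (intro integral_mono) (auto intro: Bochner_Integration.integrable_abs)
  finally show ?thesis by simp
qed

lemma conv_adjoint:
  fixes k f p :: "'a::euclidean_space \<Rightarrow> real"
  assumes k: "k \<in> borel_measurable borel" "\<And>z. \<bar>k z\<bar> \<le> M" "\<And>z. k (- z) = k z" and p: "integrable lborel p" and f: "integrable lborel f"
  shows "(LINT x|lborel. p x * conv k f x) = (LINT x|lborel. conv k p x * f x)"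
proof -
  note [measurable] = k(1) borel_measurable_integrable[OF p] borel_measurable_integrable[OF f]
  have M: "M \<ge> 0" using k(2)[of 0] by linarith
  have pf: "integrable (lborel \<Otimes>\<^sub>M lborel) (\<lambda>(x,y). p x * f y)"
  proof (rule lborel_pair.Fubini_integrable)
    have "(\<lambda>x. LINT y|lborel. norm (p x * f y)) = (\<lambda>x. \<bar>p x\<bar> * (LINT y|lborel. \<bar>f y\<bar>))" by (simp add: abs_mult)
    then show "integrable lborel (\<lambda>x. LINT y|lborel. norm (case (x, y) of (x, y) \<Rightarrow> p x * f y))" using p by simp
  qed (use f in auto)
  have pkf: "integrable (lborel \<Otimes>\<^sub>M lborel) (\<lambda>(x,y). p x * (k (x - y) * f y))"
  proof (rule Bochner_Integration.integrable_bound[OF integrable_mult_right[OF pf, of M]])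
    show "AE z in lborel \<Otimes>\<^sub>M lborel. norm (case z of (x, y) \<Rightarrow> p x * (k (x - y) * f y)) \<le> norm (M * (case z of (x, y) \<Rightarrow> p x * f y))"
    proof (rule AE_I2)
      fix z :: "'a \<times> 'a"
      obtain x y where z: "z = (x, y)" by (cases z)
      have "\<bar>k (x - y)\<bar> * (\<bar>p x\<bar> * \<bar>f y\<bar>) \<le> M * (\<bar>p x\<bar> * \<bar>f y\<bar>)" using k(2) by (intro mult_right_mono) auto
      then show "norm (case z of (x, y) \<Rightarrow> p x * (k (x - y) * f y)) \<le> norm (M * (case z of (x, y) \<Rightarrow> p x * f y))"
        using M by (simp add: z abs_mult mult_ac)
    qed
  qed measurable
  have "(LINT x|lborel. p x * conv k f x) = (LINT x|lborel. LINT y|lborel. p x * (k (x - y) * f y))"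
    using conv_alt[OF k(1), of f] by simp
  also have "\<dots> = (LINT y|lborel. LINT x|lborel. p x * (k (x - y) * f y))"
    by (rule lborel_pair.Fubini_integral[OF pkf, symmetric])
  also have "\<dots> = (LINT y|lborel. conv k p y * f y)"
  proof (rule Bochner_Integration.integral_cong[OF refl])
    fix y
    have "k (x - y) = k (y - x)" for x using k(3)[of "y - x"] by simp
    then have "(LINT x|lborel. p x * (k (x - y) * f y)) = (LINT x|lborel. (k (y - x) * p x) * f y)" by (simp add: mult_ac)
    also have "\<dots> = conv k p y * f y" using conv_alt[OF k(1), of p y] by simp
    finally show "(LINT x|lborel. p x * (k (x - y) * f y)) = conv k p y * f y" .
  qed
  finally show ?thesis .
qed

lemma Lp_norm2_square: "Lp_norm 2 f ^ 2 = (LINT x|lborel. (f x)\<^sup>2)"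
  using Lp_norm_powr[of 2 f] by simp

text \<open>For a symmetric Jacobian, |d_j \<phi>_i|^2 is (d_j \<phi>_i)(d_i \<phi>_j), whose
  integral equals that of (d_i \<phi>_i)(d_j \<phi>_j). Summed over all entries this is the squared
  norm of the divergence: the L^2 bound of second derivatives by the Laplacian, with constant 1 and
  without the Fourier transform.\<close>

lemma hessian_L2:
  fixes \<phi> :: "'a::euclidean_space \<Rightarrow> 'a \<Rightarrow> real"
  assumes \<phi>: "\<And>i. i \<in> Basis \<Longrightarrow> \<phi> i \<in> Cc1"
    and sym: "\<And>i j x. i \<in> Basis \<Longrightarrow> j \<in> Basis \<Longrightarrow> pd j (\<phi> i) x = pd i (\<phi> j) x"
    and ij: "i \<in> Basis" "j \<in> Basis"
  shows "Lp_norm 2 (pd j (\<phi> i)) \<le> Lp_norm 2 (\<lambda>x. \<Sum>i\<in>Basis. pd i (\<phi> i) x)"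
proof -
  have L: "in_Lp 2 (pd j (\<phi> i))" if "i \<in> Basis" "j \<in> Basis" for i j using Cc1_in_Lp(2)[OF \<phi>[OF that(1)] _ that(2)] by simp
  have I: "integrable lborel (\<lambda>x. pd j (\<phi> i) x * pd l (\<phi> k) x)" if "i \<in> Basis" "j \<in> Basis" "k \<in> Basis" "l \<in> Basis" for i j k l
    using Holder_integral(1)[OF L[OF that(1,2)] L[OF that(3,4)]] by simp
  have "(Lp_norm 2 (pd j (\<phi> i)))\<^sup>2 \<le> (\<Sum>i\<in>Basis. \<Sum>j\<in>Basis. (Lp_norm 2 (pd j (\<phi> i)))\<^sup>2)"
  proof -
    have "(Lp_norm 2 (pd j (\<phi> i)))\<^sup>2 \<le> (\<Sum>j\<in>Basis. (Lp_norm 2 (pd j (\<phi> i)))\<^sup>2)"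
      using ij by (intro member_le_sum[of j Basis "\<lambda>j. (Lp_norm 2 (pd j (\<phi> i)))\<^sup>2"]) auto
    also have "\<dots> \<le> (\<Sum>i\<in>Basis. \<Sum>j\<in>Basis. (Lp_norm 2 (pd j (\<phi> i)))\<^sup>2)"
      using ij by (intro member_le_sum[of i Basis "\<lambda>i. \<Sum>j\<in>Basis. (Lp_norm 2 (pd j (\<phi> i)))\<^sup>2"]) (auto intro: sum_nonneg)
    finally show ?thesis .
  qed
  also have "\<dots> = (\<Sum>i\<in>Basis. \<Sum>j\<in>Basis. LINT x|lborel. pd i (\<phi> i) x * pd j (\<phi> j) x)"
  proof (intro sum.cong refl)
    fix i j :: 'a assume ij: "i \<in> Basis" "j \<in> Basis"
    have "(Lp_norm 2 (pd j (\<phi> i)))\<^sup>2 = (LINT x|lborel. pd j (\<phi> i) x * pd i (\<phi> j) x)"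
      unfolding Lp_norm2_square using sym[OF ij] by (simp add: power2_eq_square)
    also have "\<dots> = (LINT x|lborel. pd i (\<phi> i) x * pd j (\<phi> j) x)"
      by (rule integral_pd_swap[OF \<phi>[OF ij(1)] \<phi>[OF ij(2)] ij(2) ij(1)])
    finally show "(Lp_norm 2 (pd j (\<phi> i)))\<^sup>2 = (LINT x|lborel. pd i (\<phi> i) x * pd j (\<phi> j) x)" .
  qed
  also have "\<dots> = (LINT x|lborel. (\<Sum>i\<in>Basis. \<Sum>j\<in>Basis. pd i (\<phi> i) x * pd j (\<phi> j) x))"
    using I by (simp add: Bochner_Integration.integral_sum Bochner_Integration.integrable_sum)
  also have "\<dots> = (Lp_norm 2 (\<lambda>x. \<Sum>i\<in>Basis. pd i (\<phi> i) x))\<^sup>2"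
    unfolding Lp_norm2_square by (simp add: power2_eq_square sum_product)
  finally show ?thesis by (rule power2_le_imp_le) simp
qed

lemma conv_sum_kernel:
  fixes f :: "'a::euclidean_space \<Rightarrow> real"
  assumes "\<And>i. i \<in> I \<Longrightarrow> continuous_on UNIV (k i)" "\<And>i. i \<in> I \<Longrightarrow> compact_support (k i)" "locally_integrable f"
  shows "conv (\<lambda>x. \<Sum>i\<in>I. k i x) f x = (\<Sum>i\<in>I. conv (k i) f x)"
proof -
  have "conv (\<lambda>x. \<Sum>i\<in>I. k i x) f x = (LINT y|lborel. (\<Sum>i\<in>I. k i (x - y) * f y))"
    using assms(1) locally_integrable_measurable[OF assms(3)]
    by (subst conv_alt) (auto intro!: borel_measurable_continuous_onI continuous_on_sum simp: sum_distrib_right)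
  also have "\<dots> = (\<Sum>i\<in>I. LINT y|lborel. k i (x - y) * f y)"
    by (intro Bochner_Integration.integral_sum integrable_conv assms)
  also have "\<dots> = (\<Sum>i\<in>I. conv (k i) f x)"
    using assms(1) locally_integrable_measurable[OF assms(3)]
    by (intro sum.cong refl conv_alt[symmetric]) (auto intro!: borel_measurable_continuous_onI)
  finally show ?thesis .
qed

text \<open>The field is the gradient of \<open>newton_diff a b\<close> convolved with f. One
  derivative of the kernel builds the field and the second its Jacobian, which is where the C^2
  matching of the profile is used; f contributes only boundedness and bounded support.\<close>

lemma newton_test:
  fixes f :: "real^3 \<Rightarrow> real"
  assumes ab: "0 < a" "a \<le> b" and f: "f \<in> borel_measurable borel" "\<And>x. \<bar>f x\<bar> \<le> M" "\<And>x. f x \<noteq> 0 \<Longrightarrow> norm x \<le> R"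
  obtains \<phi> :: "real^3 \<Rightarrow> real^3 \<Rightarrow> real" where "\<And>i. i \<in> Basis \<Longrightarrow> \<phi> i \<in> Cc1"
    "\<And>x. (\<Sum>i\<in>Basis. pd i (\<phi> i) x) = conv (newton_kernel b) f x - conv (newton_kernel a) f x"
    "\<And>i j. i \<in> Basis \<Longrightarrow> j \<in> Basis \<Longrightarrow> Lp_norm 2 (pd j (\<phi> i)) \<le> Lp_norm 2 (\<lambda>x. conv (newton_kernel b) f x - conv (newton_kernel a) f x)"
proof -
  have b: "0 < b" using ab by linarith
  define \<Omega> where "\<Omega> = newton_diff a b"
  define \<phi> where "\<phi> i = conv (pd i \<Omega>) f" for i
  have fl: "locally_integrable f" by (rule in_Lp_locally_integrable[OF in_Lp_bounded_support[OF f, of 1]]) auto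
  have O2: "Ck (Suc (Suc 0)) \<Omega>" unfolding \<Omega>_def using newton_diff_Ck[OF ab(1) b] by (simp only: numeral_2_eq_2)
  have Osupp: "\<Omega> x \<noteq> 0 \<Longrightarrow> norm x \<le> b" for x unfolding \<Omega>_def using newton_diff_support[OF ab] by blast
  have Oc: "compact_support \<Omega>" using Osupp by (rule compact_supportI)
  have pdO: "pd i \<Omega> x = newton_grad a i x - newton_grad b i x" for i x
    unfolding \<Omega>_def using frechet_derivative_eq[OF newton_diff_derivs(1)[OF ab(1) b]] by simp
  have pdpdO: "pd j (pd i \<Omega>) x = newton_hess a i j x - newton_hess b i j x" for i j x
    unfolding pdO using frechet_derivative_eq[OF newton_diff_derivs(2)[OF ab(1) b]] by simp
  have pC1: "pd i \<Omega> \<in> Cc1" if "i \<in> Basis" for i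
    by (rule Cc1I[OF Ck_SucD(2)[OF O2 that] compact_support_pd[OF Oc]])
  have \<phi>: "\<phi> i \<in> Cc1" if "i \<in> Basis" for i
  proof (rule Cc1I)
    show "Ck (Suc 0) (\<phi> i)" unfolding \<phi>_def by (rule Ck_conv[OF Cc1D[OF pC1[OF that]] fl])
    show "compact_support (\<phi> i)"
      by (rule compact_supportI[of _ "b + R"]) (use conv_support[of "pd i \<Omega>" b f R, OF pd_support[of \<Omega> b, OF Osupp] f(3)] in \<open>auto simp: \<phi>_def\<close>)
  qed
  have pdphi: "pd j (\<phi> i) x = conv (pd j (pd i \<Omega>)) f x" if "i \<in> Basis" "j \<in> Basis" for i j x
    unfolding \<phi>_def by (rule pd_conv[OF pC1[OF that(1)] fl that(2)])
  have cK: "continuous_on UNIV (newton_kernel r)" "compact_support (newton_kernel r)" if "r > 0" for r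
    using that by (auto intro: newton_kernel_continuous compact_supportI[of _ r] newton_kernel_support)
  have lap: "(\<Sum>i\<in>Basis. pd i (\<phi> i) x) = conv (newton_kernel b) f x - conv (newton_kernel a) f x" for x
  proof -
    have "(\<Sum>i\<in>Basis. pd i (\<phi> i) x) = (\<Sum>i\<in>Basis. conv (pd i (pd i \<Omega>)) f x)" using pdphi by simp
    also have "\<dots> = conv (\<lambda>x. \<Sum>i\<in>Basis. pd i (pd i \<Omega>) x) f x"
      by (rule conv_sum_kernel[symmetric])
        (auto intro!: fl compact_support_pd Oc Ck_continuous[of 0] Ck_SucD(2)[OF Ck_SucD(2)[OF O2]] simp del: Ck.simps)
    also have "(\<lambda>x. \<Sum>i\<in>Basis. pd i (pd i \<Omega>) x) = (\<lambda>x. newton_kernel b x - newton_kernel a x)"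
      unfolding pdpdO sum_subtractf using newton_laplacian[OF ab(1)] newton_laplacian[OF b] by (simp add: fun_eq_iff)
    also have "conv (\<lambda>x. newton_kernel b x - newton_kernel a x) f x = conv (newton_kernel b) f x - conv (newton_kernel a) f x"
      using cK[OF b] cK[OF ab(1)] integrable_conv[OF cK[OF b] fl] integrable_conv[OF cK[OF ab(1)] fl] locally_integrable_measurable[OF fl]
      by (subst (1 2 3) conv_alt) (auto intro!: borel_measurable_continuous_onI continuous_intros simp: left_diff_distrib)
    finally show ?thesis .
  qed
  show ?thesis
  proof (rule that[OF \<phi> lap])
    fix i j :: "real^3" assume ij: "i \<in> Basis" "j \<in> Basis"
    have "pd j (\<phi> i) x = pd i (\<phi> j) x" if "i \<in> Basis" "j \<in> Basis" for i j x
      using pdphi[OF that] pdphi[OF that(2,1)] by (simp add: pdpdO newton_hess_commute[of _ i j])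
    from hessian_L2[of \<phi>, OF \<phi> this ij] show "Lp_norm 2 (pd j (\<phi> i)) \<le> Lp_norm 2 (\<lambda>x. conv (newton_kernel b) f x - conv (newton_kernel a) f x)"
      by (simp add: lap)
  qed
qed

text \<open>Testing with the fields of \<open>newton_test\<close> turns the gradient bound into a
  bound of K_b * p - K_a * p against arbitrary bounded f of bounded support. Letting b grow removes
  the first part; choosing f as a truncation of K_a * p itself bounds K_a * p in L^2, and a tends to
  0 with Fatou's lemma.\<close>

lemma L2_of_gradient_bound:
  fixes p :: "real^3 \<Rightarrow> real"
  assumes p: "integrable lborel p"
    and bd: "\<And>\<phi>. (\<And>i. i \<in> Basis \<Longrightarrow> \<phi> i \<in> Cc1) \<Longrightarrow>
      \<bar>LINT x|lborel. p x * (\<Sum>i\<in>Basis. pd i (\<phi> i) x)\<bar> \<le> C * (\<Sum>i\<in>Basis. \<Sum>j\<in>Basis. Lp_norm 2 (pd j (\<phi> i)))"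
    and C: "C \<ge> 0"
  shows "in_Lp 2 p"
proof -
  define c where "c = (LINT x|lborel. newton_kernel 1 x)"
  have c: "c > 0" unfolding c_def by (rule newton_kernel_integral_pos)
  have K: "continuous_on UNIV (newton_kernel r)" "compact_support (newton_kernel r)" "newton_kernel r \<in> borel_measurable borel"
    "(LINT x|lborel. newton_kernel r x) = c" "\<And>x. newton_kernel r x \<ge> 0" "\<And>x. \<bar>newton_kernel r x\<bar> \<le> 15 / 2 / r ^ 3" if "r > 0" for r
    using that newton_kernel_integral[OF that] newton_kernel_le[OF that] newton_kernel_nonneg[OF that]
    by (auto intro: newton_kernel_continuous compact_supportI[of _ r] newton_kernel_support borel_measurable_continuous_onI simp: c_def)
  \<comment> \<open>18 is the number 9 of Jacobian entries times 2 for the two kernels, each of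
    which multiplies the L^2 norm by at most its mass c.\<close>
  define C' where "C' = 18 * C * c"
  have C': "C' \<ge> 0" using C c by (simp add: C'_def)
  have main: "\<bar>LINT x|lborel. conv (newton_kernel a) p x * f x\<bar> \<le> C' * Lp_norm 2 f"
    if a: "a > 0" and f: "f \<in> borel_measurable borel" "\<And>x. \<bar>f x\<bar> \<le> M" "\<And>x. f x \<noteq> 0 \<Longrightarrow> norm x \<le> R" for f a M R
  proof (rule tendsto_lowerbound)
    have f1: "in_Lp 1 f" by (rule in_Lp_bounded_support[OF f]) simp_all
    have f2: "in_Lp 2 f" by (rule in_Lp_bounded_support[OF f]) simp_all
    have Kf: "in_Lp 2 (conv (newton_kernel r) f)" "Lp_norm 2 (conv (newton_kernel r) f) \<le> c * Lp_norm 2 f" if "r > 0" for r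
      using Young_convolution[OF newton_kernel_integrable[OF that] K(5)[OF that] f2] K(4)[OF that] by auto
    have pK: "integrable lborel (\<lambda>x. p x * conv (newton_kernel r) f x)" if "r > 0" for r
    proof (rule Bochner_Integration.integrable_bound)
      define B where "B = 15 / 2 / r ^ 3 * (LINT y|lborel. \<bar>f y\<bar>)"
      have B: "\<bar>conv (newton_kernel r) f x\<bar> \<le> B" for x unfolding B_def by (rule conv_bound[OF K(6)[OF that] in_L1_integrable[OF f1] K(3)[OF that]])
      have "B \<ge> 0" using B[of 0] abs_ge_zero[of "conv (newton_kernel r) f 0"] by linarith
      show "integrable lborel (\<lambda>x. B * p x)" using p by simp
      show "AE x in lborel. norm (p x * conv (newton_kernel r) f x) \<le> norm (B * p x)"
        using mult_right_mono[OF B abs_ge_zero] \<open>B \<ge> 0\<close> by (intro AE_I2) (simp add: abs_mult mult.commute)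
      show "(\<lambda>x. p x * conv (newton_kernel r) f x) \<in> borel_measurable lborel"
        using borel_measurable_integrable[OF p] in_Lp_measurable[OF Kf(1)[OF that]] by simp
    qed
    \<comment> \<open>The last summand is the contribution of the wide kernel: it is at most 15/2
      b^-3 pointwise, and both f and p are in L^1, so the summand disappears as b tends to
      infinity.\<close>
    have step: "\<bar>LINT x|lborel. conv (newton_kernel a) p x * f x\<bar> \<le> C' * Lp_norm 2 f + 15 / 2 / b ^ 3 * (LINT y|lborel. \<bar>f y\<bar>) * (LINT x|lborel. \<bar>p x\<bar>)"
      if ab: "a \<le> b" for b
    proof -
      have b: "b > 0" using a ab by linarith
      obtain \<phi> where \<phi>: "\<And>i. i \<in> Basis \<Longrightarrow> \<phi> i \<in> Cc1"
        "\<And>x. (\<Sum>i\<in>Basis. pd i (\<phi> i) x) = conv (newton_kernel b) f x - conv (newton_kernel a) f x"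
        "\<And>i j. i \<in> Basis \<Longrightarrow> j \<in> Basis \<Longrightarrow> Lp_norm 2 (pd j (\<phi> i)) \<le> Lp_norm 2 (\<lambda>x. conv (newton_kernel b) f x - conv (newton_kernel a) f x)"
        by (rule newton_test[OF a ab f]) (assumption, rule that, blast+)
      have n2: "Lp_norm 2 (\<lambda>x. conv (newton_kernel b) f x - conv (newton_kernel a) f x) \<le> 2 * (c * Lp_norm 2 f)"
        using Minkowski_diff(2)[OF Kf(1)[OF b] Kf(1)[OF a]] Kf(2)[OF b] Kf(2)[OF a] by simp
      have "(\<Sum>i\<in>Basis. \<Sum>j\<in>Basis. Lp_norm 2 (pd j (\<phi> i))) \<le> (\<Sum>i\<in>(Basis::(real^3) set). \<Sum>j\<in>(Basis::(real^3) set). 2 * (c * Lp_norm 2 f))"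
        by (intro sum_mono order_trans[OF \<phi>(3) n2])
      also have "\<dots> = 18 * (c * Lp_norm 2 f)" by simp
      finally have "C * (\<Sum>i\<in>Basis. \<Sum>j\<in>Basis. Lp_norm 2 (pd j (\<phi> i))) \<le> C' * Lp_norm 2 f"
        using mult_left_mono[OF _ C] by (fastforce simp: C'_def mult_ac)
      then have 1: "\<bar>LINT x|lborel. p x * (conv (newton_kernel b) f x - conv (newton_kernel a) f x)\<bar> \<le> C' * Lp_norm 2 f"
        using bd[of \<phi>, OF \<phi>(1)] by (simp add: \<phi>(2))
      have 2: "(LINT x|lborel. p x * (conv (newton_kernel b) f x - conv (newton_kernel a) f x)) = (LINT x|lborel. p x * conv (newton_kernel b) f x) - (LINT x|lborel. p x * conv (newton_kernel a) f x)"
        using pK[OF a] pK[OF b] by (simp add: right_diff_distrib)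
      have 3: "\<bar>LINT x|lborel. p x * conv (newton_kernel b) f x\<bar> \<le> 15 / 2 / b ^ 3 * (LINT y|lborel. \<bar>f y\<bar>) * (LINT x|lborel. \<bar>p x\<bar>)"
      proof -
        have "\<bar>LINT x|lborel. p x * conv (newton_kernel b) f x\<bar> \<le> (LINT x|lborel. \<bar>p x * conv (newton_kernel b) f x\<bar>)" by (rule integral_abs_bound)
        also have "\<dots> \<le> (LINT x|lborel. 15 / 2 / b ^ 3 * (LINT y|lborel. \<bar>f y\<bar>) * \<bar>p x\<bar>)"
        proof (rule integral_mono)
          show "integrable lborel (\<lambda>x. \<bar>p x * conv (newton_kernel b) f x\<bar>)" using pK[OF b] by (rule Bochner_Integration.integrable_abs)
          show "integrable lborel (\<lambda>x. 15 / 2 / b ^ 3 * (LINT y|lborel. \<bar>f y\<bar>) * \<bar>p x\<bar>)" using p by (intro integrable_mult_right Bochner_Integration.integrable_abs)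
          fix x
          show "\<bar>p x * conv (newton_kernel b) f x\<bar> \<le> 15 / 2 / b ^ 3 * (LINT y|lborel. \<bar>f y\<bar>) * \<bar>p x\<bar>"
            unfolding abs_mult using conv_bound[OF K(6)[OF b] in_L1_integrable[OF f1] K(3)[OF b], of x] by (subst mult.commute) (rule mult_right_mono, auto)
        qed
        also have "\<dots> = 15 / 2 / b ^ 3 * (LINT y|lborel. \<bar>f y\<bar>) * (LINT x|lborel. \<bar>p x\<bar>)" by simp
        finally show ?thesis .
      qed
      have "(LINT x|lborel. p x * conv (newton_kernel a) f x) = (LINT x|lborel. conv (newton_kernel a) p x * f x)"
        by (rule conv_adjoint[OF K(3)[OF a] K(6)[OF a] newton_kernel_minus p in_L1_integrable[OF f1]])
      then show ?thesis using 1 2 3 by linarith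
    qed
    show "\<forall>\<^sub>F b in at_top. \<bar>LINT x|lborel. conv (newton_kernel a) p x * f x\<bar> \<le> C' * Lp_norm 2 f + 15 / 2 / b ^ 3 * (LINT y|lborel. \<bar>f y\<bar>) * (LINT x|lborel. \<bar>p x\<bar>)"
      using eventually_ge_at_top[of a] by eventually_elim (rule step)
    have "((\<lambda>b::real. 15 / 2 / b ^ 3) \<longlongrightarrow> 0) at_top"
      by (intro tendsto_divide_0[OF tendsto_const] filterlim_at_top_imp_at_infinity filterlim_pow_at_top filterlim_ident) auto
    from tendsto_add[OF tendsto_const tendsto_mult_left_zero[OF tendsto_mult_left_zero[OF this]]]
    show "((\<lambda>b. C' * Lp_norm 2 f + 15 / 2 / b ^ 3 * (LINT y|lborel. \<bar>f y\<bar>) * (LINT x|lborel. \<bar>p x\<bar>)) \<longlongrightarrow> C' * Lp_norm 2 f) at_top"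
      by simp
  qed simp
  define \<delta> where "\<delta> n = inverse (real (Suc n))" for n
  have \<delta>: "\<delta> n > 0" "\<delta> \<longlonglongrightarrow> 0" for n unfolding \<delta>_def using inverse_Suc_seq(1) by auto
  have "Lp_tendsto 1 (\<lambda>n. conv (newton_kernel (\<delta> n)) p) (\<lambda>x. c * p x)"
    by (rule mollification_tendsto[OF newton_kernel_integrable[OF \<delta>(1)] K(5)[OF \<delta>(1)] K(4)[OF \<delta>(1)] newton_kernel_support[OF \<delta>(1)] \<delta>(2) integrable_in_L1[OF p]]) auto
  then obtain s :: "nat \<Rightarrow> nat" where s: "strict_mono s" "AE x in lborel. (\<lambda>n. conv (newton_kernel (\<delta> (s n))) p x) \<longlonglongrightarrow> c * p x"
    using Lp_tendsto_AE_subseq[of 1] by blast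
  \<comment> \<open>The truncation to a ball makes the mollified pressure an admissible test
    function f in \<open>main\<close>. Inserted there it gives
    \<open>(Lp_norm 2 (F n))\<^sup>2 \<le> C' * Lp_norm 2 (F n)\<close>, and one factor
    cancels.\<close>
  define F where "F n x = indicator (cball 0 (real n)) x * conv (newton_kernel (\<delta> (s n))) p x" for n x
  have pl: "locally_integrable p" by (rule in_Lp_locally_integrable[OF integrable_in_L1[OF p]]) simp
  have F: "in_Lp 2 (F n) \<and> Lp_norm 2 (F n) \<le> C'" for n
  proof -
    let ?k = "newton_kernel (\<delta> (s n))"
    have kp: "continuous_on UNIV (conv ?k p)" by (rule conv_continuous[OF K(1,2)[OF \<delta>(1)] pl])
    have Fm: "F n \<in> borel_measurable borel" unfolding F_def
      by (intro borel_measurable_times borel_measurable_indicator borel_measurable_continuous_onI kp) simp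
    have Fb: "\<bar>F n x\<bar> \<le> 15 / 2 / \<delta> (s n) ^ 3 * (LINT y|lborel. \<bar>p y\<bar>)" for x
      using conv_bound[OF K(6)[OF \<delta>(1)] p K(3)[OF \<delta>(1)], of "s n" x] abs_ge_zero[of "conv ?k p x"]
      by (auto simp: F_def indicator_def simp del: abs_ge_zero)
    have Fs: "F n x \<noteq> 0 \<Longrightarrow> norm x \<le> real n" for x by (auto simp: F_def indicator_def split: if_splits)
    have in2: "in_Lp 2 (F n)" by (rule in_Lp_bounded_support[OF Fm Fb Fs]) simp_all
    have "(Lp_norm 2 (F n))\<^sup>2 = (LINT x|lborel. conv ?k p x * F n x)"
      unfolding Lp_norm2_square by (intro Bochner_Integration.integral_cong) (auto simp: F_def indicator_def power2_eq_square)
    also have "\<dots> \<le> C' * Lp_norm 2 (F n)" using main[OF \<delta>(1) Fm Fb Fs, of "s n"] by simp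
    finally have "Lp_norm 2 (F n) * Lp_norm 2 (F n) \<le> C' * Lp_norm 2 (F n)" by (simp add: power2_eq_square)
    then have "Lp_norm 2 (F n) \<le> C'" using Lp_norm_nonneg[of 2 "F n"] C' by (cases "Lp_norm 2 (F n) = 0") (auto simp: mult_le_cancel_right)
    with in2 show ?thesis by simp
  qed
  have "AE x in lborel. (\<lambda>n. F n x) \<longlonglongrightarrow> c * p x"
    using s(2)
  proof eventually_elim
    case (elim x)
    have "\<forall>\<^sub>F n in sequentially. norm x \<le> real n" using eventually_ge_at_top[of "nat \<lceil>norm x\<rceil>"] by eventually_elim linarith
    then have "\<forall>\<^sub>F n in sequentially. F n x = conv (newton_kernel (\<delta> (s n))) p x" by eventually_elim (auto simp: F_def)
    from tendsto_cong[OF this] elim show ?case by simp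
  qed
  note lim = this
  have "(\<lambda>x. c * p x) \<in> borel_measurable borel" using borel_measurable_integrable[OF p] by simp
  from Lp_Fatou(1)[OF conjunct1[OF F] conjunct2[OF F] _ this lim] have "in_Lp 2 (\<lambda>x. c * p x)" by simp
  from in_Lp_cmult[OF this, of "1 / c"] c show ?thesis by simp
qed

section \<open>The commutator lemma\<close>

text \<open>Membership in the homogeneous Sobolev space together with the witnessing sequence, with
  g as the gradient. The sequence is kept because its members are the admissible test functions;
  identities are proved for them and passed to the limit.\<close>

definition sobolev_approx :: "(nat \<Rightarrow> 'a::euclidean_space \<Rightarrow> real) \<Rightarrow> ('a \<Rightarrow> real) \<Rightarrow> ('a \<Rightarrow> 'a \<Rightarrow> real) \<Rightarrow> bool" where
  "sobolev_approx \<Phi> v g \<longleftrightarrow> (\<forall>n. \<Phi> n \<in> Cc_inf) \<and> Lp_tendsto 6 \<Phi> v \<and> (\<forall>i\<in>Basis. Lp_tendsto 2 (\<lambda>n. pd i (\<Phi> n)) (g i))"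

lemma sobolev_approxD:
  assumes "sobolev_approx \<Phi> v g"
  shows "\<Phi> n \<in> Cc_inf" "\<Phi> n \<in> Cc1" "Lp_tendsto 6 \<Phi> v" "i \<in> Basis \<Longrightarrow> Lp_tendsto 2 (\<lambda>n. pd i (\<Phi> n)) (g i)"
    "in_Lp 6 v" "i \<in> Basis \<Longrightarrow> in_Lp 2 (g i)"
  using assms by (auto simp: sobolev_approx_def intro: Cc_inf_Cc1 Lp_tendstoD)

text \<open>The parameter \<open>\<theta>\<close> covers two cases at once: \<open>\<theta> = 0\<close> bounds the differences of a function by its gradient,
  and \<open>\<theta> = 1\<close> measures their deviation from the differential.\<close>

lemma difference_Cc1:
  fixes \<phi> :: "'a::euclidean_space \<Rightarrow> real"
  assumes \<phi>: "\<phi> \<in> Cc1" and A: "\<And>k t. k \<in> Basis \<Longrightarrow> 0 \<le> t \<Longrightarrow> t \<le> 1 \<Longrightarrow> Lp_norm 2 (\<lambda>x. pd k \<phi> (x - t *\<^sub>R z) - \<theta> * pd k \<phi> x) \<le> A k"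
  shows "in_Lp 2 (\<lambda>x. \<phi> x - \<phi> (x - z) - \<theta> * (\<Sum>k\<in>Basis. (z \<bullet> k) * pd k \<phi> x))"
    "Lp_norm 2 (\<lambda>x. \<phi> x - \<phi> (x - z) - \<theta> * (\<Sum>k\<in>Basis. (z \<bullet> k) * pd k \<phi> x)) \<le> (\<Sum>k\<in>Basis. \<bar>z \<bullet> k\<bar> * A k)"
proof -
  note C = Cc1D[OF \<phi>]
  define F where "F x t = (\<Sum>k\<in>Basis. (z \<bullet> k) * (pd k \<phi> (x - t *\<^sub>R z) - \<theta> * pd k \<phi> x))" for x and t :: real
  have cont: "k \<in> Basis \<Longrightarrow> continuous_on UNIV (pd k \<phi>)" for k by (rule Ck_continuous[OF Ck_SucD(2)[OF C(1)]])
  have L: "k \<in> Basis \<Longrightarrow> in_Lp 2 (pd k \<phi>)" for k using Cc1_in_Lp(2)[OF \<phi>, of 2] by simp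
  have Lt: "k \<in> Basis \<Longrightarrow> in_Lp 2 (\<lambda>x. pd k \<phi> (x - t *\<^sub>R z) - \<theta> * pd k \<phi> x)" for k t
    by (intro Minkowski_diff in_Lp_translate in_Lp_cmult L) auto
  have A0: "k \<in> Basis \<Longrightarrow> A k \<ge> 0" for k by (rule order_trans[OF Lp_norm_nonneg A[of k 0]]) auto
  have eq: "\<phi> x - \<phi> (x - z) - \<theta> * (\<Sum>k\<in>Basis. (z \<bullet> k) * pd k \<phi> x) = (LINT t|lborel. indicator {0..1} t * F x t)" for x
  proof -
    define D where "D t = (\<Sum>k\<in>Basis. (z \<bullet> k) * pd k \<phi> (x - t *\<^sub>R z))" for t :: real
    have cD: "continuous_on UNIV D" unfolding D_def
      by (intro continuous_intros continuous_on_compose2[OF cont]) auto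
    have "(LINT t|lborel. D t * indicator {0..1} t) = - \<phi> (x - 1 *\<^sub>R z) - (- \<phi> (x - 0 *\<^sub>R z))"
    proof (rule integral_FTC_Icc_real)
      fix t :: real
      have "((\<lambda>t. \<phi> (x + t *\<^sub>R (- z))) has_field_derivative frechet_derivative \<phi> (at (x + t *\<^sub>R (- z))) (- z)) (at t)"
        by (rule has_derivative_line[OF Ck_SucD(3)[OF C(1)]])
      then have "((\<lambda>t. - \<phi> (x + t *\<^sub>R (- z))) has_field_derivative - frechet_derivative \<phi> (at (x + t *\<^sub>R (- z))) (- z)) (at t)"
        by (rule DERIV_minus)
      moreover have "- frechet_derivative \<phi> (at (x + t *\<^sub>R (- z))) (- z) = D t"
        unfolding D_def by (subst frechet_derivative_expand[OF Ck_SucD(3)[OF C(1)]]) (simp add: sum_negf)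
      ultimately show "((\<lambda>t. - \<phi> (x - t *\<^sub>R z)) has_field_derivative D t) (at t)" by simp
      show "isCont D t" using cD by (simp add: continuous_on_eq_continuous_at)
    qed simp
    then have 1: "(LINT t|lborel. indicator {0..1} t * D t) = \<phi> x - \<phi> (x - z)" by (simp add: mult.commute)
    define c where "c = \<theta> * (\<Sum>k\<in>Basis. (z \<bullet> k) * pd k \<phi> x)"
    have i1: "integrable lborel (\<lambda>t. indicator {0..1} t * D t)"
      using borel_integrable_compact[of "{0..1::real}" D] continuous_on_subset[OF cD] by (simp add: mult.commute)
    have "(LINT t|lborel. indicator {0..1} t * F x t) = (LINT t|lborel. indicator {0..1} t * D t - indicator {0..1::real} t * c)"
      unfolding F_def D_def c_def by (intro Bochner_Integration.integral_cong) (simp_all add: right_diff_distrib sum_subtractf sum_distrib_left mult_ac)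
    also have "\<dots> = \<phi> x - \<phi> (x - z) - c"
      using i1 by (subst Bochner_Integration.integral_diff) (simp_all add: 1)
    finally show ?thesis by (simp add: c_def)
  qed
  have m: "(\<lambda>(x,t). F x t) \<in> borel_measurable (borel \<Otimes>\<^sub>M borel)"
  proof -
    have "continuous_on UNIV (\<lambda>p. F (fst p) (snd p))"
      unfolding F_def by (intro continuous_intros continuous_on_compose2[OF cont]) auto
    then have "(\<lambda>p. F (fst p) (snd p)) \<in> borel_measurable borel" by (rule borel_measurable_continuous_onI)
    then show ?thesis by (simp add: borel_prod split_beta')
  qed
  have bd: "in_Lp 2 (\<lambda>x. F x t) \<and> Lp_norm 2 (\<lambda>x. F x t) \<le> (\<Sum>k\<in>Basis. \<bar>z \<bullet> k\<bar> * A k)" if "indicator {0..1} t \<noteq> (0::real)" for t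
  proof
    have t: "0 \<le> t" "t \<le> 1" using that by (auto simp: indicator_def split: if_splits)
    show "in_Lp 2 (\<lambda>x. F x t)" unfolding F_def by (intro in_Lp_sum in_Lp_cmult Lt) auto
    have "Lp_norm 2 (\<lambda>x. F x t) \<le> (\<Sum>k\<in>Basis. Lp_norm 2 (\<lambda>x. (z \<bullet> k) * (pd k \<phi> (x - t *\<^sub>R z) - \<theta> * pd k \<phi> x)))"
      unfolding F_def by (intro Lp_norm_sum in_Lp_cmult Lt) auto
    also have "\<dots> \<le> (\<Sum>k\<in>Basis. \<bar>z \<bullet> k\<bar> * A k)"
      using A[OF _ t] by (intro sum_mono) (auto simp: Lp_norm_cmult intro!: mult_left_mono)
    finally show "Lp_norm 2 (\<lambda>x. F x t) \<le> (\<Sum>k\<in>Basis. \<bar>z \<bullet> k\<bar> * A k)" .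
  qed
  \<comment> \<open>The segment from x to x - z is treated as a superposition over t with the
    indicator of [0, 1] as kernel of mass one, so that the integral Minkowski inequality moves the
    norm under the integral.\<close>
  have k: "integrable lborel (indicator {0..1::real} :: real \<Rightarrow> real)" by (simp add: integrable_indicator_iff)
  note M = Minkowski_integral[OF k _ _ m bd]
  show "in_Lp 2 (\<lambda>x. \<phi> x - \<phi> (x - z) - \<theta> * (\<Sum>k\<in>Basis. (z \<bullet> k) * pd k \<phi> x))"
    unfolding eq by (rule M(2)) (auto intro!: sum_nonneg mult_nonneg_nonneg A0)
  have "Lp_norm 2 (\<lambda>x. LINT t|lborel. indicator {0..1} t * F x t) \<le> (LINT t|lborel. indicator {0..1::real} t) * (\<Sum>k\<in>Basis. \<bar>z \<bullet> k\<bar> * A k)"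
    by (rule M(3)) (auto intro!: sum_nonneg mult_nonneg_nonneg A0)
  then show "Lp_norm 2 (\<lambda>x. \<phi> x - \<phi> (x - z) - \<theta> * (\<Sum>k\<in>Basis. (z \<bullet> k) * pd k \<phi> x)) \<le> (\<Sum>k\<in>Basis. \<bar>z \<bullet> k\<bar> * A k)"
    unfolding eq by simp
qed

lemma Lp_tendsto_translate:
  assumes "Lp_tendsto r F f" "r \<ge> 1"
  shows "Lp_tendsto r (\<lambda>n x. F n (x - h)) (\<lambda>x. f (x - h))"
proof -
  note F = Lp_tendstoD[OF assms(1)]
  have "Lp_norm r (\<lambda>x. F n (x - h) - f (x - h)) = Lp_norm r (\<lambda>x. F n x - f x)" for n
    using Lp_norm_translate[OF Minkowski_diff(1)[OF F(1)[of n] F(2) assms(2)], of h] by simp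
  then show ?thesis using F in_Lp_translate[OF F(1)] in_Lp_translate[OF F(2)] by (auto simp: Lp_tendsto_def)
qed

lemma Lp_tendsto_diff:
  assumes "Lp_tendsto r F f" "Lp_tendsto r G g" "r \<ge> 1"
  shows "Lp_tendsto r (\<lambda>n x. F n x - G n x) (\<lambda>x. f x - g x)"
  using Lp_tendsto_add[OF assms(1) Lp_tendsto_cmult[OF assms(2), of "-1"] assms(3)] assms(3) by simp

lemma Lp_tendsto_AE_subseq2:
  assumes "Lp_tendsto r F f" "r \<ge> 1" "Lp_tendsto q G g" "q \<ge> 1"
  obtains s :: "nat \<Rightarrow> nat" where "strict_mono s" "AE x in lborel. (\<lambda>n. F (s n) x) \<longlonglongrightarrow> f x" "AE x in lborel. (\<lambda>n. G (s n) x) \<longlonglongrightarrow> g x"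
proof -
  obtain s where s: "strict_mono s" "AE x in lborel. (\<lambda>n. F (s n) x) \<longlonglongrightarrow> f x"
    using Lp_tendsto_AE_subseq[OF assms(1,2)] by blast
  obtain t where t: "strict_mono t" "AE x in lborel. (\<lambda>n. G (s (t n)) x) \<longlonglongrightarrow> g x"
    using Lp_tendsto_AE_subseq[OF Lp_tendsto_subseq[OF assms(3) s(1)] assms(4)] by blast
  have "AE x in lborel. (\<lambda>n. F (s (t n)) x) \<longlonglongrightarrow> f x"
    using s(2) by eventually_elim (use LIMSEQ_subseq_LIMSEQ[OF _ t(1)] in \<open>auto simp: o_def\<close>)
  with t s show ?thesis using that[of "\<lambda>n. s (t n)"] by (auto intro: strict_mono_compose[unfolded o_def] simp: strict_mono_def)
qed

text \<open>The approximants satisfy the premise on translations up to an error that tends to 0 with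
  the gradients. Differences converge in L^6 but the linear term in L^2, so the two are joined by
  almost everywhere convergence along a common subsequence and Fatou's lemma.\<close>

lemma difference_sobolev:
  fixes v :: "'a::euclidean_space \<Rightarrow> real"
  assumes ap: "sobolev_approx \<Phi> v g"
    and A: "\<And>k t. k \<in> Basis \<Longrightarrow> 0 \<le> t \<Longrightarrow> t \<le> 1 \<Longrightarrow> Lp_norm 2 (\<lambda>x. g k (x - t *\<^sub>R z) - \<theta> * g k x) \<le> A k"
  shows "in_Lp 2 (\<lambda>x. v x - v (x - z) - \<theta> * (\<Sum>k\<in>Basis. (z \<bullet> k) * g k x))"
    "Lp_norm 2 (\<lambda>x. v x - v (x - z) - \<theta> * (\<Sum>k\<in>Basis. (z \<bullet> k) * g k x)) \<le> (\<Sum>k\<in>Basis. \<bar>z \<bullet> k\<bar> * A k)"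
proof -
  note D = sobolev_approxD[OF ap]
  \<comment> \<open>The factor 1 + |\<theta>| counts the two places where d_k \<Phi>_n replaces g_k:
    once translated, which preserves the norm, and once multiplied by \<theta>.\<close>
  define B where "B n k = A k + (1 + \<bar>\<theta>\<bar>) * Lp_norm 2 (\<lambda>x. pd k (\<Phi> n) x - g k x)" for n k
  have Bn: "Lp_norm 2 (\<lambda>x. pd k (\<Phi> n) (x - t *\<^sub>R z) - \<theta> * pd k (\<Phi> n) x) \<le> B n k" if k: "k \<in> Basis" and t: "0 \<le> t" "t \<le> 1" for n k t
  proof -
    note Pk = Lp_tendstoD(1)[OF D(4)[OF k], of n] and gk = D(6)[OF k]
    have d: "in_Lp 2 (\<lambda>x. pd k (\<Phi> n) x - g k x)" using Pk gk by (intro Minkowski_diff) auto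
    have gt: "in_Lp 2 (\<lambda>x. g k (x - t *\<^sub>R z) - \<theta> * g k x)" by (intro Minkowski_diff in_Lp_translate in_Lp_cmult gk) auto
    have d1: "in_Lp 2 (\<lambda>x. pd k (\<Phi> n) (x - t *\<^sub>R z) - g k (x - t *\<^sub>R z))" using in_Lp_translate[OF d] .
    have d2: "in_Lp 2 (\<lambda>x. \<theta> * (pd k (\<Phi> n) x - g k x))" using in_Lp_cmult[OF d] .
    have "Lp_norm 2 (\<lambda>x. pd k (\<Phi> n) (x - t *\<^sub>R z) - \<theta> * pd k (\<Phi> n) x) =
       Lp_norm 2 (\<lambda>x. ((g k (x - t *\<^sub>R z) - \<theta> * g k x) + (pd k (\<Phi> n) (x - t *\<^sub>R z) - g k (x - t *\<^sub>R z))) - \<theta> * (pd k (\<Phi> n) x - g k x))"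
      by (simp add: algebra_simps)
    also have "\<dots> \<le> Lp_norm 2 (\<lambda>x. (g k (x - t *\<^sub>R z) - \<theta> * g k x) + (pd k (\<Phi> n) (x - t *\<^sub>R z) - g k (x - t *\<^sub>R z))) + Lp_norm 2 (\<lambda>x. \<theta> * (pd k (\<Phi> n) x - g k x))"
      by (intro Minkowski_diff(2) Minkowski(1) gt d1 d2) auto
    also have "Lp_norm 2 (\<lambda>x. (g k (x - t *\<^sub>R z) - \<theta> * g k x) + (pd k (\<Phi> n) (x - t *\<^sub>R z) - g k (x - t *\<^sub>R z)))
       \<le> Lp_norm 2 (\<lambda>x. g k (x - t *\<^sub>R z) - \<theta> * g k x) + Lp_norm 2 (\<lambda>x. pd k (\<Phi> n) (x - t *\<^sub>R z) - g k (x - t *\<^sub>R z))"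
      by (intro Minkowski(2) gt d1) auto
    also have "Lp_norm 2 (\<lambda>x. pd k (\<Phi> n) (x - t *\<^sub>R z) - g k (x - t *\<^sub>R z)) = Lp_norm 2 (\<lambda>x. pd k (\<Phi> n) x - g k x)"
      using Lp_norm_translate[OF d, of "t *\<^sub>R z"] by simp
    also have "Lp_norm 2 (\<lambda>x. \<theta> * (pd k (\<Phi> n) x - g k x)) = \<bar>\<theta>\<bar> * Lp_norm 2 (\<lambda>x. pd k (\<Phi> n) x - g k x)"
      by (rule Lp_norm_cmult) simp
    finally show ?thesis using A[OF k t] by (simp add: B_def algebra_simps)
  qed
  define E where "E n x = \<Phi> n x - \<Phi> n (x - z) - \<theta> * (\<Sum>k\<in>Basis. (z \<bullet> k) * pd k (\<Phi> n) x)" for n x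
  define e where "e x = v x - v (x - z) - \<theta> * (\<Sum>k\<in>Basis. (z \<bullet> k) * g k x)" for x
  have E: "in_Lp 2 (E n)" "Lp_norm 2 (E n) \<le> (\<Sum>k\<in>Basis. \<bar>z \<bullet> k\<bar> * B n k)" for n
    unfolding E_def using difference_Cc1[OF D(2) Bn] by auto
  have t6: "Lp_tendsto 6 (\<lambda>n x. \<Phi> n x - \<Phi> n (x - z)) (\<lambda>x. v x - v (x - z))"
    by (intro Lp_tendsto_diff Lp_tendsto_translate D) auto
  have t2: "Lp_tendsto 2 (\<lambda>n x. \<theta> * (\<Sum>k\<in>Basis. (z \<bullet> k) * pd k (\<Phi> n) x)) (\<lambda>x. \<theta> * (\<Sum>k\<in>Basis. (z \<bullet> k) * g k x))"
    by (intro Lp_tendsto_cmult Lp_tendsto_sum D) auto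
  obtain s where s: "strict_mono s" "AE x in lborel. (\<lambda>n. \<Phi> (s n) x - \<Phi> (s n) (x - z)) \<longlonglongrightarrow> v x - v (x - z)"
    "AE x in lborel. (\<lambda>n. \<theta> * (\<Sum>k\<in>Basis. (z \<bullet> k) * pd k (\<Phi> (s n)) x)) \<longlonglongrightarrow> \<theta> * (\<Sum>k\<in>Basis. (z \<bullet> k) * g k x)"
    using Lp_tendsto_AE_subseq2[OF t6 _ t2] by auto
  have lim: "AE x in lborel. (\<lambda>n. E (s n) x) \<longlonglongrightarrow> e x"
    using s(2,3) unfolding E_def e_def by eventually_elim (rule tendsto_diff)
  have m: "e \<in> borel_measurable borel"
    unfolding e_def using in_Lp_measurable[OF Lp_tendstoD(2)[OF t6]] in_Lp_measurable[OF Lp_tendstoD(2)[OF t2]] by measurable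
  define S where "S = (\<Sum>k\<in>Basis. \<bar>z \<bullet> k\<bar> * A k)"
  have "(\<lambda>n. \<Sum>k\<in>Basis. \<bar>z \<bullet> k\<bar> * B n k) \<longlonglongrightarrow> (\<Sum>k\<in>Basis. \<bar>z \<bullet> k\<bar> * (A k + (1 + \<bar>\<theta>\<bar>) * 0))"
    unfolding B_def by (intro tendsto_intros Lp_tendstoD(3)[OF D(4)])
  then have Blim: "(\<lambda>n. \<Sum>k\<in>Basis. \<bar>z \<bullet> k\<bar> * B n k) \<longlonglongrightarrow> S" by (simp add: S_def)
  have fin: "in_Lp 2 e \<and> Lp_norm 2 e \<le> S + d" if d: "d > 0" for d
  proof -
    obtain N where N: "\<And>n. n \<ge> N \<Longrightarrow> (\<Sum>k\<in>Basis. \<bar>z \<bullet> k\<bar> * B n k) < S + d"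
      using order_tendstoD(2)[OF Blim, of "S + d"] d by (auto simp: eventually_sequentially)
    have "s (n + N) \<ge> N" for n using strict_mono_imp_increasing[OF s(1), of "n + N"] by simp
    then have le: "Lp_norm 2 (E (s (n + N))) \<le> S + d" for n using E(2)[of "s (n + N)"] N[of "s (n + N)"] by fastforce
    have l: "AE x in lborel. (\<lambda>n. E (s (n + N)) x) \<longlonglongrightarrow> e x"
      using lim by eventually_elim (rule LIMSEQ_ignore_initial_segment)
    show ?thesis using Lp_Fatou[OF E(1) le _ m l] by simp
  qed
  show "in_Lp 2 (\<lambda>x. v x - v (x - z) - \<theta> * (\<Sum>k\<in>Basis. (z \<bullet> k) * g k x))" using fin[of 1] unfolding e_def by simp
  have "Lp_norm 2 e \<le> S" by (rule field_le_epsilon) (use fin in blast)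
  then show "Lp_norm 2 (\<lambda>x. v x - v (x - z) - \<theta> * (\<Sum>k\<in>Basis. (z \<bullet> k) * g k x)) \<le> (\<Sum>k\<in>Basis. \<bar>z \<bullet> k\<bar> * A k)"
    unfolding e_def S_def .
qed

lemma Holder3:
  assumes W: "in_Lp b W" and f: "in_Lp a f" and D: "in_Lp 2 D" and ab: "a \<ge> 1" "b \<ge> 1" "1/a + 1/b = 1/2"
  shows "integrable lborel (\<lambda>x. W x * (f x * D x))" "\<bar>LINT x|lborel. W x * (f x * D x)\<bar> \<le> Lp_norm b W * Lp_norm a f * Lp_norm 2 D"
    "(LINT x|lborel. \<bar>W x * (f x * D x)\<bar>) \<le> Lp_norm b W * Lp_norm a f * Lp_norm 2 D"
proof -
  have ba: "1/b + 1/a = 1/2" using ab by simp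
  have 1: "in_Lp 2 (\<lambda>x. W x * f x)" "Lp_norm 2 (\<lambda>x. W x * f x) \<le> Lp_norm b W * Lp_norm a f"
    using Holder[OF W f _ _ _ ba] ab by auto
  have eq: "W x * (f x * D x) = (W x * f x) * D x" for x by simp
  have le: "Lp_norm 2 (\<lambda>x. W x * f x) * Lp_norm 2 D \<le> Lp_norm b W * Lp_norm a f * Lp_norm 2 D"
    by (rule mult_right_mono[OF 1(2)]) simp
  show "integrable lborel (\<lambda>x. W x * (f x * D x))" unfolding eq by (rule Holder_integral[OF 1(1) D]) auto
  show "\<bar>LINT x|lborel. W x * (f x * D x)\<bar> \<le> Lp_norm b W * Lp_norm a f * Lp_norm 2 D"
    unfolding eq using Holder_integral(2)[OF 1(1) D] le by simp
  have "\<bar>LINT x|lborel. \<bar>W x * f x\<bar> * \<bar>D x\<bar>\<bar> \<le> Lp_norm 2 (\<lambda>x. \<bar>W x * f x\<bar>) * Lp_norm 2 (\<lambda>x. \<bar>D x\<bar>)"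
    by (rule Holder_integral(2)[OF in_Lp_abs[OF 1(1)] in_Lp_abs[OF D]]) auto
  moreover have "(LINT x|lborel. \<bar>(W x * f x) * D x\<bar>) = (LINT x|lborel. \<bar>W x * f x\<bar> * \<bar>D x\<bar>)"
    by (simp only: abs_mult)
  ultimately show "(LINT x|lborel. \<bar>W x * (f x * D x)\<bar>) \<le> Lp_norm b W * Lp_norm a f * Lp_norm 2 D"
    unfolding eq using le unfolding Lp_norm_abs by linarith
qed

lemma sum_abs_inner_le: "(\<Sum>k\<in>Basis. \<bar>z \<bullet> k\<bar> * a k) \<le> norm z * (\<Sum>k\<in>Basis. a k)"
  if "\<And>k. k \<in> Basis \<Longrightarrow> a k \<ge> 0" for z :: "'a::euclidean_space"
  unfolding sum_distrib_left using that by (intro sum_mono mult_right_mono Basis_le_norm) auto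

text \<open>The product W \<rho>(x - z) is only in L^2 and v only in L^6, so the two halves of the
  difference of v need not be integrable separately. The difference as a whole is in L^2 with norm
  at most |z| S, and this provides the integrable majorant on the product space.\<close>

lemma commutator_Fubini:
  fixes v :: "'a::euclidean_space \<Rightarrow> real"
  assumes ap: "sobolev_approx \<Phi> v g" and \<rho>: "in_Lp a \<rho>" and W: "in_Lp b W"
    and ab: "a \<ge> 1" "b \<ge> 1" "1/a + 1/b = 1/2"
    and k: "continuous_on UNIV k" "compact_support k"
  shows "integrable lborel (\<lambda>x. W x * (LINT z|lborel. k z * (\<rho> (x - z) * (v x - v (x - z)))))"
    "integrable lborel (\<lambda>z. k z * (LINT x|lborel. W x * (\<rho> (x - z) * (v x - v (x - z)))))"
    "(LINT x|lborel. W x * (LINT z|lborel. k z * (\<rho> (x - z) * (v x - v (x - z)))))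
      = (LINT z|lborel. k z * (LINT x|lborel. W x * (\<rho> (x - z) * (v x - v (x - z)))))"
proof -
  note D = sobolev_approxD[OF ap]
  define S where "S = (\<Sum>k\<in>Basis. Lp_norm 2 (g k))"
  have vd: "in_Lp 2 (\<lambda>x. v x - v (x - z))" "Lp_norm 2 (\<lambda>x. v x - v (x - z)) \<le> norm z * S" for z
    using difference_sobolev[OF ap, of z 0 "\<lambda>k. Lp_norm 2 (g k)"] Lp_norm_translate[OF D(6)]
      sum_abs_inner_le[of "\<lambda>k. Lp_norm 2 (g k)" z] by (auto simp: S_def)
  note [measurable] = in_Lp_measurable[OF \<rho>] in_Lp_measurable[OF W] in_Lp_measurable[OF D(5)] borel_measurable_continuous_onI[OF k(1)]
  have H: "integrable lborel (\<lambda>x. W x * (\<rho> (x - z) * (v x - v (x - z))))"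
    "(LINT x|lborel. \<bar>W x * (\<rho> (x - z) * (v x - v (x - z)))\<bar>) \<le> Lp_norm b W * Lp_norm a \<rho> * (norm z * S)" for z
  proof -
    show "integrable lborel (\<lambda>x. W x * (\<rho> (x - z) * (v x - v (x - z))))"
      by (rule Holder3(1)[OF W in_Lp_translate[OF \<rho>] vd(1) ab])
    have "Lp_norm b W * Lp_norm a \<rho> * Lp_norm 2 (\<lambda>x. v x - v (x - z)) \<le> Lp_norm b W * Lp_norm a \<rho> * (norm z * S)"
      by (intro mult_left_mono vd) auto
    then show "(LINT x|lborel. \<bar>W x * (\<rho> (x - z) * (v x - v (x - z)))\<bar>) \<le> Lp_norm b W * Lp_norm a \<rho> * (norm z * S)"
      using Holder3(3)[OF W in_Lp_translate[OF \<rho>] vd(1) ab, of z z] Lp_norm_translate[OF \<rho>, of z] by simp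
  qed
  let ?f = "\<lambda>z x. W x * (k z * (\<rho> (x - z) * (v x - v (x - z))))"
  have feq: "?f z x = k z * (W x * (\<rho> (x - z) * (v x - v (x - z))))" for z x by simp
  have I: "integrable (lborel \<Otimes>\<^sub>M lborel) (\<lambda>(z,x). ?f z x)"
  proof (rule lborel_pair.Fubini_integrable)
    show "AE z in lborel. integrable lborel (\<lambda>x. case (z, x) of (z, x) \<Rightarrow> ?f z x)"
      using H(1) by (auto simp: feq simp del: mult.left_commute)
    have "integrable lborel (\<lambda>z. Lp_norm b W * Lp_norm a \<rho> * S * (norm z * \<bar>k z\<bar>))"
      by (intro integrable_mult_right in_L1_integrable in_Lp_Cc continuous_intros k compact_support_mult(2) compact_support_subset[OF k(2)]) auto
    then show "integrable lborel (\<lambda>z. LINT x|lborel. norm (case (z, x) of (z, x) \<Rightarrow> ?f z x))"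
    proof (rule Bochner_Integration.integrable_bound)
      show "AE z in lborel. norm (LINT x|lborel. norm (case (z, x) of (z, x) \<Rightarrow> ?f z x)) \<le> norm (Lp_norm b W * Lp_norm a \<rho> * S * (norm z * \<bar>k z\<bar>))"
      proof (rule AE_I2)
        fix z
        have S0: "S \<ge> 0" unfolding S_def by (intro sum_nonneg) auto
        have "(LINT x|lborel. norm (case (z, x) of (z, x) \<Rightarrow> ?f z x)) = \<bar>k z\<bar> * (LINT x|lborel. \<bar>W x * (\<rho> (x - z) * (v x - v (x - z)))\<bar>)"
          by (simp only: prod.case feq real_norm_def abs_mult[of "k z"] integral_mult_right_zero)
        also have "\<dots> \<le> \<bar>k z\<bar> * (Lp_norm b W * Lp_norm a \<rho> * (norm z * S))" by (intro mult_left_mono H) auto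
        finally show "norm (LINT x|lborel. norm (case (z, x) of (z, x) \<Rightarrow> ?f z x)) \<le> norm (Lp_norm b W * Lp_norm a \<rho> * S * (norm z * \<bar>k z\<bar>))"
          using S0 by (simp add: abs_mult mult_ac)
      qed
    qed measurable
  qed measurable
  have 1: "(LINT z|lborel. ?f z x) = W x * (LINT z|lborel. k z * (\<rho> (x - z) * (v x - v (x - z))))" for x by simp
  have 2: "(LINT x|lborel. ?f z x) = k z * (LINT x|lborel. W x * (\<rho> (x - z) * (v x - v (x - z))))" for z
    unfolding feq by simp
  show "(LINT x|lborel. W x * (LINT z|lborel. k z * (\<rho> (x - z) * (v x - v (x - z)))))
      = (LINT z|lborel. k z * (LINT x|lborel. W x * (\<rho> (x - z) * (v x - v (x - z)))))"
    using lborel_pair.Fubini_integral[OF I] by (simp only: 1 2)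
  show "integrable lborel (\<lambda>z. k z * (LINT x|lborel. W x * (\<rho> (x - z) * (v x - v (x - z)))))"
    using lborel_pair.integrable_fst'[OF I] by (simp only: prod.case 2)
  have "integrable (lborel \<Otimes>\<^sub>M lborel) (\<lambda>(x,z). ?f z x)"
    using lborel_pair.integrable_product_swap[OF I] by (simp add: split_beta')
  from lborel_pair.integrable_fst'[OF this]
  show "integrable lborel (\<lambda>x. W x * (LINT z|lborel. k z * (\<rho> (x - z) * (v x - v (x - z)))))"
    by (simp only: prod.case 1)
qed

text \<open>The commutator lemma of DiPerna and Lions.  Only the size of the difference quotients of \<open>v\<close> enters,
  since \<open>|z| |\<nabla>\<eta>\<^sub>n(z)|\<close> stays bounded in \<open>L\<^sup>1\<close>; the first moments of \<open>\<nabla>\<eta>\<^sub>n\<close> identify the limit.\<close>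

lemma commutator_tendsto:
  fixes v :: "'a::euclidean_space \<Rightarrow> real"
  assumes ap: "sobolev_approx \<Phi> v g" and \<rho>: "in_Lp a \<rho>" and W: "Lp_tendsto b W w"
    and ab: "a \<ge> 1" "b \<ge> 1" "1/a + 1/b = 1/2" and j: "j \<in> Basis"
    and \<eta>: "\<And>n. \<eta> n \<in> Cc_inf" "\<And>n. (LINT x|lborel. \<eta> n x) = 1"
      "\<And>n x. \<eta> n x \<noteq> 0 \<Longrightarrow> norm x \<le> inverse (real (Suc n))"
      "\<And>n. (LINT x|lborel. norm x * \<bar>pd j (\<eta> n) x\<bar>) \<le> C"
  shows "(\<lambda>n. LINT x|lborel. W n x * (LINT z|lborel. pd j (\<eta> n) z * (\<rho> (x - z) * (v x - v (x - z)))))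
    \<longlonglongrightarrow> - (LINT x|lborel. w x * (\<rho> x * g j x))"
proof -
  note D = sobolev_approxD[OF ap] and Wt = Lp_tendstoD[OF W]
  define S where "S = (\<Sum>k\<in>Basis. Lp_norm 2 (g k))"
  have S0: "S \<ge> 0" unfolding S_def by (intro sum_nonneg) auto
  define L where "L k = (LINT x|lborel. w x * (\<rho> x * g k x))" for k
  define I where "I n z = (LINT x|lborel. W n x * (\<rho> (x - z) * (v x - v (x - z))))" for n z
  have vd: "in_Lp 2 (\<lambda>x. v x - v (x - z))" "Lp_norm 2 (\<lambda>x. v x - v (x - z)) \<le> norm z * S" for z
    using difference_sobolev[OF ap, of z 0 "\<lambda>k. Lp_norm 2 (g k)"] Lp_norm_translate[OF D(6)]
      sum_abs_inner_le[of "\<lambda>k. Lp_norm 2 (g k)" z] by (auto simp: S_def)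
  have C1: "Ck (Suc 0) (\<eta> n)" "compact_support (\<eta> n)" "\<eta> n \<in> Cc1" for n using Cc_infD[OF \<eta>(1)] Cc_inf_Cc1[OF \<eta>(1)] by auto
  have kc: "continuous_on UNIV (pd j (\<eta> n))" "compact_support (pd j (\<eta> n))" for n
    by (auto intro!: Ck_continuous[OF Ck_SucD(2)[OF C1(1) j]] compact_support_pd C1)
  have C0: "C \<ge> 0" by (rule order_trans[OF Bochner_Integration.integral_nonneg \<eta>(4)[of 0]]) simp
  have main: "\<exists>N. \<forall>n\<ge>N. \<bar>(LINT x|lborel. W n x * (LINT z|lborel. pd j (\<eta> n) z * (\<rho> (x - z) * (v x - v (x - z))))) + L j\<bar> \<le> e * C"
    if e: "e > 0" for e
  proof -
    \<comment> \<open>The coefficients of the three errors estimated below, with 1 added to allow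
      division by K.\<close>
    define K where "K = Lp_norm a \<rho> * S + Lp_norm b w * S + Lp_norm b w * Lp_norm a \<rho> * DIM('a) + 1"
    have K: "K > 0" unfolding K_def using S0 by (intro add_nonneg_pos add_nonneg_nonneg) auto
    define d where "d = e / K"
    have d: "d > 0" using e K by (simp add: d_def)
    obtain d1 where d1: "d1 > 0" "\<And>h. norm h < d1 \<Longrightarrow> Lp_norm a (\<lambda>x. \<rho> (x - h) - \<rho> x) < d"
      using Lp_translation_continuous[OF \<rho> ab(1) d] by blast
    have "\<exists>d2>0. \<forall>h. norm h < d2 \<longrightarrow> Lp_norm 2 (\<lambda>x. g k (x - h) - g k x) < d" if "k \<in> Basis" for k
      using Lp_translation_continuous[OF D(6)[OF that] _ d] by (metis one_le_numeral)
    then obtain d2 where d2: "\<And>k. k \<in> Basis \<Longrightarrow> d2 k > 0" "\<And>k h. k \<in> Basis \<Longrightarrow> norm h < d2 k \<Longrightarrow> Lp_norm 2 (\<lambda>x. g k (x - h) - g k x) < d"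
      by metis
    define d3 where "d3 = min d1 (Min (d2 ` Basis))"
    have d3: "d3 > 0" "d3 \<le> d1" "\<And>k. k \<in> Basis \<Longrightarrow> d3 \<le> d2 k" unfolding d3_def using d1(1) d2(1) by (auto simp: Min_gr_iff intro: min.coboundedI2)
    have "\<forall>\<^sub>F n in sequentially. inverse (real (Suc n)) < d3 \<and> Lp_norm b (\<lambda>x. W n x - w x) < d"
      using order_tendstoD(2)[OF inverse_Suc_seq(1) d3(1)] order_tendstoD(2)[OF Wt(3) d] by eventually_elim auto
    then obtain N where N: "\<And>n. n \<ge> N \<Longrightarrow> inverse (real (Suc n)) < d3 \<and> Lp_norm b (\<lambda>x. W n x - w x) < d"
      by (auto simp: eventually_sequentially)
    \<comment> \<open>On the support of the mollifier the inner integral is linear in z up to e |z|,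
      and the weight |z| is exactly what the gradient of the mollifier tolerates.\<close>
    have est: "\<bar>I n z - (\<Sum>k\<in>Basis. (z \<bullet> k) * L k)\<bar> \<le> e * norm z" if n: "n \<ge> N" and z: "norm z \<le> inverse (real (Suc n))" for n z
    proof -
      have z3: "norm z < d3" using N[OF n] z by linarith
      have tz: "norm (t *\<^sub>R z) < d3" if "0 \<le> t" "t \<le> 1" for t
        using z3 that mult_right_mono[OF that(2) norm_ge_zero[of z]] by simp
      have \<rho>z: "in_Lp a (\<lambda>x. \<rho> (x - z))" "Lp_norm a (\<lambda>x. \<rho> (x - z)) = Lp_norm a \<rho>" by (auto intro: in_Lp_translate Lp_norm_translate \<rho>)
      have \<rho>d: "in_Lp a (\<lambda>x. \<rho> (x - z) - \<rho> x)" "Lp_norm a (\<lambda>x. \<rho> (x - z) - \<rho> x) \<le> d"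
        using d1(2)[of z] z3 d3(2) ab by (auto intro!: Minkowski_diff \<rho>z \<rho>)
      have gd: "in_Lp 2 (\<lambda>x. v x - v (x - z) - (\<Sum>k\<in>Basis. (z \<bullet> k) * g k x))" "Lp_norm 2 (\<lambda>x. v x - v (x - z) - (\<Sum>k\<in>Basis. (z \<bullet> k) * g k x)) \<le> norm z * (DIM('a) * d)"
      proof -
        have h: "Lp_norm 2 (\<lambda>x. g k (x - t *\<^sub>R z) - 1 * g k x) \<le> d" if "k \<in> Basis" "0 \<le> t" "t \<le> 1" for k t
          using d2(2)[OF that(1), of "t *\<^sub>R z"] tz[OF that(2,3)] d3(3)[OF that(1)] by simp
        show "in_Lp 2 (\<lambda>x. v x - v (x - z) - (\<Sum>k\<in>Basis. (z \<bullet> k) * g k x))" using difference_sobolev(1)[OF ap h] by simp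
        have "Lp_norm 2 (\<lambda>x. v x - v (x - z) - (\<Sum>k\<in>Basis. (z \<bullet> k) * g k x)) \<le> (\<Sum>k\<in>Basis. \<bar>z \<bullet> k\<bar> * d)"
          using difference_sobolev(2)[OF ap h] by simp
        also have "\<dots> \<le> norm z * (DIM('a) * d)" using sum_abs_inner_le[of "\<lambda>_. d" z] d by simp
        finally show "Lp_norm 2 (\<lambda>x. v x - v (x - z) - (\<Sum>k\<in>Basis. (z \<bullet> k) * g k x)) \<le> norm z * (DIM('a) * d)" .
      qed
      have Wd: "in_Lp b (\<lambda>x. W n x - w x)" using Wt ab by (intro Minkowski_diff) auto
      \<comment> \<open>Three replacements, one at a time: W n by w, the translated \<rho> by
        \<rho>, and the difference of v by its differential. The first two errors carry a factor |z|
        from the difference of v, the third from the differential estimate.\<close>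
      note H1 = Holder3[OF Wd \<rho>z(1) vd(1)[of z] ab] and H2 = Holder3[OF Wt(2) \<rho>d(1) vd(1)[of z] ab] and H3 = Holder3[OF Wt(2) \<rho> gd(1) ab]
      have gk: "integrable lborel (\<lambda>x. w x * (\<rho> x * g k x))" if "k \<in> Basis" for k by (rule Holder3(1)[OF Wt(2) \<rho> D(6)[OF that] ab])
      have i0: "integrable lborel (\<lambda>x. (\<Sum>k\<in>Basis. (z \<bullet> k) * (w x * (\<rho> x * g k x))))"
        using gk by (intro Bochner_Integration.integrable_sum integrable_mult_right) auto
      have "(\<Sum>k\<in>Basis. (z \<bullet> k) * L k) = (LINT x|lborel. (\<Sum>k\<in>Basis. (z \<bullet> k) * (w x * (\<rho> x * g k x))))"
        unfolding L_def using gk by (subst Bochner_Integration.integral_sum) auto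
      then have "I n z - (\<Sum>k\<in>Basis. (z \<bullet> k) * L k) = (LINT x|lborel. W n x * (\<rho> (x - z) * (v x - v (x - z))) - (\<Sum>k\<in>Basis. (z \<bullet> k) * (w x * (\<rho> x * g k x))))"
        unfolding I_def using Holder3(1)[OF Wt(1)[of n] \<rho>z(1) vd(1)[of z] ab] i0 by simp
      also have "\<dots> = (LINT x|lborel. (W n x - w x) * (\<rho> (x - z) * (v x - v (x - z))) + w x * ((\<rho> (x - z) - \<rho> x) * (v x - v (x - z)))
           + w x * (\<rho> x * (v x - v (x - z) - (\<Sum>k\<in>Basis. (z \<bullet> k) * g k x))))"
      proof (rule Bochner_Integration.integral_cong[OF refl])
        fix x
        have "(\<Sum>k\<in>Basis. (z \<bullet> k) * (w x * (\<rho> x * g k x))) = w x * (\<rho> x * (\<Sum>k\<in>Basis. (z \<bullet> k) * g k x))"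
          by (simp add: sum_distrib_left mult_ac)
        then show "W n x * (\<rho> (x - z) * (v x - v (x - z))) - (\<Sum>k\<in>Basis. (z \<bullet> k) * (w x * (\<rho> x * g k x))) =
          (W n x - w x) * (\<rho> (x - z) * (v x - v (x - z))) + w x * ((\<rho> (x - z) - \<rho> x) * (v x - v (x - z)))
           + w x * (\<rho> x * (v x - v (x - z) - (\<Sum>k\<in>Basis. (z \<bullet> k) * g k x)))"
          by (simp add: algebra_simps)
      qed
      also have "\<dots> = (LINT x|lborel. (W n x - w x) * (\<rho> (x - z) * (v x - v (x - z)))) + (LINT x|lborel. w x * ((\<rho> (x - z) - \<rho> x) * (v x - v (x - z))))
           + (LINT x|lborel. w x * (\<rho> x * (v x - v (x - z) - (\<Sum>k\<in>Basis. (z \<bullet> k) * g k x))))"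
        using H1(1) H2(1) H3(1) by simp
      finally have Ieq: "I n z - (\<Sum>k\<in>Basis. (z \<bullet> k) * L k) = (LINT x|lborel. (W n x - w x) * (\<rho> (x - z) * (v x - v (x - z)))) + (LINT x|lborel. w x * ((\<rho> (x - z) - \<rho> x) * (v x - v (x - z))))
           + (LINT x|lborel. w x * (\<rho> x * (v x - v (x - z) - (\<Sum>k\<in>Basis. (z \<bullet> k) * g k x))))" .
      have "\<bar>I n z - (\<Sum>k\<in>Basis. (z \<bullet> k) * L k)\<bar> \<le> d * Lp_norm a \<rho> * (norm z * S) + Lp_norm b w * d * (norm z * S) + Lp_norm b w * Lp_norm a \<rho> * (norm z * (DIM('a) * d))"
      proof -
        have "Lp_norm b (\<lambda>x. W n x - w x) * Lp_norm a (\<lambda>x. \<rho> (x - z)) * Lp_norm 2 (\<lambda>x. v x - v (x - z)) \<le> d * Lp_norm a \<rho> * (norm z * S)"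
          unfolding \<rho>z(2) using N[OF n] vd(2)[of z] d by (intro mult_mono) auto
        moreover have "Lp_norm b w * Lp_norm a (\<lambda>x. \<rho> (x - z) - \<rho> x) * Lp_norm 2 (\<lambda>x. v x - v (x - z)) \<le> Lp_norm b w * d * (norm z * S)"
          using \<rho>d(2) vd(2)[of z] d by (intro mult_mono) auto
        moreover have "Lp_norm b w * Lp_norm a \<rho> * Lp_norm 2 (\<lambda>x. v x - v (x - z) - (\<Sum>k\<in>Basis. (z \<bullet> k) * g k x)) \<le> Lp_norm b w * Lp_norm a \<rho> * (norm z * (DIM('a) * d))"
          by (intro mult_left_mono gd(2)) auto
        ultimately show ?thesis using H1(2) H2(2) H3(2) unfolding Ieq by linarith
      qed
      also have "\<dots> = d * (K - 1) * norm z" by (simp add: K_def algebra_simps)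
      also have "\<dots> \<le> d * K * norm z" using d by (intro mult_right_mono) auto
      also have "\<dots> = e * norm z" using K by (simp add: d_def)
      finally show ?thesis .
    qed
    show ?thesis
    proof (intro exI[of _ N] allI impI)
      fix n assume n: "n \<ge> N"
      note F = commutator_Fubini[OF ap \<rho> Wt(1)[of n] ab kc[of n]]
      have im: "integrable lborel (\<lambda>z. pd j (\<eta> n) z * (z \<bullet> k))" for k
        by (intro in_L1_integrable in_Lp_Cc continuous_intros kc compact_support_mult(1)) auto
      have isum: "integrable lborel (\<lambda>z. \<Sum>k\<in>Basis. L k * (pd j (\<eta> n) z * (z \<bullet> k)))"
        using im by (intro Bochner_Integration.integrable_sum integrable_mult_right) auto
      have "(LINT z|lborel. (\<Sum>k\<in>Basis. L k * (pd j (\<eta> n) z * (z \<bullet> k)))) = (\<Sum>k\<in>Basis. L k * (LINT z|lborel. pd j (\<eta> n) z * (z \<bullet> k)))"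
        using im by (subst Bochner_Integration.integral_sum) auto
      also have "\<dots> = (\<Sum>k\<in>Basis. L k * (if j = k then - 1 else 0))"
        using moment_pd[OF C1(3) j] \<eta>(2) by (intro sum.cong) auto
      also have "\<dots> = (\<Sum>k\<in>Basis. if k = j then - L j else 0)" by (intro sum.cong) auto
      also have "\<dots> = - L j" using j by simp
      \<comment> \<open>Only the j-th first moment of d_j \<eta>_n is nonzero, and it is -1; the
        linear part of the inner integral therefore yields -L j exactly, for every n.\<close>
      finally have mom: "(LINT z|lborel. (\<Sum>k\<in>Basis. L k * (pd j (\<eta> n) z * (z \<bullet> k)))) = - L j" .
      have iI: "integrable lborel (\<lambda>z. pd j (\<eta> n) z * I n z)" using F(2) unfolding I_def .
      have "(LINT x|lborel. W n x * (LINT z|lborel. pd j (\<eta> n) z * (\<rho> (x - z) * (v x - v (x - z))))) + L j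
        = (LINT z|lborel. pd j (\<eta> n) z * I n z) - (LINT z|lborel. (\<Sum>k\<in>Basis. L k * (pd j (\<eta> n) z * (z \<bullet> k))))"
        unfolding F(3) mom I_def by simp
      also have "\<dots> = (LINT z|lborel. pd j (\<eta> n) z * I n z - (\<Sum>k\<in>Basis. L k * (pd j (\<eta> n) z * (z \<bullet> k))))"
        using iI isum by simp
      finally have "\<bar>(LINT x|lborel. W n x * (LINT z|lborel. pd j (\<eta> n) z * (\<rho> (x - z) * (v x - v (x - z))))) + L j\<bar>
        = \<bar>LINT z|lborel. pd j (\<eta> n) z * I n z - (\<Sum>k\<in>Basis. L k * (pd j (\<eta> n) z * (z \<bullet> k)))\<bar>" by simp
      also have "\<dots> \<le> (LINT z|lborel. \<bar>pd j (\<eta> n) z * I n z - (\<Sum>k\<in>Basis. L k * (pd j (\<eta> n) z * (z \<bullet> k)))\<bar>)"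
        by (rule integral_abs_bound)
      also have "\<dots> \<le> (LINT z|lborel. e * (norm z * \<bar>pd j (\<eta> n) z\<bar>))"
      proof (rule integral_mono)
        show "integrable lborel (\<lambda>z. \<bar>pd j (\<eta> n) z * I n z - (\<Sum>k\<in>Basis. L k * (pd j (\<eta> n) z * (z \<bullet> k)))\<bar>)"
          using iI isum by (intro Bochner_Integration.integrable_abs Bochner_Integration.integrable_diff)
        show "integrable lborel (\<lambda>z. e * (norm z * \<bar>pd j (\<eta> n) z\<bar>))"
          by (intro integrable_mult_right in_L1_integrable in_Lp_Cc continuous_intros kc compact_support_mult(2) compact_support_subset[OF kc(2)]) auto
        fix z
        show "\<bar>pd j (\<eta> n) z * I n z - (\<Sum>k\<in>Basis. L k * (pd j (\<eta> n) z * (z \<bullet> k)))\<bar> \<le> e * (norm z * \<bar>pd j (\<eta> n) z\<bar>)"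
        proof (cases "pd j (\<eta> n) z = 0")
          case False
          have "norm z \<le> inverse (real (Suc n))" by (rule pd_support[OF \<eta>(3) False])
          from est[OF n this] have "\<bar>pd j (\<eta> n) z\<bar> * \<bar>I n z - (\<Sum>k\<in>Basis. (z \<bullet> k) * L k)\<bar> \<le> \<bar>pd j (\<eta> n) z\<bar> * (e * norm z)"
            by (intro mult_left_mono) auto
          then show ?thesis by (simp add: abs_mult[symmetric] right_diff_distrib sum_distrib_left mult_ac)
        qed (use e in simp)
      qed
      also have "\<dots> = e * (LINT z|lborel. norm z * \<bar>pd j (\<eta> n) z\<bar>)" by simp
      also have "\<dots> \<le> e * C" using e by (intro mult_left_mono \<eta>) auto
      finally show "\<bar>(LINT x|lborel. W n x * (LINT z|lborel. pd j (\<eta> n) z * (\<rho> (x - z) * (v x - v (x - z))))) + L j\<bar> \<le> e * C" .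
    qed
  qed
  show ?thesis
  proof (rule LIMSEQ_I)
    fix r :: real assume r: "r > 0"
    have "r / (C + 1) * C < r" using r C0 by (simp add: field_simps)
    moreover obtain N where "\<And>n. n \<ge> N \<Longrightarrow> \<bar>(LINT x|lborel. W n x * (LINT z|lborel. pd j (\<eta> n) z * (\<rho> (x - z) * (v x - v (x - z))))) + L j\<bar> \<le> r / (C + 1) * C"
      using main[of "r / (C + 1)"] r C0 by auto
    ultimately show "\<exists>N. \<forall>n\<ge>N. norm ((LINT x|lborel. W n x * (LINT z|lborel. pd j (\<eta> n) z * (\<rho> (x - z) * (v x - v (x - z))))) - - (LINT x|lborel. w x * (\<rho> x * g j x))) < r"
      unfolding L_def[symmetric] by (intro exI[of _ N]) fastforce
  qed
qed

section \<open>Renormalization and the energy identity\<close>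

text \<open>Domination by |k| * |f| extends Young's bound to signed kernels, as needed for
  derivatives of mollifiers.\<close>

lemma conv_in_Lp:
  fixes k f :: "'a::euclidean_space \<Rightarrow> real"
  assumes k: "integrable lborel k" and f: "in_Lp r f" and r: "r \<ge> 1"
  shows "in_Lp r (conv k f)"
proof -
  note [measurable] = borel_measurable_integrable[OF k] in_Lp_measurable[OF f]
  have 1: "in_Lp r (conv (\<lambda>z. \<bar>k z\<bar>) (\<lambda>x. \<bar>f x\<bar>))"
    using k r by (intro Young_convolution(2) in_Lp_abs f) auto
  show ?thesis
  proof (rule in_Lp_bound(1)[OF 1])
    show "conv k f \<in> borel_measurable borel" unfolding conv_def by measurable
    show "AE x in lborel. \<bar>conv k f x\<bar> \<le> \<bar>conv (\<lambda>z. \<bar>k z\<bar>) (\<lambda>x. \<bar>f x\<bar>) x\<bar>"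
    proof (rule AE_I2)
      fix x
      have "\<bar>conv k f x\<bar> \<le> (LINT z|lborel. \<bar>k z * f (x - z)\<bar>)" unfolding conv_def by (rule integral_abs_bound)
      also have "\<dots> = conv (\<lambda>z. \<bar>k z\<bar>) (\<lambda>x. \<bar>f x\<bar>) x" by (simp add: conv_def abs_mult)
      finally show "\<bar>conv k f x\<bar> \<le> \<bar>conv (\<lambda>z. \<bar>k z\<bar>) (\<lambda>x. \<bar>f x\<bar>) x\<bar>" by simp
    qed
  qed (use r in simp)
qed

text \<open>The mean value theorem; adding the powers at both ends bounds the one at the
  intermediate point whichever end is larger.\<close>

lemma powr_diff_le:
  fixes a b s :: real
  assumes "a \<ge> 0" "b \<ge> 0" "s > 1"
  shows "\<bar>a powr s - b powr s\<bar> \<le> s * (\<bar>a - b\<bar> * (a powr (s - 1) + b powr (s - 1)))"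
proof -
  have *: "\<bar>b powr s - a powr s\<bar> \<le> s * (\<bar>b - a\<bar> * (a powr (s - 1) + b powr (s - 1)))" if ab: "0 \<le> a" "a < b" for a b :: real
  proof -
    have "\<exists>l z. a < z \<and> z < b \<and> ((\<lambda>x. x powr s) has_field_derivative l) (at z) \<and> b powr s - a powr s = (b - a) * l"
    proof (rule MVT[OF ab(2)])
      show "continuous_on {a..b} (\<lambda>x. x powr s)" using ab assms(3) by (intro continuous_on_powr') (auto intro: continuous_intros)
      show "(\<lambda>x. x powr s) differentiable (at x)" if "a < x" "x < b" for x
        using has_real_derivative_powr[of x s] that ab by (auto simp: real_differentiable_def)
    qed
    then obtain l z where z: "a < z" "z < b" "((\<lambda>x. x powr s) has_field_derivative l) (at z)" "b powr s - a powr s = (b - a) * l" by blast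
    have "l = s * z powr (s - 1)" using DERIV_unique[OF z(3) has_real_derivative_powr] z ab by simp
    moreover have "z powr (s - 1) \<le> b powr (s - 1)" "a powr s \<le> b powr s" using z ab assms(3) by (auto intro!: powr_mono2)
    moreover have "a powr (s - 1) \<ge> 0" by simp
    ultimately have "\<bar>b powr s - a powr s\<bar> = (b - a) * (s * z powr (s - 1))" "z powr (s - 1) \<le> a powr (s - 1) + b powr (s - 1)"
      using z(4) by (simp, linarith)
    then show ?thesis using ab assms(3) by (simp add: mult_left_mono mult.left_commute)
  qed
  consider "a < b" | "b < a" | "a = b" by linarith
  then show ?thesis
  proof cases
    case 1 then show ?thesis using *[OF assms(1) 1] by (simp add: abs_minus_commute)
  next
    case 2 then show ?thesis using *[OF assms(2) 2] by (simp add: add.commute)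
  qed simp
qed

lemma in_Lp_powr_nonneg:
  assumes "in_Lp r f" "s > 0" "\<And>x. f x \<ge> 0"
  shows "in_Lp (r / s) (\<lambda>x. f x powr s)"
  using in_Lp_powr[OF assms(1,2)] assms(3) by simp

lemma Lp_norm_powr_nonneg:
  assumes "r > 0" "s > 0" "\<And>x. f x \<ge> 0"
  shows "Lp_norm (r / s) (\<lambda>x. f x powr s) = Lp_norm r f powr s"
  using Lp_norm_powr_fun[OF assms(1,2), of f] assms(3) by simp

text \<open>The increment bound \<open>powr_diff_le\<close> splits the error into F - f in L^r and
  (s-1)-st powers in L^(r/(s-1)), and Hoelder's inequality recombines them to L^(r/s).\<close>

lemma Lp_tendsto_powr:
  assumes F: "Lp_tendsto r F f" and nn: "\<And>n x. F n x \<ge> 0" "\<And>x. f x \<ge> 0" and s: "s > 1" "s \<le> r"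
  shows "Lp_tendsto (r / s) (\<lambda>n x. F n x powr s) (\<lambda>x. f x powr s)"
  unfolding Lp_tendsto_def
proof (intro conjI allI)
  note Ft = Lp_tendstoD[OF F]
  have pos: "r / s \<ge> 1" "r / s > 0" "r > 0" "r / (s - 1) > 0" "r / (s - 1) \<ge> 1" "1 / r + 1 / (r / (s - 1)) = 1 / (r / s)" using s by (auto simp: field_simps)
  show L: "in_Lp (r / s) (\<lambda>x. F n x powr s)" for n using Ft nn s by (intro in_Lp_powr_nonneg) auto
  show l: "in_Lp (r / s) (\<lambda>x. f x powr s)" using Ft nn s by (intro in_Lp_powr_nonneg) auto
  show "(\<lambda>n. Lp_norm (r / s) (\<lambda>x. F n x powr s - f x powr s)) \<longlonglongrightarrow> 0"
  proof (rule Lim_null_comparison)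
    have "(\<lambda>n. Lp_norm r (F n) powr (s - 1)) \<longlonglongrightarrow> Lp_norm r f powr (s - 1)"
      using s by (intro tendsto_powr' Lp_tendsto_norm F tendsto_const) (auto intro!: always_eventually)
    then have "(\<lambda>n. s * (Lp_norm r (\<lambda>x. F n x - f x) * (Lp_norm r (F n) powr (s - 1) + Lp_norm r f powr (s - 1)))) \<longlonglongrightarrow> s * (0 * (Lp_norm r f powr (s - 1) + Lp_norm r f powr (s - 1)))"
      by (intro tendsto_mult tendsto_add tendsto_const Ft(3))
    then show "(\<lambda>n. s * (Lp_norm r (\<lambda>x. F n x - f x) * (Lp_norm r (F n) powr (s - 1) + Lp_norm r f powr (s - 1)))) \<longlonglongrightarrow> 0" by simp
    show "\<forall>\<^sub>F n in sequentially. norm (Lp_norm (r / s) (\<lambda>x. F n x powr s - f x powr s)) \<le> s * (Lp_norm r (\<lambda>x. F n x - f x) * (Lp_norm r (F n) powr (s - 1) + Lp_norm r f powr (s - 1)))"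
    proof (rule always_eventually, rule allI)
      fix n
      have d: "in_Lp r (\<lambda>x. F n x - f x)" using Ft s by (intro Minkowski_diff) auto
      have p1: "in_Lp (r / (s - 1)) (\<lambda>x. F n x powr (s - 1))" and p2: "in_Lp (r / (s - 1)) (\<lambda>x. f x powr (s - 1))"
        using Ft nn s by (auto intro!: in_Lp_powr_nonneg)
      have p: "in_Lp (r / (s - 1)) (\<lambda>x. F n x powr (s - 1) + f x powr (s - 1))" using Minkowski(1)[OF p1 p2 pos(5)] .
      have "Lp_norm (r / (s - 1)) (\<lambda>x. F n x powr (s - 1) + f x powr (s - 1)) \<le> Lp_norm (r / (s - 1)) (\<lambda>x. F n x powr (s - 1)) + Lp_norm (r / (s - 1)) (\<lambda>x. f x powr (s - 1))"
        by (rule Minkowski(2)[OF p1 p2 pos(5)])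
      also have "\<dots> = Lp_norm r (F n) powr (s - 1) + Lp_norm r f powr (s - 1)"
        using Lp_norm_powr_nonneg[of r "s - 1" "F n"] Lp_norm_powr_nonneg[of r "s - 1" f] nn s by simp
      finally have pn: "Lp_norm (r / (s - 1)) (\<lambda>x. F n x powr (s - 1) + f x powr (s - 1)) \<le> Lp_norm r (F n) powr (s - 1) + Lp_norm r f powr (s - 1)" .
      note H = Holder[OF in_Lp_abs[OF d] p pos(3,4,2,6)]
      have ptw: "AE x in lborel. \<bar>F n x powr s - f x powr s\<bar> \<le> \<bar>s * (\<bar>F n x - f x\<bar> * (F n x powr (s - 1) + f x powr (s - 1)))\<bar>"
        using powr_diff_le[OF nn(1) nn(2) s(1)] by (intro AE_I2) (rule order_trans[OF _ abs_ge_self])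
      have "Lp_norm (r / s) (\<lambda>x. F n x powr s - f x powr s) \<le> Lp_norm (r / s) (\<lambda>x. s * (\<bar>F n x - f x\<bar> * (F n x powr (s - 1) + f x powr (s - 1))))"
        by (rule in_Lp_bound(2)[OF in_Lp_cmult[OF H(1)] _ ptw]) (use pos in_Lp_measurable[OF L[of n]] in_Lp_measurable[OF l] in auto)
      also have "\<dots> = s * Lp_norm (r / s) (\<lambda>x. \<bar>F n x - f x\<bar> * (F n x powr (s - 1) + f x powr (s - 1)))"
        using pos s by (simp add: Lp_norm_cmult)
      also have "\<dots> \<le> s * (Lp_norm r (\<lambda>x. F n x - f x) * (Lp_norm r (F n) powr (s - 1) + Lp_norm r f powr (s - 1)))"
        using s by (intro mult_left_mono order_trans[OF H(2)] mult_mono pn) (auto simp: Lp_norm_abs)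
      finally show "norm (Lp_norm (r / s) (\<lambda>x. F n x powr s - f x powr s)) \<le> s * (Lp_norm r (\<lambda>x. F n x - f x) * (Lp_norm r (F n) powr (s - 1) + Lp_norm r f powr (s - 1)))"
        by simp
    qed
  qed
qed

text \<open>The absolute value makes the derivative at \<open>0\<close> two-sided.\<close>

lemma DERIV_abs_powr:
  assumes "t \<ge> 0" "s > 1"
  shows "((\<lambda>t::real. \<bar>t\<bar> powr s) has_field_derivative s * t powr (s - 1)) (at t)"
proof (cases "t = 0")
  case False
  then have t: "t > 0" using assms by simp
  show ?thesis
    by (rule has_field_derivative_transform_within_open[OF has_real_derivative_powr[OF t], of "{0<..}"]) (use t in auto)
next
  case True
  have "((\<lambda>h::real. (\<bar>0 + h\<bar> powr s - \<bar>0\<bar> powr s) / h) \<longlongrightarrow> 0) (at 0)"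
  proof (rule Lim_null_comparison)
    have "((\<lambda>h::real. \<bar>h\<bar> powr (s - 1)) \<longlongrightarrow> \<bar>0\<bar> powr (s - 1)) (at 0)"
      using assms by (intro tendsto_powr' tendsto_intros) (auto intro!: always_eventually)
    then show "((\<lambda>h::real. \<bar>h\<bar> powr (s - 1)) \<longlongrightarrow> 0) (at 0)" by simp
    show "\<forall>\<^sub>F h in at (0::real). norm ((\<bar>0 + h\<bar> powr s - \<bar>0\<bar> powr s) / h) \<le> \<bar>h\<bar> powr (s - 1)"
    proof (rule eventually_at_filter[THEN iffD2, OF always_eventually], intro allI impI)
      fix h :: real assume "h \<noteq> 0"
      then show "norm ((\<bar>0 + h\<bar> powr s - \<bar>0\<bar> powr s) / h) \<le> \<bar>h\<bar> powr (s - 1)"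
        using powr_diff[of "\<bar>h\<bar>" s 1] by (simp add: abs_divide)
    qed
  qed
  then show ?thesis using True by (simp add: DERIV_def)
qed

lemma Ck1_powr:
  fixes f :: "'a::euclidean_space \<Rightarrow> real"
  assumes f: "Ck (Suc 0) f" "\<And>x. f x \<ge> 0" and s: "s > 1"
  shows "Ck (Suc 0) (\<lambda>x. f x powr s)" "pd i (\<lambda>x. f x powr s) x = s * f x powr (s - 1) * pd i f x"
proof -
  have D: "((\<lambda>x. f x powr s) has_derivative (\<lambda>h. s * f x powr (s - 1) * frechet_derivative f (at x) h)) (at x)" for x
  proof -
    from diff_chain_at[OF Ck_SucD(1)[OF f(1)] DERIV_abs_powr[OF f(2) s, THEN has_field_derivative_imp_has_derivative], of x]
    show ?thesis using f(2) by (simp add: o_def)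
  qed
  show "pd i (\<lambda>x. f x powr s) x = s * f x powr (s - 1) * pd i f x" using frechet_derivative_eq[OF D] by simp
  show "Ck (Suc 0) (\<lambda>x. f x powr s)"
  proof (rule Ck_SucI[OF D])
    fix i :: 'a assume i: "i \<in> Basis"
    have "continuous_on UNIV (\<lambda>x. f x powr (s - 1))"
      using f(2) s Ck_continuous[OF f(1)] by (intro continuous_on_powr') (auto intro: continuous_intros)
    then show "Ck 0 (\<lambda>x. s * f x powr (s - 1) * pd i f x)"
      using Ck_continuous[OF Ck_SucD(2)[OF f(1) i]] by (auto intro!: continuous_intros)
  qed
qed

lemma integrable_conv':
  fixes k f :: "'a::euclidean_space \<Rightarrow> real"
  assumes "continuous_on UNIV k" "compact_support k" "locally_integrable f"
  shows "integrable lborel (\<lambda>z. k z * f (x - z))"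
proof -
  note [measurable] = borel_measurable_continuous_onI[OF assms(1)] locally_integrable_measurable[OF assms(3)]
  have "(\<lambda>z. k z * f (x - z)) \<in> borel_measurable borel" by measurable
  from integral_lborel_reflect(2)[OF this, of x] show ?thesis using integrable_conv[OF assms, of x] by simp
qed

text \<open>Write P for the sum. The mollified continuity equation says that u . grad r_n equals a
  commutator. Multiplied by r_n^(\<gamma>-1), the left side integrates to -1/\<gamma> times the
  integral of r_n^\<gamma> div u, with limit -P/\<gamma>, while the commutator has limit -P. So P =
  P/\<gamma>, and \<gamma> > 1 forces P = 0.\<close>

lemma pressure_divergence_integral_eq_0:
  fixes \<rho> :: "'a::euclidean_space \<Rightarrow> real"
  assumes ap: "\<And>j. j \<in> Basis \<Longrightarrow> sobolev_approx (\<Phi> j) (u j) (J j)"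
    and \<rho>: "in_Lp 6 \<rho>" "in_Lp (2 * \<gamma>) \<rho>" "\<And>x. \<rho> x \<ge> 0" and \<gamma>: "\<gamma> \<ge> 6"
    and cont: "\<And>\<phi>. \<phi> \<in> Cc_inf \<Longrightarrow> (\<Sum>j\<in>Basis. LINT x|lborel. \<rho> x * u j x * pd j \<phi> x) = 0"
  shows "(\<Sum>j\<in>Basis. LINT x|lborel. \<rho> x powr \<gamma> * J j j x) = 0"
proof -
  obtain \<eta> :: "nat \<Rightarrow> 'a \<Rightarrow> real" and C where
    \<eta>: "\<And>n. \<eta> n \<in> Cc_inf" "\<And>n x. \<eta> n x \<ge> 0" "\<And>n. (LINT x|lborel. \<eta> n x) = 1"
    "\<And>n x. \<eta> n x \<noteq> 0 \<Longrightarrow> norm x \<le> inverse (real (Suc n))"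
    "\<And>n i. i \<in> Basis \<Longrightarrow> (LINT x|lborel. norm x * \<bar>pd i (\<eta> n) x\<bar>) \<le> C"
    using ex_mollifier by blast
  note A = sobolev_approxD[OF ap]
  define r where "r n = conv (\<eta> n) \<rho>" for n
  define W where "W n x = r n x powr (\<gamma> - 1)" for n x
  have C1: "Ck (Suc 0) (\<eta> n)" "compact_support (\<eta> n)" "\<eta> n \<in> Cc1" for n
    using Cc_infD[OF \<eta>(1)] Cc_inf_Cc1[OF \<eta>(1)] by auto
  have ec: "continuous_on UNIV (\<eta> n)" for n by (rule Ck_continuous[OF C1(1)])
  have kc: "continuous_on UNIV (pd j (\<eta> n))" "compact_support (pd j (\<eta> n))" if "j \<in> Basis" for j n
    using that by (auto intro!: Ck_continuous[OF Ck_SucD(2)[OF C1(1)]] compact_support_pd C1)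
  have ei: "integrable lborel (\<eta> n)" for n by (intro in_L1_integrable Cc1_in_Lp(1) C1) simp
  have pei: "j \<in> Basis \<Longrightarrow> integrable lborel (pd j (\<eta> n))" for j n by (intro in_L1_integrable Cc1_in_Lp(2) C1) simp_all
  have \<rho>in: "in_Lp s \<rho>" if "6 \<le> s" "s \<le> 2 * \<gamma>" for s by (rule in_Lp_interpolate[OF \<rho>(1,2) that]) simp
  have rin: "in_Lp s (r n)" if "6 \<le> s" "s \<le> 2 * \<gamma>" for s n unfolding r_def using that by (intro conv_in_Lp ei \<rho>in) auto
  have r0: "r n x \<ge> 0" for n x unfolding r_def conv_def using \<eta>(2) \<rho>(3) by simp
  have \<rho>l: "locally_integrable \<rho>" by (rule in_Lp_locally_integrable[OF \<rho>(1)]) simp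
  have \<rho>u: "in_Lp 3 (\<lambda>x. \<rho> x * u j x)" if "j \<in> Basis" for j by (rule Holder(1)[OF \<rho>(1) A(5)[OF that]]) auto
  have \<rho>ul: "j \<in> Basis \<Longrightarrow> locally_integrable (\<lambda>x. \<rho> x * u j x)" for j by (rule in_Lp_locally_integrable[OF \<rho>u]) auto
  have rC: "Ck (Suc 0) (r n)" for n unfolding r_def by (rule Ck_conv[OF C1(1,2) \<rho>l])
  have pr: "j \<in> Basis \<Longrightarrow> pd j (r n) x = conv (pd j (\<eta> n)) \<rho> x" for j n x unfolding r_def by (rule pd_conv[OF C1(3) \<rho>l])
  have prin: "in_Lp s (pd j (r n))" if "6 \<le> s" "s \<le> 2 * \<gamma>" "j \<in> Basis" for s j n
    using conv_in_Lp[OF pei[OF that(3)] \<rho>in[OF that(1,2)], of n] that by (simp add: pr)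
  have rt: "Lp_tendsto (2 * \<gamma>) r \<rho>"
    unfolding r_def using mollification_tendsto[OF ei \<eta>(2,3,4) inverse_Suc_seq(1) \<rho>(2)] \<gamma> by simp
  have Wt: "Lp_tendsto (2 * \<gamma> / (\<gamma> - 1)) W (\<lambda>x. \<rho> x powr (\<gamma> - 1))"
    unfolding W_def using \<gamma> by (intro Lp_tendsto_powr rt r0 \<rho>) auto
  have Bt: "Lp_tendsto 2 (\<lambda>n x. r n x powr \<gamma>) (\<lambda>x. \<rho> x powr \<gamma>)"
    using Lp_tendsto_powr[OF rt r0 \<rho>(3), of \<gamma>] \<gamma> by simp
  have byparts: "(LINT x|lborel. r n x powr \<gamma> * J j j x) = - \<gamma> * (LINT x|lborel. W n x * pd j (r n) x * u j x)" if j: "j \<in> Basis" for n j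
  proof -
    \<comment> \<open>Chosen so that \<gamma>/s = 5/6: then r_n^(\<gamma>-1) d_j r_n lies in L^(6/5)
      and pairs with u_j in L^6. It lies between 6 and 2\<gamma>, where \<rho> and its
      mollifications are controlled.\<close>
    define s where "s = 6 * \<gamma> / 5"
    have s: "6 \<le> s" "s \<le> 2 * \<gamma>" "s > 0" using \<gamma> by (auto simp: s_def)
    have e: "(\<gamma> - 1) / s + 1 / s = 5 / 6" using \<gamma> by (simp add: s_def add_divide_distrib[symmetric])
    have W1: "in_Lp (s / (\<gamma> - 1)) (W n)" unfolding W_def using \<gamma> by (intro in_Lp_powr_nonneg rin s r0) auto
    have "in_Lp (6/5) (\<lambda>x. W n x * pd j (r n) x)"
      by (rule Holder(1)[OF W1 prin[OF s(1,2) j]]) (use s \<gamma> e in auto)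
    then have L65: "in_Lp (6/5) (\<lambda>x. \<gamma> * (W n x * pd j (r n) x))" by (rule in_Lp_cmult)
    have B: "Ck (Suc 0) (\<lambda>x. r n x powr \<gamma>)" "pd j (\<lambda>x. r n x powr \<gamma>) x = \<gamma> * (W n x * pd j (r n) x)" for x
      using Ck1_powr[OF rC r0, of \<gamma> n] \<gamma> by (auto simp: W_def mult.assoc)
    have eq: "(LINT x|lborel. r n x powr \<gamma> * pd j (\<Phi> j m) x) = - (LINT x|lborel. \<gamma> * (W n x * pd j (r n) x) * \<Phi> j m x)" for m
      using integration_by_parts[OF B(1) A(2)[OF j] j, of m] by (simp add: B(2))
    have l1: "(\<lambda>m. LINT x|lborel. r n x powr \<gamma> * pd j (\<Phi> j m) x) \<longlonglongrightarrow> (LINT x|lborel. r n x powr \<gamma> * J j j x)"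
      by (rule Lp_tendsto_integral_mult[OF Lp_tendsto_const[OF Lp_tendstoD(1)[OF Bt]] A(4)[OF j j]]) auto
    have "(\<lambda>m. LINT x|lborel. \<gamma> * (W n x * pd j (r n) x) * \<Phi> j m x) \<longlonglongrightarrow> (LINT x|lborel. \<gamma> * (W n x * pd j (r n) x) * u j x)"
      by (rule Lp_tendsto_integral_mult[OF Lp_tendsto_const[OF L65] A(3)[OF j]]) auto
    from tendsto_minus[OF this] have l2: "(\<lambda>m. LINT x|lborel. r n x powr \<gamma> * pd j (\<Phi> j m) x) \<longlonglongrightarrow> - (LINT x|lborel. \<gamma> * (W n x * pd j (r n) x) * u j x)"
      unfolding eq .
    have "(LINT x|lborel. \<gamma> * (W n x * pd j (r n) x) * u j x) = \<gamma> * (LINT x|lborel. W n x * pd j (r n) x * u j x)"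
      by (simp add: mult.assoc)
    with LIMSEQ_unique[OF l1 l2] show ?thesis by simp
  qed
  \<comment> \<open>The commutator in unexpanded form; both this form, for the estimate, and its
    expansion in \<open>Xsum\<close>, for the continuity equation, are used.\<close>
  define X where "X n j x = (LINT z|lborel. pd j (\<eta> n) z * (\<rho> (x - z) * (u j x - u j (x - z))))" for n j x
  \<comment> \<open>The exponents 2\<gamma> of \<rho> and 2\<gamma>/(\<gamma>-1) of its power leave
    precisely L^2 for the gradient of u. This is where the gain from L^\<gamma> to L^(2\<gamma>) is
    spent.\<close>
  have ab: "2 * \<gamma> \<ge> 1" "2 * \<gamma> / (\<gamma> - 1) \<ge> 1" "1 / (2 * \<gamma>) + 1 / (2 * \<gamma> / (\<gamma> - 1)) = 1 / 2"
    using \<gamma> by (auto simp: field_simps)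
  have comm: "(\<lambda>n. LINT x|lborel. W n x * X n j x) \<longlonglongrightarrow> - (LINT x|lborel. \<rho> x powr (\<gamma> - 1) * (\<rho> x * J j j x))" if j: "j \<in> Basis" for j
    unfolding X_def by (rule commutator_tendsto[OF ap[OF j] \<rho>(2) Wt ab j \<eta>(1) \<eta>(3) \<eta>(4) \<eta>(5)[OF j]])
  have WX: "integrable lborel (\<lambda>x. W n x * X n j x)" if j: "j \<in> Basis" for n j
    unfolding X_def by (rule commutator_Fubini(1)[OF ap[OF j] \<rho>(2) Lp_tendstoD(1)[OF Wt] ab kc[OF j]])
  have Xsum: "(\<Sum>j\<in>Basis. X n j x) = (\<Sum>j\<in>Basis. pd j (r n) x * u j x)" for n x
  proof -
    have "X n j x = pd j (r n) x * u j x - conv (pd j (\<eta> n)) (\<lambda>x. \<rho> x * u j x) x" if j: "j \<in> Basis" for j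
    proof -
      have i1: "integrable lborel (\<lambda>z. pd j (\<eta> n) z * \<rho> (x - z) * u j x)" by (intro integrable_mult_left integrable_conv' kc[OF j] \<rho>l)
      have i2: "integrable lborel (\<lambda>z. pd j (\<eta> n) z * (\<rho> (x - z) * u j (x - z)))" using integrable_conv'[OF kc[OF j] \<rho>ul[OF j]] .
      have "X n j x = (LINT z|lborel. pd j (\<eta> n) z * \<rho> (x - z) * u j x - pd j (\<eta> n) z * (\<rho> (x - z) * u j (x - z)))"
        unfolding X_def by (intro Bochner_Integration.integral_cong) (auto simp: algebra_simps)
      then show ?thesis using i1 i2 by (simp add: pr[OF j] conv_def)
    qed
    moreover have "(\<Sum>j\<in>Basis. conv (pd j (\<eta> n)) (\<lambda>x. \<rho> x * u j x) x) = 0"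
    proof -
      have "conv (pd j (\<eta> n)) (\<lambda>x. \<rho> x * u j x) x = - (LINT y|lborel. \<rho> y * u j y * pd j (\<lambda>y. \<eta> n (x - y)) y)" if j: "j \<in> Basis" for j
      proof -
        have "pd j (\<lambda>y. \<eta> n (x - y)) y = - pd j (\<eta> n) (x - y)" for y
          using pd_affine[OF C1(1)[of n], where i=j and a=x and s="-1" and x=y] by simp
        moreover have "conv (pd j (\<eta> n)) (\<lambda>x. \<rho> x * u j x) x = (LINT y|lborel. pd j (\<eta> n) (x - y) * (\<rho> y * u j y))"
          by (rule conv_alt[OF borel_measurable_continuous_onI[OF kc(1)[OF j]] in_Lp_measurable[OF \<rho>u[OF j]]])
        ultimately show ?thesis by (simp add: mult_ac)
      qed
      then have "(\<Sum>j\<in>Basis. conv (pd j (\<eta> n)) (\<lambda>x. \<rho> x * u j x) x) = - (\<Sum>j\<in>Basis. LINT y|lborel. \<rho> y * u j y * pd j (\<lambda>y. \<eta> n (x - y)) y)"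
        by (simp add: sum_negf)
      then show ?thesis using cont[OF Cc_inf_reflect[OF \<eta>(1)], of n x] by simp
    qed
    ultimately show ?thesis by (simp add: sum_subtractf)
  qed
  have id: "(\<Sum>j\<in>Basis. LINT x|lborel. W n x * X n j x) = - (1 / \<gamma>) * (\<Sum>j\<in>Basis. LINT x|lborel. r n x powr \<gamma> * J j j x)" for n
  proof -
    have i3: "integrable lborel (\<lambda>x. W n x * pd j (r n) x * u j x)" if j: "j \<in> Basis" for j
    proof -
      have e: "(\<gamma> - 1) / (6 * \<gamma> / 5) + 1 / (6 * \<gamma> / 5) = 5 / 6" using \<gamma> by (simp add: add_divide_distrib[symmetric])
      have W1: "in_Lp ((6 * \<gamma> / 5) / (\<gamma> - 1)) (W n)" unfolding W_def using \<gamma> by (intro in_Lp_powr_nonneg rin r0) auto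
      have "in_Lp (6/5) (\<lambda>x. W n x * pd j (r n) x)"
        by (rule Holder(1)[OF W1 prin[of "6 * \<gamma> / 5", OF _ _ j]]) (use \<gamma> e in auto)
      from Holder_integral(1)[OF this A(5)[OF j]] show ?thesis by simp
    qed
    have "(\<Sum>j\<in>Basis. LINT x|lborel. W n x * X n j x) = (LINT x|lborel. (\<Sum>j\<in>Basis. W n x * X n j x))"
      using WX by (subst Bochner_Integration.integral_sum) auto
    also have "\<dots> = (LINT x|lborel. (\<Sum>j\<in>Basis. W n x * pd j (r n) x * u j x))"
      using Xsum by (simp add: sum_distrib_left[symmetric] mult.assoc)
    also have "\<dots> = (\<Sum>j\<in>Basis. LINT x|lborel. W n x * pd j (r n) x * u j x)"
      using i3 by (subst Bochner_Integration.integral_sum) auto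
    also have "\<dots> = - (1 / \<gamma>) * (\<Sum>j\<in>Basis. LINT x|lborel. r n x powr \<gamma> * J j j x)"
      unfolding sum_distrib_left using \<gamma> by (intro sum.cong refl) (simp add: byparts)
    finally show ?thesis .
  qed
  define P where "P = (\<Sum>j\<in>Basis. LINT x|lborel. \<rho> x powr \<gamma> * J j j x)"
  have pw: "\<rho> x powr (\<gamma> - 1) * (\<rho> x * y) = \<rho> x powr \<gamma> * y" for x y
    using powr_add[of "\<rho> x" "\<gamma> - 1" 1] \<rho>(3) by (simp add: mult.assoc[symmetric])
  have "(\<lambda>n. \<Sum>j\<in>Basis. LINT x|lborel. W n x * X n j x) \<longlonglongrightarrow> (\<Sum>j\<in>Basis. - (LINT x|lborel. \<rho> x powr \<gamma> * J j j x))"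
    using comm[unfolded pw] by (intro tendsto_sum)
  then have l1: "(\<lambda>n. - (1 / \<gamma>) * (\<Sum>j\<in>Basis. LINT x|lborel. r n x powr \<gamma> * J j j x)) \<longlonglongrightarrow> - P"
    unfolding id P_def by (simp add: sum_negf)
  have l2: "(\<lambda>n. - (1 / \<gamma>) * (\<Sum>j\<in>Basis. LINT x|lborel. r n x powr \<gamma> * J j j x)) \<longlonglongrightarrow> - (1 / \<gamma>) * P"
    unfolding P_def
  proof (intro tendsto_mult tendsto_const tendsto_sum)
    fix j :: 'a assume j: "j \<in> Basis"
    show "(\<lambda>n. LINT x|lborel. r n x powr \<gamma> * J j j x) \<longlonglongrightarrow> (LINT x|lborel. \<rho> x powr \<gamma> * J j j x)"
      by (rule Lp_tendsto_integral_mult[OF Bt Lp_tendsto_const[OF A(6)[OF j j]]]) auto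
  qed
  have "P = (1 / \<gamma>) * P" using LIMSEQ_unique[OF l1 l2] by simp
  then have "P * (\<gamma> - 1) = 0" using \<gamma> by (simp add: field_simps)
  then show ?thesis using \<gamma> by (simp add: P_def)
qed

section \<open>Energy identity\<close>

text \<open>The entries of \<open>stress\<close> with directions from \<open>Basis\<close> in place
  of coordinate indices, and with the two trace terms merged into the coefficient \<eta> -
  2\<mu>/3.\<close>

definition stress_component :: "real \<Rightarrow> real \<Rightarrow> ('a::euclidean_space \<Rightarrow> 'a \<Rightarrow> 'a \<Rightarrow> real) \<Rightarrow> 'a \<Rightarrow> 'a \<Rightarrow> 'a \<Rightarrow> real" where
  "stress_component \<mu> \<eta> J i j x = \<mu> * (J i j x + J j i x)
     + (if i = j then (\<eta> - 2 / 3 * \<mu>) * (\<Sum>k\<in>Basis. J k k x) else 0)"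

lemma in_Lp_stress_component:
  fixes J :: "'a::euclidean_space \<Rightarrow> 'a \<Rightarrow> 'a \<Rightarrow> real"
  assumes J: "\<And>i j. i \<in> Basis \<Longrightarrow> j \<in> Basis \<Longrightarrow> in_Lp 2 (J i j)" and ij: "i \<in> Basis" "j \<in> Basis"
  shows "in_Lp 2 (stress_component \<mu> \<eta> J i j)"
proof -
  have 1: "in_Lp 2 (\<lambda>x. \<mu> * (J i j x + J j i x))" by (intro in_Lp_cmult Minkowski J ij) auto
  have 2: "in_Lp 2 (\<lambda>x. (\<eta> - 2 / 3 * \<mu>) * (\<Sum>k\<in>Basis. J k k x))" by (intro in_Lp_cmult in_Lp_sum J) auto
  show ?thesis using 1 2 Minkowski(1)[OF 1 2] unfolding stress_component_def by (cases "i = j") auto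
qed

text \<open>Kept as three separate quadratic forms because the second and third have equal integrals
  although they differ pointwise.\<close>

lemma stress_dissipation:
  "(\<Sum>i\<in>Basis. \<Sum>j\<in>Basis. stress_component \<mu> \<eta> J i j x * J i j x)
   = \<mu> * (\<Sum>i\<in>Basis. \<Sum>j\<in>Basis. J i j x * J i j x) + \<mu> * (\<Sum>i\<in>Basis. \<Sum>j\<in>Basis. J i j x * J j i x)
     + (\<eta> - 2 / 3 * \<mu>) * (\<Sum>i\<in>Basis. \<Sum>j\<in>Basis. J i i x * J j j x)"
proof -
  define T where "T = (\<Sum>k\<in>Basis. J k k x)"
  have "(\<Sum>i\<in>Basis. \<Sum>j\<in>Basis. stress_component \<mu> \<eta> J i j x * J i j x)
    = (\<Sum>i\<in>Basis. \<Sum>j\<in>Basis. \<mu> * (J i j x * J i j x) + \<mu> * (J i j x * J j i x) + (if i = j then (\<eta> - 2 / 3 * \<mu>) * T * J i i x else 0))"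
    unfolding stress_component_def T_def[symmetric] by (intro sum.cong refl) (auto simp: algebra_simps)
  also have "\<dots> = \<mu> * (\<Sum>i\<in>Basis. \<Sum>j\<in>Basis. J i j x * J i j x) + \<mu> * (\<Sum>i\<in>Basis. \<Sum>j\<in>Basis. J i j x * J j i x)
     + (\<Sum>i\<in>Basis. (\<eta> - 2 / 3 * \<mu>) * T * J i i x)"
    by (simp add: sum.distrib sum_distrib_left)
  also have "(\<Sum>i\<in>Basis. (\<eta> - 2 / 3 * \<mu>) * T * J i i x) = (\<eta> - 2 / 3 * \<mu>) * (T * T)"
    unfolding T_def by (simp add: sum_distrib_left[symmetric] mult.assoc)
  also have "T * T = (\<Sum>i\<in>Basis. \<Sum>j\<in>Basis. J i i x * J j j x)" unfolding T_def by (rule sum_product)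
  finally show ?thesis .
qed

text \<open>The whole argument for Borel data and in components: u, J and g are the limits of the
  approximating sequences, which decouples the analysis from weak derivatives and from completed
  Lebesgue measure.\<close>

lemma liouville_core:
  fixes \<rho> :: "real^3 \<Rightarrow> real"
  assumes \<mu>: "\<mu> > 0" and \<eta>: "\<eta> \<ge> 0" and \<gamma>: "\<gamma> \<ge> 6"
    and aq: "6 \<le> a" "a \<le> \<gamma>" "q \<ge> 1" "1/a + 1/q = 5/6"
    and \<rho>: "in_Lp 6 \<rho>" "in_Lp \<gamma> \<rho>" "\<And>x. \<rho> x \<ge> 0"
    and ap: "\<And>i. i \<in> Basis \<Longrightarrow> sobolev_approx (\<Phi> i) (u i) (J i)"
    and \<psi>: "\<And>n. \<psi> n \<in> Cc_inf" "\<And>j. j \<in> Basis \<Longrightarrow> Lp_tendsto q (\<lambda>n. pd j (\<psi> n)) (g j)"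
    and cont: "\<And>\<phi>. \<phi> \<in> Cc_inf \<Longrightarrow> (\<Sum>j\<in>Basis. LINT x|lborel. \<rho> x * u j x * pd j \<phi> x) = 0"
    and mom: "\<And>\<phi>. (\<And>i. i \<in> Basis \<Longrightarrow> \<phi> i \<in> Cc1) \<Longrightarrow>
      (\<Sum>i\<in>Basis. \<Sum>j\<in>Basis. LINT x|lborel. \<rho> x * u i x * u j x * pd j (\<phi> i) x) + (\<Sum>i\<in>Basis. LINT x|lborel. \<rho> x powr \<gamma> * pd i (\<phi> i) x)
      = (\<Sum>i\<in>Basis. \<Sum>j\<in>Basis. LINT x|lborel. stress_component \<mu> \<eta> J i j x * pd j (\<phi> i) x) - (\<Sum>j\<in>Basis. LINT x|lborel. \<rho> x * g j x * \<phi> j x)"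
    and i: "i \<in> Basis"
  shows "AE x in lborel. u i x = 0"
proof -
  note A = sobolev_approxD[OF ap]
  define S where "S = stress_component \<mu> \<eta> J"
  have \<rho>u: "in_Lp 3 (\<lambda>x. \<rho> x * u j x)" if "j \<in> Basis" for j by (rule Holder(1)[OF \<rho>(1) A(5)[OF that]]) auto
  have Q: "in_Lp 2 (\<lambda>x. \<rho> x * u i x * u j x)" if "i \<in> Basis" "j \<in> Basis" for i j
    by (rule Holder(1)[OF \<rho>u[OF that(1)] A(5)[OF that(2)]]) auto
  have SL: "in_Lp 2 (S i j)" if "i \<in> Basis" "j \<in> Basis" for i j
    unfolding S_def by (rule in_Lp_stress_component[OF A(6) that])
  have \<rho>a: "in_Lp a \<rho>" by (rule in_Lp_interpolate[OF \<rho>(1,2) aq(1,2)]) simp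
  \<comment> \<open>At q = 1 the relation between a and q would make 1/a negative. Strictness
    provides the finite conjugate exponent used for the force term.\<close>
  have q1: "q > 1"
  proof (rule ccontr)
    assume "\<not> q > 1" then have q: "q = 1" using aq by simp
    moreover have "1 / a > 0" using aq(1) by simp
    ultimately show False using aq(4) unfolding q by linarith
  qed
  have gq: "j \<in> Basis \<Longrightarrow> in_Lp q (g j)" for j by (rule Lp_tendstoD(2)[OF \<psi>(2)])
  have \<rho>g: "in_Lp (6/5) (\<lambda>x. \<rho> x * g j x)" if "j \<in> Basis" for j
    by (rule Holder(1)[OF \<rho>a gq[OF that]]) (use aq in auto)
  have p1: "in_Lp 1 (\<lambda>x. \<rho> x powr \<gamma>)" using in_Lp_powr_nonneg[OF \<rho>(2) _ \<rho>(3), of \<gamma>] \<gamma> by simp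
  \<comment> \<open>Viscous, convective and force terms each contribute the norm that pairs with the
    test field; the factor 4 is the Sobolev constant that turns the L^6 norm of the field into
    gradient norms.\<close>
  define C where "C = (\<Sum>i\<in>Basis. \<Sum>j\<in>Basis. Lp_norm 2 (S i j) + Lp_norm 2 (\<lambda>x. \<rho> x * u i x * u j x)) + (\<Sum>j\<in>Basis. Lp_norm (6/5) (\<lambda>x. \<rho> x * g j x) * 4)"
  have p2: "in_Lp 2 (\<lambda>x. \<rho> x powr \<gamma>)"
  proof (rule L2_of_gradient_bound[OF in_L1_integrable[OF p1]])
    show "C \<ge> 0" unfolding C_def by (intro add_nonneg_nonneg sum_nonneg) auto
    fix \<phi> :: "real^3 \<Rightarrow> real^3 \<Rightarrow> real" assume \<phi>: "\<And>i. i \<in> Basis \<Longrightarrow> \<phi> i \<in> Cc1"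
    define N where "N i j = Lp_norm 2 (pd j (\<phi> i))" for i j
    define NN where "NN = (\<Sum>i\<in>Basis. \<Sum>j\<in>Basis. N i j)"
    have N0: "N i j \<ge> 0" for i j by (simp add: N_def)
    have NNi: "(\<Sum>j\<in>Basis. N i j) \<le> NN" if "i \<in> Basis" for i
      unfolding NN_def using that N0 by (intro member_le_sum[of i Basis "\<lambda>i. \<Sum>j\<in>Basis. N i j"]) (auto intro: sum_nonneg)
    have NNij: "N i j \<le> NN" if "i \<in> Basis" "j \<in> Basis" for i j
      using order_trans[OF member_le_sum[of j Basis "N i"] NNi[OF that(1)]] that N0 by simp
    have dL: "in_Lp 2 (pd j (\<phi> i))" if "i \<in> Basis" "j \<in> Basis" for i j using Cc1_in_Lp(2)[OF \<phi>[OF that(1)] _ that(2)] by simp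
    have pdi: "integrable lborel (\<lambda>x. \<rho> x powr \<gamma> * pd i (\<phi> i) x)" if "i \<in> Basis" for i
    proof -
      have "integrable lborel (\<lambda>x. pd i (\<phi> i) x * \<rho> x powr \<gamma>)"
        by (rule locally_integrable_mult_Cc[OF in_Lp_locally_integrable[OF p1] Ck_continuous[OF Ck_SucD(2)[OF Cc1D(1)[OF \<phi>]]] compact_support_pd[OF Cc1D(2)[OF \<phi>]]]) (use that in auto)
      then show ?thesis by (simp add: mult.commute)
    qed
    have "(LINT x|lborel. \<rho> x powr \<gamma> * (\<Sum>i\<in>Basis. pd i (\<phi> i) x)) = (\<Sum>i\<in>Basis. LINT x|lborel. \<rho> x powr \<gamma> * pd i (\<phi> i) x)"
      unfolding sum_distrib_left using pdi by (subst Bochner_Integration.integral_sum) auto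
    also have "\<dots> = (\<Sum>i\<in>Basis. \<Sum>j\<in>Basis. LINT x|lborel. S i j x * pd j (\<phi> i) x) - (\<Sum>i\<in>Basis. \<Sum>j\<in>Basis. LINT x|lborel. \<rho> x * u i x * u j x * pd j (\<phi> i) x) - (\<Sum>j\<in>Basis. LINT x|lborel. \<rho> x * g j x * \<phi> j x)"
      using mom[of \<phi>, OF \<phi>] unfolding S_def by simp
    finally have eq: "(LINT x|lborel. \<rho> x powr \<gamma> * (\<Sum>i\<in>Basis. pd i (\<phi> i) x)) = (\<Sum>i\<in>Basis. \<Sum>j\<in>Basis. LINT x|lborel. S i j x * pd j (\<phi> i) x) - (\<Sum>i\<in>Basis. \<Sum>j\<in>Basis. LINT x|lborel. \<rho> x * u i x * u j x * pd j (\<phi> i) x) - (\<Sum>j\<in>Basis. LINT x|lborel. \<rho> x * g j x * \<phi> j x)" .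
    have b1: "\<bar>\<Sum>i\<in>Basis. \<Sum>j\<in>Basis. LINT x|lborel. S i j x * pd j (\<phi> i) x\<bar> \<le> (\<Sum>i\<in>Basis. \<Sum>j\<in>Basis. Lp_norm 2 (S i j) * NN)"
    proof (intro order_trans[OF sum_abs] sum_mono)
      fix i j :: "real^3" assume ij: "i \<in> Basis" "j \<in> Basis"
      have "\<bar>LINT x|lborel. S i j x * pd j (\<phi> i) x\<bar> \<le> Lp_norm 2 (S i j) * N i j"
        unfolding N_def by (rule Holder_integral(2)[OF SL[OF ij] dL[OF ij]]) auto
      also have "\<dots> \<le> Lp_norm 2 (S i j) * NN" by (intro mult_left_mono NNij ij) simp
      finally show "\<bar>LINT x|lborel. S i j x * pd j (\<phi> i) x\<bar> \<le> Lp_norm 2 (S i j) * NN" .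
    qed
    have b2: "\<bar>\<Sum>i\<in>Basis. \<Sum>j\<in>Basis. LINT x|lborel. \<rho> x * u i x * u j x * pd j (\<phi> i) x\<bar> \<le> (\<Sum>i\<in>Basis. \<Sum>j\<in>Basis. Lp_norm 2 (\<lambda>x. \<rho> x * u i x * u j x) * NN)"
    proof (intro order_trans[OF sum_abs] sum_mono)
      fix i j :: "real^3" assume ij: "i \<in> Basis" "j \<in> Basis"
      have "\<bar>LINT x|lborel. \<rho> x * u i x * u j x * pd j (\<phi> i) x\<bar> \<le> Lp_norm 2 (\<lambda>x. \<rho> x * u i x * u j x) * N i j"
        unfolding N_def by (rule Holder_integral(2)[OF Q[OF ij] dL[OF ij]]) auto
      also have "\<dots> \<le> Lp_norm 2 (\<lambda>x. \<rho> x * u i x * u j x) * NN" by (intro mult_left_mono NNij ij) simp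
      finally show "\<bar>LINT x|lborel. \<rho> x * u i x * u j x * pd j (\<phi> i) x\<bar> \<le> Lp_norm 2 (\<lambda>x. \<rho> x * u i x * u j x) * NN" .
    qed
    have b3: "\<bar>\<Sum>j\<in>Basis. LINT x|lborel. \<rho> x * g j x * \<phi> j x\<bar> \<le> (\<Sum>j\<in>Basis. Lp_norm (6/5) (\<lambda>x. \<rho> x * g j x) * 4 * NN)"
    proof (intro order_trans[OF sum_abs] sum_mono)
      fix j :: "real^3" assume j: "j \<in> Basis"
      have "\<bar>LINT x|lborel. \<rho> x * g j x * \<phi> j x\<bar> \<le> Lp_norm (6/5) (\<lambda>x. \<rho> x * g j x) * Lp_norm 6 (\<phi> j)"
        by (rule Holder_integral(2)[OF \<rho>g[OF j] Cc1_in_Lp(1)[OF \<phi>[OF j]]]) auto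
      also have "\<dots> \<le> Lp_norm (6/5) (\<lambda>x. \<rho> x * g j x) * (4 * NN)"
        using Sobolev_inequality[OF \<phi>[OF j]] NNi[OF j] by (intro mult_left_mono) (auto simp: N_def)
      finally show "\<bar>LINT x|lborel. \<rho> x * g j x * \<phi> j x\<bar> \<le> Lp_norm (6/5) (\<lambda>x. \<rho> x * g j x) * 4 * NN" by (simp add: mult.assoc)
    qed
    have "\<bar>LINT x|lborel. \<rho> x powr \<gamma> * (\<Sum>i\<in>Basis. pd i (\<phi> i) x)\<bar> \<le> (\<Sum>i\<in>Basis. \<Sum>j\<in>Basis. Lp_norm 2 (S i j) * NN) + (\<Sum>i\<in>Basis. \<Sum>j\<in>Basis. Lp_norm 2 (\<lambda>x. \<rho> x * u i x * u j x) * NN) + (\<Sum>j\<in>Basis. Lp_norm (6/5) (\<lambda>x. \<rho> x * g j x) * 4 * NN)"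
      unfolding eq using b1 b2 b3 by linarith
    also have "\<dots> = C * NN" unfolding C_def by (simp add: sum_distrib_right sum.distrib distrib_right)
    finally show "\<bar>LINT x|lborel. \<rho> x powr \<gamma> * (\<Sum>i\<in>Basis. pd i (\<phi> i) x)\<bar> \<le> C * (\<Sum>i\<in>Basis. \<Sum>j\<in>Basis. Lp_norm 2 (pd j (\<phi> i)))"
      unfolding NN_def N_def .
  qed
  have \<rho>2: "in_Lp (2 * \<gamma>) \<rho>"
    using in_Lp_integrable[OF p2] in_Lp_measurable[OF \<rho>(1)] \<rho>(3) unfolding in_Lp_def by (simp add: powr_powr mult.commute)
  have pres: "(\<Sum>j\<in>Basis. LINT x|lborel. \<rho> x powr \<gamma> * J j j x) = 0"
    by (rule pressure_divergence_integral_eq_0[OF ap \<rho>(1) \<rho>2 \<rho>(3) \<gamma> cont])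
  \<comment> \<open>The continuity equation is tested with the square of the i-th approximant, which
    is again a smooth compactly supported function; its gradient is 2 \<Phi> grad \<Phi>. In the
    limit \<rho> u_j \<Phi> converges in L^2 and grad \<Phi> in L^2.\<close>
  have conv0: "(\<Sum>j\<in>Basis. LINT x|lborel. \<rho> x * u i x * u j x * J i j x) = 0" if i: "i \<in> Basis" for i
  proof -
    have z: "(\<Sum>j\<in>Basis. LINT x|lborel. \<rho> x * u j x * \<Phi> i n x * pd j (\<Phi> i n) x) = 0" for n
    proof -
      note P = Cc_infD[OF A(1)[OF i, of n]]
      have "(\<lambda>x. \<Phi> i n x * \<Phi> i n x) \<in> Cc_inf" unfolding Cc_inf_def using Ck_mult[OF P(1) P(1)] compact_support_mult(1)[OF P(2)] by simp
      note c = cont[OF this]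
      have P1: "Ck (Suc 0) (\<Phi> i n)" by (rule P(1))
      have pm: "pd j (\<lambda>x. \<Phi> i n x * \<Phi> i n x) x = 2 * (\<Phi> i n x * pd j (\<Phi> i n) x)" for j x
        using pd_mult[OF P1 P1, where i=j and x=x] by simp
      from c have "(\<Sum>j\<in>Basis. LINT x|lborel. 2 * (\<rho> x * u j x * \<Phi> i n x * pd j (\<Phi> i n) x)) = 0"
        unfolding pm by (simp add: algebra_simps)
      then show ?thesis by (simp add: sum_distrib_left[symmetric])
    qed
    have "(\<lambda>n. LINT x|lborel. \<rho> x * u j x * \<Phi> i n x * pd j (\<Phi> i n) x) \<longlonglongrightarrow> (LINT x|lborel. \<rho> x * u j x * u i x * J i j x)" if j: "j \<in> Basis" for j
    proof (rule Lp_tendsto_integral_mult[OF _ A(4)[OF i j]])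
      show "Lp_tendsto 2 (\<lambda>n x. \<rho> x * u j x * \<Phi> i n x) (\<lambda>x. \<rho> x * u j x * u i x)"
        by (rule Lp_tendsto_mult[OF Lp_tendsto_const[OF \<rho>u[OF j]] A(3)[OF i]]) auto
    qed auto
    then have "(\<lambda>n. \<Sum>j\<in>Basis. LINT x|lborel. \<rho> x * u j x * \<Phi> i n x * pd j (\<Phi> i n) x) \<longlonglongrightarrow> (\<Sum>j\<in>Basis. LINT x|lborel. \<rho> x * u j x * u i x * J i j x)"
      by (rule tendsto_sum)
    then have "(\<Sum>j\<in>Basis. LINT x|lborel. \<rho> x * u j x * u i x * J i j x) = 0" unfolding z by (simp only: LIMSEQ_const_iff)
    then show ?thesis by (simp add: mult_ac)
  qed
  have force0: "(\<Sum>j\<in>Basis. LINT x|lborel. \<rho> x * g j x * u j x) = 0"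
  proof -
    \<comment> \<open>The conjugate exponent of q. Since 1/a + 1/q = 5/6, it satisfies 1/q' = 1/a +
      1/6, the Hoelder exponent of \<rho> in L^a times u in L^6; the gradients of \<psi> can thus be
      passed to the limit in the continuity equation.\<close>
    define q' where "q' = 1 / (1 - 1 / q)"
    have q': "q' \<ge> 1" "1 / a + 1 / 6 = 1 / q'" "1 / q' + 1 / q = 1" using q1 aq by (auto simp: q'_def field_simps)
    have L: "in_Lp q' (\<lambda>x. \<rho> x * u j x)" if "j \<in> Basis" for j
      by (rule Holder(1)[OF \<rho>a A(5)[OF that]]) (use aq q' in auto)
    have "(\<lambda>n. \<Sum>j\<in>Basis. LINT x|lborel. \<rho> x * u j x * pd j (\<psi> n) x) \<longlonglongrightarrow> (\<Sum>j\<in>Basis. LINT x|lborel. \<rho> x * u j x * g j x)"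
      by (intro tendsto_sum Lp_tendsto_integral_mult[OF Lp_tendsto_const[OF L] \<psi>(2)]) (use q' aq in auto)
    then have "(\<Sum>j\<in>Basis. LINT x|lborel. \<rho> x * u j x * g j x) = 0" unfolding cont[OF \<psi>(1)] by (simp only: LIMSEQ_const_iff)
    then show ?thesis by (simp add: mult_ac)
  qed
  have energy: "(\<Sum>i\<in>Basis. \<Sum>j\<in>Basis. LINT x|lborel. S i j x * J i j x) = 0"
  proof -
    have eqn: "(\<Sum>i\<in>Basis. \<Sum>j\<in>Basis. LINT x|lborel. \<rho> x * u i x * u j x * pd j (\<Phi> i n) x) + (\<Sum>i\<in>Basis. LINT x|lborel. \<rho> x powr \<gamma> * pd i (\<Phi> i n) x)
      - (\<Sum>i\<in>Basis. \<Sum>j\<in>Basis. LINT x|lborel. S i j x * pd j (\<Phi> i n) x) + (\<Sum>j\<in>Basis. LINT x|lborel. \<rho> x * g j x * \<Phi> j n x) = 0" for n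
      using mom[of "\<lambda>i. \<Phi> i n", OF A(2)] unfolding S_def by simp
    have "(\<lambda>n. (\<Sum>i\<in>Basis. \<Sum>j\<in>Basis. LINT x|lborel. \<rho> x * u i x * u j x * pd j (\<Phi> i n) x) + (\<Sum>i\<in>Basis. LINT x|lborel. \<rho> x powr \<gamma> * pd i (\<Phi> i n) x)
      - (\<Sum>i\<in>Basis. \<Sum>j\<in>Basis. LINT x|lborel. S i j x * pd j (\<Phi> i n) x) + (\<Sum>j\<in>Basis. LINT x|lborel. \<rho> x * g j x * \<Phi> j n x))
      \<longlonglongrightarrow> (\<Sum>i\<in>Basis. \<Sum>j\<in>Basis. LINT x|lborel. \<rho> x * u i x * u j x * J i j x) + (\<Sum>i\<in>Basis. LINT x|lborel. \<rho> x powr \<gamma> * J i i x)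
      - (\<Sum>i\<in>Basis. \<Sum>j\<in>Basis. LINT x|lborel. S i j x * J i j x) + (\<Sum>j\<in>Basis. LINT x|lborel. \<rho> x * g j x * u j x)"
    proof (intro tendsto_add tendsto_diff tendsto_sum)
      fix i j :: "real^3" assume i: "i \<in> Basis"
      show "(\<lambda>n. LINT x|lborel. \<rho> x powr \<gamma> * pd i (\<Phi> i n) x) \<longlonglongrightarrow> (LINT x|lborel. \<rho> x powr \<gamma> * J i i x)"
        by (rule Lp_tendsto_integral_mult[OF Lp_tendsto_const[OF p2] A(4)[OF i i]]) auto
      show "(\<lambda>n. LINT x|lborel. \<rho> x * g i x * \<Phi> i n x) \<longlonglongrightarrow> (LINT x|lborel. \<rho> x * g i x * u i x)"
        by (rule Lp_tendsto_integral_mult[OF Lp_tendsto_const[OF \<rho>g[OF i]] A(3)[OF i]]) auto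
      assume j: "j \<in> Basis"
      show "(\<lambda>n. LINT x|lborel. \<rho> x * u i x * u j x * pd j (\<Phi> i n) x) \<longlonglongrightarrow> (LINT x|lborel. \<rho> x * u i x * u j x * J i j x)"
        by (rule Lp_tendsto_integral_mult[OF Lp_tendsto_const[OF Q[OF i j]] A(4)[OF i j]]) auto
      show "(\<lambda>n. LINT x|lborel. S i j x * pd j (\<Phi> i n) x) \<longlonglongrightarrow> (LINT x|lborel. S i j x * J i j x)"
        by (rule Lp_tendsto_integral_mult[OF Lp_tendsto_const[OF SL[OF i j]] A(4)[OF i j]]) auto
    qed
    then have "(\<Sum>i\<in>Basis. \<Sum>j\<in>Basis. LINT x|lborel. \<rho> x * u i x * u j x * J i j x) + (\<Sum>i\<in>Basis. LINT x|lborel. \<rho> x powr \<gamma> * J i i x)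
      - (\<Sum>i\<in>Basis. \<Sum>j\<in>Basis. LINT x|lborel. S i j x * J i j x) + (\<Sum>j\<in>Basis. LINT x|lborel. \<rho> x * g j x * u j x) = 0"
      unfolding eqn by (simp only: LIMSEQ_const_iff)
    then show ?thesis using conv0 pres force0 by simp
  qed
  have JJ: "integrable lborel (\<lambda>x. J i j x * J k l x)" if "i \<in> Basis" "j \<in> Basis" "k \<in> Basis" "l \<in> Basis" for i j k l
    using Holder_integral(1)[OF A(6)[OF that(1,2)] A(6)[OF that(3,4)]] by simp
  \<comment> \<open>The exchange of derivatives holds for the C^1 approximants, and both sides
    converge because all gradients converge in L^2.\<close>
  have swap: "(LINT x|lborel. J i j x * J j i x) = (LINT x|lborel. J i i x * J j j x)" if ij: "i \<in> Basis" "j \<in> Basis" for i j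
  proof -
    have l1: "(\<lambda>n. LINT x|lborel. pd j (\<Phi> i n) x * pd i (\<Phi> j n) x) \<longlonglongrightarrow> (LINT x|lborel. J i j x * J j i x)"
      by (rule Lp_tendsto_integral_mult[OF A(4)[OF ij] A(4)[OF ij(2,1)]]) auto
    have l2: "(\<lambda>n. LINT x|lborel. pd i (\<Phi> i n) x * pd j (\<Phi> j n) x) \<longlonglongrightarrow> (LINT x|lborel. J i i x * J j j x)"
      by (rule Lp_tendsto_integral_mult[OF A(4)[OF ij(1,1)] A(4)[OF ij(2,2)]]) auto
    show ?thesis using l1 l2 unfolding integral_pd_swap[OF A(2)[OF ij(1)] A(2)[OF ij(2)] ij(2,1)] by (rule LIMSEQ_unique)
  qed
  define E where "E = (\<Sum>i\<in>Basis. \<Sum>j\<in>Basis. LINT x|lborel. J i j x * J i j x)"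
  define T where "T = (\<Sum>i\<in>Basis. \<Sum>j\<in>Basis. LINT x|lborel. J i i x * J j j x)"
  have sumint: "(LINT x|lborel. (\<Sum>i\<in>Basis. \<Sum>j\<in>Basis. f i j x)) = (\<Sum>i\<in>Basis. \<Sum>j\<in>Basis. LINT x|lborel. f i j x)"
    "integrable lborel (\<lambda>x. \<Sum>i\<in>Basis. \<Sum>j\<in>Basis. f i j x)"
    if "\<And>i j. i \<in> Basis \<Longrightarrow> j \<in> Basis \<Longrightarrow> integrable lborel (f i j)" for f :: "real^3 \<Rightarrow> real^3 \<Rightarrow> real^3 \<Rightarrow> real"
    using that by (simp_all add: Bochner_Integration.integral_sum Bochner_Integration.integrable_sum)
  have SJ: "integrable lborel (\<lambda>x. S i j x * J i j x)" if "i \<in> Basis" "j \<in> Basis" for i j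
    using Holder_integral(1)[OF SL[OF that] A(6)[OF that]] by simp
  have "0 = (LINT x|lborel. (\<Sum>i\<in>Basis. \<Sum>j\<in>Basis. S i j x * J i j x))"
    using energy sumint(1)[of "\<lambda>i j x. S i j x * J i j x"] SJ by simp
  also have "\<dots> = (LINT x|lborel. \<mu> * (\<Sum>i\<in>Basis. \<Sum>j\<in>Basis. J i j x * J i j x) + \<mu> * (\<Sum>i\<in>Basis. \<Sum>j\<in>Basis. J i j x * J j i x)
     + (\<eta> - 2 / 3 * \<mu>) * (\<Sum>i\<in>Basis. \<Sum>j\<in>Basis. J i i x * J j j x))"
    unfolding S_def stress_dissipation ..
  also have "\<dots> = \<mu> * (LINT x|lborel. (\<Sum>i\<in>Basis. \<Sum>j\<in>Basis. J i j x * J i j x)) + \<mu> * (LINT x|lborel. (\<Sum>i\<in>Basis. \<Sum>j\<in>Basis. J i j x * J j i x))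
     + (\<eta> - 2 / 3 * \<mu>) * (LINT x|lborel. (\<Sum>i\<in>Basis. \<Sum>j\<in>Basis. J i i x * J j j x))"
    using sumint(2)[of "\<lambda>i j x. J i j x * J i j x"] sumint(2)[of "\<lambda>i j x. J i j x * J j i x"] sumint(2)[of "\<lambda>i j x. J i i x * J j j x"] JJ
    by simp
  also have "\<dots> = \<mu> * E + \<mu> * T + (\<eta> - 2 / 3 * \<mu>) * T"
    using sumint(1)[of "\<lambda>i j x. J i j x * J i j x"] sumint(1)[of "\<lambda>i j x. J i j x * J j i x"] sumint(1)[of "\<lambda>i j x. J i i x * J j j x"] JJ swap
    by (simp add: E_def T_def)
  \<comment> \<open>The coefficient of T collects \<mu> from the exchanged cross terms and \<eta> -
    2\<mu>/3 from the trace. Since T is the integral of (div u)^2, both summands are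
    nonnegative.\<close>
  finally have en: "\<mu> * E + (\<mu> / 3 + \<eta>) * T = 0" by (simp add: algebra_simps)
  have T0: "T \<ge> 0"
  proof -
    have "T = (LINT x|lborel. (\<Sum>i\<in>Basis. \<Sum>j\<in>Basis. J i i x * J j j x))" unfolding T_def using sumint(1)[of "\<lambda>i j x. J i i x * J j j x"] JJ by simp
    also have "\<dots> = (LINT x|lborel. (\<Sum>i\<in>Basis. J i i x) * (\<Sum>j\<in>Basis. J j j x))" by (simp only: sum_product)
    finally show ?thesis by simp
  qed
  have E0: "E = 0"
  proof -
    have "E \<ge> 0" unfolding E_def by (intro sum_nonneg Bochner_Integration.integral_nonneg) simp
    moreover have "(\<mu> / 3 + \<eta>) * T \<ge> 0" using \<mu> \<eta> T0 by simp
    moreover have "\<mu> * E \<ge> 0" using \<mu> \<open>E \<ge> 0\<close> by simp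
    ultimately have "\<mu> * E = 0" using en by linarith
    then show ?thesis using \<mu> by simp
  qed
  have J0: "Lp_norm 2 (J i j) = 0" if ij: "i \<in> Basis" "j \<in> Basis" for i j
  proof -
    have "(\<Sum>j\<in>Basis. LINT x|lborel. J i j x * J i j x) = 0"
      using E0 ij sum_nonneg_eq_0_iff[of Basis "\<lambda>i. \<Sum>j\<in>Basis. LINT x|lborel. J i j x * J i j x"]
      unfolding E_def by (simp add: sum_nonneg)
    then have "(LINT x|lborel. J i j x * J i j x) = 0"
      using ij sum_nonneg_eq_0_iff[of Basis "\<lambda>j. LINT x|lborel. J i j x * J i j x"] by simp
    then show ?thesis using Lp_norm2_square[of "J i j"] by (simp add: power2_eq_square)
  qed
  have "Lp_norm 6 (u i) \<le> 4 * (\<Sum>j\<in>Basis. Lp_norm 2 (J i j))"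
  proof (rule LIMSEQ_le)
    show "(\<lambda>n. Lp_norm 6 (\<Phi> i n)) \<longlonglongrightarrow> Lp_norm 6 (u i)" by (rule Lp_tendsto_norm[OF A(3)[OF i]]) simp
    show "(\<lambda>n. 4 * (\<Sum>j\<in>Basis. Lp_norm 2 (pd j (\<Phi> i n)))) \<longlonglongrightarrow> 4 * (\<Sum>j\<in>Basis. Lp_norm 2 (J i j))"
      by (intro tendsto_mult tendsto_const tendsto_sum Lp_tendsto_norm A i) simp_all
    show "\<exists>N. \<forall>n\<ge>N. Lp_norm 6 (\<Phi> i n) \<le> 4 * (\<Sum>j\<in>Basis. Lp_norm 2 (pd j (\<Phi> i n)))"
      using Sobolev_inequality[OF A(2)[OF i]] by blast
  qed
  then have "Lp_norm 6 (u i) = 0" using J0[OF i] Lp_norm_nonneg[of 6 "u i"] by simp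
  then show ?thesis by (rule Lp_norm_eq_0_AE[OF A(5)[OF i]]) simp
qed

section \<open>Weak derivatives\<close>

text \<open>The bridge between completed Lebesgue measure and \<open>lborel\<close>: equality with a
  Borel function off a \<open>lborel\<close> null set already determines measurability,
  integrability and integral.\<close>

lemma integral_lebesgue_eq_lborel:
  fixes F g :: "'a::euclidean_space \<Rightarrow> 'b::euclidean_space"
  assumes g: "g \<in> borel_measurable borel" and ae: "AE x in lborel. F x = g x"
  shows "F \<in> borel_measurable lebesgue" "(LINT x|lebesgue. F x) = (LINT x|lborel. g x)"
    "integrable lebesgue F \<longleftrightarrow> integrable lborel g"
proof -
  have gl: "g \<in> borel_measurable lebesgue" by (rule measurable_completion) (simp add: g)
  have ae': "AE x in lebesgue. g x = F x" using ae unfolding AE_completion_iff by eventually_elim simp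
  show F: "F \<in> borel_measurable lebesgue" by (rule borel_measurable_AE[OF gl ae'])
  have gb: "g \<in> borel_measurable lborel" using g by simp
  have "(LINT x|lebesgue. F x) = (LINT x|lebesgue. g x)"
    by (rule integral_cong_AE[OF F gl]) (use ae' in eventually_elim, simp)
  then show "(LINT x|lebesgue. F x) = (LINT x|lborel. g x)" by (simp add: integral_completion[OF gb])
  have "integrable lebesgue F \<longleftrightarrow> integrable lebesgue g"
    by (rule integrable_cong_AE[OF F gl]) (use ae' in eventually_elim, simp)
  then show "integrable lebesgue F \<longleftrightarrow> integrable lborel g" by (simp add: integrable_completion[OF gb])
qed

lemma borel_representative:
  fixes f :: "'a::euclidean_space \<Rightarrow> real"
  assumes "f \<in> borel_measurable lebesgue"
  obtains g where "g \<in> borel_measurable borel" "AE x in lborel. f x = g x"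
  using completion_ex_borel_measurable_real[OF assms] by auto

text \<open>Local integrability speaks of f on compact sets only; global measurability follows since
  f is the pointwise limit of its restrictions to growing balls.\<close>

lemma L1_loc_measurable:
  fixes f :: "'a::euclidean_space \<Rightarrow> 'b::euclidean_space"
  assumes "f \<in> L1_loc" shows "f \<in> borel_measurable lebesgue"
proof (rule borel_measurable_LIMSEQ_metric)
  fix n :: nat
  have "integrable lebesgue (\<lambda>x. indicator (cball 0 (real n)) x *\<^sub>R f x)"
    using assms by (simp add: L1_loc_def set_integrable_def)
  then show "(\<lambda>x. indicator (cball 0 (real n)) x *\<^sub>R f x) \<in> borel_measurable lebesgue"
    by (rule borel_measurable_integrable)
next
  fix x :: 'a
  have "\<forall>\<^sub>F n in sequentially. norm x \<le> real n" using eventually_ge_at_top[of "nat \<lceil>norm x\<rceil>"] by eventually_elim linarith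
  then have "\<forall>\<^sub>F n in sequentially. indicator (cball 0 (real n)) x *\<^sub>R f x = f x" by eventually_elim simp
  then show "(\<lambda>n. indicator (cball 0 (real n)) x *\<^sub>R f x) \<longlonglongrightarrow> f x" by (rule tendsto_eventually)
qed

lemma L1_loc_inner:
  fixes f :: "'a::euclidean_space \<Rightarrow> 'b::euclidean_space"
  assumes "f \<in> L1_loc" shows "(\<lambda>x. f x \<bullet> b) \<in> L1_loc"
proof -
  have "integrable lebesgue (\<lambda>x. indicator K x *\<^sub>R (f x \<bullet> b))" if "compact K" for K
    using integrable_inner_left[of b lebesgue "\<lambda>x. indicator K x *\<^sub>R f x"] assms that by (simp add: L1_loc_def set_integrable_def)
  then show ?thesis by (simp add: L1_loc_def set_integrable_def)
qed

lemma L1_loc_representative: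
  fixes f :: "'a::euclidean_space \<Rightarrow> real"
  assumes "f \<in> L1_loc"
  obtains g where "locally_integrable g" "AE x in lborel. f x = g x"
proof -
  obtain g where g: "g \<in> borel_measurable borel" "AE x in lborel. f x = g x"
    using borel_representative[OF L1_loc_measurable[OF assms]] .
  have "integrable lborel (\<lambda>x. indicator (cball 0 R) x * g x)" for R
  proof -
    have m: "(\<lambda>x. indicator (cball 0 R) x * g x) \<in> borel_measurable borel"
      by (intro borel_measurable_times borel_measurable_indicator g) simp
    have "AE x in lborel. indicator (cball 0 R) x *\<^sub>R f x = indicator (cball 0 R) x * g x"
      using g(2) by eventually_elim simp
    from integral_lebesgue_eq_lborel(3)[OF m this] assms show ?thesis
      by (simp add: L1_loc_def set_integrable_def)
  qed
  then show ?thesis using that[of g] g by (simp add: locally_integrable_def)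
qed

lemma locally_integrable_L1_loc:
  fixes f :: "'a::euclidean_space \<Rightarrow> real"
  assumes f: "locally_integrable f" shows "f \<in> L1_loc"
  unfolding L1_loc_def set_integrable_def mem_Collect_eq
proof (intro allI impI)
  fix K :: "'a set" assume K: "compact K"
  obtain R where R: "K \<subseteq> cball 0 R" using compact_imp_bounded[OF K] unfolding bounded_def by (auto simp: dist_norm subset_eq) (metis bounded_iff compact_imp_bounded[OF K])
  have Kb: "K \<in> sets borel" using K by (simp add: borel_compact)
  have m: "(\<lambda>x. indicator K x *\<^sub>R f x) \<in> borel_measurable borel"
    using locally_integrable_measurable[OF f] Kb by simp
  have "integrable lborel (\<lambda>x. indicator K x * f x)"
    by (rule locally_integrable_mult[OF f, of _ 1 R]) (use Kb R in \<open>auto simp: indicator_def split: if_splits\<close>)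
  then show "integrable lebesgue (\<lambda>x. indicator K x *\<^sub>R f x)"
    using integral_lebesgue_eq_lborel(3)[OF m, of "\<lambda>x. indicator K x *\<^sub>R f x"] by simp
qed

lemma L1_loc_componentwise:
  fixes f :: "'a::euclidean_space \<Rightarrow> 'b::euclidean_space"
  assumes "\<And>b. b \<in> Basis \<Longrightarrow> (\<lambda>x. f x \<bullet> b) \<in> L1_loc" shows "f \<in> L1_loc"
  using assms unfolding L1_loc_def by (auto intro: absolutely_integrable_componentwise)

lemma L1_loc_mult_Cc:
  fixes f :: "'a::euclidean_space \<Rightarrow> 'b::euclidean_space" and k :: "'a \<Rightarrow> real"
  assumes f: "f \<in> L1_loc" and k: "continuous_on UNIV k" "compact_support k"
  shows "integrable lebesgue (\<lambda>x. k x *\<^sub>R f x)"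
proof -
  obtain M where M: "M > 0" "\<And>x. \<bar>k x\<bar> \<le> M" using bounded_on_compact_support[OF k] by metis
  obtain R where R: "\<And>x. k x \<noteq> 0 \<Longrightarrow> norm x \<le> R" using compact_supportE[OF k(2)] by metis
  have i: "integrable lebesgue (\<lambda>x. indicator (cball 0 R) x *\<^sub>R f x)" using f by (simp add: L1_loc_def set_integrable_def)
  have km: "k \<in> borel_measurable lebesgue"
    by (rule measurable_completion) (use borel_measurable_continuous_onI[OF k(1)] in simp)
  show ?thesis
  proof (rule Bochner_Integration.integrable_bound[OF integrable_scaleR_right[OF i, of M]])
    show "(\<lambda>x. k x *\<^sub>R f x) \<in> borel_measurable lebesgue"
      by (intro borel_measurable_scaleR km L1_loc_measurable f)
    show "AE x in lebesgue. norm (k x *\<^sub>R f x) \<le> norm (M *\<^sub>R indicator (cball 0 R) x *\<^sub>R f x)"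
    proof (rule AE_I2)
      fix x show "norm (k x *\<^sub>R f x) \<le> norm (M *\<^sub>R indicator (cball 0 R) x *\<^sub>R f x)"
        using M(2)[of x] M(1) R[of x] by (cases "k x = 0") (auto simp: mult_right_mono)
    qed
  qed
qed

text \<open>The fundamental lemma is applied to each component of the difference. It ties the
  representative picked by \<open>weak_deriv\<close> to any other weak derivative.\<close>

lemma weak_deriv_unique:
  fixes v :: "'a::euclidean_space \<Rightarrow> 'b::euclidean_space"
  assumes 1: "has_weak_deriv v i g" and 2: "has_weak_deriv v i h"
  shows "AE x in lborel. g x = h x"
proof -
  have "AE x in lborel. (g x - h x) \<bullet> b = 0" for b
  proof -
    have gl: "g \<in> L1_loc" and hl: "h \<in> L1_loc" using 1 2 by (auto simp: has_weak_deriv_def)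
    have "(\<lambda>x. g x - h x) \<in> L1_loc" using gl hl unfolding L1_loc_def by (auto intro: set_integral_diff)
    from L1_loc_inner[OF this] obtain f where f: "locally_integrable f" "AE x in lborel. (g x - h x) \<bullet> b = f x"
      by (rule L1_loc_representative[of "\<lambda>x. (g x - h x) \<bullet> b"])
    have "AE x in lborel. f x = 0"
    proof (rule fundamental_lemma[OF f(1)])
      fix \<phi> :: "'a \<Rightarrow> real" assume \<phi>: "\<phi> \<in> Cc_inf"
      note P = Cc_infD[OF \<phi>]
      have c: "continuous_on UNIV \<phi>" by (rule Ck_continuous[OF P(1)[of 0]])
      have ig: "integrable lebesgue (\<lambda>x. \<phi> x *\<^sub>R g x)" and ih: "integrable lebesgue (\<lambda>x. \<phi> x *\<^sub>R h x)"
        by (intro L1_loc_mult_Cc gl hl c P)+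
      have "(LINT x|lborel. \<phi> x * f x) = (LINT x|lebesgue. \<phi> x * ((g x - h x) \<bullet> b))"
      proof (rule integral_lebesgue_eq_lborel(2)[symmetric])
        show "(\<lambda>x. \<phi> x * f x) \<in> borel_measurable borel"
          by (intro borel_measurable_times borel_measurable_continuous_onI c locally_integrable_measurable f)
        show "AE x in lborel. \<phi> x * ((g x - h x) \<bullet> b) = \<phi> x * f x" using f(2) by eventually_elim simp
      qed
      also have "\<dots> = (LINT x|lebesgue. (\<phi> x *\<^sub>R g x - \<phi> x *\<^sub>R h x) \<bullet> b)"
        by (simp add: inner_diff_left right_diff_distrib)
      also have "\<dots> = ((LINT x|lebesgue. \<phi> x *\<^sub>R g x) - (LINT x|lebesgue. \<phi> x *\<^sub>R h x)) \<bullet> b"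
        using ig ih by simp
      also have "\<dots> = 0" using 1 2 \<phi> by (simp add: has_weak_deriv_def)
      finally show "(LINT x|lborel. \<phi> x * f x) = 0" .
    qed
    with f(2) show ?thesis by eventually_elim simp
  qed
  then have "AE x in lborel. \<forall>b\<in>Basis. (g x - h x) \<bullet> b = 0" by (subst AE_ball_countable) (auto simp: countable_finite)
  then show ?thesis
  proof eventually_elim
    case (elim x) have "g x - h x = 0" by (rule euclidean_eqI) (use elim in simp)
    then show ?case by simp
  qed
qed

lemma Ck_inner_right: "Ck k f \<Longrightarrow> Ck k (\<lambda>x. f x \<bullet> b)"
  by (rule Ck_bounded_linear[OF bounded_linear_inner_left])

lemma Cc_inf_inner: "f \<in> Cc_inf \<Longrightarrow> (\<lambda>x. f x \<bullet> b) \<in> Cc_inf"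
  by (auto simp: Cc_inf_def intro: Ck_inner_right compact_support_linear[of "\<lambda>y. y \<bullet> b"])

lemma pd_inner_comp: "Ck (Suc k) f \<Longrightarrow> pd i (\<lambda>x. f x \<bullet> b) x = pd i f x \<bullet> b"
  by (rule pd_bounded_linear[OF bounded_linear_inner_left])

lemma compact_support_diff:
  fixes f g :: "'a::euclidean_space \<Rightarrow> 'b::real_vector"
  assumes "compact_support f" "compact_support g" shows "compact_support (\<lambda>x. f x - g x)"
  using compact_support_add[OF assms(1) compact_support_linear[of "\<lambda>y. - y", OF _ assms(2)]] by simp

section \<open>Gradients and Sobolev limits of elements of \<open>D0\<close>\<close>

lemma Lp_norm_le_D0_norm:
  fixes w :: "'a::euclidean_space \<Rightarrow> 'b::euclidean_space"
  assumes w: "w \<in> Cc_inf" and i: "i \<in> Basis" and b: "b \<in> Basis" and q: "q \<ge> 1"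
  shows "Lp_norm q (pd i (\<lambda>x. w x \<bullet> b)) \<le> D0_norm q w"
proof -
  have C: "Ck (Suc 0) w" "compact_support w" using Cc_infD[OF w] by auto
  define h where "h x = L2_set (\<lambda>i. norm (pd i w x)) Basis" for x
  have h0: "h x \<ge> 0" for x by (simp add: h_def)
  have hc: "continuous_on UNIV h"
    unfolding h_def L2_set_def using Ck_continuous[OF Ck_SucD(2)[OF C(1)]] by (intro continuous_intros) auto
  have hs: "compact_support h"
  proof -
    obtain R where R: "\<And>x. w x \<noteq> 0 \<Longrightarrow> norm x \<le> R" using compact_supportE[OF C(2)] by metis
    have "norm x \<le> R" if "h x \<noteq> 0" for x
    proof (rule ccontr)
      assume "\<not> norm x \<le> R"
      then have "pd i w x = 0" for i using pd_support[where f=w and R=R and i=i and x=x] R by blast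
      then show False using that by (simp add: h_def L2_set_def)
    qed
    then show ?thesis by (rule compact_supportI)
  qed
  have hL: "in_Lp q h" by (rule in_Lp_Cc[OF hc hs]) (use q in simp)
  have "D0_norm q w = Lp_norm q h"
  proof -
    have "(LINT x|lebesgue. h x powr q) = (LINT x|lborel. \<bar>h x\<bar> powr q)"
      by (rule integral_lebesgue_eq_lborel(2)) (use borel_measurable_continuous_onI[OF hc] h0 in auto)
    then show ?thesis by (simp add: D0_norm_def Lp_norm_def h_def)
  qed
  moreover have "Lp_norm q (pd i (\<lambda>x. w x \<bullet> b)) \<le> Lp_norm q h"
  proof (rule in_Lp_bound(2)[OF hL])
    show "pd i (\<lambda>x. w x \<bullet> b) \<in> borel_measurable borel"
      by (intro borel_measurable_continuous_onI Ck_continuous[OF Ck_SucD(2)[OF Ck_inner_right[OF C(1)] i]])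
    show "AE x in lborel. \<bar>pd i (\<lambda>x. w x \<bullet> b) x\<bar> \<le> \<bar>h x\<bar>"
    proof (rule AE_I2)
      fix x
      have "\<bar>pd i w x \<bullet> b\<bar> \<le> norm (pd i w x)" by (rule Basis_le_norm[OF b])
      also have "\<dots> \<le> h x" unfolding h_def by (rule member_le_L2_set) (use i in auto)
      finally show "\<bar>pd i (\<lambda>x. w x \<bullet> b) x\<bar> \<le> \<bar>h x\<bar>" by (simp add: pd_inner_comp[OF C(1)])
    qed
  qed (use q in simp)
  ultimately show ?thesis by simp
qed

text \<open>The gradient norm dominates every entry of the Jacobian, so the Cauchy condition becomes
  convergence of each entry by completeness of L^q. The local L^1 convergence is carried along
  because it is the only link between the sequence and v.\<close>

lemma D0_approximation:
  fixes v :: "'a::euclidean_space \<Rightarrow> 'b::euclidean_space"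
  assumes v: "v \<in> D0 q" and q: "q \<ge> 1"
  obtains \<Phi> J where "\<And>n. \<Phi> n \<in> Cc_inf"
    "\<And>i b. i \<in> Basis \<Longrightarrow> b \<in> Basis \<Longrightarrow> Lp_tendsto q (\<lambda>n. pd i (\<lambda>x. \<Phi> n x \<bullet> b)) (J b i)"
    "\<And>K. compact K \<Longrightarrow> (\<lambda>n. LINT x:K|lebesgue. norm (\<Phi> n x - v x)) \<longlonglongrightarrow> 0"
proof -
  obtain \<Phi> :: "nat \<Rightarrow> 'a \<Rightarrow> 'b" where \<Phi>: "\<And>n. \<Phi> n \<in> Cc_inf"
    and cauchy: "\<And>\<epsilon>. \<epsilon> > 0 \<Longrightarrow> \<exists>N. \<forall>m\<ge>N. \<forall>n\<ge>N. D0_norm q (\<lambda>x. \<Phi> m x - \<Phi> n x) < \<epsilon>"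
    and lim: "\<And>K. compact K \<Longrightarrow> (\<lambda>n. LINT x:K|lebesgue. norm (\<Phi> n x - v x)) \<longlonglongrightarrow> 0"
    using v unfolding D0_def by blast
  have "\<exists>g. Lp_tendsto q (\<lambda>n. pd i (\<lambda>x. \<Phi> n x \<bullet> b)) g" if ib: "i \<in> Basis" "b \<in> Basis" for i b
  proof -
    have C: "Ck (Suc 0) (\<Phi> n)" for n by (rule Cc_infD[OF \<Phi>])
    have L: "in_Lp q (pd i (\<lambda>x. \<Phi> n x \<bullet> b))" for n
      by (rule Cc1_in_Lp(2)[OF Cc_inf_Cc1[OF Cc_inf_inner[OF \<Phi>]]]) (use q ib in auto)
    have "\<exists>N. \<forall>m\<ge>N. \<forall>n\<ge>N. Lp_norm q (\<lambda>x. pd i (\<lambda>x. \<Phi> m x \<bullet> b) x - pd i (\<lambda>x. \<Phi> n x \<bullet> b) x) < e" if e: "e > 0" for e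
    proof -
      obtain N where N: "\<And>m n. m \<ge> N \<Longrightarrow> n \<ge> N \<Longrightarrow> D0_norm q (\<lambda>x. \<Phi> m x - \<Phi> n x) < e" using cauchy[OF e] by blast
      have "Lp_norm q (\<lambda>x. pd i (\<lambda>x. \<Phi> m x \<bullet> b) x - pd i (\<lambda>x. \<Phi> n x \<bullet> b) x) \<le> D0_norm q (\<lambda>x. \<Phi> m x - \<Phi> n x)" for m n
      proof -
        have w: "(\<lambda>x. \<Phi> m x - \<Phi> n x) \<in> Cc_inf" unfolding Cc_inf_def
          using Ck_diff[OF Cc_infD(1)[OF \<Phi>[of m]] Cc_infD(1)[OF \<Phi>[of n]]]
            compact_support_diff[OF Cc_infD(2)[OF \<Phi>[of m]] Cc_infD(2)[OF \<Phi>[of n]]] by blast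
        have "pd i (\<lambda>x. (\<Phi> m x - \<Phi> n x) \<bullet> b) x = pd i (\<lambda>x. \<Phi> m x \<bullet> b) x - pd i (\<lambda>x. \<Phi> n x \<bullet> b) x" for x
          unfolding inner_diff_left by (rule pd_diff[OF Ck_inner_right[OF C] Ck_inner_right[OF C]])
        then show ?thesis using Lp_norm_le_D0_norm[OF w ib q] by simp
      qed
      then show ?thesis using N by (intro exI[of _ N]) (meson le_less_trans)
    qed
    from Lp_complete[OF L q this] show ?thesis by blast
  qed
  note ex = this
  define J where "J b i = (SOME g. Lp_tendsto q (\<lambda>n. pd i (\<lambda>x. \<Phi> n x \<bullet> b)) g)" for b i
  have "Lp_tendsto q (\<lambda>n. pd i (\<lambda>x. \<Phi> n x \<bullet> b)) (J b i)" if "i \<in> Basis" "b \<in> Basis" for i b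
    unfolding J_def by (rule someI_ex[OF ex[OF that]])
  from that[OF \<Phi> this lim] show ?thesis by blast
qed

lemma tendsto_test_integral:
  fixes v :: "'a::euclidean_space \<Rightarrow> 'b::euclidean_space"
  assumes v: "v \<in> L1_loc" and \<Phi>: "\<And>n. \<Phi> n \<in> Cc_inf"
    and lim: "\<And>K. compact K \<Longrightarrow> (\<lambda>n. LINT x:K|lebesgue. norm (\<Phi> n x - v x)) \<longlonglongrightarrow> 0"
    and k: "continuous_on UNIV k" "compact_support k" and b: "b \<in> Basis"
  shows "(\<lambda>n. LINT x|lborel. k x * (\<Phi> n x \<bullet> b)) \<longlonglongrightarrow> (LINT x|lebesgue. k x * (v x \<bullet> b))"
proof -
  obtain M where M: "M > 0" "\<And>x. \<bar>k x\<bar> \<le> M" using bounded_on_compact_support[OF k] by metis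
  obtain R where R: "\<And>x. k x \<noteq> 0 \<Longrightarrow> norm x \<le> R" using compact_supportE[OF k(2)] by metis
  have c: "continuous_on UNIV (\<Phi> n)" for n by (rule Ck_continuous[OF Cc_infD(1)[OF \<Phi>, where k=0]])
  have \<Phi>m: "\<Phi> n \<in> borel_measurable borel" for n by (intro borel_measurable_continuous_onI c)
  have \<Phi>L: "\<Phi> n \<in> L1_loc" for n
  proof (rule L1_loc_componentwise)
    fix b :: 'b assume "b \<in> Basis"
    show "(\<lambda>x. \<Phi> n x \<bullet> b) \<in> L1_loc"
      by (intro locally_integrable_L1_loc in_Lp_locally_integrable[of 1] Cc1_in_Lp(1) Cc_inf_Cc1 Cc_inf_inner \<Phi>) auto
  qed
  have dL: "(\<lambda>x. \<Phi> n x - v x) \<in> L1_loc" for n using \<Phi>L[of n] v unfolding L1_loc_def by (auto intro: set_integral_diff)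
  show ?thesis
  proof (rule LIM_zero_cancel, rule Lim_null_comparison)
    show "(\<lambda>n. M * (LINT x:cball 0 R|lebesgue. norm (\<Phi> n x - v x))) \<longlonglongrightarrow> 0"
      using tendsto_mult_right_zero[OF lim[of "cball 0 R"], of M] by simp
    show "\<forall>\<^sub>F n in sequentially. norm ((LINT x|lborel. k x * (\<Phi> n x \<bullet> b)) - (LINT x|lebesgue. k x * (v x \<bullet> b))) \<le> M * (LINT x:cball 0 R|lebesgue. norm (\<Phi> n x - v x))"
    proof (rule always_eventually, rule allI)
      fix n
      have 1: "integrable lebesgue (\<lambda>x. k x * (\<Phi> n x \<bullet> b))" and 2: "integrable lebesgue (\<lambda>x. k x * (v x \<bullet> b))"
        using L1_loc_mult_Cc[OF L1_loc_inner[OF \<Phi>L] k] L1_loc_mult_Cc[OF L1_loc_inner[OF v] k] by auto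
      have "(LINT x|lebesgue. k x * (\<Phi> n x \<bullet> b)) = (LINT x|lborel. k x * (\<Phi> n x \<bullet> b))"
        by (rule integral_lebesgue_eq_lborel(2)) (use \<Phi>m borel_measurable_continuous_onI[OF k(1)] in auto)
      then have "(LINT x|lborel. k x * (\<Phi> n x \<bullet> b)) - (LINT x|lebesgue. k x * (v x \<bullet> b)) = (LINT x|lebesgue. k x * (\<Phi> n x \<bullet> b) - k x * (v x \<bullet> b))"
        using 1 2 by simp
      also have "norm \<dots> \<le> (LINT x|lebesgue. M * (indicator (cball 0 R) x *\<^sub>R norm (\<Phi> n x - v x)))"
      proof (rule order_trans[OF integral_norm_bound integral_mono])
        show "integrable lebesgue (\<lambda>x. norm (k x * (\<Phi> n x \<bullet> b) - k x * (v x \<bullet> b)))" using 1 2 by (intro integrable_norm) simp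
        have "set_integrable lebesgue (cball 0 R) (\<lambda>x. \<Phi> n x - v x)" using dL[of n] by (simp add: L1_loc_def)
        from set_integrable_norm[OF this] show "integrable lebesgue (\<lambda>x. M * (indicator (cball 0 R) x *\<^sub>R norm (\<Phi> n x - v x)))"
          unfolding set_integrable_def by (intro integrable_mult_right)
        fix x
        have "k x * (\<Phi> n x \<bullet> b) - k x * (v x \<bullet> b) = k x * ((\<Phi> n x - v x) \<bullet> b)" by (simp add: inner_diff_left right_diff_distrib)
        moreover have "\<bar>k x\<bar> * \<bar>(\<Phi> n x - v x) \<bullet> b\<bar> \<le> M * norm (\<Phi> n x - v x)"
          using M by (intro mult_mono Basis_le_norm b) auto
        ultimately show "norm (k x * (\<Phi> n x \<bullet> b) - k x * (v x \<bullet> b)) \<le> M * (indicator (cball 0 R) x *\<^sub>R norm (\<Phi> n x - v x))"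
          using R[of x] by (cases "k x = 0") (auto simp: abs_mult M(1) less_imp_le)
      qed
      also have "\<dots> = M * (LINT x:cball 0 R|lebesgue. norm (\<Phi> n x - v x))" by (simp add: set_lebesgue_integral_def)
      finally show "norm ((LINT x|lborel. k x * (\<Phi> n x \<bullet> b)) - (LINT x|lebesgue. k x * (v x \<bullet> b))) \<le> M * (LINT x:cball 0 R|lebesgue. norm (\<Phi> n x - v x))" .
    qed
  qed
qed

lemma integral_test_Lp_tendsto:
  fixes k :: "'a::euclidean_space \<Rightarrow> real"
  assumes F: "Lp_tendsto q F f" and q: "q \<ge> 1" and k: "continuous_on UNIV k" "compact_support k"
  shows "(\<lambda>n. LINT x|lborel. k x * F n x) \<longlonglongrightarrow> (LINT x|lborel. k x * f x)"
proof -
  note Ft = Lp_tendstoD[OF F]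
  obtain M where M: "M > 0" "\<And>x. \<bar>k x\<bar> \<le> M" using bounded_on_compact_support[OF k] by metis
  show ?thesis
  proof (cases "q = 1")
    \<comment> \<open>For q = 1 the conjugate exponent is infinite, so boundedness of k is used
      directly in place of Hoelder's inequality.\<close>
    case True
    show ?thesis
    proof (rule L1_tendsto_integral)
      have km: "k \<in> borel_measurable borel" by (rule borel_measurable_continuous_onI[OF k(1)])
      have bd: "in_Lp 1 (\<lambda>x. k x * h x) \<and> Lp_norm 1 (\<lambda>x. k x * h x) \<le> M * Lp_norm 1 h" if h: "in_Lp 1 h" for h
      proof -
        have p: "AE x in lborel. \<bar>k x * h x\<bar> \<le> \<bar>M * h x\<bar>" using M by (intro AE_I2) (simp add: abs_mult mult_right_mono)
        have m: "(\<lambda>x. k x * h x) \<in> borel_measurable borel" using km in_Lp_measurable[OF h] by simp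
        show ?thesis using in_Lp_bound[OF in_Lp_cmult[OF h] m p] Lp_norm_cmult[of 1 M h] M(1) by simp
      qed
      have Fd: "in_Lp 1 (\<lambda>x. F n x - f x)" for n using Ft True by (intro Minkowski_diff) auto
      have le: "Lp_norm 1 (\<lambda>x. k x * F n x - k x * f x) \<le> M * Lp_norm 1 (\<lambda>x. F n x - f x)" for n
        using bd[OF Fd[of n]] by (simp add: right_diff_distrib)
      have "(\<lambda>n. Lp_norm 1 (\<lambda>x. k x * F n x - k x * f x)) \<longlonglongrightarrow> 0"
        by (rule Lim_null_comparison[OF _ tendsto_mult_right_zero[OF Ft(3)[unfolded True], of M]]) (use le in auto)
      then show "Lp_tendsto 1 (\<lambda>n x. k x * F n x) (\<lambda>x. k x * f x)"
        unfolding Lp_tendsto_def using bd Ft True by auto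
    qed
  next
    case False
    define p where "p = 1 / (1 - 1 / q)"
    have p: "p \<ge> 1" "1 / p + 1 / q = 1" using q False by (auto simp: p_def field_simps)
    have "in_Lp p k" by (rule in_Lp_Cc[OF k]) (use p in simp)
    from Lp_tendsto_integral_mult[OF Lp_tendsto_const[OF this] F p(1) q p(2)] show ?thesis .
  qed
qed

text \<open>Integration by parts holds for the approximants; one side converges by local L^1
  convergence to v and the other by L^q convergence of the gradients. Existence has to be shown
  before anything can be said about the choice in \<open>weak_deriv\<close>.\<close>

lemma D0_has_weak_deriv:
  fixes v :: "'a::euclidean_space \<Rightarrow> 'b::euclidean_space"
  assumes vL: "v \<in> L1_loc" and q: "q \<ge> 1" and \<Phi>: "\<And>n. \<Phi> n \<in> Cc_inf"
    and J: "\<And>i b. i \<in> Basis \<Longrightarrow> b \<in> Basis \<Longrightarrow> Lp_tendsto q (\<lambda>n. pd i (\<lambda>x. \<Phi> n x \<bullet> b)) (J b i)"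
    and lim: "\<And>K. compact K \<Longrightarrow> (\<lambda>n. LINT x:K|lebesgue. norm (\<Phi> n x - v x)) \<longlonglongrightarrow> 0"
    and i: "i \<in> Basis"
  shows "has_weak_deriv v i (\<lambda>x. \<Sum>b\<in>Basis. J b i x *\<^sub>R b)"
  unfolding has_weak_deriv_def
proof (intro conjI ballI)
  define g where "g x = (\<Sum>b\<in>Basis. J b i x *\<^sub>R b)" for x
  have gb: "g x \<bullet> b = J b i x" if "b \<in> Basis" for x b unfolding g_def using that by (simp add: inner_sum_left inner_Basis if_distrib cong: if_cong)
  show "v \<in> L1_loc" by (rule vL)
  have gL: "g \<in> L1_loc"
  proof (rule L1_loc_componentwise)
    fix b :: 'b assume b: "b \<in> Basis"
    have "J b i \<in> L1_loc" by (intro locally_integrable_L1_loc in_Lp_locally_integrable[OF Lp_tendstoD(2)[OF J[OF i b]] q])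
    then show "(\<lambda>x. g x \<bullet> b) \<in> L1_loc" by (simp add: gb[OF b])
  qed
  then show "(\<lambda>x. \<Sum>b\<in>Basis. J b i x *\<^sub>R b) \<in> L1_loc" unfolding g_def .
  fix \<phi> :: "'a \<Rightarrow> real" assume \<phi>: "\<phi> \<in> Cc_inf"
  note P = Cc_infD[OF \<phi>]
  have c: "continuous_on UNIV \<phi>" "continuous_on UNIV (pd i \<phi>)" "compact_support (pd i \<phi>)"
    by (auto intro!: Ck_continuous[OF P(1)[of 0]] Ck_continuous[OF Ck_SucD(2)[OF P(1)[of "Suc 0"] i]] compact_support_pd P)
  have "(LINT x|lebesgue. pd i \<phi> x *\<^sub>R v x) = - (LINT x|lebesgue. \<phi> x *\<^sub>R g x)"
  proof (rule euclidean_eqI)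
    fix b :: 'b assume b: "b \<in> Basis"
    have i1: "integrable lebesgue (\<lambda>x. pd i \<phi> x *\<^sub>R v x)" by (rule L1_loc_mult_Cc[OF vL c(2,3)])
    have i2: "integrable lebesgue (\<lambda>x. \<phi> x *\<^sub>R g x)" by (rule L1_loc_mult_Cc[OF gL c(1) P(2)])
    have e: "(LINT x|lborel. pd i \<phi> x * (\<Phi> n x \<bullet> b)) = - (LINT x|lborel. \<phi> x * pd i (\<lambda>x. \<Phi> n x \<bullet> b) x)" for n
      using integration_by_parts[OF Cc_infD(1)[OF \<phi>] Cc_inf_Cc1[OF Cc_inf_inner[OF \<Phi>]] i, of n b] by simp
    have l1: "(\<lambda>n. LINT x|lborel. pd i \<phi> x * (\<Phi> n x \<bullet> b)) \<longlonglongrightarrow> (LINT x|lebesgue. pd i \<phi> x * (v x \<bullet> b))"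
      by (rule tendsto_test_integral[OF vL \<Phi> lim c(2,3) b])
    have l2: "(\<lambda>n. LINT x|lborel. pd i \<phi> x * (\<Phi> n x \<bullet> b)) \<longlonglongrightarrow> - (LINT x|lborel. \<phi> x * J b i x)"
      unfolding e by (intro tendsto_minus integral_test_Lp_tendsto[OF J[OF i b] q c(1) P(2)])
    have "(LINT x|lebesgue. \<phi> x * (g x \<bullet> b)) = (LINT x|lborel. \<phi> x * J b i x)"
    proof (rule integral_lebesgue_eq_lborel(2))
      show "(\<lambda>x. \<phi> x * J b i x) \<in> borel_measurable borel"
        by (intro borel_measurable_times borel_measurable_continuous_onI c in_Lp_measurable[OF Lp_tendstoD(2)[OF J[OF i b]]])
    qed (simp add: gb[OF b])
    with LIMSEQ_unique[OF l1 l2] have "(LINT x|lebesgue. pd i \<phi> x * (v x \<bullet> b)) = - (LINT x|lebesgue. \<phi> x * (g x \<bullet> b))" by simp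
    moreover have "(LINT x|lebesgue. pd i \<phi> x * (v x \<bullet> b)) = (LINT x|lebesgue. pd i \<phi> x *\<^sub>R v x) \<bullet> b"
      using integral_inner_left[OF i1, of b] by (simp only: inner_scaleR_left)
    moreover have "(LINT x|lebesgue. \<phi> x * (g x \<bullet> b)) = (LINT x|lebesgue. \<phi> x *\<^sub>R g x) \<bullet> b"
      using integral_inner_left[OF i2, of b] by (simp only: inner_scaleR_left)
    ultimately show "(LINT x|lebesgue. pd i \<phi> x *\<^sub>R v x) \<bullet> b = (- (LINT x|lebesgue. \<phi> x *\<^sub>R g x)) \<bullet> b"
      by (simp only: inner_minus_left)
  qed
  then show "(LINT x|lebesgue. pd i \<phi> x *\<^sub>R v x) = - (LINT x|lebesgue. \<phi> x *\<^sub>R (\<Sum>b\<in>Basis. J b i x *\<^sub>R b))"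
    unfolding g_def .
qed

text \<open>Existence makes the \<open>SOME\<close> in \<open>weak_deriv\<close> a genuine weak
  derivative, and uniqueness identifies it almost everywhere with the limit of gradients. Through
  this the weak formulation becomes a statement about J.\<close>

lemma D0_weak_deriv_eq:
  fixes v :: "'a::euclidean_space \<Rightarrow> 'b::euclidean_space"
  assumes "v \<in> L1_loc" "q \<ge> 1" "\<And>n. \<Phi> n \<in> Cc_inf"
    "\<And>i b. i \<in> Basis \<Longrightarrow> b \<in> Basis \<Longrightarrow> Lp_tendsto q (\<lambda>n. pd i (\<lambda>x. \<Phi> n x \<bullet> b)) (J b i)"
    "\<And>K. compact K \<Longrightarrow> (\<lambda>n. LINT x:K|lebesgue. norm (\<Phi> n x - v x)) \<longlonglongrightarrow> 0"
    and i: "i \<in> Basis" and b: "b \<in> Basis"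
  shows "AE x in lborel. weak_deriv v i x \<bullet> b = J b i x"
proof -
  have W: "has_weak_deriv v i (\<lambda>x. \<Sum>b\<in>Basis. J b i x *\<^sub>R b)"
    by (rule D0_has_weak_deriv[where \<Phi>=\<Phi> and J=J and q=q]) (fact assms)+
  have "has_weak_deriv v i (weak_deriv v i)" unfolding weak_deriv_def by (rule someI[where P="has_weak_deriv v i", OF W])
  from weak_deriv_unique[OF this W] show ?thesis
    by eventually_elim (use b in \<open>simp add: inner_sum_left inner_Basis if_distrib cong: if_cong\<close>)
qed

text \<open>The Sobolev inequality for differences of approximants makes them Cauchy in L^6. Their
  L^6 limit and v have the same integrals against test functions, hence agree almost
  everywhere.\<close>

lemma D0_sobolev_limit:
  fixes v :: "real^3 \<Rightarrow> 'b::euclidean_space"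
  assumes vL: "v \<in> L1_loc" and \<Phi>: "\<And>n. \<Phi> n \<in> Cc_inf"
    and J: "\<And>i b. i \<in> Basis \<Longrightarrow> b \<in> Basis \<Longrightarrow> Lp_tendsto 2 (\<lambda>n. pd i (\<lambda>x. \<Phi> n x \<bullet> b)) (J b i)"
    and lim: "\<And>K. compact K \<Longrightarrow> (\<lambda>n. LINT x:K|lebesgue. norm (\<Phi> n x - v x)) \<longlonglongrightarrow> 0"
    and b: "b \<in> Basis"
  obtains f where "sobolev_approx (\<lambda>n x. \<Phi> n x \<bullet> b) f (J b)" "AE x in lborel. v x \<bullet> b = f x"
proof -
  define \<Psi> where "\<Psi> n x = \<Phi> n x \<bullet> b" for n x
  have \<Psi>: "\<Psi> n \<in> Cc_inf" for n unfolding \<Psi>_def by (rule Cc_inf_inner[OF \<Phi>])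
  have \<Psi>1: "\<Psi> n \<in> Cc1" for n by (rule Cc_inf_Cc1[OF \<Psi>])
  have Jb: "i \<in> Basis \<Longrightarrow> Lp_tendsto 2 (\<lambda>n. pd i (\<Psi> n)) (J b i)" for i unfolding \<Psi>_def using J b by blast
  have L6: "in_Lp 6 (\<Psi> n)" for n by (rule Cc1_in_Lp(1)[OF \<Psi>1]) simp
  have bound: "Lp_norm 6 (\<lambda>x. \<Psi> m x - \<Psi> n x) \<le> 4 * (\<Sum>i\<in>Basis. Lp_norm 2 (\<lambda>x. pd i (\<Psi> m) x - J b i x)) + 4 * (\<Sum>i\<in>Basis. Lp_norm 2 (\<lambda>x. pd i (\<Psi> n) x - J b i x))" for m n
  proof -
    have "(\<lambda>x. \<Psi> m x - \<Psi> n x) \<in> Cc1"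
      by (rule Cc1I[of 0 "\<lambda>x. \<Psi> m x - \<Psi> n x"]) (use Cc1D[OF \<Psi>1] compact_support_add[OF Cc1D(2)[OF \<Psi>1[of m]] compact_support_linear[of "\<lambda>y. - y", OF _ Cc1D(2)[OF \<Psi>1[of n]]]] in \<open>auto intro: Ck_diff simp del: Ck.simps\<close>)
    from Sobolev_inequality[OF this] have "Lp_norm 6 (\<lambda>x. \<Psi> m x - \<Psi> n x) \<le> 4 * (\<Sum>i\<in>Basis. Lp_norm 2 (\<lambda>x. pd i (\<Psi> m) x - pd i (\<Psi> n) x))"
      by (simp add: pd_diff[OF Cc1D(1)[OF \<Psi>1] Cc1D(1)[OF \<Psi>1]])
    also have "\<dots> \<le> 4 * (\<Sum>i\<in>Basis. Lp_norm 2 (\<lambda>x. pd i (\<Psi> m) x - J b i x) + Lp_norm 2 (\<lambda>x. pd i (\<Psi> n) x - J b i x))"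
    proof (intro mult_left_mono sum_mono)
      fix i :: "real^3" assume i: "i \<in> Basis"
      note t = Lp_tendstoD[OF Jb[OF i]]
      show "Lp_norm 2 (\<lambda>x. pd i (\<Psi> m) x - pd i (\<Psi> n) x) \<le> Lp_norm 2 (\<lambda>x. pd i (\<Psi> m) x - J b i x) + Lp_norm 2 (\<lambda>x. pd i (\<Psi> n) x - J b i x)"
        using Lp_norm_triangle3[OF t(1)[of m] t(2) t(1)[of n]] Lp_norm_diff_commute[of 2 "J b i" "pd i (\<Psi> n)"] by simp
    qed simp
    finally show ?thesis by (simp add: sum.distrib)
  qed
  have d0: "(\<lambda>n. 4 * (\<Sum>i\<in>Basis. Lp_norm 2 (\<lambda>x. pd i (\<Psi> n) x - J b i x))) \<longlonglongrightarrow> 4 * (\<Sum>i\<in>(Basis::(real^3) set). 0)"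
    by (intro tendsto_mult tendsto_const tendsto_sum Lp_tendstoD(3)[OF Jb])
  have "\<exists>N. \<forall>m\<ge>N. \<forall>n\<ge>N. Lp_norm 6 (\<lambda>x. \<Psi> m x - \<Psi> n x) < e" if e: "e > 0" for e
  proof -
    obtain N where N: "\<And>n. n \<ge> N \<Longrightarrow> 4 * (\<Sum>i\<in>Basis. Lp_norm 2 (\<lambda>x. pd i (\<Psi> n) x - J b i x)) < e / 2"
      using order_tendstoD(2)[OF d0, of "e / 2"] e by (auto simp: eventually_sequentially)
    show ?thesis
    proof (intro exI[of _ N] allI impI)
      fix m n assume "m \<ge> N" "n \<ge> N"
      then show "Lp_norm 6 (\<lambda>x. \<Psi> m x - \<Psi> n x) < e" using bound[of m n] N[of m] N[of n] by linarith
    qed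
  qed
  from Lp_complete[OF L6 _ this] obtain f where f: "Lp_tendsto 6 \<Psi> f" by auto
  have ap: "sobolev_approx (\<lambda>n x. \<Phi> n x \<bullet> b) f (J b)"
    using \<Psi> f Jb unfolding sobolev_approx_def \<Psi>_def by auto
  obtain h where h: "locally_integrable h" "AE x in lborel. v x \<bullet> b = h x"
    by (rule L1_loc_representative[OF L1_loc_inner[OF vL, of b]]) (rule that)
  have fl: "locally_integrable f" by (rule in_Lp_locally_integrable[OF Lp_tendstoD(2)[OF f]]) simp
  have "AE x in lborel. h x - f x = 0"
  proof (rule fundamental_lemma)
    show "locally_integrable (\<lambda>x. h x - f x)" using h(1) fl by (auto simp: locally_integrable_def right_diff_distrib)
    fix \<phi> :: "real^3 \<Rightarrow> real" assume \<phi>: "\<phi> \<in> Cc_inf"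
    have c: "continuous_on UNIV \<phi>" "compact_support \<phi>" using Ck_continuous[OF Cc_infD(1)[OF \<phi>, of 0]] Cc_infD(2)[OF \<phi>] by auto
    have l1: "(\<lambda>n. LINT x|lborel. \<phi> x * \<Psi> n x) \<longlonglongrightarrow> (LINT x|lebesgue. \<phi> x * (v x \<bullet> b))"
      unfolding \<Psi>_def by (rule tendsto_test_integral[OF vL \<Phi> lim c b])
    have l2: "(\<lambda>n. LINT x|lborel. \<phi> x * \<Psi> n x) \<longlonglongrightarrow> (LINT x|lborel. \<phi> x * f x)"
      by (rule integral_test_Lp_tendsto[OF f _ c]) simp
    have "(LINT x|lebesgue. \<phi> x * (v x \<bullet> b)) = (LINT x|lborel. \<phi> x * h x)"
    proof (rule integral_lebesgue_eq_lborel(2))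
      show "(\<lambda>x. \<phi> x * h x) \<in> borel_measurable borel"
        by (intro borel_measurable_times borel_measurable_continuous_onI c locally_integrable_measurable h)
      show "AE x in lborel. \<phi> x * (v x \<bullet> b) = \<phi> x * h x" using h(2) by eventually_elim simp
    qed
    then have "(LINT x|lborel. \<phi> x * h x) = (LINT x|lborel. \<phi> x * f x)" using LIMSEQ_unique[OF l1 l2] by simp
    then show "(LINT x|lborel. \<phi> x * (h x - f x)) = 0"
      using locally_integrable_mult_Cc[OF h(1) c] locally_integrable_mult_Cc[OF fl c] by (simp add: right_diff_distrib)
  qed
  with h(2) have "AE x in lborel. v x \<bullet> b = f x" by eventually_elim simp
  with ap show ?thesis by (rule that)
qed

section \<open>The Liouville theorem\<close>

lemma sum_axis_Basis:
  fixes f :: "real^3 \<Rightarrow> real"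
  shows "(\<Sum>i\<in>UNIV. f (axis i 1)) = (\<Sum>b\<in>Basis. f b)"
  by (simp add: Basis_real3 sum_3 add.assoc)

lemma ddot_Basis:
  fixes F H :: "real^3^3" and f h :: "real^3 \<Rightarrow> real^3 \<Rightarrow> real"
  assumes "\<And>i j. F $ i $ j = f (axis i 1) (axis j 1)" "\<And>i j. H $ i $ j = h (axis i 1) (axis j 1)"
  shows "ddot F H = (\<Sum>b\<in>Basis. \<Sum>c\<in>Basis. f b c * h b c)"
  unfolding ddot_def assms sum_axis_Basis[of "\<lambda>c. f b c * h b c" for b, symmetric]
  by (rule sum_axis_Basis[of "\<lambda>b. \<Sum>j\<in>UNIV. f b (axis j 1) * h b (axis j 1)"])

lemma trace_Basis:
  fixes H :: "real^3^3" and h :: "real^3 \<Rightarrow> real^3 \<Rightarrow> real"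
  assumes "\<And>i j. H $ i $ j = h (axis i 1) (axis j 1)"
  shows "trace H = (\<Sum>b\<in>Basis. h b b)"
  unfolding trace_def assms by (rule sum_axis_Basis[of "\<lambda>b. h b b"])

lemma nth_axis: "v $ i = v \<bullet> axis i 1" for v :: "real^3"
  by (simp add: inner_axis)

lemma stress_nth:
  fixes A :: "real^3^3" and J :: "real^3 \<Rightarrow> real^3 \<Rightarrow> real^3 \<Rightarrow> real"
  assumes A: "\<And>i j. A $ i $ j = J (axis i 1) (axis j 1) x"
  shows "stress \<mu> \<eta> A $ i $ j = stress_component \<mu> \<eta> J (axis i 1) (axis j 1) x"
  unfolding stress_def stress_component_def
  by (simp add: trace_Basis[of A "\<lambda>b c. J b c x", OF A] transpose_def mat_def A axis_eq_axis algebra_simps)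

text \<open>The core argument tests with one scalar function per direction, whereas the momentum
  equation takes a vector field; this assembles the field and reads off its value and
  Jacobian.\<close>

lemma field_of_components:
  fixes \<phi> :: "real^3 \<Rightarrow> real^3 \<Rightarrow> real"
  assumes \<phi>: "\<And>b. b \<in> Basis \<Longrightarrow> \<phi> b \<in> Cc1"
  shows "(\<lambda>x. \<Sum>b\<in>Basis. \<phi> b x *\<^sub>R b) \<in> Cc1"
    "(\<Sum>b\<in>Basis. \<phi> b x *\<^sub>R b) $ i = \<phi> (axis i 1) x"
    "jacobian (\<lambda>x. \<Sum>b\<in>Basis. \<phi> b x *\<^sub>R b) (at x) $ i $ j = pd (axis j 1) (\<phi> (axis i 1)) x"
proof -
  define f where "f x = (\<Sum>b\<in>Basis. \<phi> b x *\<^sub>R b)" for x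
  have C: "Ck (Suc 0) f" unfolding f_def[abs_def]
    by (intro Ck_sum Ck_bounded_linear[OF bounded_linear_scaleR_left] Cc1D \<phi>)
  have s: "compact_support f" unfolding f_def[abs_def]
    by (intro compact_support_sum compact_support_subset[OF Cc1D(2)[OF \<phi>]]) auto
  show "(\<lambda>x. \<Sum>b\<in>Basis. \<phi> b x *\<^sub>R b) \<in> Cc1" using Cc1I[OF C s] by (simp only: f_def[abs_def])
  have n: "f x \<bullet> axis i 1 = \<phi> (axis i 1) x" for x i
    unfolding f_def by (simp add: inner_sum_left inner_Basis if_distrib cong: if_cong)
  then show "(\<Sum>b\<in>Basis. \<phi> b x *\<^sub>R b) $ i = \<phi> (axis i 1) x" by (simp add: nth_axis f_def)
  have "jacobian f (at x) $ i $ j = pd (axis j 1) f x \<bullet> axis i 1"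
    by (simp add: jacobian_def matrix_def nth_axis[symmetric])
  also have "\<dots> = pd (axis j 1) (\<lambda>x. f x \<bullet> axis i 1) x" by (rule pd_inner_comp[OF C, symmetric])
  finally show "jacobian (\<lambda>x. \<Sum>b\<in>Basis. \<phi> b x *\<^sub>R b) (at x) $ i $ j = pd (axis j 1) (\<phi> (axis i 1)) x"
    by (simp add: n f_def[abs_def])
qed

lemma integral_sum_lebesgue:
  fixes F :: "'a::euclidean_space \<Rightarrow> real"
  assumes "AE x in lborel. F x = (\<Sum>i\<in>I. g i x)" "\<And>i. i \<in> I \<Longrightarrow> integrable lborel (g i)"
  shows "(LINT x|lebesgue. F x) = (\<Sum>i\<in>I. LINT x|lborel. g i x)"
proof -
  have "(LINT x|lebesgue. F x) = (LINT x|lborel. (\<Sum>i\<in>I. g i x))"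
    by (rule integral_lebesgue_eq_lborel(2)) (use assms borel_measurable_integrable[OF assms(2)] in \<open>auto intro!: borel_measurable_sum\<close>)
  then show ?thesis using assms(2) by (simp add: Bochner_Integration.integral_sum)
qed

lemma Lp_representative:
  assumes f: "f \<in> Lp r" and g: "g \<in> borel_measurable borel" and ae: "AE x in lborel. f x = g x"
  shows "in_Lp r g"
proof -
  have m: "(\<lambda>x. \<bar>g x\<bar> powr r) \<in> borel_measurable borel" using g by measurable
  have "AE x in lborel. norm (f x) powr r = \<bar>g x\<bar> powr r" using ae by eventually_elim simp
  from integral_lebesgue_eq_lborel(3)[OF m this] f g show ?thesis by (simp add: Lp_def in_Lp_def)
qed

theorem theorem5:
  fixes \<mu> \<eta> \<gamma> q :: real
    and G \<rho> :: "real^3 \<Rightarrow> real"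
    and u :: "real^3 \<Rightarrow> real^3"
  assumes "\<mu> > 0" and "\<eta> \<ge> 0"
    and "\<gamma> \<ge> 6"
    and "6 * \<gamma> / (5 * \<gamma> - 6) \<le> q" and "q \<le> 3 / 2"
    and "G \<in> D0 q"
    and "weak_solution \<mu> \<eta> (\<lambda>r. r powr \<gamma>) G \<rho> u"
    and "\<rho> \<in> Lp 6 \<inter> Lp \<gamma>"
  shows "AE x in lebesgue. u x = 0"
proof -
  note ws = assms(7)[unfolded weak_solution_def]
  have q0: "6 * \<gamma> / (5 * \<gamma> - 6) > 1" using assms(3) by (simp add: field_simps)
  then have q1: "q \<ge> 1" using assms(4) by linarith
  \<comment> \<open>The exponent with 1/a + 1/q = 5/6. The two bounds on q below translate into 6 <=
    a <= \<gamma>, so that \<rho> is in L^a and \<rho> grad G in L^(6/5).\<close>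
  define a where "a = 1 / (5 / 6 - 1 / q)"
  have qi: "5 / 6 - 1 / q \<le> 1 / 6" "1 / \<gamma> \<le> 5 / 6 - 1 / q"
  proof -
    have "1 / q \<ge> 1 / (3 / 2)" using q1 assms(5) by (intro divide_left_mono) auto
    then show "5 / 6 - 1 / q \<le> 1 / 6" by simp
    have "1 / q \<le> 1 / (6 * \<gamma> / (5 * \<gamma> - 6))" using q0 assms(4) by (intro frac_le) auto
    also have "\<dots> = 5 / 6 - 1 / \<gamma>" using assms(3) by (simp add: field_simps)
    finally show "1 / \<gamma> \<le> 5 / 6 - 1 / q" by simp
  qed
  have pos: "5 / 6 - 1 / q > 0" using qi(2) assms(3) by (intro less_le_trans[OF _ qi(2)]) simp
  have a: "6 \<le> a" "a \<le> \<gamma>" "1 / a + 1 / q = 5 / 6"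
  proof -
    have "1 / (1 / 6) \<le> a" unfolding a_def using qi pos by (intro divide_left_mono) auto
    then show "6 \<le> a" by simp
    have "a \<le> 1 / (1 / \<gamma>)" unfolding a_def using qi pos assms(3) by (intro divide_left_mono) auto
    then show "a \<le> \<gamma>" by simp
    show "1 / a + 1 / q = 5 / 6" by (simp add: a_def)
  qed
  have uD: "u \<in> D0 2" using ws by blast
  have uL: "u \<in> L1_loc" using uD by (simp add: D0_def)
  obtain \<Phi> J where \<Phi>: "\<And>n. \<Phi> n \<in> Cc_inf"
    "\<And>i b. i \<in> Basis \<Longrightarrow> b \<in> Basis \<Longrightarrow> Lp_tendsto 2 (\<lambda>n. pd i (\<lambda>x. \<Phi> n x \<bullet> b)) (J b i)"
    "\<And>K. compact K \<Longrightarrow> (\<lambda>n. LINT x:K|lebesgue. norm (\<Phi> n x - u x)) \<longlonglongrightarrow> 0"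
    by (rule D0_approximation[OF uD]) (simp, rule that)
  have "\<exists>f. sobolev_approx (\<lambda>n x. \<Phi> n x \<bullet> b) f (J b) \<and> (AE x in lborel. u x \<bullet> b = f x)" if b: "b \<in> Basis" for b
    by (rule D0_sobolev_limit[OF uL \<Phi> b]) blast+
  note ex = this
  \<comment> \<open>Borel representatives of the components of u, picked once so that a single
    function serves each direction.\<close>
  define U where "U b = (SOME f. sobolev_approx (\<lambda>n x. \<Phi> n x \<bullet> b) f (J b) \<and> (AE x in lborel. u x \<bullet> b = f x))" for b
  have "sobolev_approx (\<lambda>n x. \<Phi> n x \<bullet> b) (U b) (J b) \<and> (AE x in lborel. u x \<bullet> b = U b x)" if "b \<in> Basis" for b
    unfolding U_def by (rule someI_ex[OF ex[OF that]])
  then have U: "\<And>b. b \<in> Basis \<Longrightarrow> sobolev_approx (\<lambda>n x. \<Phi> n x \<bullet> b) (U b) (J b)"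
    "\<And>b. b \<in> Basis \<Longrightarrow> AE x in lborel. u x \<bullet> b = U b x" by blast+
  have GL: "G \<in> L1_loc" using assms(6) by (simp add: D0_def)
  obtain \<Psi> g' where \<Psi>: "\<And>n. \<Psi> n \<in> Cc_inf"
    "\<And>i b. i \<in> Basis \<Longrightarrow> b \<in> Basis \<Longrightarrow> Lp_tendsto q (\<lambda>n. pd i (\<lambda>x. \<Psi> n x \<bullet> b)) (g' b i)"
    "\<And>K. compact K \<Longrightarrow> (\<lambda>n. LINT x:K|lebesgue. norm (\<Psi> n x - G x)) \<longlonglongrightarrow> 0"
    by (rule D0_approximation[OF assms(6) q1]) (rule that)
  \<comment> \<open>G is scalar, and the only basis vector of the reals is 1; the component index of
    g' is therefore fixed to 1.\<close>
  define g where "g = g' 1"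
  have g: "Lp_tendsto q (\<lambda>n. pd i (\<Psi> n)) (g i)" if "i \<in> Basis" for i
    using \<Psi>(2)[OF that, of 1] by (simp add: g_def)
  have \<rho>m: "\<rho> \<in> borel_measurable lebesgue" using ws by blast
  obtain \<rho>' where \<rho>': "\<rho>' \<in> borel_measurable borel" "AE x in lborel. \<rho> x = \<rho>' x"
    using borel_representative[OF \<rho>m] .
  \<comment> \<open>The positive part changes the Borel representative on a null set only and makes
    it nonnegative everywhere, as the pointwise powers of the density require.\<close>
  define r where "r x = max 0 (\<rho>' x)" for x
  have rm: "r \<in> borel_measurable borel" unfolding r_def using \<rho>'(1) by measurable
  have r0: "r x \<ge> 0" for x by (simp add: r_def)
  have "AE x in lborel. 0 \<le> \<rho> x" using ws unfolding AE_completion_iff by blast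
  with \<rho>'(2) have rae: "AE x in lborel. \<rho> x = r x" by eventually_elim (simp add: r_def)
  have rL: "in_Lp 6 r" "in_Lp \<gamma> r" using assms(8) Lp_representative[OF _ rm rae] by auto
  have uae: "AE x in lborel. \<forall>b\<in>Basis. u x \<bullet> b = U b x"
    using U(2) by (subst AE_ball_countable) (auto simp: countable_finite)
  have wu: "AE x in lborel. weak_deriv u c x \<bullet> b = J b c x" if "c \<in> Basis" "b \<in> Basis" for b c
    by (rule D0_weak_deriv_eq[where \<Phi>=\<Phi> and q=2, OF uL _ \<Phi> that]) simp
  have wuae: "AE x in lborel. \<forall>b\<in>Basis. \<forall>c\<in>Basis. weak_deriv u c x \<bullet> b = J b c x"
    using wu by (subst AE_ball_countable, simp add: countable_finite)+ auto
  have wG: "AE x in lborel. weak_deriv G i x = g i x" if "i \<in> Basis" for i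
    using D0_weak_deriv_eq[where \<Phi>=\<Psi> and q=q and b=1, OF GL q1 \<Psi> that] by (simp add: g_def)
  have wGae: "AE x in lborel. \<forall>i\<in>Basis. weak_deriv G i x = g i x"
    using wG by (subst AE_ball_countable) (auto simp: countable_finite)
  note A = sobolev_approxD[OF U(1)]
  have ru: "in_Lp 3 (\<lambda>x. r x * U b x)" if "b \<in> Basis" for b by (rule Holder(1)[OF rL(1) A(5)[OF that]]) auto
  have Q: "in_Lp 2 (\<lambda>x. r x * U b x * U c x)" if "b \<in> Basis" "c \<in> Basis" for b c
    by (rule Holder(1)[OF ru[OF that(1)] A(5)[OF that(2)]]) auto
  have S: "in_Lp 2 (stress_component \<mu> \<eta> J b c)" if "b \<in> Basis" "c \<in> Basis" for b c
    by (rule in_Lp_stress_component) (use A that in auto)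
  have ra: "in_Lp a r" by (rule in_Lp_interpolate[OF rL a(1,2)]) simp
  have rg: "in_Lp (6/5) (\<lambda>x. r x * g b x)" if "b \<in> Basis" for b
    by (rule Holder(1)[OF ra Lp_tendstoD(2)[OF g[OF that]]]) (use a q1 in auto)
  have p1: "in_Lp 1 (\<lambda>x. r x powr \<gamma>)" using in_Lp_powr_nonneg[OF rL(2) _ r0, of \<gamma>] assms(3) by simp
  have int: "integrable lborel (\<lambda>x. h x * k x)" if "in_Lp s h" "s \<ge> 1" "continuous_on UNIV k" "compact_support k" for s and h k :: "real^3 \<Rightarrow> real"
    using locally_integrable_mult_Cc[OF in_Lp_locally_integrable[OF that(1,2)] that(3,4)] by (simp add: mult.commute)
  have cont: "(\<Sum>b\<in>Basis. LINT x|lborel. r x * U b x * pd b \<phi> x) = 0" if \<phi>: "\<phi> \<in> Cc_inf" for \<phi>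
  proof -
    note P = Cc1D[OF Cc_inf_Cc1[OF \<phi>]]
    have "(LINT x|lebesgue. (\<rho> x *\<^sub>R u x) \<bullet> grad \<phi> x) = (\<Sum>b\<in>Basis. LINT x|lborel. r x * U b x * pd b \<phi> x)"
    proof (rule integral_sum_lebesgue)
      show "AE x in lborel. (\<rho> x *\<^sub>R u x) \<bullet> grad \<phi> x = (\<Sum>b\<in>Basis. r x * U b x * pd b \<phi> x)"
        using rae uae
      proof eventually_elim
        case (elim x)
        have "(\<rho> x *\<^sub>R u x) \<bullet> grad \<phi> x = (\<Sum>i\<in>UNIV. \<rho> x * u x $ i * pd (axis i 1) \<phi> x)"
          by (simp add: inner_vec_def grad_def)
        also have "\<dots> = (\<Sum>i\<in>UNIV. \<rho> x * (u x \<bullet> axis i 1) * pd (axis i 1) \<phi> x)" by (simp only: nth_axis)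
        also have "\<dots> = (\<Sum>b\<in>Basis. \<rho> x * (u x \<bullet> b) * pd b \<phi> x)" by (rule sum_axis_Basis)
        also have "\<dots> = (\<Sum>b\<in>Basis. r x * U b x * pd b \<phi> x)" using elim by simp
        finally show ?case .
      qed
      fix b :: "real^3" assume b: "b \<in> Basis"
      show "integrable lborel (\<lambda>x. r x * U b x * pd b \<phi> x)"
        by (rule int[OF ru[OF b] _ Ck_continuous[OF Ck_SucD(2)[OF P(1) b]] compact_support_pd[OF P(2)]]) simp
    qed
    moreover have "(LINT x|lebesgue. (\<rho> x *\<^sub>R u x) \<bullet> grad \<phi> x) = 0" using ws \<phi> by blast
    ultimately show ?thesis by simp
  qed
  have mom: "(\<Sum>b\<in>Basis. \<Sum>c\<in>Basis. LINT x|lborel. r x * U b x * U c x * pd c (\<phi> b) x) + (\<Sum>b\<in>Basis. LINT x|lborel. r x powr \<gamma> * pd b (\<phi> b) x)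
      = (\<Sum>b\<in>Basis. \<Sum>c\<in>Basis. LINT x|lborel. stress_component \<mu> \<eta> J b c x * pd c (\<phi> b) x) - (\<Sum>b\<in>Basis. LINT x|lborel. r x * g b x * \<phi> b x)"
    if \<phi>: "\<And>b. b \<in> Basis \<Longrightarrow> \<phi> b \<in> Cc1" for \<phi>
  proof -
    define f where "f x = (\<Sum>b\<in>Basis. \<phi> b x *\<^sub>R b)" for x
    have f: "f \<in> Cc1" "f x $ i = \<phi> (axis i 1) x" "jacobian f (at x) $ i $ j = pd (axis j 1) (\<phi> (axis i 1)) x" for x i j
      using field_of_components[of \<phi>, OF \<phi>] by (simp_all only: f_def[abs_def])
    have c: "continuous_on UNIV (\<phi> b)" "compact_support (\<phi> b)" "c \<in> Basis \<Longrightarrow> continuous_on UNIV (pd c (\<phi> b))" "compact_support (pd c (\<phi> b))" if "b \<in> Basis" for b c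
      using Ck_continuous[OF Cc1D(1)[OF \<phi>[OF that]]] Cc1D(2)[OF \<phi>[OF that]]
        Ck_continuous[OF Ck_SucD(2)[OF Cc1D(1)[OF \<phi>[OF that]]]] compact_support_pd[OF Cc1D(2)[OF \<phi>[OF that]]] by blast+
    have iQ: "integrable lborel (\<lambda>x. r x * U b x * U c x * pd c (\<phi> b) x)" if "b \<in> Basis" "c \<in> Basis" for b c
      by (rule int[OF Q[OF that] _ c(3)[OF that] c(4)[OF that(1)]]) simp
    have ip: "integrable lborel (\<lambda>x. r x powr \<gamma> * pd b (\<phi> b) x)" if "b \<in> Basis" for b
      by (rule int[OF p1 _ c(3)[OF that that] c(4)[OF that]]) simp
    have iS: "integrable lborel (\<lambda>x. stress_component \<mu> \<eta> J b c x * pd c (\<phi> b) x)" if "b \<in> Basis" "c \<in> Basis" for b c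
      by (rule int[OF S[OF that] _ c(3)[OF that] c(4)[OF that(1)]]) simp
    have ig: "integrable lborel (\<lambda>x. r x * g b x * \<phi> b x)" if "b \<in> Basis" for b
      by (rule int[OF rg[OF that] _ c(1,2)[OF that]]) simp
    have "(LINT x|lebesgue. ddot (tensor (\<rho> x *\<^sub>R u x) (u x)) (jacobian f (at x)) + (\<rho> x) powr \<gamma> * trace (jacobian f (at x)))
       = (\<Sum>b\<in>Basis. LINT x|lborel. (\<Sum>c\<in>Basis. r x * U b x * U c x * pd c (\<phi> b) x) + r x powr \<gamma> * pd b (\<phi> b) x)"
    proof (rule integral_sum_lebesgue)
      show "AE x in lborel. ddot (tensor (\<rho> x *\<^sub>R u x) (u x)) (jacobian f (at x)) + (\<rho> x) powr \<gamma> * trace (jacobian f (at x))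
        = (\<Sum>b\<in>Basis. (\<Sum>c\<in>Basis. r x * U b x * U c x * pd c (\<phi> b) x) + r x powr \<gamma> * pd b (\<phi> b) x)"
        using rae uae
      proof eventually_elim
        case (elim x)
        have t: "tensor (\<rho> x *\<^sub>R u x) (u x) $ i $ j = r x * U (axis i 1) x * U (axis j 1) x" for i j
        proof -
          have "u x $ i = U (axis i 1) x" for i using elim(2) by (simp add: nth_axis)
          then show ?thesis using elim(1) by (simp add: tensor_def)
        qed
        show ?case
          using elim unfolding ddot_Basis[of _ "\<lambda>b c. r x * U b x * U c x" _ "\<lambda>b c. pd c (\<phi> b) x", OF t f(3)]
            trace_Basis[of _ "\<lambda>b c. pd c (\<phi> b) x", OF f(3)]
          by (simp add: sum.distrib sum_distrib_left)
      qed
    qed (use iQ ip in auto)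
    also have "\<dots> = (\<Sum>b\<in>Basis. \<Sum>c\<in>Basis. LINT x|lborel. r x * U b x * U c x * pd c (\<phi> b) x) + (\<Sum>b\<in>Basis. LINT x|lborel. r x powr \<gamma> * pd b (\<phi> b) x)"
      using iQ ip by (simp add: Bochner_Integration.integral_sum Bochner_Integration.integrable_sum sum.distrib)
    finally have L: "(LINT x|lebesgue. ddot (tensor (\<rho> x *\<^sub>R u x) (u x)) (jacobian f (at x)) + (\<rho> x) powr \<gamma> * trace (jacobian f (at x)))
       = (\<Sum>b\<in>Basis. \<Sum>c\<in>Basis. LINT x|lborel. r x * U b x * U c x * pd c (\<phi> b) x) + (\<Sum>b\<in>Basis. LINT x|lborel. r x powr \<gamma> * pd b (\<phi> b) x)" .
    have "(LINT x|lebesgue. ddot (stress \<mu> \<eta> (weak_jacobian u x)) (jacobian f (at x)))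
      = (\<Sum>b\<in>Basis. LINT x|lborel. (\<Sum>c\<in>Basis. stress_component \<mu> \<eta> J b c x * pd c (\<phi> b) x))"
    proof (rule integral_sum_lebesgue)
      show "AE x in lborel. ddot (stress \<mu> \<eta> (weak_jacobian u x)) (jacobian f (at x)) = (\<Sum>b\<in>Basis. \<Sum>c\<in>Basis. stress_component \<mu> \<eta> J b c x * pd c (\<phi> b) x)"
        using wuae
      proof eventually_elim
        case (elim x)
        have "weak_jacobian u x $ i $ j = J (axis i 1) (axis j 1) x" for i j
        proof -
          have "weak_deriv u (axis j 1) x $ i = J (axis i 1) (axis j 1) x" using elim by (simp add: nth_axis)
          then show ?thesis by (simp add: weak_jacobian_def)
        qed
        note s = stress_nth[of _ J, OF this]
        show ?case by (rule ddot_Basis[OF s f(3)])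
      qed
    qed (use iS in auto)
    also have "\<dots> = (\<Sum>b\<in>Basis. \<Sum>c\<in>Basis. LINT x|lborel. stress_component \<mu> \<eta> J b c x * pd c (\<phi> b) x)"
      using iS by (simp add: Bochner_Integration.integral_sum)
    finally have R1: "(LINT x|lebesgue. ddot (stress \<mu> \<eta> (weak_jacobian u x)) (jacobian f (at x)))
      = (\<Sum>b\<in>Basis. \<Sum>c\<in>Basis. LINT x|lborel. stress_component \<mu> \<eta> J b c x * pd c (\<phi> b) x)" .
    have R2: "(LINT x|lebesgue. (\<rho> x *\<^sub>R weak_grad G x) \<bullet> f x) = (\<Sum>b\<in>Basis. LINT x|lborel. r x * g b x * \<phi> b x)"
    proof (rule integral_sum_lebesgue)
      show "AE x in lborel. (\<rho> x *\<^sub>R weak_grad G x) \<bullet> f x = (\<Sum>b\<in>Basis. r x * g b x * \<phi> b x)"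
        using rae wGae
      proof eventually_elim
        case (elim x)
        have "(\<rho> x *\<^sub>R weak_grad G x) \<bullet> f x = (\<Sum>i\<in>UNIV. r x * g (axis i 1) x * \<phi> (axis i 1) x)"
          using elim by (simp add: inner_vec_def weak_grad_def f(2))
        also have "\<dots> = (\<Sum>b\<in>Basis. r x * g b x * \<phi> b x)" by (rule sum_axis_Basis)
        finally show ?case .
      qed
    qed (use ig in auto)
    have "(LINT x|lebesgue. ddot (tensor (\<rho> x *\<^sub>R u x) (u x)) (jacobian f (at x)) + (\<rho> x) powr \<gamma> * trace (jacobian f (at x)))
      = (LINT x|lebesgue. ddot (stress \<mu> \<eta> (weak_jacobian u x)) (jacobian f (at x))) - (LINT x|lebesgue. (\<rho> x *\<^sub>R weak_grad G x) \<bullet> f x)"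
      using ws f(1) by blast
    then show ?thesis unfolding L R1 R2 .
  qed
  have "AE x in lborel. U b x = 0" if "b \<in> Basis" for b
    by (rule liouville_core[where \<Phi>="\<lambda>b n x. \<Phi> n x \<bullet> b" and \<psi>=\<Psi> and g=g and q=q and a=a, OF assms(1,2,3) a(1,2) q1 a(3) rL r0 U(1) \<Psi>(1) g cont mom that])
  then have "AE x in lborel. \<forall>b\<in>Basis. U b x = 0" by (subst AE_ball_countable) (auto simp: countable_finite)
  with uae have "AE x in lborel. u x = 0"
  proof eventually_elim
    case (elim x)
    show ?case by (rule euclidean_eqI) (use elim in simp)
  qed
  then show ?thesis unfolding AE_completion_iff .
qed

end
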